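(* Let $K$ be a compact connected Lie group with Lie algebra $\mathfrak{k}$. Let $\mathcal{O}\subset\mathfrak{k}^*$ be a regular admissible coadjoint orbit of $K$, and let $\mathcal{P}\subset\mathfrak{k}^*$ be a coadjoint orbit belonging to a Dixmier sheet $S$. Then the distance between $\mathcal{O}$ and $\mathcal{P}$ is greater than or equal to $\|\rho_S\|$.
   Context: Fix a $K$-invariant Euclidean inner product on $\mathfrak{k}$, used to identify $\mathfrak{k}\simeq\mathfrak{k}^*$; $\|\cdot\|$ is the associated norm on $\mathfrak{k}^*$. The distance between two coadjoint orbits is the minimum of $\|x-y\|$ for $x$ in the first and $y$ in the second. For $\xi\in\mathfrak{k}^*$, $K_\xi$ is its stabilizer (a connected group), with Lie algebra $\mathfrak{k}_\xi$. Roots with respect to a Cartan subalgebra $\mathfrak{t}$ are elements $\alpha\in\mathfrak{t}^*$ (the corresponding character of $T$ is $e^{i\alpha}$). For a compact connected group $H$, $\rho^H$ is half the sum of the positive roots for some choice of maximal torus and positive system; it is well defined up to conjugacy, so $\|\rho^H\|$ is well defined (for $H\subset K$, the norm is the restricted one). Regular: $\xi$ (or the orbit $K\xi$) is regular if $K_\xi$ is a Cartan subgroup (maximal torus) of $K$. Admissible: for $\xi\in\mathfrak{k}^*$, $\mathfrak{k}/\mathfrak{k}_\xi$ carries the symplectic form $\Omega_\xi(\bar X,\bar Y)=\langle\xi,[X,Y]\rangle$ and a unique $K_\xi$-invariant complex structure $J_\xi$ such that $\Omega_\xi(-,J_\xi-)$ is a scalar product; $\mathfrak{q}^\xi$ denotes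 $\mathfrak{k}/\mathfrak{k}_\xi$ as a complex vector space via $J_\xi$. Define $\rho(\xi)\in\mathfrak{k}_\xi^*$ by $\langle\rho(\xi),X\rangle=\frac{1}{2i}\mathrm{Tr}_{\mathfrak{q}^\xi}\mathrm{ad}(X)$, $X\in\mathfrak{k}_\xi$ (if $\xi\in\mathfrak{t}^*$ and $\Delta$ is the root system of $\mathfrak{t}$, then $\rho(\xi)=\frac12\sum_{\alpha\in\Delta,(\alpha,\xi)>0}\alpha$). The orbit $K\xi$ is admissible if $i(\xi-\rho(\xi))$, restricted to $\mathfrak{k}_\xi$, is the differential of a $1$-dimensional (unitary) representation of $K_\xi$. Dixmier sheet: for a conjugacy class $(\mathfrak{h})$ of subalgebras of the form $\mathfrak{h}=\mathfrak{k}_\xi$, $\xi\in\mathfrak{k}^*$, the Dixmier sheet $S=\mathfrak{k}^*_{(\mathfrak{h})}$ is the set of coadjoint orbits $K\xi$ such that $\mathfrak{k}_\xi$ is conjugate to $\mathfrak{h}$. Let $H$ be the connected Lie subgroup with Lie algebra $\mathfrak{h}$; then $\|\rho_S\|:=\|\rho^H\|$. *)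

theory Defs
  imports "HOL-Analysis.Analysis" "HOL-Algebra.Generated_Groups"
begin

section \<open>Smooth manifolds\<close>

text \<open>
  Manifolds are modelled on a linear subspace \<open>V\<close> of a Euclidean space. Types of class
  \<open>euclidean_space\<close> have positive dimension; a subspace also allows dimension 0, hence the
  trivial group. \<open>S\<close> below is meant to be open relative to \<open>V\<close>, so the derivative at a point
  of \<open>S\<close> is determined on \<open>V\<close>, and only its values on \<open>V\<close> are used.
\<close>

primrec Ck_on ::
  "nat \<Rightarrow> 'a::real_normed_vector set \<Rightarrow> 'a set \<Rightarrow> ('a \<Rightarrow> 'b::real_normed_vector) \<Rightarrow> bool" where
  "Ck_on 0 V S f \<longleftrightarrow> continuous_on S f"
| "Ck_on (Suc k) V S f \<longleftrightarrow>
     (\<exists>D. (\<forall>x\<in>S. (f has_derivative D x) (at x within S)) \<and> (\<forall>v\<in>V. Ck_on k V S (\<lambda>x. D x v)))"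

definition smooth_on ::
  "'a::real_normed_vector set \<Rightarrow> 'a set \<Rightarrow> ('a \<Rightarrow> 'b::real_normed_vector) \<Rightarrow> bool" where
  "smooth_on V S f \<longleftrightarrow> (\<forall>k. Ck_on k V S f)"

type_synonym ('m, 'e) atlas = "('m set \<times> ('m \<Rightarrow> 'e)) set"

definition smooth_manifold ::
  "'m topology \<Rightarrow> 'e::euclidean_space set \<Rightarrow> ('m, 'e) atlas \<Rightarrow> bool" where
  "smooth_manifold T V A \<longleftrightarrow>
     subspace V \<and> Hausdorff_space T \<and> second_countable T \<and>
     (\<Union>(U, \<phi>)\<in>A. U) = topspace T \<and>
     (\<forall>(U, \<phi>)\<in>A. openin T U \<and> openin (top_of_set V) (\<phi> ` U) \<and>
        homeomorphic_map (subtopology T U) (top_of_set (\<phi> ` U)) \<phi>) \<and>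
     (\<forall>(U, \<phi>)\<in>A. \<forall>(W, \<psi>)\<in>A. smooth_on V (\<phi> ` (U \<inter> W)) (\<psi> \<circ> inv_into U \<phi>))"

definition smooth_map ::
  "'m topology \<Rightarrow> 'e::euclidean_space set \<Rightarrow> ('m, 'e) atlas \<Rightarrow>
   'n topology \<Rightarrow> ('n, 'f::euclidean_space) atlas \<Rightarrow> ('m \<Rightarrow> 'n) \<Rightarrow> bool" where
  "smooth_map T V A T' A' f \<longleftrightarrow>
     continuous_map T T' f \<and>
     (\<forall>(U, \<phi>)\<in>A. \<forall>(W, \<psi>)\<in>A'.
        smooth_on V (\<phi> ` {x \<in> U. f x \<in> W}) (\<psi> \<circ> f \<circ> inv_into U \<phi>))"

definition prod_atlas :: "('m, 'e) atlas \<Rightarrow> ('n, 'f) atlas \<Rightarrow> ('m \<times> 'n, 'e \<times> 'f) atlas" where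
  "prod_atlas A B = {(U \<times> W, map_prod \<phi> \<psi>) | U \<phi> W \<psi>. (U, \<phi>) \<in> A \<and> (W, \<psi>) \<in> B}"


section \<open>Lie groups, Lie algebra, adjoint representation\<close>

record ('g, 'e) lie_struct = "'g monoid" +
  topo :: "'g topology"
  model :: "'e set"
  charts :: "('g, 'e) atlas"

locale lie_group = group K for K :: "('g, 'e::euclidean_space) lie_struct" (structure) +
  assumes topspace_topo: "topspace (topo K) = carrier K"
    and manifold: "smooth_manifold (topo K) (model K) (charts K)"
    and smooth_mult:
      "smooth_map (prod_topology (topo K) (topo K)) (model K \<times> model K)
         (prod_atlas (charts K) (charts K)) (topo K) (charts K) (\<lambda>(g, h). g \<otimes> h)"
    and smooth_inv:
      "smooth_map (topo K) (model K) (charts K) (topo K) (charts K) (\<lambda>g. inv g)"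

text \<open>
  The Lie algebra is the tangent space at the identity. It is identified with the model space
  through the differential of one (arbitrarily chosen) chart around the identity: \<open>X\<close> in the
  model space is the velocity at 0 of \<open>coord_curve K X\<close>.
\<close>

definition one_chart :: "('g, 'e::euclidean_space) lie_struct \<Rightarrow> 'g set \<times> ('g \<Rightarrow> 'e)" where
  "one_chart K = (SOME c. c \<in> charts K \<and> \<one>\<^bsub>K\<^esub> \<in> fst c)"

definition to_coord :: "('g, 'e::euclidean_space) lie_struct \<Rightarrow> 'g \<Rightarrow> 'e" where
  "to_coord K = snd (one_chart K)"

definition of_coord :: "('g, 'e::euclidean_space) lie_struct \<Rightarrow> 'e \<Rightarrow> 'g" where
  "of_coord K = inv_into (fst (one_chart K)) (to_coord K)"

definition coord_curve :: "('g, 'e::euclidean_space) lie_struct \<Rightarrow> 'e \<Rightarrow> real \<Rightarrow> 'g" where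
  "coord_curve K X s = of_coord K (to_coord K \<one>\<^bsub>K\<^esub> + s *\<^sub>R X)"

abbreviation lie_algebra :: "('g, 'e::euclidean_space) lie_struct \<Rightarrow> 'e set" where
  "lie_algebra K \<equiv> model K"

definition Ad :: "('g, 'e::euclidean_space) lie_struct \<Rightarrow> 'g \<Rightarrow> 'e \<Rightarrow> 'e" where
  "Ad K g X =
     vector_derivative (\<lambda>s. to_coord K (g \<otimes>\<^bsub>K\<^esub> coord_curve K X s \<otimes>\<^bsub>K\<^esub> inv\<^bsub>K\<^esub> g)) (at 0)"

text \<open>The bracket is the differential of \<open>Ad\<close> at the identity.\<close>

definition lie_bracket :: "('g, 'e::euclidean_space) lie_struct \<Rightarrow> 'e \<Rightarrow> 'e \<Rightarrow> 'e" where
  "lie_bracket K X Y = vector_derivative (\<lambda>s. Ad K (coord_curve K X s) Y) (at 0)"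

definition one_parameter_subgroup ::
  "('g, 'e::euclidean_space) lie_struct \<Rightarrow> 'e \<Rightarrow> (real \<Rightarrow> 'g) \<Rightarrow> bool" where
  "one_parameter_subgroup K X \<gamma> \<longleftrightarrow>
     continuous_map euclideanreal (topo K) \<gamma> \<and>
     (\<forall>s t. \<gamma> (s + t) = \<gamma> s \<otimes>\<^bsub>K\<^esub> \<gamma> t) \<and>
     ((\<lambda>s. to_coord K (\<gamma> s)) has_vector_derivative X) (at 0)"

definition lie_exp :: "('g, 'e::euclidean_space) lie_struct \<Rightarrow> 'e \<Rightarrow> 'g" where
  "lie_exp K X = (THE \<gamma>. one_parameter_subgroup K X \<gamma>) 1"

definition lie_algebra_of :: "('g, 'e::euclidean_space) lie_struct \<Rightarrow> 'g set \<Rightarrow> 'e set" where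
  "lie_algebra_of K A = {X \<in> lie_algebra K. \<forall>s. lie_exp K (s *\<^sub>R X) \<in> A}"

text \<open>The connected Lie subgroup with Lie algebra \<open>\<hh>\<close>.\<close>

definition connected_lie_subgroup ::
  "('g, 'e::euclidean_space) lie_struct \<Rightarrow> 'e set \<Rightarrow> 'g set" where
  "connected_lie_subgroup K \<hh> = generate K (lie_exp K ` \<hh>)"

text \<open>Compact subgroups are closed, hence Lie subgroups.\<close>

definition torus :: "('g, 'e::euclidean_space) lie_struct \<Rightarrow> 'g set \<Rightarrow> bool" where
  "torus K A \<longleftrightarrow> subgroup A K \<and> compactin (topo K) A \<and> connectedin (topo K) A \<and>
     (\<forall>g\<in>A. \<forall>h\<in>A. g \<otimes>\<^bsub>K\<^esub> h = h \<otimes>\<^bsub>K\<^esub> g)"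

definition maximal_torus ::
  "('g, 'e::euclidean_space) lie_struct \<Rightarrow> 'g set \<Rightarrow> 'g set \<Rightarrow> bool" where
  "maximal_torus K H A \<longleftrightarrow>
     torus K A \<and> A \<subseteq> H \<and> (\<forall>B. torus K B \<and> A \<subseteq> B \<and> B \<subseteq> H \<longrightarrow> B = A)"


section \<open>Linear functionals, invariant inner products, norms\<close>

text \<open>
  Functionals on a subspace \<open>W\<close> are extensional functions, so that two functionals that agree
  on \<open>W\<close> are equal.
\<close>

definition dual :: "'e::real_vector set \<Rightarrow> ('e \<Rightarrow> real) set" where
  "dual W = {f \<in> extensional W. (\<forall>x\<in>W. \<forall>y\<in>W. f (x + y) = f x + f y) \<and>
     (\<forall>c. \<forall>x\<in>W. f (c *\<^sub>R x) = c * f x)}"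

definition invariant_inner_product ::
  "('g, 'e::euclidean_space) lie_struct \<Rightarrow> ('e \<Rightarrow> 'e \<Rightarrow> real) \<Rightarrow> bool" where
  "invariant_inner_product K ip \<longleftrightarrow>
     (\<forall>X\<in>lie_algebra K. \<forall>Y\<in>lie_algebra K. ip X Y = ip Y X) \<and>
     (\<forall>X\<in>lie_algebra K. \<forall>Y\<in>lie_algebra K. \<forall>Z\<in>lie_algebra K. ip (X + Y) Z = ip X Z + ip Y Z) \<and>
     (\<forall>c. \<forall>X\<in>lie_algebra K. \<forall>Y\<in>lie_algebra K. ip (c *\<^sub>R X) Y = c * ip X Y) \<and>
     (\<forall>X\<in>lie_algebra K. X \<noteq> 0 \<longrightarrow> ip X X > 0) \<and>
     (\<forall>g\<in>carrier K. \<forall>X\<in>lie_algebra K. \<forall>Y\<in>lie_algebra K. ip (Ad K g X) (Ad K g Y) = ip X Y)"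

text \<open>
  The norm of a functional \<open>f\<close> on a subspace \<open>W\<close>: the length of the vector of \<open>W\<close> that
  corresponds to \<open>f\<close> under the identification of \<open>W\<close> with its dual given by \<open>ip\<close>.
\<close>

definition dual_norm :: "('e \<Rightarrow> 'e \<Rightarrow> real) \<Rightarrow> 'e set \<Rightarrow> ('e \<Rightarrow> real) \<Rightarrow> real" where
  "dual_norm ip W f = (let x = (THE x. x \<in> W \<and> (\<forall>y\<in>W. f y = ip x y)) in sqrt (ip x x))"


section \<open>Coadjoint orbits\<close>

definition Coad ::
  "('g, 'e::euclidean_space) lie_struct \<Rightarrow> 'g \<Rightarrow> ('e \<Rightarrow> real) \<Rightarrow> 'e \<Rightarrow> real" where
  "Coad K g \<xi> = (\<lambda>X\<in>lie_algebra K. \<xi> (Ad K (inv\<^bsub>K\<^esub> g) X))"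

definition coadjoint_orbit ::
  "('g, 'e::euclidean_space) lie_struct \<Rightarrow> ('e \<Rightarrow> real) \<Rightarrow> ('e \<Rightarrow> real) set" where
  "coadjoint_orbit K \<xi> = (\<lambda>g. Coad K g \<xi>) ` carrier K"

definition coad_stabilizer ::
  "('g, 'e::euclidean_space) lie_struct \<Rightarrow> ('e \<Rightarrow> real) \<Rightarrow> 'g set" where
  "coad_stabilizer K \<xi> = {g \<in> carrier K. Coad K g \<xi> = \<xi>}"

abbreviation stabilizer_algebra ::
  "('g, 'e::euclidean_space) lie_struct \<Rightarrow> ('e \<Rightarrow> real) \<Rightarrow> 'e set" where
  "stabilizer_algebra K \<xi> \<equiv> lie_algebra_of K (coad_stabilizer K \<xi>)"

text \<open>The distance is a minimum, since the orbits of a compact group are compact.\<close>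

definition orbit_distance ::
  "('g, 'e::euclidean_space) lie_struct \<Rightarrow> ('e \<Rightarrow> 'e \<Rightarrow> real) \<Rightarrow>
   ('e \<Rightarrow> real) set \<Rightarrow> ('e \<Rightarrow> real) set \<Rightarrow> real" where
  "orbit_distance K ip A B =
     Inf {dual_norm ip (lie_algebra K) (\<lambda>X. \<xi> X - \<eta> X) | \<xi> \<eta>. \<xi> \<in> A \<and> \<eta> \<in> B}"

definition regular :: "('g, 'e::euclidean_space) lie_struct \<Rightarrow> ('e \<Rightarrow> real) \<Rightarrow> bool" where
  "regular K \<xi> \<longleftrightarrow> maximal_torus K (carrier K) (coad_stabilizer K \<xi>)"

definition dixmier_sheet ::
  "('g, 'e::euclidean_space) lie_struct \<Rightarrow> 'e set \<Rightarrow> ('e \<Rightarrow> real) set set" where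
  "dixmier_sheet K \<hh> = {coadjoint_orbit K \<xi> | \<xi>.
     \<xi> \<in> dual (lie_algebra K) \<and> (\<exists>g\<in>carrier K. stabilizer_algebra K \<xi> = Ad K g ` \<hh>)}"


section \<open>Admissible orbits\<close>

text \<open>
  A linear map of the quotient \<open>V / W\<close> is represented by a map of \<open>V\<close> preserving \<open>W\<close>;
  equality in \<open>V / W\<close> is congruence modulo \<open>W\<close>.
\<close>

definition cscale :: "('e::real_vector \<Rightarrow> 'e) \<Rightarrow> complex \<Rightarrow> 'e \<Rightarrow> 'e" where
  "cscale J z X = Re z *\<^sub>R X + Im z *\<^sub>R J X"

definition complex_basis ::
  "'e::real_vector set \<Rightarrow> 'e set \<Rightarrow> ('e \<Rightarrow> 'e) \<Rightarrow> 'e set \<Rightarrow> bool" where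
  "complex_basis V W J B \<longleftrightarrow> finite B \<and> B \<subseteq> V \<and>
     (\<forall>X\<in>V. \<exists>!c. c \<in> B \<rightarrow>\<^sub>E UNIV \<and> X - (\<Sum>b\<in>B. cscale J (c b) b) \<in> W)"

definition complex_coord ::
  "'e::real_vector set \<Rightarrow> ('e \<Rightarrow> 'e) \<Rightarrow> 'e set \<Rightarrow> 'e \<Rightarrow> 'e \<Rightarrow> complex" where
  "complex_coord W J B X = (THE c. c \<in> B \<rightarrow>\<^sub>E UNIV \<and> X - (\<Sum>b\<in>B. cscale J (c b) b) \<in> W)"

definition complex_trace ::
  "'e::real_vector set \<Rightarrow> 'e set \<Rightarrow> ('e \<Rightarrow> 'e) \<Rightarrow> ('e \<Rightarrow> 'e) \<Rightarrow> complex" where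
  "complex_trace V W J A =
     (let B = (SOME B. complex_basis V W J B) in \<Sum>b\<in>B. complex_coord W J B (A b) b)"

definition Omega ::
  "('g, 'e::euclidean_space) lie_struct \<Rightarrow> ('e \<Rightarrow> real) \<Rightarrow> 'e \<Rightarrow> 'e \<Rightarrow> real" where
  "Omega K \<xi> X Y = \<xi> (lie_bracket K X Y)"

definition orbit_complex_structure ::
  "('g, 'e::euclidean_space) lie_struct \<Rightarrow> ('e \<Rightarrow> real) \<Rightarrow> ('e \<Rightarrow> 'e) \<Rightarrow> bool" where
  "orbit_complex_structure K \<xi> J \<longleftrightarrow>
     (let V = lie_algebra K; W = stabilizer_algebra K \<xi> in
       J ` V \<subseteq> V \<and> J ` W \<subseteq> W \<and>
       (\<forall>X\<in>V. \<forall>Y\<in>V. J (X + Y) = J X + J Y) \<and> (\<forall>c. \<forall>X\<in>V. J (c *\<^sub>R X) = c *\<^sub>R J X) \<and>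
       (\<forall>X\<in>V. J (J X) + X \<in> W) \<and>
       (\<forall>g\<in>coad_stabilizer K \<xi>. \<forall>X\<in>V. J (Ad K g X) - Ad K g (J X) \<in> W) \<and>
       (\<forall>X\<in>V. \<forall>Y\<in>V. Omega K \<xi> X (J Y) = Omega K \<xi> Y (J X)) \<and>
       (\<forall>X\<in>V - W. Omega K \<xi> X (J X) > 0))"

text \<open>
  The complex structure is unique on the quotient. The trace is purely imaginary, so taking the
  real part only changes the type.
\<close>

definition rho :: "('g, 'e::euclidean_space) lie_struct \<Rightarrow> ('e \<Rightarrow> real) \<Rightarrow> 'e \<Rightarrow> real" where
  "rho K \<xi> =
     (let W = stabilizer_algebra K \<xi>; J = (SOME J. orbit_complex_structure K \<xi> J) in
       (\<lambda>X\<in>W. Re (complex_trace (lie_algebra K) W J (lie_bracket K X) / (2 * \<i>))))"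

definition unitary_character ::
  "('g, 'e::euclidean_space) lie_struct \<Rightarrow> 'g set \<Rightarrow> ('g \<Rightarrow> complex) \<Rightarrow> bool" where
  "unitary_character K A \<tau> \<longleftrightarrow>
     continuous_map (subtopology (topo K) A) euclidean \<tau> \<and>
     (\<forall>g\<in>A. \<forall>h\<in>A. \<tau> (g \<otimes>\<^bsub>K\<^esub> h) = \<tau> g * \<tau> h) \<and> (\<forall>g\<in>A. norm (\<tau> g) = 1)"

definition admissible :: "('g, 'e::euclidean_space) lie_struct \<Rightarrow> ('e \<Rightarrow> real) \<Rightarrow> bool" where
  "admissible K \<xi> \<longleftrightarrow>
     (\<exists>\<tau>. unitary_character K (coad_stabilizer K \<xi>) \<tau> \<and>
       (\<forall>X\<in>stabilizer_algebra K \<xi>.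
          ((\<lambda>s. \<tau> (lie_exp K (s *\<^sub>R X))) has_vector_derivative \<i> * of_real (\<xi> X - rho K \<xi> X)) (at 0)))"


section \<open>Roots and the norm of half the sum of the positive roots\<close>

text \<open>
  \<open>(U, V)\<close> stands for the vector \<open>U + \<i> V\<close> of the complexification of \<open>\<hh>\<close>; the two equations
  say that \<open>[X, U + \<i> V] = \<i> \<alpha>(X) (U + \<i> V)\<close>.
\<close>

definition roots ::
  "('g, 'e::euclidean_space) lie_struct \<Rightarrow> 'e set \<Rightarrow> 'e set \<Rightarrow> ('e \<Rightarrow> real) set" where
  "roots K \<hh> \<tt> = {\<alpha> \<in> dual \<tt>. (\<exists>X\<in>\<tt>. \<alpha> X \<noteq> 0) \<and>
     (\<exists>U\<in>\<hh>. \<exists>V\<in>\<hh>. (U, V) \<noteq> (0, 0) \<and>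
        (\<forall>X\<in>\<tt>. lie_bracket K X U = - \<alpha> X *\<^sub>R V \<and> lie_bracket K X V = \<alpha> X *\<^sub>R U))}"

definition positive_system :: "'e set \<Rightarrow> ('e \<Rightarrow> real) set \<Rightarrow> ('e \<Rightarrow> real) set \<Rightarrow> bool" where
  "positive_system \<tt> \<Delta> P \<longleftrightarrow> (\<exists>X\<in>\<tt>. (\<forall>\<alpha>\<in>\<Delta>. \<alpha> X \<noteq> 0) \<and> P = {\<alpha> \<in> \<Delta>. \<alpha> X > 0})"

definition rho_norm ::
  "('g, 'e::euclidean_space) lie_struct \<Rightarrow> ('e \<Rightarrow> 'e \<Rightarrow> real) \<Rightarrow> 'g set \<Rightarrow> real" where
  "rho_norm K ip H = (SOME r. \<exists>A P. maximal_torus K H A \<and>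
     positive_system (lie_algebra_of K A) (roots K (lie_algebra_of K H) (lie_algebra_of K A)) P \<and>
     r = dual_norm ip (lie_algebra_of K A) (\<lambda>X. (\<Sum>\<alpha>\<in>P. \<alpha> X) / 2))"

end

theory Submission
  imports Defs
begin

text \<open>
  The exponential map is built from the group law alone: in a chart the squaring map is
  \<open>x \<mapsto> 2 x + O(|x|\<^sup>2)\<close>, so \<open>n\<close>-fold squaring applied to \<open>x / 2\<^sup>n\<close> converges (Koenigs' linearization).

  Let \<open>x\<close> represent the regular admissible orbit, let \<open>T\<close> be its stabilizer, and let \<open>y\<close> be the point of
  the other orbit closest to \<open>x\<close>. The first variation of the distance gives \<open>[x, y] = 0\<close>, so that
  \<open>y \<in> \<tt>\<close>, and comparing \<open>y\<close> with its images under the reflections shows that \<open>y\<close> lies in the closed Weyl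
  chamber of \<open>x\<close>. The relation \<open>exp (2 \<pi> H) = 1\<close> for the coroots \<open>H\<close> comes from the
  quaternion relations \<open>i j i\<^sup>-\<^sup>1 = j\<^sup>-\<^sup>1\<close>, \<open>j i j\<^sup>-\<^sup>1 = i\<^sup>-\<^sup>1\<close> in the image of \<open>SU(2)\<close>, which force \<open>i\<^sup>4 = 1\<close>.
  By this relation, admissibility makes \<open>2 (x, \<alpha>) / (\<alpha>, \<alpha>)\<close> a positive integer for every simple root \<open>\<alpha>\<close>, hence
  \<open>(x - y, \<alpha>) \<ge> (\<alpha>, \<alpha>) / 2 = (\<rho>\<^sub>y, \<alpha>)\<close> for the simple roots \<open>\<alpha>\<close> of the stabilizer of \<open>y\<close>, where \<open>\<rho>\<^sub>y\<close> is half the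
  sum of its positive roots. As \<open>\<rho>\<^sub>y\<close> is a nonnegative combination of these simple roots,
  \<open>\<parallel>\<rho>\<^sub>y\<parallel> \<le> \<parallel>x - y\<parallel>\<close>.
\<close>

section \<open>Linearization of the doubling map\<close>

text \<open>\<open>rho_norm\<close> is defined through a chosen maximal torus and a chosen positive
  system, so its value must be shown independent of both; the maximization that yields the closest
  point, repeated inside the stabilizer of \<open>y\<close>, does this too. Likewise
  \<open>rho\<close> rests on a chosen complex structure and a chosen complex basis, and is computed
  only after the structure is known to be unique modulo the Cartan subalgebra.

  Admissibility concerns x - \<rho>, not x. As \<rho> takes the value 1 on every simple coroot,
  integrality passes to x there, and regularity makes the integer positive. The inequality is wanted
  at the simple roots of the stabilizer of \<open>y\<close>; because \<open>y\<close> lies in the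
  closed chamber of x, these are simple for the whole group.

  Identities between exponentials are proved by halving: two sequences in which each term is the
  square of the next one coincide as soon as they agree up to o(2^-n). That a torus is the
  exponential image of its Lie algebra lets inclusions of tori be read off from their Lie
  algebras.\<close>

locale koenigs =
  fixes f :: "'a::euclidean_space \<Rightarrow> 'a" and V :: "'a set" and C r :: real
  assumes V: "subspace V" and C: "C > 0" and r: "r > 0"
    and fV: "\<And>x. x \<in> V \<Longrightarrow> norm x \<le> r \<Longrightarrow> f x \<in> V" and f0: "f 0 = 0"
    and est: "\<And>x y s. x \<in> V \<Longrightarrow> y \<in> V \<Longrightarrow> norm x \<le> s \<Longrightarrow> norm y \<le> s \<Longrightarrow> s \<le> r \<Longrightarrow>
      norm (f x - f y - 2 *\<^sub>R (x - y)) \<le> C * s * norm (x - y)"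
begin

text \<open>Iterates that start below \<open>4 * \<delta> / 2 ^ n\<close> may grow to
  \<open>8 * \<delta>\<close>, which the first bound keeps within \<open>r\<close>. The second bound
  makes the accumulated exponent \<open>2 * C * (4 * \<delta>)\<close> at most 1/2, so that the
  distortion of n iterations is at most 2.\<close>

definition "\<delta> = min (r / 8) (1 / (16 * C))"

lemma \<delta>_pos: "\<delta> > 0" and \<delta>_r: "8 * \<delta> \<le> r" and \<delta>_C: "16 * C * \<delta> \<le> 1"
  using C r by (auto simp: \<delta>_def min_def field_simps)

lemma exp_half_le: "exp (t::real) \<le> 2" if "t \<le> 1/2"
proof -
  have "exp t \<le> exp (1/2)" using that by simp
  also have "\<dots> \<le> 1 + 1/2 + (1/2)^2" by (rule exp_bound) auto
  finally show ?thesis by (simp add: power2_eq_square)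
qed

text \<open>One step multiplies distances by at most 2 (1 + C 2^k u). The product of the factors 1 +
  C 2^k u stays bounded because 2^k u grows geometrically; the exponent 2 C 2^k u doubles with every
  step, which leaves room for one more factor.\<close>

lemma iter_aux:
  assumes "x \<in> V" "y \<in> V" "norm x \<le> u" "norm y \<le> u" "2 ^ n * u \<le> 4 * \<delta>" "k \<le> n"
  shows "(f ^^ k) x \<in> V \<and> (f ^^ k) y \<in> V \<and>
    norm ((f ^^ k) x) \<le> 2 ^ k * exp (2 * C * 2 ^ k * u) * u \<and>
    norm ((f ^^ k) y) \<le> 2 ^ k * exp (2 * C * 2 ^ k * u) * u \<and>
    norm ((f ^^ k) x - (f ^^ k) y) \<le> 2 ^ k * exp (2 * C * 2 ^ k * u) * norm (x - y)"
  using \<open>k \<le> n\<close>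
proof (induction k)
  case 0
  have u: "u \<ge> 0" using assms(3) norm_ge_zero order_trans by blast
  then have "exp (2 * C * u) \<ge> 1" using C by simp
  then have "1 * u \<le> exp (2 * C * u) * u" "1 * norm (x - y) \<le> exp (2 * C * u) * norm (x - y)"
    using u by (intro mult_right_mono; simp)+
  then show ?case using assms by auto
next
  case (Suc k)
  have u: "u \<ge> 0" using assms(3) norm_ge_zero order_trans by blast
  define e where "e = 2 ^ k * exp (2 * C * 2 ^ k * u)"
  have "(2::real) ^ Suc k \<le> 2 ^ n" using Suc.prems by (intro power_increasing) auto
  then have "2 ^ Suc k * u \<le> 2 ^ n * u" using u by (intro mult_right_mono) auto
  then have k4: "2 ^ Suc k * u \<le> 4 * \<delta>" using assms(5) by linarith
  then have "2 * C * (2 ^ k * u) \<le> C * (4 * \<delta>)" using C by simp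
  then have "2 * C * 2 ^ k * u \<le> 1/2" using \<delta>_C by (simp add: mult_ac)
  then have "exp (2 * C * 2 ^ k * u) \<le> 2" by (rule exp_half_le)
  then have eu: "e * u \<le> 2 * 2 ^ k * u" unfolding e_def
    by (intro mult_right_mono[OF _ u]) simp
  \<comment> \<open>A radius that contains both iterates, because the exponential factor is at most
    2 in this range.\<close>
  define s where "s = 2 * 2 ^ k * u"
  have "s = 2 ^ Suc k * u" by (simp add: s_def)
  then have s: "s \<le> r" using k4 \<delta>_r \<delta>_pos by linarith
  have step: "norm (f a - f b) \<le> (2 + C * s) * norm (a - b)"
    if "a \<in> V" "b \<in> V" "norm a \<le> s" "norm b \<le> s" for a b
  proof -
    have "norm (f a - f b) = norm ((f a - f b - 2 *\<^sub>R (a - b)) + 2 *\<^sub>R (a - b))" by simp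
    also have "\<dots> \<le> norm (f a - f b - 2 *\<^sub>R (a - b)) + norm (2 *\<^sub>R (a - b))" by (rule norm_triangle_ineq)
    also have "\<dots> \<le> C * s * norm (a - b) + 2 * norm (a - b)"
      using est[OF that s] by simp
    finally show ?thesis by (simp add: algebra_simps)
  qed
  have "1 + C * 2 ^ k * u \<le> exp (C * 2 ^ k * u)" by simp
  also have "\<dots> \<le> exp (2 * C * 2 ^ k * u)" using C u by simp
  finally have "(2 + C * s) \<le> 2 * exp (2 * C * 2 ^ k * u)" by (simp add: s_def mult_ac)
  then have "(2 + C * s) * e \<le> 2 * exp (2 * C * 2 ^ k * u) * e"
    by (intro mult_right_mono) (simp_all add: e_def)
  also have "\<dots> = 2 ^ Suc k * (exp (2 * C * 2 ^ k * u) * exp (2 * C * 2 ^ k * u))"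
    by (simp add: e_def)
  also have "\<dots> = 2 ^ Suc k * exp (2 * C * 2 ^ Suc k * u)"
    by (simp add: exp_add[symmetric])
  finally have ek: "(2 + C * s) * e \<le> 2 ^ Suc k * exp (2 * C * 2 ^ Suc k * u)" .
  have Cs: "0 \<le> 2 + C * s" using C u by (simp add: s_def)
  \<comment> \<open>Serves the difference of the two iterates and, with \<open>b = 0\<close> and
    \<open>f 0 = 0\<close>, the norm of each of them.\<close>
  have big: "norm (f a - f b) \<le> 2 ^ Suc k * exp (2 * C * 2 ^ Suc k * u) * d"
    if "a \<in> V" "b \<in> V" "norm a \<le> s" "norm b \<le> s" "norm (a - b) \<le> e * d" "0 \<le> d" for a b d
  proof -
    have "norm (f a - f b) \<le> (2 + C * s) * (e * d)"
      using step[OF that(1-4)] mult_left_mono[OF that(5) Cs] by linarith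
    also have "\<dots> \<le> 2 ^ Suc k * exp (2 * C * 2 ^ Suc k * u) * d"
      using mult_right_mono[OF ek that(6)] by (simp add: mult_ac)
    finally show ?thesis .
  qed
  have IH: "(f ^^ k) x \<in> V" "(f ^^ k) y \<in> V" "norm ((f ^^ k) x) \<le> e * u" "norm ((f ^^ k) y) \<le> e * u"
    "norm ((f ^^ k) x - (f ^^ k) y) \<le> e * norm (x - y)"
    using Suc by (auto simp: e_def)
  have ss: "norm ((f ^^ k) x) \<le> s" "norm ((f ^^ k) y) \<le> s" "0 \<le> s"
    using IH(3,4) eu u by (simp_all add: s_def)
  have 0: "0 \<in> V" using V subspace_0 by blast
  show ?case
    using fV[OF IH(1)] fV[OF IH(2)] ss s big[OF IH(1,2) ss(1,2) IH(5)]
      big[OF IH(1) 0 ss(1) _ _ u] big[OF IH(2) 0 ss(2) _ _ u] IH(3,4) by (simp add: f0)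
qed

lemma iter:
  assumes "x \<in> V" "y \<in> V" "norm x \<le> u" "norm y \<le> u" "2 ^ n * u \<le> 4 * \<delta>"
  shows "(f ^^ n) x \<in> V" "norm ((f ^^ n) x) \<le> 2 * 2 ^ n * u"
    "norm ((f ^^ n) x - (f ^^ n) y) \<le> 2 * 2 ^ n * norm (x - y)"
proof -
  have u: "u \<ge> 0" using assms(3) norm_ge_zero order_trans by blast
  have "2 * C * (2 ^ n * u) \<le> 2 * C * (4 * \<delta>)" using C by (intro mult_left_mono assms(5)) simp
  then have "2 * C * 2 ^ n * u \<le> 1/2" using \<delta>_C by (simp add: mult_ac)
  then have "exp (2 * C * 2 ^ n * u) \<le> 2" by (rule exp_half_le)
  then have e: "2 ^ n * exp (2 * C * 2 ^ n * u) \<le> 2 * 2 ^ n" by simp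
  note a = iter_aux[OF assms order_refl]
  show "(f ^^ n) x \<in> V" using a by blast
  show "norm ((f ^^ n) x) \<le> 2 * 2 ^ n * u" "norm ((f ^^ n) x - (f ^^ n) y) \<le> 2 * 2 ^ n * norm (x - y)"
    using a mult_right_mono[OF e u] mult_right_mono[OF e norm_ge_zero[of "x - y"]] by linarith+
qed

text \<open>The n-th iterate stretches distances by at most 2 * 2^n, so a backward orbit is
  determined by its behaviour to first order at the origin. The rules for powers and inverses of
  exponentials and the uniqueness of one-parameter subgroups are all obtained by recognizing both
  sides as backward orbits of the squaring map.\<close>

lemma orbit_unique:
  assumes g: "\<And>n. g n \<in> V" "\<And>n. f (g (Suc n)) = g n"
    and h: "\<And>n. h n \<in> V" "\<And>n. f (h (Suc n)) = h n"
    and b: "\<And>n. 2 ^ n * norm (g n) \<le> 4 * \<delta>" "\<And>n. 2 ^ n * norm (h n) \<le> 4 * \<delta>"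
    and lim: "(\<lambda>n. 2 ^ n * norm (g n - h n)) \<longlonglongrightarrow> 0"
  shows "g 0 = h 0"
proof -
  have it: "(f ^^ n) (k n) = k 0" if "\<And>n. f (k (Suc n)) = k n" for k n
  proof (induction n)
    case (Suc n)
    have "(f ^^ Suc n) (k (Suc n)) = (f ^^ n) (f (k (Suc n)))" by (simp add: funpow_swap1)
    then show ?case using Suc that by simp
  qed simp
  have le: "norm (g 0 - h 0) \<le> 2 * (2 ^ n * norm (g n - h n))" for n
    using iter(3)[OF g(1)[of n] h(1)[of n], of "max (norm (g n)) (norm (h n))" n] b[of n]
    by (simp add: it[of g, OF g(2)] it[of h, OF h(2)] max_def mult_ac split: if_splits)
  have "norm (g 0 - h 0) \<le> 2 * 0"
    by (rule LIMSEQ_le_const[OF tendsto_mult[OF tendsto_const lim]]) (use le in auto)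
  then show ?thesis by simp
qed

definition "En n X = (f ^^ n) (X /\<^sub>R 2 ^ n)"
definition "E X = lim (\<lambda>n. En n X)"

lemma f_bound:
  assumes "x \<in> V" "norm x \<le> 4 * \<delta>"
  shows "norm (f x - 2 *\<^sub>R x) \<le> C * norm x ^ 2" "norm (f x) \<le> 4 * norm x"
proof -
  have *: "norm (f x - 2 *\<^sub>R x) \<le> C * norm x * norm x"
    using est[OF assms(1) subspace_0[OF V] order_refl] assms \<delta>_r \<delta>_pos by (simp add: f0)
  then show "norm (f x - 2 *\<^sub>R x) \<le> C * norm x ^ 2" by (simp add: power2_eq_square)
  have "C * norm x \<le> C * (4 * \<delta>)" using C assms by simp
  then have "C * norm x \<le> 1" using \<delta>_C by linarith
  then have "C * norm x * norm x \<le> 1 * norm x" by (intro mult_right_mono) auto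
  moreover have "norm (f x) \<le> norm (f x - 2 *\<^sub>R x) + norm (2 *\<^sub>R x)"
    using norm_triangle_ineq[of "f x - 2 *\<^sub>R x" "2 *\<^sub>R x"] by simp
  ultimately show "norm (f x) \<le> 4 * norm x" using * norm_ge_zero[of x] unfolding norm_scaleR by linarith
qed

text \<open>With x = X / 2^(n+1), the two iterations start from \<open>f x\<close> and 2 x, whose
  distance is O(4^-n); n further iterations enlarge it by a factor 2 * 2^n only.\<close>

lemma En_step:
  assumes "X \<in> V" "norm X \<le> \<delta>"
  shows "norm (En (Suc n) X - En n X) \<le> C * norm X ^ 2 * (1/2) ^ n"
proof -
  define x where "x = X /\<^sub>R 2 ^ Suc n"
  have x: "x \<in> V" unfolding x_def by (intro subspace_mul V assms)
  have nx: "2 * (2 ^ n * norm x) = norm X" by (simp add: x_def field_simps)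
  have "norm x * 1 \<le> norm x * (2 * 2 ^ n)"
  proof (intro mult_left_mono norm_ge_zero)
    show "(1::real) \<le> 2 * 2 ^ n" using one_le_power[of "2::real" n] by linarith
  qed
  also have "\<dots> = norm X" using nx by (simp add: mult_ac)
  finally have "norm x \<le> norm X" by simp
  then have xd: "norm x \<le> 4 * \<delta>" using assms \<delta>_pos by linarith
  have "norm (En (Suc n) X - En n X) = norm ((f ^^ n) (f x) - (f ^^ n) (2 *\<^sub>R x))"
    by (simp add: En_def x_def funpow_swap1)
  also have "\<dots> \<le> 2 * 2 ^ n * norm (f x - 2 *\<^sub>R x)"
    using assms nx x xd \<delta>_r \<delta>_pos f_bound[OF x xd]
    by (intro iter(3)[of _ _ "4 * norm x"] fV subspace_mul V) auto
  also have "\<dots> \<le> 2 * 2 ^ n * (C * norm x ^ 2)"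
    using f_bound(1)[OF x xd] by simp
  also have "\<dots> \<le> C * norm X ^ 2 * (1/2) ^ n"
    using C by (simp add: x_def field_simps power2_eq_square power_divide)
  finally show ?thesis .
qed

lemma E_uniform:
  assumes "0 \<le> t" "t \<le> \<delta>"
  shows "uniform_limit (V \<inter> cball 0 t) En E sequentially"
proof -
  have "uniform_limit (V \<inter> cball 0 t) (\<lambda>n X. \<Sum>i<n. En (Suc i) X - En i X)
      (\<lambda>X. suminf (\<lambda>i. En (Suc i) X - En i X)) sequentially"
  proof (rule Weierstrass_m_test)
    show "norm (En (Suc n) x - En n x) \<le> C * t ^ 2 * (1/2) ^ n" if "x \<in> V \<inter> cball 0 t" for n x
    proof -
      have "norm (En (Suc n) x - En n x) \<le> C * norm x ^ 2 * (1/2) ^ n"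
        by (rule En_step) (use that assms in auto)
      also have "\<dots> \<le> C * t ^ 2 * (1/2) ^ n"
        by (intro mult_right_mono mult_left_mono power_mono) (use that C in auto)
      finally show ?thesis .
    qed
    show "summable (\<lambda>n. C * t\<^sup>2 * (1/2) ^ n)" by (intro summable_mult summable_geometric) auto
  qed
  then have "uniform_limit (V \<inter> cball 0 t) (\<lambda>n X. (\<Sum>i<n. En (Suc i) X - En i X) + X)
      (\<lambda>X. suminf (\<lambda>i. En (Suc i) X - En i X) + X) sequentially"
    by (intro uniform_limit_add uniform_limit_const)
  moreover have tel: "(\<Sum>i<n. En (Suc i) X - En i X) + X = En n X" for n X
    by (subst sum_lessThan_telescope) (simp add: En_def)
  ultimately have u: "uniform_limit (V \<inter> cball 0 t) En (\<lambda>X. suminf (\<lambda>i. En (Suc i) X - En i X) + X) sequentially"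
    by (simp add: tel)
  have "E X = suminf (\<lambda>i. En (Suc i) X - En i X) + X" if "X \<in> V \<inter> cball 0 t" for X
    unfolding E_def using tendsto_uniform_limitI[OF u that] by (rule limI)
  then show ?thesis using u by (subst uniform_limit_cong'[where i = "\<lambda>X. suminf (\<lambda>i. En (Suc i) X - En i X) + X" and g = En]) auto
qed

lemma E_lim: assumes "X \<in> V" "norm X \<le> \<delta>" shows "(\<lambda>n. En n X) \<longlonglongrightarrow> E X"
  using tendsto_uniform_limitI[OF E_uniform[of \<delta>], of X] assms \<delta>_pos by auto

lemma En_V:
  assumes "X \<in> V" "norm X \<le> \<delta>"
  shows "En n X \<in> V" "norm (En n X) \<le> 2 * norm X"
proof -
  have *: "X /\<^sub>R 2 ^ n \<in> V" by (intro subspace_mul V assms)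
  have n: "2 ^ n * (norm X / 2 ^ n) = norm X" by simp
  show "En n X \<in> V" "norm (En n X) \<le> 2 * norm X"
    using iter(1,2)[OF * *, of "norm X / 2 ^ n" n] n assms \<delta>_pos
    by (simp_all add: En_def field_simps)
qed

lemma E_V:
  assumes "X \<in> V" "norm X \<le> \<delta>"
  shows "E X \<in> V" "norm (E X) \<le> 2 * norm X"
proof -
  show "E X \<in> V"
    using closed_sequentially[OF closed_subspace[OF V] _ E_lim[OF assms]] En_V[OF assms] by auto
  show "norm (E X) \<le> 2 * norm X"
    by (rule LIMSEQ_le_const2[OF tendsto_norm[OF E_lim[OF assms]]]) (use En_V[OF assms] in auto)
qed

text \<open>The geometric series of the successive differences sums to at most 2. A quadratic error
  survives multiplication by 2^n at arguments of size 2^-n, which is the comparison that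
  \<open>orbit_unique\<close> demands.\<close>

lemma E_approx:
  assumes "X \<in> V" "norm X \<le> \<delta>"
  shows "norm (E X - X) \<le> 2 * C * norm X ^ 2"
proof -
  have "norm (En n X - X) \<le> C * norm X ^ 2 * (2 - 2 * (1/2) ^ n)" for n
  proof (induction n)
    case 0 then show ?case by (simp add: En_def)
  next
    case (Suc n)
    have "norm (En (Suc n) X - X) \<le> norm (En (Suc n) X - En n X) + norm (En n X - X)"
      using norm_triangle_ineq[of "En (Suc n) X - En n X" "En n X - X"] by simp
    also have "\<dots> \<le> C * norm X ^ 2 * (1/2) ^ n + C * norm X ^ 2 * (2 - 2 * (1/2) ^ n)"
      using Suc En_step[OF assms, of n] by linarith
    finally show ?case by (simp add: algebra_simps)
  qed
  moreover have "C * norm X ^ 2 * (2 - 2 * (1/2) ^ n) \<le> 2 * C * norm X ^ 2" for n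
    using C by (simp add: algebra_simps)
  ultimately have "norm (En n X - X) \<le> 2 * C * norm X ^ 2" for n using order_trans by blast
  then show ?thesis
    by (intro LIMSEQ_le_const2[OF tendsto_norm[OF tendsto_diff[OF E_lim[OF assms] tendsto_const]]]) auto
qed

lemma f_continuous: "continuous_on (V \<inter> cball 0 r) f"
proof (rule lipschitz_on_continuous_on[of "2 + C * r"], rule lipschitz_onI)
  show "0 \<le> 2 + C * r" using C r by simp
  fix x y assume *: "x \<in> V \<inter> cball 0 r" "y \<in> V \<inter> cball 0 r"
  have "norm (f x - f y) \<le> norm (f x - f y - 2 *\<^sub>R (x - y)) + norm (2 *\<^sub>R (x - y))"
    using norm_triangle_ineq[of "f x - f y - 2 *\<^sub>R (x - y)" "2 *\<^sub>R (x - y)"] by simp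
  also have "\<dots> \<le> C * r * norm (x - y) + 2 * norm (x - y)"
    using est[of x y r] * by simp
  finally show "dist (f x) (f y) \<le> (2 + C * r) * dist x y" by (simp add: dist_norm algebra_simps)
qed

lemma E_continuous: "continuous_on (V \<inter> cball 0 \<delta>) E"
proof (rule uniform_limit_theorem[OF _ E_uniform[OF less_imp_le[OF \<delta>_pos] order_refl]])
  have "continuous_on (V \<inter> cball 0 \<delta>) (\<lambda>X. (f ^^ k) (X /\<^sub>R 2 ^ n))" if "k \<le> n" for k n
    using that
  proof (induction k)
    case 0 then show ?case by (auto intro!: continuous_intros)
  next
    case (Suc k)
    have "(f ^^ k) (X /\<^sub>R 2 ^ n) \<in> V \<inter> cball 0 r" if "X \<in> V \<inter> cball 0 \<delta>" for X
    proof -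
      \<comment> \<open>Regrouping the halvings turns the k-th iterate at X / 2^n into the k-th
        approximation at X / 2^(n-k), whose size is already bounded.\<close>
      define Y where "Y = X /\<^sub>R 2 ^ (n - k)"
      have "norm X \<le> norm X * 2 ^ (n - k)" by (simp add: mult_le_cancel_left1)
      then have "Y \<in> V" "norm Y \<le> \<delta>" using that V
        by (auto simp: Y_def subspace_mul field_simps intro: order_trans)
      moreover have "2 ^ n = (2::real) ^ k * 2 ^ (n - k)"
        using Suc.prems by (simp add: power_add[symmetric])
      then have "(f ^^ k) (X /\<^sub>R 2 ^ n) = En k Y"
        by (simp add: En_def Y_def)
      ultimately show ?thesis using En_V[of Y k] \<delta>_r \<delta>_pos by auto
    qed
    moreover have "continuous_on (V \<inter> cball 0 \<delta>) (\<lambda>X. (f ^^ k) (X /\<^sub>R 2 ^ n))" using Suc by simp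
    ultimately have "continuous_on (V \<inter> cball 0 \<delta>) (\<lambda>X. f ((f ^^ k) (X /\<^sub>R 2 ^ n)))"
      by (intro continuous_on_compose2[OF f_continuous]) blast+
    then show ?case by simp
  qed
  then show "\<forall>\<^sub>F n in sequentially. continuous_on (V \<inter> cball 0 \<delta>) (En n)"
    by (auto simp: En_def[abs_def])
qed auto

text \<open>Applying \<open>f\<close> to the n-th approximation at X / 2 gives the next
  approximation at X; in the limit this is exp X = (exp (X / 2))^2 in coordinates.\<close>

lemma f_E_half:
  assumes "X \<in> V" "norm X \<le> \<delta>"
  shows "f (E (X /\<^sub>R 2)) = E X"
proof -
  have h: "X /\<^sub>R 2 \<in> V" "norm (X /\<^sub>R 2) \<le> \<delta>" using assms \<delta>_pos V by (auto simp: subspace_mul)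
  have r2: "2 * norm (X /\<^sub>R 2) \<le> r" using h(2) \<delta>_r \<delta>_pos by linarith
  have "(\<lambda>n. f (En n (X /\<^sub>R 2))) \<longlonglongrightarrow> f (E (X /\<^sub>R 2))"
    by (rule continuous_on_tendsto_compose[OF f_continuous E_lim[OF h]])
      (use E_V[OF h] En_V[OF h] r2 order_trans in \<open>auto intro!: always_eventually simp del: norm_scaleR, blast+\<close>)
  moreover have "f (En n (X /\<^sub>R 2)) = En (Suc n) X" for n by (simp add: En_def)
  ultimately have "(\<lambda>n. En (Suc n) X) \<longlonglongrightarrow> f (E (X /\<^sub>R 2))" by simp
  then show ?thesis using LIMSEQ_unique LIMSEQ_Suc[OF E_lim[OF assms]] by blast
qed

end

section \<open>Coordinates near the identity\<close>

lemma subspace_projection: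
  fixes W :: "'a::euclidean_space set"
  assumes "subspace W"
  obtains P where "bounded_linear P" "\<And>x. P x \<in> W" "\<And>x. x \<in> W \<Longrightarrow> P x = x"
    "\<And>x w. w \<in> W \<Longrightarrow> (x - P x) \<bullet> w = 0"
proof -
  obtain B where B: "B \<subseteq> W" "pairwise orthogonal B" "\<And>x. x \<in> B \<Longrightarrow> norm x = 1"
    "independent B" "span B = W"
    using orthonormal_basis_subspace[OF assms] by metis
  have fin: "finite B" using B(4) by (rule independent_imp_finite)
  define P where "P x = (\<Sum>b\<in>B. (x \<bullet> b) *\<^sub>R b)" for x
  have bl: "bounded_linear P" unfolding P_def
    by (intro bounded_linear_sum bounded_linear_scaleR_left[THEN bounded_linear_compose]
        bounded_linear_inner_left)
  have PW: "P x \<in> W" for x unfolding P_def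
    using B(1) assms by (intro subspace_sum subspace_mul) auto
  have orth: "(x - P x) \<bullet> b = 0" if "b \<in> B" for x b
  proof -
    have "P x \<bullet> b = (\<Sum>a\<in>B. (x \<bullet> a) * (a \<bullet> b))" by (simp add: P_def inner_sum_left)
    also have "\<dots> = (\<Sum>a\<in>B. if a = b then x \<bullet> b else 0)"
      using B(2,3) that by (intro sum.cong) (auto simp: pairwise_def orthogonal_def norm_eq_1)
    also have "\<dots> = x \<bullet> b" using fin that by simp
    finally show ?thesis by (simp add: inner_diff_left)
  qed
  have orthW: "(x - P x) \<bullet> w = 0" if "w \<in> W" for x w
  proof -
    have "w \<in> span B" using that B(5) by simp
    then have "orthogonal (x - P x) w"
      by (rule orthogonal_to_span) (use orth in \<open>auto simp: orthogonal_def\<close>)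
    then show ?thesis by (simp add: orthogonal_def)
  qed
  have "P x = x" if "x \<in> W" for x
  proof -
    have "x - P x \<in> W" using that PW assms by (simp add: subspace_diff)
    then show ?thesis using orthW[of "x - P x" x] by simp
  qed
  then show thesis using that bl PW orthW by blast
qed

text \<open>Smoothness in charts is relative to a subspace and to a set that is only relatively
  open. Composition with the affine map c + Q, whose values lie in that set, yields ordinary
  derivatives on an open subset of the ambient space. Two orders are extracted: the derivative, and
  the differentiability of each of its directional values.\<close>

lemma smooth_on_derivatives:
  fixes Q :: "'a::real_normed_vector \<Rightarrow> 'a"
  assumes "smooth_on W S f" "bounded_linear Q" "\<And>x. Q x \<in> W"
    "open O'" "\<And>x. x \<in> O' \<Longrightarrow> c + Q x \<in> S"
  obtains D where "\<And>x. x \<in> O' \<Longrightarrow> ((\<lambda>x. f (c + Q x)) has_derivative D x) (at x)"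
    "\<And>x v. x \<in> O' \<Longrightarrow> (\<lambda>x. D x v) differentiable (at x)"
proof -
  have "Ck_on (Suc (Suc 0)) W S f" using assms(1) by (simp add: smooth_on_def del: Ck_on.simps)
  then obtain D0 where D0: "\<And>x. x \<in> S \<Longrightarrow> (f has_derivative D0 x) (at x within S)"
    and D1: "\<And>v. v \<in> W \<Longrightarrow> Ck_on (Suc 0) W S (\<lambda>x. D0 x v)" by auto
  have comp: "((\<lambda>x. h (c + Q x)) has_derivative (h' \<circ> Q)) (at x)"
    if "(h has_derivative h') (at (c + Q x) within S)" "x \<in> O'" for h :: "'a \<Rightarrow> 'b" and h' x
  proof -
    have q: "((\<lambda>x. c + Q x) has_derivative Q) (at x within O')"
      using bounded_linear_imp_has_derivative[OF assms(2)] by (auto intro!: derivative_eq_intros)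
    have "((\<lambda>x. h (c + Q x)) has_derivative (\<lambda>x. h' (Q x))) (at x within O')"
      by (rule has_derivative_in_compose[OF q])
        (rule has_derivative_subset[OF that(1)], use assms(5) in auto)
    then show ?thesis unfolding at_within_open[OF that(2) assms(4)] o_def .
  qed
  define D where "D x = D0 (c + Q x) \<circ> Q" for x
  show thesis
  proof (rule that[of D])
    show "((\<lambda>x. f (c + Q x)) has_derivative D x) (at x)" if "x \<in> O'" for x
      unfolding D_def by (rule comp[OF D0[OF assms(5)[OF that]] that])
    show "(\<lambda>x. D x v) differentiable (at x)" if "x \<in> O'" for x v
    proof -
      from D1[OF assms(3)[of v]] obtain D2 where
        "\<And>x. x \<in> S \<Longrightarrow> ((\<lambda>x. D0 x (Q v)) has_derivative D2 x) (at x within S)" by auto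
      from comp[OF this[OF assms(5)[OF that]] that] show ?thesis
        unfolding D_def differentiable_def by auto
    qed
  qed
qed

context lie_group
begin

abbreviation V where "V \<equiv> model K"
abbreviation X where "X \<equiv> topo K"

lemma V: "subspace V" and Hausdorff: "Hausdorff_space X"
  and charts_Union: "(\<Union>c\<in>charts K. fst c) = carrier K"
  using manifold topspace_topo unfolding smooth_manifold_def by (simp_all add: case_prod_beta)

text \<open>Maps on the model space are extended to the ambient space by composition with this
  orthogonal projection, so that derivatives are taken on open sets and algebraic identities need no
  membership conditions.\<close>

definition "proj = (SOME P. bounded_linear P \<and> (\<forall>x. P x \<in> V) \<and> (\<forall>x\<in>V. P x = x) \<and>
  (\<forall>x. \<forall>w\<in>V. (x - P x) \<bullet> w = 0))"

lemma proj_bl: "bounded_linear proj" and proj_V [simp]: "proj x \<in> V"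
  and proj_id [simp]: "x \<in> V \<Longrightarrow> proj x = x"
  and proj_orth: "w \<in> V \<Longrightarrow> (x - proj x) \<bullet> w = 0"
proof -
  obtain P where "bounded_linear P" "\<And>x. P x \<in> V" "\<And>x. x \<in> V \<Longrightarrow> P x = x"
    "\<And>x w. w \<in> V \<Longrightarrow> (x - P x) \<bullet> w = 0" using subspace_projection[OF V] by blast
  then have "\<exists>P. bounded_linear P \<and> (\<forall>x. P x \<in> V) \<and> (\<forall>x\<in>V. P x = x) \<and>
  (\<forall>x. \<forall>w\<in>V. (x - P x) \<bullet> w = 0)" by blast
  from someI_ex[OF this]
  have *: "bounded_linear proj \<and> (\<forall>x. proj x \<in> V) \<and> (\<forall>x\<in>V. proj x = x) \<and>
    (\<forall>x. \<forall>w\<in>V. (x - proj x) \<bullet> w = 0)" unfolding proj_def .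
  show "bounded_linear proj" "proj x \<in> V" "x \<in> V \<Longrightarrow> proj x = x" "w \<in> V \<Longrightarrow> (x - proj x) \<bullet> w = 0"
    using * by auto
qed

lemma proj_linear: "linear proj" using proj_bl by (rule bounded_linear.linear)
lemma proj_0 [simp]: "proj 0 = 0" using proj_linear linear_0 by blast
lemma proj_proj [simp]: "proj (proj x) = proj x" by simp
lemma proj_continuous: "continuous_on S proj" using proj_bl linear_continuous_on by blast
lemma zero_V [simp]: "0 \<in> V" using V subspace_0 by blast

lemma chart:
  assumes "c \<in> charts K"
  shows "openin X (fst c)" "openin (top_of_set V) (snd c ` fst c)" "inj_on (snd c) (fst c)"
    "continuous_map (subtopology X (fst c)) euclidean (snd c)"
    "continuous_map (top_of_set (snd c ` fst c)) X (inv_into (fst c) (snd c))"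
    "fst c \<subseteq> carrier K" "snd c ` fst c \<subseteq> V"
proof -
  obtain U \<phi> where c: "c = (U, \<phi>)" by (cases c)
  have *: "openin X U" "openin (top_of_set V) (\<phi> ` U)"
    "homeomorphic_map (subtopology X U) (top_of_set (\<phi> ` U)) \<phi>"
    using manifold assms c by (auto simp: smooth_manifold_def)
  then have UG: "U \<subseteq> carrier K" using topspace_topo openin_subset by blast
  then have tU: "topspace (subtopology X U) = U" using topspace_topo by auto
  show "openin X (fst c)" "openin (top_of_set V) (snd c ` fst c)" "fst c \<subseteq> carrier K" using * UG c by auto
  show "snd c ` fst c \<subseteq> V" using *(2) c openin_imp_subset by fastforce
  have inj: "inj_on \<phi> U" using *(3) tU by (simp add: homeomorphic_map_def)
  then show "inj_on (snd c) (fst c)" by (simp add: c)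
  obtain g where g: "homeomorphic_maps (subtopology X U) (top_of_set (\<phi> ` U)) \<phi> g"
    using *(3) homeomorphic_map_maps by blast
  then show "continuous_map (subtopology X (fst c)) euclidean (snd c)"
    using continuous_map_in_subtopology[of _ euclidean] c by (auto simp: homeomorphic_maps_def)
  have "continuous_map (top_of_set (\<phi> ` U)) X g"
    using g by (auto simp: homeomorphic_maps_def continuous_map_in_subtopology)
  moreover have "g y = inv_into U \<phi> y" if "y \<in> \<phi> ` U" for y
    using g that inj tU by (auto simp: homeomorphic_maps_def)
  ultimately have "continuous_map (top_of_set (\<phi> ` U)) X (inv_into U \<phi>)"
    by (rule continuous_map_eq) auto
  then show "continuous_map (top_of_set (snd c ` fst c)) X (inv_into (fst c) (snd c))"
    by (simp add: c)
qed

text \<open>The inverse chart, recentred at \<open>g\<close> and constant along the kernel of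
  \<open>proj\<close>; the domain \<open>local_dom\<close> is thereby open in the ambient
  space.\<close>

definition "local_inv c g x = inv_into (fst c) (snd c) (snd c g + proj x)"
definition "local_dom c g = {x. snd c g + proj x \<in> snd c ` fst c}"

lemma local_inv:
  assumes "c \<in> charts K" "g \<in> fst c"
  shows "open (local_dom c g)" "0 \<in> local_dom c g"
    "continuous_map (top_of_set (local_dom c g)) X (local_inv c g)"
    "x \<in> local_dom c g \<Longrightarrow> local_inv c g x \<in> fst c"
    "x \<in> local_dom c g \<Longrightarrow> snd c (local_inv c g x) = snd c g + proj x"
    "h \<in> fst c \<Longrightarrow> snd c h - snd c g \<in> local_dom c g"
    "h \<in> fst c \<Longrightarrow> local_inv c g (snd c h - snd c g) = h"
proof -
  note c = chart[OF assms(1)]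
  obtain T where T: "open T" "snd c ` fst c = V \<inter> T" using c(2) by (auto simp: openin_open)
  have gV: "snd c g \<in> V" using c(7) assms(2) by blast
  then have "local_dom c g = (\<lambda>x. snd c g + proj x) -` T"
    using T V by (auto simp: local_dom_def subspace_add)
  moreover have "open ((\<lambda>x. snd c g + proj x) -` T)"
    by (rule open_vimage[OF T(1)]) (intro continuous_on_add continuous_on_const proj_continuous)
  ultimately show "open (local_dom c g)" by (rule ssubst)
  show "0 \<in> local_dom c g" using assms by (simp add: local_dom_def)
  have "continuous_map (top_of_set (local_dom c g)) (top_of_set (snd c ` fst c)) (\<lambda>x. snd c g + proj x)"
    by (auto simp: local_dom_def intro!: continuous_intros proj_continuous)
  from continuous_map_compose[OF this c(5)]
  show "continuous_map (top_of_set (local_dom c g)) X (local_inv c g)"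
    by (simp add: local_inv_def[abs_def] o_def)
  show "x \<in> local_dom c g \<Longrightarrow> local_inv c g x \<in> fst c"
    by (auto simp: local_dom_def local_inv_def intro: inv_into_into)
  show "x \<in> local_dom c g \<Longrightarrow> snd c (local_inv c g x) = snd c g + proj x"
    by (auto simp: local_dom_def local_inv_def f_inv_into_f)
  assume h: "h \<in> fst c"
  then have "snd c h - snd c g \<in> V" using gV c(7) V by (auto intro: subspace_diff)
  then show "snd c h - snd c g \<in> local_dom c g" "local_inv c g (snd c h - snd c g) = h"
    using h c(3) by (auto simp: local_dom_def local_inv_def)
qed

lemma mult_continuous: "continuous_map (prod_topology X X) X (\<lambda>(g, h). g \<otimes> h)"
  using smooth_mult by (simp add: smooth_map_def)

lemma inv_continuous: "continuous_map X X (\<lambda>g. inv g)"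
  using smooth_inv by (simp add: smooth_map_def)

lemma continuous_map_mult:
  assumes "continuous_map Y X a" "continuous_map Y X b"
  shows "continuous_map Y X (\<lambda>y. a y \<otimes> b y)"
  using continuous_map_compose[OF continuous_map_pairedI[OF assms] mult_continuous] by (simp add: o_def)

text \<open>Three separate charts are allowed because conjugation by \<open>g\<close> passes through
  charts around \<open>g\<close> and around its inverse. With all three equal to the chart at the
  identity the map is \<open>coord_mult\<close> up to a translation.\<close>

lemma mult_chart:
  assumes "c1 \<in> charts K" "g \<in> fst c1" "c2 \<in> charts K" "h \<in> fst c2" "c3 \<in> charts K" "g \<otimes> h \<in> fst c3"
  obtains O' D where "open O'" "(0, 0) \<in> O'"
    "\<And>p. p \<in> O' \<Longrightarrow> fst p \<in> local_dom c1 g \<and> snd p \<in> local_dom c2 h \<and>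
        local_inv c1 g (fst p) \<otimes> local_inv c2 h (snd p) \<in> fst c3"
    "\<And>p. p \<in> O' \<Longrightarrow>
       ((\<lambda>p. snd c3 (local_inv c1 g (fst p) \<otimes> local_inv c2 h (snd p))) has_derivative D p) (at p)"
    "\<And>p v. p \<in> O' \<Longrightarrow> (\<lambda>p. D p v) differentiable (at p)"
proof -
  define m where "m p = local_inv c1 g (fst p) \<otimes> local_inv c2 h (snd p)" for p
  define O1 where "O1 = local_dom c1 g \<times> local_dom c2 h"
  have O1: "open O1" unfolding O1_def by (intro open_Times local_inv assms)
  have "continuous_map (top_of_set O1) X (\<lambda>p. local_inv c1 g (fst p))"
    "continuous_map (top_of_set O1) X (\<lambda>p. local_inv c2 h (snd p))"
    using continuous_map_compose[OF _ local_inv(3)[OF assms(1,2)], of "top_of_set O1" fst]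
      continuous_map_compose[OF _ local_inv(3)[OF assms(3,4)], of "top_of_set O1" snd]
    by (simp_all add: o_def O1_def continuous_on_fst continuous_on_snd Pi_def)
  then have "continuous_map (top_of_set O1) X m" unfolding m_def by (rule continuous_map_mult)
  from openin_continuous_map_preimage[OF this chart(1)[OF assms(5)]]
  have "openin (top_of_set O1) {p \<in> O1. m p \<in> fst c3}" by simp
  then have op: "open {p \<in> O1. m p \<in> fst c3}" using O1 openin_open_trans by blast
  define O' where "O' = {p \<in> O1. m p \<in> fst c3}"
  define S where "S = map_prod (snd c1) (snd c2) ` {p \<in> fst c1 \<times> fst c2. (\<lambda>(g, h). g \<otimes> h) p \<in> fst c3}"
  define F where "F = snd c3 \<circ> (\<lambda>(g, h). g \<otimes> h) \<circ> inv_into (fst c1 \<times> fst c2) (map_prod (snd c1) (snd c2))"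
  have "(fst c1 \<times> fst c2, map_prod (snd c1) (snd c2)) \<in> prod_atlas (charts K) (charts K)"
    unfolding prod_atlas_def mem_Collect_eq using assms(1,3)
    by (intro exI[of _ "fst c1"] exI[of _ "snd c1"] exI[of _ "fst c2"] exI[of _ "snd c2"]) simp
  moreover have "(fst c3, snd c3) \<in> charts K" using assms by simp
  ultimately have sm: "smooth_on (V \<times> V) S F"
    using smooth_mult unfolding smooth_map_def S_def F_def by blast
  have Q: "bounded_linear (map_prod proj proj)"
    unfolding map_prod_def case_prod_beta
    by (intro bounded_linear_Pair bounded_linear_compose[OF proj_bl] bounded_linear_fst bounded_linear_snd)
  have inj: "inj_on (map_prod (snd c1) (snd c2)) (fst c1 \<times> fst c2)"
    using chart(3)[OF assms(1)] chart(3)[OF assms(3)] by (rule map_prod_inj_on)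
  have eq: "(snd c1 g, snd c2 h) + map_prod proj proj p =
      map_prod (snd c1) (snd c2) (local_inv c1 g (fst p), local_inv c2 h (snd p))" if "p \<in> O'" for p
    using that local_inv(5)[OF assms(1,2), of "fst p"] local_inv(5)[OF assms(3,4), of "snd p"]
    by (auto simp: O'_def O1_def)
  have mem: "local_inv c1 g (fst p) \<in> fst c1" "local_inv c2 h (snd p) \<in> fst c2" if "p \<in> O'" for p
    using that local_inv(4)[OF assms(1,2), of "fst p"] local_inv(4)[OF assms(3,4), of "snd p"]
    by (auto simp: O'_def O1_def)
  have inS: "(snd c1 g, snd c2 h) + map_prod proj proj p \<in> S" if "p \<in> O'" for p
    unfolding eq[OF that] S_def using mem[OF that] that
    by (intro imageI) (auto simp: O'_def m_def)
  have Fm: "F ((snd c1 g, snd c2 h) + map_prod proj proj p) = snd c3 (m p)" if "p \<in> O'" for p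
    unfolding eq[OF that] F_def using mem[OF that] inv_into_f_f[OF inj, of "(local_inv c1 g (fst p), local_inv c2 h (snd p))"]
    by (simp add: m_def)
  have Q': "map_prod proj proj p \<in> V \<times> V" for p by (cases p) simp
  obtain D where D: "\<And>x. x \<in> O' \<Longrightarrow> ((\<lambda>x. F ((snd c1 g, snd c2 h) + map_prod proj proj x)) has_derivative D x) (at x)"
    "\<And>x v. x \<in> O' \<Longrightarrow> (\<lambda>x. D x v) differentiable (at x)"
    by (rule smooth_on_derivatives[OF sm Q Q' op[folded O'_def] inS]) (assumption, rule that)
  show thesis
  proof (rule that[of O' D])
    show "open O'" using op by (simp add: O'_def)
    have "local_inv c1 g 0 = g" "local_inv c2 h 0 = h"
      using local_inv(7)[OF assms(1,2,2)] local_inv(7)[OF assms(3,4,4)] by auto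
    then show "(0, 0) \<in> O'" using local_inv(2)[OF assms(1,2)] local_inv(2)[OF assms(3,4)] assms(6)
      by (simp add: O'_def O1_def m_def)
    show "fst p \<in> local_dom c1 g \<and> snd p \<in> local_dom c2 h \<and>
        local_inv c1 g (fst p) \<otimes> local_inv c2 h (snd p) \<in> fst c3" if "p \<in> O'" for p
      using that by (auto simp: O'_def O1_def m_def)
    show "((\<lambda>p. snd c3 (local_inv c1 g (fst p) \<otimes> local_inv c2 h (snd p))) has_derivative D p) (at p)"
      if "p \<in> O'" for p
      using has_derivative_transform_within_open[OF D(1)[OF that] \<open>open O'\<close> that Fm] by (simp add: m_def)
  qed (use D in auto)
qed

definition "c1 = one_chart K"
lemma c1: "c1 \<in> charts K" "\<one> \<in> fst c1"
proof -
  have "\<exists>c. c \<in> charts K \<and> \<one> \<in> fst c" using charts_Union one_closed by blast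
  from someI_ex[OF this] show "c1 \<in> charts K" "\<one> \<in> fst c1" by (auto simp: c1_def one_chart_def)
qed

definition "chart_nbhd = fst c1"
definition "to_chart g = to_coord K g - to_coord K \<one>"
definition "from_chart x = local_inv c1 \<one> x"
definition "chart_dom = local_dom c1 \<one>"

lemma to_coord: "to_coord K = snd c1" by (simp add: c1_def to_coord_def)

lemma chart_nbhd: "openin X chart_nbhd" "\<one> \<in> chart_nbhd" "chart_nbhd \<subseteq> carrier K"
  using chart[OF c1(1)] c1 by (auto simp: chart_nbhd_def)

lemma from_chart: "open chart_dom" "0 \<in> chart_dom" "continuous_map (top_of_set chart_dom) X from_chart"
  "x \<in> chart_dom \<Longrightarrow> from_chart x \<in> chart_nbhd" "x \<in> chart_dom \<Longrightarrow> to_chart (from_chart x) = proj x"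
  "h \<in> chart_nbhd \<Longrightarrow> to_chart h \<in> chart_dom" "h \<in> chart_nbhd \<Longrightarrow> from_chart (to_chart h) = h" "from_chart 0 = \<one>" "to_chart \<one> = 0"
  "x \<in> chart_dom \<Longrightarrow> from_chart x \<in> carrier K"
  using local_inv[OF c1] c1(2) chart(6)[OF c1(1)] local_inv(7)[OF c1 c1(2)]
  by (auto simp: chart_nbhd_def to_chart_def to_coord chart_dom_def from_chart_def[abs_def])

lemma to_chart_V: "h \<in> chart_nbhd \<Longrightarrow> to_chart h \<in> V"
  using chart(7)[OF c1(1)] c1(2) V by (auto simp: chart_nbhd_def to_chart_def to_coord intro!: subspace_diff)

lemma to_chart_continuous: "continuous_map (subtopology X chart_nbhd) euclidean to_chart"
  using chart(4)[OF c1(1)] unfolding to_chart_def to_coord chart_nbhd_def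
  by (auto intro!: continuous_intros)

lemma from_chart_proj: "from_chart (proj x) = from_chart x" "proj x \<in> chart_dom \<longleftrightarrow> x \<in> chart_dom"
  by (simp_all add: from_chart_def local_inv_def chart_dom_def local_dom_def)

lemma coord_curve: assumes "Y \<in> V" shows "coord_curve K Y s = from_chart (s *\<^sub>R Y)"
  using V assms by (simp add: coord_curve_def of_coord_def from_chart_def local_inv_def to_coord c1_def subspace_mul)

lemma eventually_from_chart:
  assumes "openin X W" "\<one> \<in> W"
  shows "\<forall>\<^sub>F x in nhds 0. x \<in> chart_dom \<and> from_chart x \<in> W"
proof -
  have "openin (top_of_set chart_dom) {x \<in> chart_dom. from_chart x \<in> W}"
    using openin_continuous_map_preimage[OF from_chart(3) assms(1)] by simp
  then have "open {x \<in> chart_dom. from_chart x \<in> W}" using from_chart(1) openin_open_trans by blast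
  then show ?thesis using assms from_chart by (auto simp: eventually_nhds intro!: exI[of _ "{x \<in> chart_dom. from_chart x \<in> W}"])
qed

lemma to_chart_nbhd:
  assumes "\<epsilon> > 0"
  obtains W where "openin X W" "\<one> \<in> W" "W \<subseteq> chart_nbhd" "\<And>g. g \<in> W \<Longrightarrow> norm (to_chart g) < \<epsilon>"
proof -
  let ?W = "{g \<in> topspace (subtopology X chart_nbhd). to_chart g \<in> ball 0 \<epsilon>}"
  have "openin (subtopology X chart_nbhd) ?W"
    by (rule openin_continuous_map_preimage[OF to_chart_continuous]) auto
  then have "openin X ?W" using chart_nbhd(1) openin_trans_full by blast
  moreover have "\<one> \<in> ?W" using chart_nbhd(2) assms from_chart(9) by (simp add: topspace_topo)
  moreover have "?W \<subseteq> chart_nbhd" by auto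
  ultimately show thesis by (rule that) simp
qed

end

lemma differentiable_locally_lipschitz_at:
  fixes f :: "'a::real_normed_vector \<Rightarrow> 'b::real_normed_vector"
  assumes "f differentiable (at x)"
  obtains L d where "L > 0" "d > 0" "\<And>y. norm (y - x) < d \<Longrightarrow> norm (f y - f x) \<le> L * norm (y - x)"
proof -
  obtain f' where f': "(f has_derivative f') (at x)" using assms by (auto simp: differentiable_def)
  then have bl: "bounded_linear f'" by (rule has_derivative_bounded_linear)
  obtain d where d: "d > 0" "\<And>y. norm (y - x) < d \<Longrightarrow> norm (f y - f x - f' (y - x)) \<le> 1 * norm (y - x)"
    using f' unfolding has_derivative_at_alt by (metis zero_less_one)
  have "norm (f y - f x) \<le> (onorm f' + 1) * norm (y - x)" if "norm (y - x) < d" for y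
  proof -
    have "norm (f y - f x) \<le> norm (f y - f x - f' (y - x)) + norm (f' (y - x))"
      using norm_triangle_ineq[of "f y - f x - f' (y - x)" "f' (y - x)"] by simp
    also have "\<dots> \<le> 1 * norm (y - x) + onorm f' * norm (y - x)"
      using d(2)[OF that] onorm[OF bl] by (rule add_mono)
    finally show ?thesis by (simp add: algebra_simps)
  qed
  moreover have "onorm f' + 1 > 0" using onorm_pos_le[OF bl] by linarith
  ultimately show thesis using that d(1) by blast
qed

text \<open>Only the pointwise differentiability of the derivative at the origin is used: it already
  makes the deviation from the linear part quadratically small.\<close>

lemma quadratic_deviation:
  fixes f :: "'a::euclidean_space \<Rightarrow> 'b::real_normed_vector"
  assumes "open S" "0 \<in> S" and f: "\<And>x. x \<in> S \<Longrightarrow> (f has_derivative D x) (at x)"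
    and D: "\<And>v. (\<lambda>x. D x v) differentiable (at 0)"
  obtains C r where "C > 0" "r > 0" "cball 0 r \<subseteq> S"
    "\<And>x y s. norm x \<le> s \<Longrightarrow> norm y \<le> s \<Longrightarrow> s \<le> r \<Longrightarrow> norm (f x - f y - D 0 (x - y)) \<le> C * s * norm (x - y)"
proof -
  have "\<exists>L d. L > 0 \<and> d > 0 \<and> (\<forall>x. norm x < d \<longrightarrow> norm (D x v - D 0 v) \<le> L * norm x)" for v
    using differentiable_locally_lipschitz_at[OF D[of v]] by (metis diff_zero)
  then obtain L d where L: "\<And>v. L v > 0" and d: "\<And>v. d v > 0"
    and Ld: "\<And>v x. norm x < d v \<Longrightarrow> norm (D x v - D 0 v) \<le> L v * norm x" by metis
  obtain r0 where r0: "r0 > 0" "cball 0 r0 \<subseteq> S" using assms(1,2) open_contains_cball by blast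
  define r where "r = min r0 (Min (d ` Basis) / 2)"
  define C where "C = (\<Sum>b\<in>Basis. L b)"
  have "Min (d ` Basis) > 0" using d by simp
  then have r: "r > 0" using r0 by (simp add: r_def)
  have rd: "r < d b" if "b \<in> Basis" for b
  proof -
    have "Min (d ` Basis) \<le> d b" using that by simp
    then show ?thesis using d[of b] unfolding r_def by linarith
  qed
  have C: "C > 0" unfolding C_def using L by (intro sum_pos) auto
  have lin: "linear (D x)" if "x \<in> S" for x using f[OF that] has_derivative_linear by blast
  \<comment> \<open>Differentiability of \<open>D x v\<close> in \<open>x\<close> is known for one
    \<open>v\<close> at a time. Expanding \<open>v\<close> in the basis combines finitely many
    Lipschitz constants at the origin into an operator bound.\<close>
  have est: "norm (D x v - D 0 v) \<le> C * norm x * norm v" if "norm x \<le> r" for x v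
  proof -
    have xS: "x \<in> S" using that r0 by (auto simp: r_def)
    have "D x v - D 0 v = (\<Sum>b\<in>Basis. (v \<bullet> b) *\<^sub>R (D x b - D 0 b))"
      using linear_sum[OF lin[OF xS], of "\<lambda>b. (v \<bullet> b) *\<^sub>R b" Basis] linear_sum[OF lin[OF assms(2)], of "\<lambda>b. (v \<bullet> b) *\<^sub>R b" Basis]
      by (simp add: euclidean_representation linear_cmul[OF lin[OF xS]] linear_cmul[OF lin[OF assms(2)]]
          sum_subtractf scaleR_diff_right)
    also have "norm \<dots> \<le> (\<Sum>b\<in>Basis. norm v * (L b * norm x))"
    proof (intro sum_norm_le)
      fix b :: 'a assume b: "b \<in> Basis"
      have "\<bar>v \<bullet> b\<bar> * norm (D x b - D 0 b) \<le> norm v * (L b * norm x)"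
        using that rd[OF b] Ld[of x b] Basis_le_norm[OF b, of v] by (intro mult_mono) auto
      then show "norm ((v \<bullet> b) *\<^sub>R (D x b - D 0 b)) \<le> norm v * (L b * norm x)" by simp
    qed
    also have "\<dots> = C * norm x * norm v" by (simp add: C_def sum_distrib_left sum_distrib_right mult_ac)
    finally show ?thesis .
  qed
  show thesis
  proof (rule that[OF C r])
    show "cball 0 r \<subseteq> S" using r0 by (auto simp: r_def)
    fix x y :: 'a and s :: real assume s: "norm x \<le> s" "norm y \<le> s" "s \<le> r"
    then have s0: "s \<ge> 0" using norm_ge_zero order_trans by blast
    have sub: "cball 0 s \<subseteq> S" using s(3) r0 by (auto simp: r_def)
    have "norm (f x - f y - D 0 (x - y)) \<le> norm (x - y) * (C * s)"
    proof (rule differentiable_bound_linearization[of _ _ "cball 0 s"])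
      show "y + t *\<^sub>R (x - y) \<in> cball 0 s" if "t \<in> {0..1}" for t
      proof -
        have "y + t *\<^sub>R (x - y) = (1 - t) *\<^sub>R y + t *\<^sub>R x" by (simp add: algebra_simps)
        moreover have "convex (cball (0::'a) s)" by simp
        ultimately show ?thesis using s that convexD_alt[of "cball 0 s" y x t] by auto
      qed
      show "(f has_derivative D z) (at z within cball 0 s)" if "z \<in> cball 0 s" for z
        using f sub that has_derivative_at_withinI by blast
      show "onorm (D z - D 0) \<le> C * s" if "z \<in> cball 0 s" for z
      proof (rule onorm_le)
        fix v
        have "norm (D z v - D 0 v) \<le> C * norm z * norm v" using est that s by auto
        also have "\<dots> \<le> C * s * norm v" using that C by (intro mult_right_mono mult_left_mono) auto
        finally show "norm ((D z - D 0) v) \<le> C * s * norm v" by simp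
      qed
      show "0 \<in> cball 0 s" using s0 by simp
    qed
    then show "norm (f x - f y - D 0 (x - y)) \<le> C * s * norm (x - y)" by (simp add: mult_ac)
  qed
qed

section \<open>Second-order behaviour of the product at the identity\<close>

context lie_group
begin

definition "coord_mult p = to_chart (from_chart (fst p) \<otimes> from_chart (snd p))"

lemma coord_mult_deriv:
  obtains O' D where "open O'" "(0, 0) \<in> O'"
    "\<And>p. p \<in> O' \<Longrightarrow> fst p \<in> chart_dom \<and> snd p \<in> chart_dom \<and> from_chart (fst p) \<otimes> from_chart (snd p) \<in> chart_nbhd"
    "\<And>p. p \<in> O' \<Longrightarrow> (coord_mult has_derivative D p) (at p)"
    "\<And>p v. p \<in> O' \<Longrightarrow> (\<lambda>p. D p v) differentiable (at p)"
proof -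
  obtain O' D where *: "open O'" "(0, 0) \<in> O'"
    "\<And>p. p \<in> O' \<Longrightarrow> fst p \<in> local_dom c1 \<one> \<and> snd p \<in> local_dom c1 \<one> \<and>
        local_inv c1 \<one> (fst p) \<otimes> local_inv c1 \<one> (snd p) \<in> fst c1"
    "\<And>p. p \<in> O' \<Longrightarrow>
       ((\<lambda>p. snd c1 (local_inv c1 \<one> (fst p) \<otimes> local_inv c1 \<one> (snd p))) has_derivative D p) (at p)"
    "\<And>p v. p \<in> O' \<Longrightarrow> (\<lambda>p. D p v) differentiable (at p)"
    by (rule mult_chart[OF c1 c1 c1(1)]) (use c1 in auto)
  have coord_mult: "coord_mult = (\<lambda>p. snd c1 (local_inv c1 \<one> (fst p) \<otimes> local_inv c1 \<one> (snd p)) - to_coord K \<one>)"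
    by (auto simp: coord_mult_def to_chart_def to_coord from_chart_def)
  show thesis
  proof (rule that[OF *(1,2)])
    fix p assume p: "p \<in> O'"
    show "(coord_mult has_derivative D p) (at p)"
      using has_derivative_diff[OF *(4)[OF p] has_derivative_const] by (simp add: coord_mult)
  qed (use *(3,5) in \<open>auto simp: chart_dom_def chart_nbhd_def from_chart_def\<close>)
qed

lemma coord_mult_0: "x \<in> chart_dom \<Longrightarrow> coord_mult (x, 0) = proj x" "x \<in> chart_dom \<Longrightarrow> coord_mult (0, x) = proj x"
  using from_chart(4,5,8,10) by (simp_all add: coord_mult_def)

text \<open>On either axis the product is \<open>proj\<close>, which determines its derivative at
  the origin; the rest is \<open>quadratic_deviation\<close>. The bound is stated for two points
  \<open>p\<close> and \<open>q\<close>, so that comparison with a point of an axis later gives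
  errors proportional to the size of one factor.\<close>

lemma coord_mult_est_ex: "\<exists>C r. C > 0 \<and> r > 0 \<and>
    (\<forall>p. norm p \<le> r \<longrightarrow> fst p \<in> chart_dom \<and> snd p \<in> chart_dom \<and> from_chart (fst p) \<otimes> from_chart (snd p) \<in> chart_nbhd) \<and>
    (\<forall>p q s. norm p \<le> s \<longrightarrow> norm q \<le> s \<longrightarrow> s \<le> r \<longrightarrow>
      norm (coord_mult p - coord_mult q - (proj (fst p - fst q) + proj (snd p - snd q))) \<le> C * s * norm (p - q))"
proof -
  obtain O' D where O': "open O'" "(0, 0) \<in> O'"
    "\<And>p. p \<in> O' \<Longrightarrow> fst p \<in> chart_dom \<and> snd p \<in> chart_dom \<and> from_chart (fst p) \<otimes> from_chart (snd p) \<in> chart_nbhd"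
    "\<And>p. p \<in> O' \<Longrightarrow> (coord_mult has_derivative D p) (at p)"
    "\<And>p v. p \<in> O' \<Longrightarrow> (\<lambda>p. D p v) differentiable (at p)" by (rule coord_mult_deriv) blast
  have 0: "0 \<in> O'" using O'(2) by (simp add: zero_prod_def)
  have lin: "linear (D 0)" using O'(4)[OF 0] has_derivative_linear by blast
  have pd: "(proj has_derivative proj) (at 0)" by (rule bounded_linear_imp_has_derivative[OF proj_bl])
  have d0: "(coord_mult has_derivative D 0) (at (0, 0))" using O'(4)[OF 0] by (simp add: zero_prod_def)
  have "((\<lambda>x. coord_mult (x, 0)) has_derivative (\<lambda>u. D 0 (u, 0))) (at 0)"
    by (rule has_derivative_compose[of "\<lambda>x. (x, 0)" "\<lambda>u. (u, 0)" 0 UNIV coord_mult "D 0"])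
      (use d0 in \<open>auto intro!: derivative_eq_intros\<close>)
  moreover have "((\<lambda>x. coord_mult (x, 0)) has_derivative proj) (at 0)"
    by (rule has_derivative_transform_within_open[OF pd from_chart(1,2)]) (simp add: coord_mult_0)
  ultimately have 1: "(\<lambda>u. D 0 (u, 0)) = proj" by (rule has_derivative_unique)
  have "((\<lambda>x. coord_mult (0, x)) has_derivative (\<lambda>u. D 0 (0, u))) (at 0)"
    by (rule has_derivative_compose[of "\<lambda>x. (0, x)" "\<lambda>u. (0, u)" 0 UNIV coord_mult "D 0"])
      (use d0 in \<open>auto intro!: derivative_eq_intros\<close>)
  moreover have "((\<lambda>x. coord_mult (0, x)) has_derivative proj) (at 0)"
    by (rule has_derivative_transform_within_open[OF pd from_chart(1,2)]) (simp add: coord_mult_0)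
  ultimately have 2: "(\<lambda>u. D 0 (0, u)) = proj" by (rule has_derivative_unique)
  have D0: "D 0 p = proj (fst p) + proj (snd p)" for p
  proof -
    have "D 0 p = D 0 ((fst p, 0) + (0, snd p))" by simp
    also have "\<dots> = D 0 (fst p, 0) + D 0 (0, snd p)" by (rule linear_add[OF lin])
    finally show ?thesis using fun_cong[OF 1, of "fst p"] fun_cong[OF 2, of "snd p"] by simp
  qed
  obtain C r where Cr: "C > 0" "r > 0" "cball 0 r \<subseteq> O'"
    "\<And>x y s. norm x \<le> s \<Longrightarrow> norm y \<le> s \<Longrightarrow> s \<le> r \<Longrightarrow> norm (coord_mult x - coord_mult y - D 0 (x - y)) \<le> C * s * norm (x - y)"
    by (rule quadratic_deviation[OF O'(1) 0 O'(4) O'(5)[OF 0]]) (assumption, rule that)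
  have "\<forall>p. norm p \<le> r \<longrightarrow> fst p \<in> chart_dom \<and> snd p \<in> chart_dom \<and> from_chart (fst p) \<otimes> from_chart (snd p) \<in> chart_nbhd"
    using Cr(3) O'(3) by (meson mem_cball_0 subsetD)
  then show ?thesis using Cr(1,2,4) by (intro exI[of _ C] exI[of _ r]) (simp add: D0)
qed

text \<open>Constant and radius are chosen as a pair, since the estimate couples them.\<close>

definition "C0r0 = (SOME Cr. fst Cr > 0 \<and> snd Cr > 0 \<and>
    (\<forall>p. norm p \<le> snd Cr \<longrightarrow> fst p \<in> chart_dom \<and> snd p \<in> chart_dom \<and> from_chart (fst p) \<otimes> from_chart (snd p) \<in> chart_nbhd) \<and>
    (\<forall>p q s. norm p \<le> s \<longrightarrow> norm q \<le> s \<longrightarrow> s \<le> snd Cr \<longrightarrow>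
      norm (coord_mult p - coord_mult q - (proj (fst p - fst q) + proj (snd p - snd q))) \<le> fst Cr * s * norm (p - q)))"
definition "C0 = fst C0r0"
definition "r0 = snd C0r0"

lemma C0: "C0 > 0" and r0: "r0 > 0"
  and dom_small: "norm p \<le> r0 \<Longrightarrow> fst p \<in> chart_dom \<and> snd p \<in> chart_dom \<and> from_chart (fst p) \<otimes> from_chart (snd p) \<in> chart_nbhd"
  and coord_mult_est: "norm p \<le> s \<Longrightarrow> norm q \<le> s \<Longrightarrow> s \<le> r0 \<Longrightarrow>
    norm (coord_mult p - coord_mult q - (proj (fst p - fst q) + proj (snd p - snd q))) \<le> C0 * s * norm (p - q)"
proof -
  obtain C r where *: "C > 0" "r > 0"
    "(\<forall>p. norm p \<le> r \<longrightarrow> fst p \<in> chart_dom \<and> snd p \<in> chart_dom \<and> from_chart (fst p) \<otimes> from_chart (snd p) \<in> chart_nbhd)"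
    "(\<forall>p q s. norm p \<le> s \<longrightarrow> norm q \<le> s \<longrightarrow> s \<le> r \<longrightarrow>
      norm (coord_mult p - coord_mult q - (proj (fst p - fst q) + proj (snd p - snd q))) \<le> C * s * norm (p - q))"
    using coord_mult_est_ex by blast
  have "C0 > 0 \<and> r0 > 0 \<and>
    (\<forall>p. norm p \<le> r0 \<longrightarrow> fst p \<in> chart_dom \<and> snd p \<in> chart_dom \<and> from_chart (fst p) \<otimes> from_chart (snd p) \<in> chart_nbhd) \<and>
    (\<forall>p q s. norm p \<le> s \<longrightarrow> norm q \<le> s \<longrightarrow> s \<le> r0 \<longrightarrow>
      norm (coord_mult p - coord_mult q - (proj (fst p - fst q) + proj (snd p - snd q))) \<le> C0 * s * norm (p - q))"
    unfolding C0_def r0_def C0r0_def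
    by (rule someI[of _ "(C, r)"]) (use * in simp)
  then show "C0 > 0" "r0 > 0" "norm p \<le> r0 \<Longrightarrow> fst p \<in> chart_dom \<and> snd p \<in> chart_dom \<and> from_chart (fst p) \<otimes> from_chart (snd p) \<in> chart_nbhd"
    "norm p \<le> s \<Longrightarrow> norm q \<le> s \<Longrightarrow> s \<le> r0 \<Longrightarrow>
    norm (coord_mult p - coord_mult q - (proj (fst p - fst q) + proj (snd p - snd q))) \<le> C0 * s * norm (p - q)"
    by blast+
qed

lemma chart_dom_small: "norm x \<le> r0 \<Longrightarrow> x \<in> chart_dom"
  using dom_small[of "(x, 0)"] by simp

lemma from_chart_coord_mult:
  assumes "norm x + norm y \<le> r0"
  shows "from_chart x \<otimes> from_chart y = from_chart (coord_mult (x, y))" "coord_mult (x, y) \<in> V" "from_chart x \<otimes> from_chart y \<in> chart_nbhd"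
proof -
  have "norm (x, y) \<le> r0" using norm_Pair_le[of x y] assms by linarith
  from dom_small[OF this] show "from_chart x \<otimes> from_chart y \<in> chart_nbhd" by simp
  then show "from_chart x \<otimes> from_chart y = from_chart (coord_mult (x, y))" "coord_mult (x, y) \<in> V" by (simp_all add: coord_mult_def from_chart(7) to_chart_V)
qed

lemma coord_mult_continuous: "continuous_on (cball 0 r0) coord_mult"
proof (rule continuous_onI)
  fix p :: "'e \<times> 'e" and \<epsilon> :: real assume p: "p \<in> cball 0 r0" and \<epsilon>: "\<epsilon> > 0"
  obtain B where B: "B > 0" "\<And>x. norm (proj x) \<le> B * norm x"
    using bounded_linear.pos_bounded[OF proj_bl] by (auto simp: mult.commute)
  define L where "L = C0 * r0 + 2 * B"
  have L: "L > 0" unfolding L_def using C0 r0 B by (simp add: add_pos_pos)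
  have "norm (coord_mult q - coord_mult p) \<le> L * norm (q - p)" if "q \<in> cball 0 r0" for q
  proof -
    have "norm (coord_mult q - coord_mult p) \<le> norm (coord_mult q - coord_mult p - (proj (fst q - fst p) + proj (snd q - snd p)))
        + (norm (proj (fst q - fst p)) + norm (proj (snd q - snd p)))"
      using norm_triangle_ineq[of "coord_mult q - coord_mult p - (proj (fst q - fst p) + proj (snd q - snd p))"
          "proj (fst q - fst p) + proj (snd q - snd p)"]
        norm_triangle_ineq[of "proj (fst q - fst p)" "proj (snd q - snd p)"] by simp
    also have "\<dots> \<le> C0 * r0 * norm (q - p) + (B * norm (q - p) + B * norm (q - p))"
    proof (intro add_mono)
      show "norm (coord_mult q - coord_mult p - (proj (fst q - fst p) + proj (snd q - snd p))) \<le> C0 * r0 * norm (q - p)"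
        by (rule coord_mult_est) (use that p in auto)
      have "norm (fst q - fst p) \<le> norm (q - p)" "norm (snd q - snd p) \<le> norm (q - p)"
        by (cases q, cases p, simp add: norm_fst_le norm_snd_le)+
      then show "norm (proj (fst q - fst p)) \<le> B * norm (q - p)" "norm (proj (snd q - snd p)) \<le> B * norm (q - p)"
        using B by (meson mult_left_mono less_imp_le order_trans)+
    qed
    finally show ?thesis by (simp add: L_def algebra_simps)
  qed
  note lip = this
  have "dist (coord_mult q) (coord_mult p) \<le> \<epsilon>" if "q \<in> cball 0 r0" "dist q p < \<epsilon> / L" for q
  proof -
    have "L * norm (q - p) \<le> \<epsilon>" using that(2) L by (simp add: dist_norm field_simps)
    then show ?thesis using lip[OF that(1)] by (simp add: dist_norm)
  qed
  then show "\<exists>d>0. \<forall>q\<in>cball 0 r0. dist q p < d \<longrightarrow> dist (coord_mult q) (coord_mult p) \<le> \<epsilon>"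
    using L \<epsilon> by (intro exI[of _ "\<epsilon> / L"]) auto
qed

end

text \<open>Squaring is the product on the diagonal. The norm of (x, x) is at most 2 norm x, which
  costs a factor 2 in the radius and another one in the difference; hence \<open>4 * C0\<close> and
  \<open>r0 / 2\<close>.\<close>

sublocale lie_group \<subseteq> koenigs: koenigs "\<lambda>x. coord_mult (x, x)" "model K" "4 * C0" "r0 / 2"
proof
  show "subspace V" by (rule V)
  show "0 < 4 * C0" "0 < r0 / 2" using C0 r0 by auto
  show "coord_mult (x, x) \<in> V" if "x \<in> V" "norm x \<le> r0 / 2" for x using from_chart_coord_mult(2)[of x x] that by simp
  show "coord_mult (0, 0) = 0" using coord_mult_0(1)[OF from_chart(2)] by simp
  fix x y s assume *: "x \<in> V" "y \<in> V" "norm x \<le> s" "norm y \<le> s" "s \<le> r0 / 2"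
  have "proj (x - y) = x - y" using * V by (simp add: subspace_diff)
  then have "norm (coord_mult (x, x) - coord_mult (y, y) - 2 *\<^sub>R (x - y)) =
     norm (coord_mult (x, x) - coord_mult (y, y) - (proj (fst (x, x) - fst (y, y)) + proj (snd (x, x) - snd (y, y))))"
    by (simp add: scaleR_2)
  also have "\<dots> \<le> C0 * (2 * s) * norm ((x, x) - (y, y))"
    using norm_Pair_le[of x x] norm_Pair_le[of y y] * by (intro coord_mult_est) auto
  also have "\<dots> \<le> C0 * (2 * s) * (2 * norm (x - y))"
    using norm_Pair_le[of "x - y" "x - y"] C0 order_trans[OF norm_ge_zero *(3)] by (intro mult_left_mono) auto
  finally show "norm (coord_mult (x, x) - coord_mult (y, y) - 2 *\<^sub>R (x - y)) \<le> 4 * C0 * s * norm (x - y)" by simp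
qed

section \<open>The exponential map\<close>

context lie_group
begin

abbreviation \<delta> where "\<delta> \<equiv> koenigs.\<delta>"
abbreviation E where "E \<equiv> koenigs.E"

lemma \<delta>: "\<delta> > 0" "16 * \<delta> \<le> r0" "64 * C0 * \<delta> \<le> 1"
  using koenigs.\<delta>_pos koenigs.\<delta>_r koenigs.\<delta>_C by auto

definition "near_exp Y = from_chart (E Y)"

lemma E_small:
  assumes "Y \<in> V" "norm Y \<le> \<delta>"
  shows "E Y \<in> chart_dom" "near_exp Y \<in> chart_nbhd" "near_exp Y \<in> carrier K" "to_chart (near_exp Y) = E Y"
proof -
  have "norm (E Y) \<le> r0" using koenigs.E_V(2)[OF assms] assms(2) \<delta> by linarith
  then show "E Y \<in> chart_dom" by (rule chart_dom_small)
  then show "near_exp Y \<in> chart_nbhd" "near_exp Y \<in> carrier K" "to_chart (near_exp Y) = E Y"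
    using from_chart(4,5,10) koenigs.E_V(1)[OF assms] by (auto simp: near_exp_def)
qed

lemma near_exp_half:
  assumes "Y \<in> V" "norm Y \<le> \<delta>"
  shows "near_exp (Y /\<^sub>R 2) \<otimes> near_exp (Y /\<^sub>R 2) = near_exp Y"
proof -
  have h: "Y /\<^sub>R 2 \<in> V" "norm (Y /\<^sub>R 2) \<le> \<delta>" using assms \<delta> V by (auto simp: subspace_mul)
  have "norm (E (Y /\<^sub>R 2)) + norm (E (Y /\<^sub>R 2)) \<le> r0"
    using koenigs.E_V(2)[OF h] h(2) \<delta> by linarith
  from from_chart_coord_mult(1)[OF this] show ?thesis using koenigs.f_E_half[OF assms] by (simp add: near_exp_def)
qed

lemma scaled_small:
  assumes "Y \<in> V" "norm Y \<le> \<delta>"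
  shows "Y /\<^sub>R 2 ^ n \<in> V" "norm (Y /\<^sub>R 2 ^ n) \<le> \<delta>"
proof -
  show "Y /\<^sub>R 2 ^ n \<in> V" using assms V by (simp add: subspace_mul)
  have "norm Y / 2 ^ n \<le> norm Y / 1" by (intro divide_left_mono) auto
  moreover have "norm (Y /\<^sub>R 2 ^ n) = norm Y / 2 ^ n" by (simp add: field_simps)
  ultimately show "norm (Y /\<^sub>R 2 ^ n) \<le> \<delta>" using assms(2) by linarith
qed

lemma near_exp_half':
  assumes "Y \<in> V" "norm Y \<le> \<delta>"
  shows "near_exp (Y /\<^sub>R 2 ^ Suc n) \<otimes> near_exp (Y /\<^sub>R 2 ^ Suc n) = near_exp (Y /\<^sub>R 2 ^ n)"
  using near_exp_half[OF scaled_small[OF assms, of n]] by simp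

text \<open>Passing to the next power adds \<open>a\<close> up to an error C0 (2 k + 1) |a|^2, and
  the odd numbers sum to k^2. The two smallness conditions keep all partial powers in the chart and
  their growth linear in k.\<close>

lemma pow_est:
  assumes "a \<in> V" "(2 * real k + 2) * norm a \<le> r0" "C0 * (2 * real k + 1) * norm a \<le> 1"
  shows "from_chart a [^] k \<in> chart_nbhd \<and> norm (to_chart (from_chart a [^] k)) \<le> 2 * real k * norm a \<and>
    norm (to_chart (from_chart a [^] k) - real k *\<^sub>R a) \<le> C0 * real k ^ 2 * norm a ^ 2"
  using assms(2,3)
proof (induction k)
  case 0 then show ?case using chart_nbhd(2) from_chart(9) by simp
next
  case (Suc k)
  have k2: "(2 * real k + 2) * norm a \<le> (2 * real (Suc k) + 2) * norm a"
    "C0 * (2 * real k + 1) * norm a \<le> C0 * (2 * real (Suc k) + 1) * norm a"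
    using C0 by (intro mult_right_mono mult_left_mono; simp)+
  have IH: "from_chart a [^] k \<in> chart_nbhd" "norm (to_chart (from_chart a [^] k)) \<le> 2 * real k * norm a"
    "norm (to_chart (from_chart a [^] k) - real k *\<^sub>R a) \<le> C0 * real k ^ 2 * norm a ^ 2"
    using Suc k2 by linarith+
  define y where "y = to_chart (from_chart a [^] k)"
  have yV: "y \<in> V" using IH(1) by (simp add: y_def to_chart_V)
  have ny: "norm y \<le> 2 * real k * norm a" using IH by (simp add: y_def)
  have s: "norm y + norm a \<le> (2 * real k + 1) * norm a" using ny by (simp add: algebra_simps)
  have s2: "(2 * real k + 1) * norm a \<le> r0"
    using Suc.prems(1) mult_right_mono[of "2 * real k + 1" "2 * real (Suc k) + 2" "norm a"] by auto
  have eq: "from_chart a [^] Suc k = from_chart y \<otimes> from_chart a" using IH(1) by (simp add: y_def from_chart(7))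
  have m: "from_chart y \<otimes> from_chart a \<in> chart_nbhd" "to_chart (from_chart y \<otimes> from_chart a) = coord_mult (y, a)"
    using from_chart_coord_mult(3)[of y a] s s2 by simp (simp add: coord_mult_def)
  have ydom: "y \<in> chart_dom" using s s2 norm_ge_zero[of a] by (intro chart_dom_small) linarith
  have pl: "proj a = a" using assms(1) by simp
  have "norm (y, a) \<le> (2 * real k + 1) * norm a" "norm (y, 0::'e) \<le> (2 * real k + 1) * norm a"
  proof -
    show "norm (y, a) \<le> (2 * real k + 1) * norm a" using s norm_Pair_le[of y a] by linarith
    have "norm y \<le> (2 * real k + 1) * norm a" using s norm_ge_zero[of a] by linarith
    then show "norm (y, 0::'e) \<le> (2 * real k + 1) * norm a" by (simp add: norm_Pair)
  qed
  \<comment> \<open>The product is compared with its value at (y, 0) rather than at the origin, so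
    that the error carries a factor \<open>norm a\<close>.\<close>
  from coord_mult_est[OF this s2]
  have est: "norm (coord_mult (y, a) - y - a) \<le> C0 * (2 * real k + 1) * norm a * norm a"
    using yV by (simp add: coord_mult_0 ydom pl norm_Pair)
  also have "\<dots> \<le> 1 * norm a"
    using Suc.prems(2) k2(2) by (intro mult_right_mono) auto
  finally have "norm (coord_mult (y, a) - y - a) \<le> norm a" by simp
  then have "norm (coord_mult (y, a)) \<le> norm y + 2 * norm a"
    using norm_triangle_ineq[of "coord_mult (y, a) - y - a" "y + a"] norm_triangle_ineq[of y a] by simp
  then have 1: "norm (coord_mult (y, a)) \<le> 2 * real (Suc k) * norm a" using ny by (simp add: algebra_simps)
  have "norm (coord_mult (y, a) - real (Suc k) *\<^sub>R a) \<le> norm (coord_mult (y, a) - y - a) + norm (y - real k *\<^sub>R a)"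
    using norm_triangle_ineq[of "coord_mult (y, a) - y - a" "y - real k *\<^sub>R a"] by (simp add: algebra_simps)
  also have "\<dots> \<le> C0 * (2 * real k + 1) * norm a * norm a + C0 * real k ^ 2 * norm a ^ 2"
    using est IH(3) by (simp add: y_def)
  also have "\<dots> = C0 * real (Suc k) ^ 2 * norm a ^ 2" by (simp add: power2_eq_square algebra_simps)
  finally show ?case unfolding eq m(2) using m(1) 1 by blast
qed

text \<open>The coordinates of the k-th powers of \<open>near_exp\<close> at Y / 2^n and the values
  of \<open>E\<close> at k Y / 2^n are both backward orbits of squaring. They differ by O(4^-n),
  hence agree at n = 0.\<close>

lemma near_exp_pow:
  assumes Y: "Y \<in> V" "norm Y \<le> \<delta>" "real k * norm Y \<le> \<delta>"
  shows "near_exp Y [^] k = near_exp (real k *\<^sub>R Y)"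
proof -
  define g where "g n = to_chart (near_exp (Y /\<^sub>R 2 ^ n) [^] k)" for n
  define h where "h n = E ((real k *\<^sub>R Y) /\<^sub>R 2 ^ n)" for n
  define a where "a n = E (Y /\<^sub>R 2 ^ n)" for n
  note sY = scaled_small[OF Y(1,2)]
  have kY: "real k *\<^sub>R Y \<in> V" "norm (real k *\<^sub>R Y) \<le> \<delta>" using Y V by (auto simp: subspace_mul)
  note skY = scaled_small[OF kY]
  have nY: "norm (Y /\<^sub>R 2 ^ n) * 2 ^ n = norm Y" for n by simp
  have aV: "a n \<in> V" for n unfolding a_def using koenigs.E_V(1)[OF sY] .
  have an: "norm (a n) \<le> 2 * norm (Y /\<^sub>R 2 ^ n)" for n unfolding a_def using koenigs.E_V(2)[OF sY] .
  have an2: "norm (a n) \<le> 2 * norm Y / 2 ^ n" for n using an[of n] by (simp add: divide_inverse mult_ac)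
  have nYn: "norm (Y /\<^sub>R 2 ^ n) \<le> norm Y" for n
    using divide_left_mono[of 1 "2 ^ n" "norm Y"] by (simp add: divide_inverse mult.commute)
  have an3: "norm (a n) \<le> 2 * norm Y" for n using an[of n] nYn[of n] by linarith
  have p: "(2 * real k + 2) * norm (a n) \<le> 8 * \<delta>" "(2 * real k + 1) * norm (a n) \<le> 8 * \<delta>" for n
  proof -
    have "(2 * real k + 2) * norm (a n) \<le> (2 * real k + 2) * (2 * norm Y)"
      by (rule mult_left_mono[OF an3]) simp
    also have "\<dots> = 4 * (real k * norm Y) + 4 * norm Y" by (simp add: algebra_simps)
    finally show *: "(2 * real k + 2) * norm (a n) \<le> 8 * \<delta>" using Y by linarith
    have "(2 * real k + 1) * norm (a n) \<le> (2 * real k + 2) * norm (a n)" by (rule mult_right_mono) auto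
    then show "(2 * real k + 1) * norm (a n) \<le> 8 * \<delta>" using * by linarith
  qed
  have "C0 * (2 * real k + 1) * norm (a n) \<le> C0 * (8 * \<delta>)" for n
    using p(2)[of n] C0 by (simp add: mult.assoc)
  then have p3: "C0 * (2 * real k + 1) * norm (a n) \<le> 1" for n
  proof -
    have "C0 * (8 * \<delta>) \<le> 1" using \<delta>(3) mult_pos_pos[OF C0 \<delta>(1)] by simp
    then show ?thesis using \<open>C0 * (2 * real k + 1) * norm (a n) \<le> C0 * (8 * \<delta>)\<close> by linarith
  qed
  have pe: "from_chart (a n) [^] k \<in> chart_nbhd" "norm (g n) \<le> 2 * real k * norm (a n)"
    "norm (g n - real k *\<^sub>R a n) \<le> C0 * real k ^ 2 * norm (a n) ^ 2" for n
  proof -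
    have r: "(2 * real k + 2) * norm (a n) \<le> r0" using p(1)[of n] \<delta> by linarith
    show "from_chart (a n) [^] k \<in> chart_nbhd" "norm (g n) \<le> 2 * real k * norm (a n)"
      "norm (g n - real k *\<^sub>R a n) \<le> C0 * real k ^ 2 * norm (a n) ^ 2"
      using pow_est[OF aV r p3] by (auto simp: g_def a_def near_exp_def)
  qed
  have eU: "near_exp (Y /\<^sub>R 2 ^ n) [^] k \<in> chart_nbhd" for n using pe(1)[of n] by (simp add: a_def near_exp_def)
  have "g 0 = h 0"
  proof (rule koenigs.orbit_unique)
    show "g n \<in> V" for n unfolding g_def by (rule to_chart_V[OF eU])
    show "h n \<in> V" for n unfolding h_def by (rule koenigs.E_V(1)[OF skY])
    show "coord_mult (g (Suc n), g (Suc n)) = g n" for n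
    proof -
      let ?b = "near_exp (Y /\<^sub>R 2 ^ Suc n)"
      have b: "?b \<in> carrier K" by (rule E_small(3)[OF sY])
      have "coord_mult (g (Suc n), g (Suc n)) = to_chart (?b [^] k \<otimes> ?b [^] k)"
        by (simp only: coord_mult_def g_def fst_conv snd_conv from_chart(7)[OF eU])
      also have "?b [^] k \<otimes> ?b [^] k = (?b \<otimes> ?b) [^] k"
        using b by (simp add: pow_mult_distrib)
      also have "to_chart \<dots> = g n" unfolding g_def near_exp_half'[OF Y(1,2)] ..
      finally show ?thesis .
    qed
    show "coord_mult (h (Suc n), h (Suc n)) = h n" for n
      using koenigs.f_E_half[OF skY[of n]] by (simp add: h_def)
    show "2 ^ n * norm (g n) \<le> 4 * \<delta>" for n
    proof -
      have "2 ^ n * norm (g n) \<le> 2 ^ n * (2 * real k * (2 * norm (Y /\<^sub>R 2 ^ n)))"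
        using pe(2)[of n] mult_left_mono[OF an[of n], of "2 * real k"] by (intro mult_left_mono) (auto simp: mult_ac)
      also have "\<dots> = 4 * (real k * norm Y)" by simp
      finally show ?thesis using Y by linarith
    qed
    show "2 ^ n * norm (h n) \<le> 4 * \<delta>" for n
    proof -
      have "2 ^ n * norm (h n) \<le> 2 ^ n * (2 * norm ((real k *\<^sub>R Y) /\<^sub>R 2 ^ n))"
        unfolding h_def by (intro mult_left_mono koenigs.E_V(2)[OF skY]) auto
      also have "\<dots> = 2 * (real k * norm Y)" by simp
      finally show ?thesis using Y \<delta>(1) by linarith
    qed
    \<comment> \<open>Collects three errors of order 4^-n: that of \<open>pow_est\<close>, k times
      that of \<open>E\<close> at Y / 2^n, and that of \<open>E\<close> at k Y / 2^n.\<close>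
    define M where "M = C0 * real k ^ 2 * (2 * norm Y) ^ 2 + real k * (8 * C0 * norm Y ^ 2) + 8 * C0 * norm (real k *\<^sub>R Y) ^ 2"
    have lim: "2 ^ n * norm (g n - h n) \<le> M * (1/2) ^ n" for n
    proof -
      have "norm (g n - h n) \<le> norm (g n - real k *\<^sub>R a n) + (norm (real k *\<^sub>R a n - real k *\<^sub>R (Y /\<^sub>R 2 ^ n))
          + norm (h n - (real k *\<^sub>R Y) /\<^sub>R 2 ^ n))"
        using norm_triangle_ineq[of "g n - real k *\<^sub>R a n" "real k *\<^sub>R a n - h n"]
          norm_triangle_ineq4[of "real k *\<^sub>R a n - real k *\<^sub>R (Y /\<^sub>R 2 ^ n)" "h n - (real k *\<^sub>R Y) /\<^sub>R 2 ^ n"]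
        by (simp add: mult.commute)
      also have "\<dots> \<le> C0 * real k ^ 2 * (2 * norm Y / 2 ^ n) ^ 2 + (real k * (8 * C0 * (norm Y / 2 ^ n) ^ 2)
          + 8 * C0 * (norm (real k *\<^sub>R Y) / 2 ^ n) ^ 2)"
      proof (intro add_mono)
        show "norm (g n - real k *\<^sub>R a n) \<le> C0 * real k ^ 2 * (2 * norm Y / 2 ^ n) ^ 2"
          using pe(3)[of n] C0 an2[of n]
          by (elim order_trans) (intro mult_left_mono power_mono, auto)
        have "norm (a n - Y /\<^sub>R 2 ^ n) \<le> 8 * C0 * (norm Y / 2 ^ n) ^ 2"
          using koenigs.E_approx[OF sY[of n]] by (simp add: a_def divide_inverse mult_ac)
        then have "real k * norm (a n - Y /\<^sub>R 2 ^ n) \<le> real k * (8 * C0 * (norm Y / 2 ^ n) ^ 2)"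
          by (rule mult_left_mono) simp
        then show "norm (real k *\<^sub>R a n - real k *\<^sub>R (Y /\<^sub>R 2 ^ n)) \<le> real k * (8 * C0 * (norm Y / 2 ^ n) ^ 2)"
          unfolding scaleR_diff_right[symmetric] norm_scaleR by simp
        show "norm (h n - (real k *\<^sub>R Y) /\<^sub>R 2 ^ n) \<le> 8 * C0 * (norm (real k *\<^sub>R Y) / 2 ^ n) ^ 2"
          using koenigs.E_approx[OF skY[of n]] by (simp add: h_def divide_inverse mult_ac)
      qed
      also have "\<dots> = M * ((1/2) ^ n * (1/2) ^ n)"
        by (simp add: M_def power_divide power2_eq_square field_simps)
      finally have "2 ^ n * norm (g n - h n) \<le> 2 ^ n * (M * ((1/2) ^ n * (1/2) ^ n))"
        by (rule mult_left_mono) simp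
      then show ?thesis by (simp add: power_divide)
    qed
    have "(\<lambda>n. M * (1/2) ^ n) \<longlonglongrightarrow> 0"
      by (intro tendsto_mult_right_zero LIMSEQ_realpow_zero) auto
    then show "(\<lambda>n. 2 ^ n * norm (g n - h n)) \<longlonglongrightarrow> 0"
      by (rule Lim_null_comparison[rotated]) (use lim in simp)
  qed
  then have "from_chart (g 0) = from_chart (h 0)" by simp
  then show ?thesis using from_chart(7)[OF eU[of 0]] by (simp add: g_def h_def near_exp_def)
qed

text \<open>If y denotes the coordinates of the inverse, then \<open>coord_mult (x, y) = 0\<close>,
  and comparison with (x, 0) bounds |x + y| by C0 (|x| + |y|) |y|. For small x and y this first
  gives |y| \<le> 2 |x|, and, inserted again, the quadratic bound.\<close>

lemma inv_near_one:
  obtains d where "d > 0" "\<And>x. x \<in> V \<Longrightarrow> norm x < d \<Longrightarrow> x \<in> chart_dom \<and> inv (from_chart x) \<in> chart_nbhd \<and>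
     norm (to_chart (inv (from_chart x))) \<le> 2 * norm x \<and> norm (to_chart (inv (from_chart x)) + x) \<le> 6 * C0 * norm x ^ 2"
proof -
  define \<epsilon> where "\<epsilon> = min (r0 / 2) (1 / (4 * C0))"
  have \<epsilon>: "\<epsilon> > 0" "2 * \<epsilon> \<le> r0" "4 * C0 * \<epsilon> \<le> 1"
    using r0 C0 by (auto simp: \<epsilon>_def min_def field_simps)
  obtain W where W: "openin X W" "\<one> \<in> W" "W \<subseteq> chart_nbhd" "\<And>g. g \<in> W \<Longrightarrow> norm (to_chart g) < \<epsilon>"
    using to_chart_nbhd[OF \<epsilon>(1)] by metis
  have "openin X {g \<in> topspace X. inv g \<in> W}"
    by (rule openin_continuous_map_preimage[OF inv_continuous W(1)])
  then have "\<forall>\<^sub>F x in nhds 0. x \<in> chart_dom \<and> from_chart x \<in> {g \<in> topspace X. inv g \<in> W}"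
    by (rule eventually_from_chart) (use W(2) in \<open>simp add: topspace_topo\<close>)
  then obtain d0 where d0: "d0 > 0" "\<And>x. dist x 0 < d0 \<Longrightarrow> x \<in> chart_dom \<and> from_chart x \<in> {g \<in> topspace X. inv g \<in> W}"
    unfolding eventually_nhds_metric by blast
  show thesis
  proof (rule that)
    show "min d0 \<epsilon> > 0" using d0 \<epsilon> by simp
    fix x assume x: "x \<in> V" "norm x < min d0 \<epsilon>"
    then have xd: "x \<in> chart_dom" "from_chart x \<in> carrier K" "inv (from_chart x) \<in> W"
      using d0(2)[of x] by (auto simp: topspace_topo)
    define y where "y = to_chart (inv (from_chart x))"
    have iU: "inv (from_chart x) \<in> chart_nbhd" using xd W by blast
    have y: "norm y < \<epsilon>" "y \<in> V" "from_chart y = inv (from_chart x)"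
      using xd W iU by (auto simp: y_def from_chart(7) to_chart_V)
    have "coord_mult (x, y) = 0" using xd y from_chart(9) by (simp add: coord_mult_def)
    have "norm (x, y) \<le> norm x + norm y" "norm (x, 0::'e) \<le> norm x + norm y" "norm x + norm y \<le> r0"
      using x(2) y(1) \<epsilon> norm_Pair_le[of x y] by (simp_all add: norm_Pair)
    note est = coord_mult_est[OF this]
    have "norm (x + y) = norm (- x - y)" by (metis add_uminus_conv_diff minus_add_distrib norm_minus_cancel)
    then have est2: "norm (x + y) \<le> C0 * (norm x + norm y) * norm y"
      using est \<open>coord_mult (x, y) = 0\<close> x(1) y(2) xd(1) by (simp add: coord_mult_0 norm_Pair)
    also have "\<dots> \<le> 1/2 * norm y"
    proof (rule mult_right_mono)
      have "C0 * (norm x + norm y) \<le> C0 * (2 * \<epsilon>)" using x(2) y(1) C0 by (intro mult_left_mono) auto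
      then show "C0 * (norm x + norm y) \<le> 1/2" using \<epsilon>(3) by simp
    qed simp
    finally have "norm (x + y) \<le> 1/2 * norm y" .
    then have y2: "norm y \<le> 2 * norm x" using norm_triangle_ineq4[of "x + y" x] by simp
    have "norm (x + y) \<le> C0 * (3 * norm x) * (2 * norm x)"
      using est2 y2 C0 by (elim order_trans) (intro mult_mono, auto)
    then show "x \<in> chart_dom \<and> inv (from_chart x) \<in> chart_nbhd \<and> norm (to_chart (inv (from_chart x))) \<le> 2 * norm x \<and>
        norm (to_chart (inv (from_chart x)) + x) \<le> 6 * C0 * norm x ^ 2"
      using xd iU y2 by (simp add: y_def power2_eq_square add.commute mult_ac)
  qed
qed

end

context lie_group
begin

text \<open>The inverses of a backward orbit form a backward orbit. The radius is dictated by
  \<open>inv_near_one\<close>; taking powers of two extends the identity to the radius \<delta>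
  afterwards.\<close>

lemma near_exp_uminus_small:
  obtains \<eta> where "\<eta> > 0" "\<And>Y. Y \<in> V \<Longrightarrow> norm Y \<le> \<eta> \<Longrightarrow> norm Y \<le> \<delta> \<and> inv (near_exp Y) = near_exp (- Y)"
proof -
  obtain d where d: "d > 0" "\<And>x. x \<in> V \<Longrightarrow> norm x < d \<Longrightarrow> x \<in> chart_dom \<and> inv (from_chart x) \<in> chart_nbhd \<and>
     norm (to_chart (inv (from_chart x))) \<le> 2 * norm x \<and> norm (to_chart (inv (from_chart x)) + x) \<le> 6 * C0 * norm x ^ 2"
    by (rule inv_near_one) (rule that)
  show thesis
  proof (rule that)
    show "min \<delta> (d / 3) > 0" using d \<delta> by simp
    fix Y assume Y0: "Y \<in> V" "norm Y \<le> min \<delta> (d / 3)"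
    then have Y: "Y \<in> V" "norm Y \<le> \<delta>" by auto
    have mY: "- Y \<in> V" "norm (- Y) \<le> \<delta>" using Y V by (auto simp: subspace_neg)
    note sY = scaled_small[OF Y] and smY = scaled_small[OF mY]
    define a where "a n = E (Y /\<^sub>R 2 ^ n)" for n
    define g where "g n = to_chart (inv (near_exp (Y /\<^sub>R 2 ^ n)))" for n
    define h where "h n = E ((- Y) /\<^sub>R 2 ^ n)" for n
    have aV: "a n \<in> V" for n unfolding a_def using koenigs.E_V(1)[OF sY] .
    have an: "norm (a n) \<le> 2 * norm Y / 2 ^ n" for n
      using koenigs.E_V(2)[OF sY, of n] by (simp add: a_def divide_inverse mult_ac)
    have an3: "norm (a n) < d" for n
    proof -
      have "2 * norm Y / 2 ^ n \<le> 2 * norm Y / 1" by (intro divide_left_mono) auto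
      then show ?thesis using an[of n] Y0 d(1) by auto
    qed
    have iv: "inv (near_exp (Y /\<^sub>R 2 ^ n)) \<in> chart_nbhd" "norm (g n) \<le> 2 * norm (a n)" "norm (g n + a n) \<le> 6 * C0 * norm (a n) ^ 2" for n
      using d(2)[OF aV an3, of n] by (auto simp: a_def g_def near_exp_def)
    have "g 0 = h 0"
    proof (rule koenigs.orbit_unique)
      show "g n \<in> V" for n unfolding g_def by (rule to_chart_V[OF iv(1)])
      show "h n \<in> V" for n unfolding h_def by (rule koenigs.E_V(1)[OF smY])
      show "coord_mult (h (Suc n), h (Suc n)) = h n" for n
        using koenigs.f_E_half[OF smY[of n]] by (simp add: h_def)
      show "coord_mult (g (Suc n), g (Suc n)) = g n" for n
      proof -
        let ?b = "near_exp (Y /\<^sub>R 2 ^ Suc n)"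
        have b: "?b \<in> carrier K" by (rule E_small(3)[OF sY])
        have "coord_mult (g (Suc n), g (Suc n)) = to_chart (inv ?b \<otimes> inv ?b)"
          by (simp only: coord_mult_def g_def fst_conv snd_conv from_chart(7)[OF iv(1)])
        also have "inv ?b \<otimes> inv ?b = inv (?b \<otimes> ?b)" using b by (simp add: inv_mult_group)
        also have "to_chart \<dots> = g n" unfolding g_def near_exp_half'[OF Y] ..
        finally show ?thesis .
      qed
      show "2 ^ n * norm (g n) \<le> 4 * \<delta>" for n
      proof -
        have "2 ^ n * norm (g n) \<le> 2 ^ n * (2 * (2 * norm Y / 2 ^ n))"
          using iv(2)[of n] an[of n] by (intro mult_left_mono) auto
        then show ?thesis using Y by simp
      qed
      show "2 ^ n * norm (h n) \<le> 4 * \<delta>" for n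
      proof -
        have "2 ^ n * norm (h n) \<le> 2 ^ n * (2 * norm ((- Y) /\<^sub>R 2 ^ n))"
          unfolding h_def by (intro mult_left_mono koenigs.E_V(2)[OF smY]) auto
        also have "\<dots> = 2 * norm Y" by simp
        finally show ?thesis using Y \<delta>(1) by linarith
      qed
      define M where "M = 6 * C0 * (2 * norm Y) ^ 2 + 8 * C0 * norm Y ^ 2 + 8 * C0 * norm Y ^ 2"
      have lim: "2 ^ n * norm (g n - h n) \<le> M * (1/2) ^ n" for n
      proof -
        have "norm (g n - h n) \<le> norm (g n + a n) + (norm (a n - Y /\<^sub>R 2 ^ n) + norm (h n - (- Y) /\<^sub>R 2 ^ n))"
          using norm_triangle_ineq4[of "g n + a n" "(a n - Y /\<^sub>R 2 ^ n) + (h n - (- Y) /\<^sub>R 2 ^ n)"]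
            norm_triangle_ineq[of "a n - Y /\<^sub>R 2 ^ n" "h n - (- Y) /\<^sub>R 2 ^ n"] by simp
        also have "\<dots> \<le> 6 * C0 * (2 * norm Y / 2 ^ n) ^ 2 + (8 * C0 * (norm Y / 2 ^ n) ^ 2 + 8 * C0 * (norm Y / 2 ^ n) ^ 2)"
        proof (intro add_mono)
          show "norm (g n + a n) \<le> 6 * C0 * (2 * norm Y / 2 ^ n) ^ 2"
            using iv(3)[of n] C0 an[of n]
            by (elim order_trans) (intro mult_left_mono power_mono, auto)
          show "norm (a n - Y /\<^sub>R 2 ^ n) \<le> 8 * C0 * (norm Y / 2 ^ n) ^ 2"
            using koenigs.E_approx[OF sY[of n]] by (simp add: a_def divide_inverse mult_ac)
          show "norm (h n - (- Y) /\<^sub>R 2 ^ n) \<le> 8 * C0 * (norm Y / 2 ^ n) ^ 2"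
            using koenigs.E_approx[OF smY[of n]] by (simp add: h_def divide_inverse mult_ac)
        qed
        also have "\<dots> = M * ((1/2) ^ n * (1/2) ^ n)"
          by (simp add: M_def power_divide power2_eq_square field_simps)
        finally have "2 ^ n * norm (g n - h n) \<le> 2 ^ n * (M * ((1/2) ^ n * (1/2) ^ n))"
          by (rule mult_left_mono) simp
        then show ?thesis by (simp add: power_divide)
      qed
      have "(\<lambda>n. M * (1/2) ^ n) \<longlonglongrightarrow> 0"
        by (intro tendsto_mult_right_zero LIMSEQ_realpow_zero) auto
      then show "(\<lambda>n. 2 ^ n * norm (g n - h n)) \<longlonglongrightarrow> 0"
        by (rule Lim_null_comparison[rotated]) (use lim in simp)
    qed
    then have "from_chart (g 0) = from_chart (h 0)" by simp
    then have "inv (near_exp Y) = near_exp (- Y)" using from_chart(7)[OF iv(1)[of 0]] by (simp add: g_def h_def near_exp_def)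
    then show "norm Y \<le> \<delta> \<and> inv (near_exp Y) = near_exp (- Y)" using Y by simp
  qed
qed

lemma ex_scale: fixes \<eta> :: real assumes "\<eta> > 0" obtains n where "c \<le> 2 ^ n * \<eta>"
proof -
  obtain n where "c / \<eta> < 2 ^ n" using real_arch_pow[of 2 "c / \<eta>"] by auto
  then show thesis using that[of n] assms by (simp add: field_simps)
qed

lemma near_exp_unscale:
  assumes "Y \<in> V" "norm Y \<le> \<delta>"
  shows "near_exp Y = near_exp (Y /\<^sub>R 2 ^ n) [^] (2 ^ n :: nat)"
proof -
  have "real (2 ^ n) * norm (Y /\<^sub>R 2 ^ n) = norm Y" by simp
  then have "real (2 ^ n) * norm (Y /\<^sub>R 2 ^ n) \<le> \<delta>" using assms(2) by (simp only:)
  note p = near_exp_pow[OF scaled_small[OF assms, of n] this]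
  have "real (2 ^ n) *\<^sub>R (Y /\<^sub>R 2 ^ n) = Y" by simp
  then show ?thesis using p by (simp only:)
qed

lemma near_exp_uminus:
  assumes "Y \<in> V" "norm Y \<le> \<delta>"
  shows "inv (near_exp Y) = near_exp (- Y)"
proof -
  obtain \<eta> where \<eta>: "\<eta> > 0" "\<And>Y. Y \<in> V \<Longrightarrow> norm Y \<le> \<eta> \<Longrightarrow> norm Y \<le> \<delta> \<and> inv (near_exp Y) = near_exp (- Y)"
    by (rule near_exp_uminus_small) (rule that)
  obtain n where n: "norm Y \<le> 2 ^ n * \<eta>" using ex_scale[OF \<eta>(1)] by metis
  let ?Z = "Y /\<^sub>R 2 ^ n"
  have Z: "?Z \<in> V" "norm ?Z \<le> \<eta>" using assms V n by (simp_all add: subspace_mul field_simps)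
  have "inv (near_exp Y) = inv (near_exp ?Z [^] (2 ^ n :: nat))" using near_exp_unscale[OF assms, of n] by simp
  also have "\<dots> = inv (near_exp ?Z) [^] (2 ^ n :: nat)"
    using nat_pow_inv[OF E_small(3)[OF scaled_small[OF assms]]] by simp
  also have "\<dots> = near_exp ((- Y) /\<^sub>R 2 ^ n) [^] (2 ^ n :: nat)" using \<eta>(2)[OF Z] by simp
  also have "\<dots> = near_exp (- Y)" by (rule near_exp_unscale[symmetric]) (use assms V in \<open>auto simp: subspace_neg\<close>)
  finally show ?thesis .
qed

lemma near_exp_int_pow:
  assumes Y: "Y \<in> V" "norm Y \<le> \<delta>" "\<bar>real_of_int k\<bar> * norm Y \<le> \<delta>"
  shows "near_exp Y [^] k = near_exp (real_of_int k *\<^sub>R Y)"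
proof (cases "k \<ge> 0")
  case True
  then obtain m where "k = int m" using nonneg_int_cases by metis
  then show ?thesis using near_exp_pow[OF Y(1,2), of m] Y(3) by (simp add: int_pow_int)
next
  case False
  then obtain m where m: "k = - int m" by (metis int_cases2 linorder_not_le of_nat_0_le_iff)
  have kY: "real m *\<^sub>R Y \<in> V" "norm (real m *\<^sub>R Y) \<le> \<delta>" using Y m V by (auto simp: subspace_mul)
  have "near_exp Y [^] k = inv (near_exp Y [^] m)" using E_small(3)[OF Y(1,2)] by (simp add: m int_pow_neg_int)
  also have "\<dots> = inv (near_exp (real m *\<^sub>R Y))" using near_exp_pow[OF Y(1,2), of m] Y(3) m by simp
  also have "\<dots> = near_exp (real_of_int k *\<^sub>R Y)" using near_exp_uminus[OF kY] m by simp
  finally show ?thesis .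
qed

text \<open>For dyadic s and t with common denominator 2^n both sides are integer powers of the
  single element \<open>near_exp\<close> at Y / 2^n. Rounding down approximates arbitrary s and t,
  and the limit is taken in coordinates, where \<open>E\<close> and \<open>coord_mult\<close> are
  continuous.\<close>

lemma near_exp_add:
  assumes Y: "Y \<in> V" "norm Y \<le> \<delta> / 4" and s: "\<bar>s\<bar> \<le> 1" and t: "\<bar>t\<bar> \<le> 1"
  shows "near_exp (s *\<^sub>R Y) \<otimes> near_exp (t *\<^sub>R Y) = near_exp ((s + t) *\<^sub>R Y)"
proof -
  define f where "f r n = real_of_int \<lfloor>r * 2 ^ n\<rfloor>" for r :: real and n :: nat
  have f: "(\<lambda>n. f r n / 2 ^ n) \<longlonglongrightarrow> r" for r
  proof (rule tendsto_sandwich[of "\<lambda>n. r - (1/2) ^ n" _ _ "\<lambda>n. r"])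
    have fl: "f r n \<le> r * 2 ^ n" "r * 2 ^ n < f r n + 1" for n unfolding f_def by linarith+
    show "\<forall>\<^sub>F n in sequentially. r - (1 / 2) ^ n \<le> f r n / 2 ^ n"
      "\<forall>\<^sub>F n in sequentially. f r n / 2 ^ n \<le> r"
    proof -
      have "r - (1 / 2) ^ n = (r * 2 ^ n - 1) / 2 ^ n" for n by (simp add: field_simps power_divide)
      then have "r - (1 / 2) ^ n \<le> f r n / 2 ^ n" for n using fl(2)[of n] by (simp add: divide_right_mono)
      then show "\<forall>\<^sub>F n in sequentially. r - (1 / 2) ^ n \<le> f r n / 2 ^ n" by simp
      show "\<forall>\<^sub>F n in sequentially. f r n / 2 ^ n \<le> r" using fl(1) by (simp add: field_simps)
    qed
    have "(\<lambda>n. r - (1 / 2) ^ n) \<longlonglongrightarrow> r - 0"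
      by (intro tendsto_diff tendsto_const LIMSEQ_realpow_zero) auto
    then show "(\<lambda>n. r - (1 / 2) ^ n) \<longlonglongrightarrow> r" by simp
  qed auto
  \<comment> \<open>A crude bound: 2 for each dyadic factor, hence 4 for their sum, which is what
    the radius \<delta> / 4 accommodates.\<close>
  have fb: "\<bar>f r n\<bar> \<le> 2 * 2 ^ n" if "\<bar>r\<bar> \<le> 1" for r n
  proof -
    have "\<bar>r * 2 ^ n\<bar> \<le> 1 * 2 ^ n" unfolding abs_mult using that by (intro mult_mono) auto
    moreover have "\<bar>f r n - r * 2 ^ n\<bar> \<le> 1" unfolding f_def by linarith
    moreover have "(1::real) \<le> 2 ^ n" by simp
    ultimately show ?thesis by linarith
  qed
  have Y': "norm Y \<le> \<delta>" using Y \<delta>(1) by linarith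
  define A where "A r = r *\<^sub>R Y" for r
  have A: "A r \<in> V" "\<bar>r\<bar> \<le> c \<Longrightarrow> norm (A r) \<le> c * norm Y" for r c
    using Y(1) V by (auto simp: A_def subspace_mul mult_right_mono)
  have A2: "norm (A r) \<le> \<delta> / 2" if "\<bar>r\<bar> \<le> 2" for r using A(2)[OF that] Y by linarith
  have A4: "norm (A r) \<le> \<delta>" if "\<bar>r\<bar> \<le> 4" for r using A(2)[OF that] Y by linarith
  have E2: "norm (E (A r)) \<le> \<delta>" if "\<bar>r\<bar> \<le> 2" for r
    using koenigs.E_V(2)[OF A(1) A4[of r]] A2[OF that] that by linarith
  have fb2: "\<bar>f r n / 2 ^ n\<bar> \<le> 2" if "\<bar>r\<bar> \<le> 1" for r n using fb[OF that, of n] by (simp add: field_simps)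
  have step: "coord_mult (E (A (f s n / 2 ^ n)), E (A (f t n / 2 ^ n))) = E (A (f s n / 2 ^ n + f t n / 2 ^ n))" for n
  proof -
    let ?Z = "Y /\<^sub>R 2 ^ n"
    note Z = scaled_small[OF Y(1) Y', of n]
    have ip: "near_exp ?Z [^] k = near_exp (A (real_of_int k / 2 ^ n))" if "\<bar>real_of_int k / 2 ^ n\<bar> \<le> 4" for k
    proof -
      have "\<bar>real_of_int k\<bar> * norm ?Z = norm (A (real_of_int k / 2 ^ n))"
        by (simp add: A_def abs_mult divide_inverse)
      then have "\<bar>real_of_int k\<bar> * norm ?Z \<le> \<delta>" using A4[OF that] by simp
      moreover have "real_of_int k *\<^sub>R ?Z = A (real_of_int k / 2 ^ n)" by (simp add: A_def divide_inverse)
      ultimately show ?thesis using near_exp_int_pow[OF Z, of k] by (simp only:)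
    qed
    have k: "\<bar>f s n / 2 ^ n\<bar> \<le> 2" "\<bar>f t n / 2 ^ n\<bar> \<le> 2" "\<bar>f s n / 2 ^ n + f t n / 2 ^ n\<bar> \<le> 4"
      using fb2[OF s, of n] fb2[OF t, of n] by linarith+
    let ?k = "\<lfloor>s * 2 ^ n\<rfloor>" and ?l = "\<lfloor>t * 2 ^ n\<rfloor>"
    have "near_exp ?Z [^] (?k + ?l) = near_exp ?Z [^] ?k \<otimes> near_exp ?Z [^] ?l"
      by (rule int_pow_mult[OF E_small(3)[OF Z]])
    moreover have "near_exp ?Z [^] (?k + ?l) = near_exp (A (f s n / 2 ^ n + f t n / 2 ^ n))"
      using ip[of "?k + ?l"] k(3) by (simp add: f_def add_divide_distrib)
    moreover have "near_exp ?Z [^] ?k = near_exp (A (f s n / 2 ^ n))" "near_exp ?Z [^] ?l = near_exp (A (f t n / 2 ^ n))"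
      using ip[of ?k] ip[of ?l] k(1,2) by (simp_all add: f_def)
    ultimately have eq: "near_exp (A (f s n / 2 ^ n)) \<otimes> near_exp (A (f t n / 2 ^ n)) = near_exp (A (f s n / 2 ^ n + f t n / 2 ^ n))"
      by simp
    have "coord_mult (E (A (f s n / 2 ^ n)), E (A (f t n / 2 ^ n))) = to_chart (near_exp (A (f s n / 2 ^ n)) \<otimes> near_exp (A (f t n / 2 ^ n)))"
      by (simp add: coord_mult_def near_exp_def)
    also have "\<dots> = E (A (f s n / 2 ^ n + f t n / 2 ^ n))"
      unfolding eq by (rule E_small(4)[OF A(1) A4[OF k(3)]])
    finally show ?thesis .
  qed
  have Elim: "(\<lambda>n. E (A (u n))) \<longlonglongrightarrow> E (A r)" if "u \<longlonglongrightarrow> r" "\<And>n. \<bar>u n\<bar> \<le> 4" "\<bar>r\<bar> \<le> 4" for u r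
  proof (rule continuous_on_tendsto_compose[OF koenigs.E_continuous])
    show "(\<lambda>n. A (u n)) \<longlonglongrightarrow> A r" unfolding A_def by (intro tendsto_scaleR that tendsto_const)
  qed (use A(1) A4 that in \<open>auto intro!: always_eventually\<close>)
  have pr: "(E (A r), E (A r')) \<in> cball 0 r0" if "\<bar>r\<bar> \<le> 2" "\<bar>r'\<bar> \<le> 2" for r r'
    using norm_Pair_le[of "E (A r)" "E (A r')"] E2[OF that(1)] E2[OF that(2)] \<delta> by auto
  have "(\<lambda>n. coord_mult (E (A (f s n / 2 ^ n)), E (A (f t n / 2 ^ n)))) \<longlonglongrightarrow> coord_mult (E (A s), E (A t))"
  proof (rule continuous_on_tendsto_compose[OF coord_mult_continuous])
    show "(\<lambda>n. (E (A (f s n / 2 ^ n)), E (A (f t n / 2 ^ n)))) \<longlonglongrightarrow> (E (A s), E (A t))"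
      by (intro tendsto_Pair Elim f order_trans[OF fb2]) (use s t in auto)
    show "(E (A s), E (A t)) \<in> cball 0 r0" by (rule pr) (use s t in auto)
    show "\<forall>\<^sub>F n in sequentially. (E (A (f s n / 2 ^ n)), E (A (f t n / 2 ^ n))) \<in> cball 0 r0"
      by (intro always_eventually allI pr fb2 s t)
  qed
  moreover have "(\<lambda>n. E (A (f s n / 2 ^ n + f t n / 2 ^ n))) \<longlonglongrightarrow> E (A (s + t))"
  proof (rule Elim)
    show "(\<lambda>n. f s n / 2 ^ n + f t n / 2 ^ n) \<longlonglongrightarrow> s + t" by (intro tendsto_add f)
    show "\<bar>f s n / 2 ^ n + f t n / 2 ^ n\<bar> \<le> 4" for n using fb2[OF s, of n] fb2[OF t, of n] by linarith
  qed (use s t in linarith)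
  ultimately have "coord_mult (E (A s), E (A t)) = E (A (s + t))"
    unfolding step by (rule LIMSEQ_unique)
  moreover have "norm (E (A s)) + norm (E (A t)) \<le> r0" using E2[of s] E2[of t] s t \<delta> by linarith
  ultimately show ?thesis using from_chart_coord_mult(1) by (simp add: near_exp_def A_def)
qed

text \<open>The exponential of an arbitrary vector as a 2^n-th power of a small one. Every n that
  makes the vector small enough gives the same value, by \<open>lexp_eq\<close>.\<close>

definition "lexp Y = (let n = (SOME n. norm Y \<le> 2 ^ n * \<delta>) in near_exp (Y /\<^sub>R 2 ^ n) [^] (2 ^ n :: nat))"

lemma lexp_eq:
  assumes Y: "Y \<in> V" "norm Y \<le> 2 ^ n * \<delta>"
  shows "lexp Y = near_exp (Y /\<^sub>R 2 ^ n) [^] (2 ^ n :: nat)"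
proof -
  have up: "near_exp (Y /\<^sub>R 2 ^ n) [^] (2 ^ n :: nat) = near_exp (Y /\<^sub>R 2 ^ m) [^] (2 ^ m :: nat)"
    if n: "norm Y \<le> 2 ^ n * \<delta>" and "n \<le> m" for n m
  proof -
    have Z: "Y /\<^sub>R 2 ^ n \<in> V" "norm (Y /\<^sub>R 2 ^ n) \<le> \<delta>"
      using Y V n by (auto simp: subspace_mul field_simps)
    have pm: "(2::real) ^ m = 2 ^ (m - n) * 2 ^ n" "(2::nat) ^ m = 2 ^ (m - n) * 2 ^ n"
      using that by (simp_all add: power_add[symmetric])
    have eq: "Y /\<^sub>R 2 ^ n /\<^sub>R 2 ^ (m - n) = Y /\<^sub>R 2 ^ m" by (simp add: pm(1))
    have c: "near_exp (Y /\<^sub>R 2 ^ m) \<in> carrier K"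
      using E_small(3)[OF scaled_small[OF Z, of "m - n"]] by (simp only: eq)
    have "near_exp (Y /\<^sub>R 2 ^ n) = near_exp (Y /\<^sub>R 2 ^ m) [^] (2 ^ (m - n) :: nat)"
      using near_exp_unscale[OF Z, of "m - n"] by (simp only: eq)
    then show ?thesis using c by (simp add: nat_pow_pow pm(2))
  qed
  have "norm Y \<le> 2 ^ (SOME n. norm Y \<le> 2 ^ n * \<delta>) * \<delta>" using Y(2) by (rule someI)
  then show ?thesis unfolding lexp_def Let_def
    using up[of n] up[of "SOME n. norm Y \<le> 2 ^ n * \<delta>"] Y(2) by (metis nle_le)
qed

lemma lexp_small: "Y \<in> V \<Longrightarrow> norm Y \<le> \<delta> \<Longrightarrow> lexp Y = near_exp Y"
  using lexp_eq[of Y 0] E_small(3) by simp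

lemma unscale_small:
  assumes "Y \<in> V" "norm Y \<le> 2 ^ n * \<delta>"
  shows "Y /\<^sub>R 2 ^ n \<in> V" "norm (Y /\<^sub>R 2 ^ n) \<le> \<delta>"
  using assms V by (auto simp: subspace_mul field_simps)

lemma lexp_carrier [simp]: assumes "Y \<in> V" shows "lexp Y \<in> carrier K"
proof -
  obtain n where n: "norm Y \<le> 2 ^ n * \<delta>" using ex_scale[OF \<delta>(1)] by metis
  show ?thesis unfolding lexp_eq[OF assms n] using E_small(3)[OF unscale_small[OF assms n]] by simp
qed

text \<open>Division by \<open>M\<close> and by a power of two places both multiples where
  \<open>near_exp_add\<close> applies. The two small factors commute, so the 2^n-th power of their
  product splits.\<close>

lemma lexp_add:
  assumes Y: "Y \<in> V"
  shows "lexp ((s + t) *\<^sub>R Y) = lexp (s *\<^sub>R Y) \<otimes> lexp (t *\<^sub>R Y)"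
proof -
  define M where "M = \<bar>s\<bar> + \<bar>t\<bar> + 1"
  have M: "M > 0" "\<bar>s / M\<bar> \<le> 1" "\<bar>t / M\<bar> \<le> 1" by (auto simp: M_def abs_divide field_simps)
  have "\<delta> / 4 > 0" using \<delta> by simp
  then obtain n where n: "M * norm Y \<le> 2 ^ n * (\<delta> / 4)" using ex_scale by metis
  let ?Z = "(M / 2 ^ n) *\<^sub>R Y"
  have Z: "?Z \<in> V" "norm ?Z \<le> \<delta> / 4" using Y V n M by (auto simp: subspace_mul field_simps)
  have b: "lexp (r *\<^sub>R Y) = near_exp ((r / M) *\<^sub>R ?Z) [^] (2 ^ n :: nat)" "near_exp ((r / M) *\<^sub>R ?Z) \<in> carrier K" if "\<bar>r\<bar> \<le> M" for r
  proof -
    have "\<bar>r\<bar> * norm Y \<le> M * norm Y" using that by (rule mult_right_mono) simp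
    also have "\<dots> \<le> 2 ^ n * (\<delta> / 4)" by (rule n)
    also have "\<dots> \<le> 2 ^ n * \<delta>" using \<delta>(1) by (intro mult_left_mono) auto
    finally have r: "r *\<^sub>R Y \<in> V" "norm (r *\<^sub>R Y) \<le> 2 ^ n * \<delta>" using Y V by (auto simp: subspace_mul)
    have "(r / M) *\<^sub>R ?Z = (r *\<^sub>R Y) /\<^sub>R 2 ^ n" using M by (simp add: divide_inverse mult_ac)
    then show "lexp (r *\<^sub>R Y) = near_exp ((r / M) *\<^sub>R ?Z) [^] (2 ^ n :: nat)" "near_exp ((r / M) *\<^sub>R ?Z) \<in> carrier K"
      using lexp_eq[OF r] E_small(3)[OF unscale_small[OF r]] by (simp_all only:)
  qed
  have sum: "\<bar>s\<bar> \<le> M" "\<bar>t\<bar> \<le> M" "\<bar>s + t\<bar> \<le> M" by (auto simp: M_def)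
  let ?a = "near_exp ((s / M) *\<^sub>R ?Z)" and ?b = "near_exp ((t / M) *\<^sub>R ?Z)"
  have ab: "?a \<otimes> ?b = near_exp (((s + t) / M) *\<^sub>R ?Z)"
    using near_exp_add[OF Z M(2,3)] by (simp add: add_divide_distrib)
  have ba: "?b \<otimes> ?a = near_exp (((s + t) / M) *\<^sub>R ?Z)"
    using near_exp_add[OF Z M(3,2)] by (simp add: add_divide_distrib add.commute)
  have "lexp ((s + t) *\<^sub>R Y) = (?a \<otimes> ?b) [^] (2 ^ n :: nat)" using b(1)[OF sum(3)] ab by simp
  also have "\<dots> = ?a [^] (2 ^ n :: nat) \<otimes> ?b [^] (2 ^ n :: nat)"
    by (rule pow_mult_distrib) (use ab ba b sum in auto)
  finally show ?thesis using b(1)[OF sum(1)] b(1)[OF sum(2)] by simp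
qed

lemma continuous_map_pow:
  assumes "continuous_map T X f" shows "continuous_map T X (\<lambda>y. f y [^] (k::nat))"
  by (induction k) (auto intro!: continuous_map_mult assms simp: topspace_topo)

lemma near_exp_continuous: "continuous_map (top_of_set (V \<inter> cball 0 \<delta>)) X near_exp"
proof -
  have "continuous_map (top_of_set (V \<inter> cball 0 \<delta>)) (top_of_set chart_dom) E"
    using koenigs.E_continuous E_small(1) by auto
  from continuous_map_compose[OF this from_chart(3)] show ?thesis by (simp add: near_exp_def[abs_def] o_def)
qed

lemma lexp_continuous: "continuous_map (top_of_set V) X lexp"
proof -
  have n: "continuous_map (top_of_set (V \<inter> cball 0 (2 ^ n * \<delta>))) X lexp" for n
  proof -
    have "continuous_map (top_of_set (V \<inter> cball 0 (2 ^ n * \<delta>))) (top_of_set (V \<inter> cball 0 \<delta>)) (\<lambda>Y. Y /\<^sub>R 2 ^ n)"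
      using V by (auto intro!: continuous_intros simp: subspace_mul field_simps)
    from continuous_map_pow[OF continuous_map_compose[OF this near_exp_continuous], of "2 ^ n"]
    have "continuous_map (top_of_set (V \<inter> cball 0 (2 ^ n * \<delta>))) X (\<lambda>Y. near_exp (Y /\<^sub>R 2 ^ n) [^] (2 ^ n :: nat))"
      by (simp add: o_def)
    then show ?thesis by (rule continuous_map_eq) (use lexp_eq in auto)
  qed
  show ?thesis unfolding continuous_map_def
  proof (intro conjI allI impI)
    show "lexp \<in> topspace (top_of_set V) \<rightarrow> topspace X" by (auto simp: topspace_topo)
    fix W assume W: "openin X W"
    \<comment> \<open>On each ball a single exponent n works for all vectors, and the open balls
      exhaust the space.\<close>
    have eq: "{Y \<in> topspace (top_of_set V). lexp Y \<in> W} =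
        (\<Union>n. {Y \<in> V \<inter> ball 0 (2 ^ n * \<delta>). lexp Y \<in> W})" (is "_ = (\<Union>n. ?S n)")
    proof (intro Set.set_eqI iffI)
      fix Y assume "Y \<in> {Y \<in> topspace (top_of_set V). lexp Y \<in> W}"
      moreover obtain n where "norm Y + 1 \<le> 2 ^ n * \<delta>" using ex_scale[OF \<delta>(1)] by metis
      ultimately have "Y \<in> ?S n" by auto
      then show "Y \<in> (\<Union>n. ?S n)" by blast
    qed auto
    have "openin (top_of_set V) (?S n)" for n
    proof -
      have "openin (top_of_set (V \<inter> cball 0 (2 ^ n * \<delta>))) {Y \<in> V \<inter> cball 0 (2 ^ n * \<delta>). lexp Y \<in> W}"
        using openin_continuous_map_preimage[OF n W] by simp
      then obtain T where T: "open T" "{Y \<in> V \<inter> cball 0 (2 ^ n * \<delta>). lexp Y \<in> W} = V \<inter> cball 0 (2 ^ n * \<delta>) \<inter> T"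
        by (auto simp: openin_open)
      have "?S n = V \<inter> (ball 0 (2 ^ n * \<delta>) \<inter> T)"
      proof (intro Set.set_eqI)
        fix Y show "Y \<in> ?S n \<longleftrightarrow> Y \<in> V \<inter> (ball 0 (2 ^ n * \<delta>) \<inter> T)"
          using arg_cong[OF T(2), of "\<lambda>A. Y \<in> A"] by auto
      qed
      then show ?thesis by (simp only:) (rule openin_open_Int[OF open_Int[OF open_ball T(1)]])
    qed
    then show "openin (top_of_set V) {Y \<in> topspace (top_of_set V). lexp Y \<in> W}"
      unfolding eq by blast
  qed
qed

end

lemma has_derivative_at_0_quadratic:
  fixes f :: "'a::real_normed_vector \<Rightarrow> 'b::real_normed_vector"
  assumes "bounded_linear L" "d > 0" "\<And>x. norm x \<le> d \<Longrightarrow> norm (f x - f 0 - L x) \<le> B * norm x ^ 2"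
  shows "(f has_derivative L) (at 0)"
  unfolding has_derivative_at_alt
proof (intro conjI allI impI)
  fix e :: real assume e: "e > 0"
  have "norm (f y - f 0 - L (y - 0)) \<le> e * norm (y - 0)" if "norm (y - 0) < min d (e / (\<bar>B\<bar> + 1))" for y
  proof -
    have "(\<bar>B\<bar> + 1) * norm y \<le> e" using that by (simp add: field_simps)
    moreover have "(\<bar>B\<bar> + 1) * norm y = \<bar>B\<bar> * norm y + norm y" by (simp add: algebra_simps)
    ultimately have "\<bar>B\<bar> * norm y \<le> e" using norm_ge_zero[of y] by linarith
    then have "\<bar>B\<bar> * norm y * norm y \<le> e * norm y" by (rule mult_right_mono) simp
    moreover have "B * norm y ^ 2 \<le> \<bar>B\<bar> * norm y ^ 2" by (rule mult_right_mono) auto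
    ultimately show ?thesis using assms(3)[of y] that by (simp add: power2_eq_square mult.assoc)
  qed
  then show "\<exists>d>0. \<forall>y. norm (y - 0) < d \<longrightarrow> norm (f y - f 0 - L (y - 0)) \<le> e * norm (y - 0)"
    using assms(2) e by (intro exI[of _ "min d (e / (\<bar>B\<bar> + 1))"]) (simp add: add_nonneg_pos)
qed (rule assms(1))

section \<open>The exponential as the unique one-parameter subgroup\<close>

context lie_group
begin

lemma lexp_0 [simp]: "lexp 0 = \<one>"
proof -
  have c: "lexp 0 \<in> carrier K" by simp
  have "lexp 0 \<otimes> lexp 0 = lexp 0" using lexp_add[of 0 0 0] by simp
  then show ?thesis using c by (metis l_cancel_one)
qed

lemma to_chart_lexp:
  assumes "Y \<in> V" "norm Y \<le> \<delta>"
  shows "lexp Y \<in> chart_nbhd" "norm (to_chart (lexp Y) - Y) \<le> 8 * C0 * norm Y ^ 2"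
  using E_small[OF assms] koenigs.E_approx[OF assms] lexp_small[OF assms] by simp_all

lemma to_coord_deriv_iff:
  "((\<lambda>s. to_coord K (\<gamma> s)) has_vector_derivative Y) F \<longleftrightarrow> ((\<lambda>s. to_chart (\<gamma> s)) has_vector_derivative Y) F"
proof
  assume "((\<lambda>s. to_coord K (\<gamma> s)) has_vector_derivative Y) F"
  from has_vector_derivative_diff[OF this has_vector_derivative_const[of "to_coord K \<one>"]]
  show "((\<lambda>s. to_chart (\<gamma> s)) has_vector_derivative Y) F" by (simp add: to_chart_def)
next
  assume "((\<lambda>s. to_chart (\<gamma> s)) has_vector_derivative Y) F"
  from has_vector_derivative_add[OF this has_vector_derivative_const[of "to_coord K \<one>"]]
  show "((\<lambda>s. to_coord K (\<gamma> s)) has_vector_derivative Y) F" by (simp add: to_chart_def)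
qed

lemma to_chart_lexp_deriv: "((\<lambda>x. to_chart (lexp (proj x))) has_derivative proj) (at 0)"
proof -
  obtain B where B: "B > 0" "\<And>x. norm (proj x) \<le> norm x * B"
    using bounded_linear.pos_bounded[OF proj_bl] by blast
  show ?thesis
  proof (rule has_derivative_at_0_quadratic[OF proj_bl])
    show "\<delta> / B > 0" using B \<delta> by simp
    fix x :: 'e assume "norm x \<le> \<delta> / B"
    then have "norm x * B \<le> \<delta>" using B by (simp add: field_simps)
    then have n: "norm (proj x) \<le> \<delta>" using B(2)[of x] by linarith
    have "norm (to_chart (lexp (proj x)) - proj x) \<le> 8 * C0 * norm (proj x) ^ 2"
      by (rule to_chart_lexp(2)[OF proj_V n])
    also have "\<dots> \<le> 8 * C0 * (norm x * B) ^ 2"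
      using C0 B by (intro mult_left_mono power_mono) auto
    finally show "norm (to_chart (lexp (proj x)) - to_chart (lexp (proj 0)) - proj x) \<le> (8 * C0 * B ^ 2) * norm x ^ 2"
      by (simp add: from_chart(9) power_mult_distrib mult_ac)
  qed
qed

lemma to_chart_lexp_curve:
  assumes "Y \<in> V"
  shows "((\<lambda>s. to_chart (lexp (s *\<^sub>R Y))) has_vector_derivative Y) (at 0)"
proof -
  have "((\<lambda>s. to_chart (lexp (proj (s *\<^sub>R Y)))) has_derivative (\<lambda>s. proj (s *\<^sub>R Y))) (at 0)"
    by (rule has_derivative_compose[of "\<lambda>s. s *\<^sub>R Y"])
      (use to_chart_lexp_deriv in \<open>auto intro!: derivative_eq_intros\<close>)
  moreover have "proj (s *\<^sub>R Y) = s *\<^sub>R Y" for s using assms V by (simp add: subspace_mul)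
  ultimately show ?thesis by (simp add: has_vector_derivative_def)
qed

lemma lexp_curve_continuous:
  assumes "Y \<in> V" shows "continuous_map euclideanreal X (\<lambda>s. lexp (s *\<^sub>R Y))"
proof -
  have "continuous_map euclideanreal (top_of_set V) (\<lambda>s. s *\<^sub>R Y)"
    by (rule continuous_map_into_subtopology)
      (use assms V in \<open>auto intro!: continuous_intros simp: subspace_mul\<close>)
  from continuous_map_compose[OF this lexp_continuous] show ?thesis by (simp add: o_def)
qed

lemma lexp_one_parameter_subgroup:
  assumes "Y \<in> V" shows "one_parameter_subgroup K Y (\<lambda>s. lexp (s *\<^sub>R Y))"
  unfolding one_parameter_subgroup_def
  using assms lexp_curve_continuous to_chart_lexp_curve lexp_add by (auto simp: to_coord_deriv_iff)

lemma one_parameter_subgroupD: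
  assumes "one_parameter_subgroup K Y \<gamma>"
  shows "\<gamma> s \<in> carrier K" "\<gamma> 0 = \<one>" "\<gamma> (s + t) = \<gamma> s \<otimes> \<gamma> t"
    "((\<lambda>s. to_chart (\<gamma> s)) has_vector_derivative Y) (at 0)" "\<gamma> (real k * s) = \<gamma> s [^] k"
    "continuous_map euclideanreal X \<gamma>"
proof -
  show c: "\<gamma> s \<in> carrier K" for s
    using assms continuous_map_image_subset_topspace[of euclideanreal X \<gamma>]
    by (auto simp: one_parameter_subgroup_def topspace_topo)
  show m: "\<gamma> (s + t) = \<gamma> s \<otimes> \<gamma> t" for s t using assms by (auto simp: one_parameter_subgroup_def)
  show one: "\<gamma> 0 = \<one>" using m[of 0 0] c[of 0] by (metis add_0 l_cancel_one)
  show "((\<lambda>s. to_chart (\<gamma> s)) has_vector_derivative Y) (at 0)" "continuous_map euclideanreal X \<gamma>"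
    using assms by (auto simp: one_parameter_subgroup_def to_coord_deriv_iff)
  show "\<gamma> (real k * s) = \<gamma> s [^] k"
  proof (induction k)
    case (Suc k)
    have "\<gamma> (real (Suc k) * s) = \<gamma> (real k * s + s)" by (simp add: algebra_simps)
    then show ?case using Suc m by simp
  qed (simp add: one)
qed

text \<open>Along s / 2^n the values of \<gamma> form a backward orbit, and differentiability at 0
  gives agreement with \<open>E\<close> up to o(2^-n), which is exactly what
  \<open>orbit_unique\<close> asks for. Small parameters then determine all others by repeated
  squaring.\<close>

lemma one_parameter_subgroup_unique:
  assumes Y: "Y \<in> V" and \<gamma>: "one_parameter_subgroup K Y \<gamma>"
  shows "\<gamma> s = lexp (s *\<^sub>R Y)"
proof -
  note g = one_parameter_subgroupD[OF \<gamma>]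
  have "openin euclideanreal {s \<in> topspace euclideanreal. \<gamma> s \<in> chart_nbhd}"
    by (rule openin_continuous_map_preimage[OF g(6) chart_nbhd(1)])
  then have "open {s. \<gamma> s \<in> chart_nbhd}" by simp
  then obtain d1 where d1: "d1 > 0" "\<And>s. \<bar>s\<bar> < d1 \<Longrightarrow> \<gamma> s \<in> chart_nbhd"
    using g(2) chart_nbhd(2) unfolding open_dist by (metis (mono_tags, lifting) mem_Collect_eq dist_real_def diff_0_right)
  have der: "((\<lambda>s. to_chart (\<gamma> s)) has_derivative (\<lambda>s. s *\<^sub>R Y)) (at 0)"
    using g(4) by (simp add: has_vector_derivative_def)
  have alt: "\<And>e. e > 0 \<Longrightarrow> \<exists>d>0. \<forall>y. norm (y - 0) < d \<longrightarrow> norm (to_chart (\<gamma> y) - to_chart (\<gamma> 0) - (y - 0) *\<^sub>R Y) \<le> e * norm (y - 0)"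
    using der unfolding has_derivative_at_alt by blast
  have alt': "\<exists>d>0. \<forall>y. \<bar>y\<bar> < d \<longrightarrow> norm (to_chart (\<gamma> y) - y *\<^sub>R Y) \<le> e * \<bar>y\<bar>" if "e > 0" for e
    using alt[OF that] by (simp add: g(2) from_chart(9))
  obtain d2 where d2: "d2 > 0" "\<And>y. \<bar>y\<bar> < d2 \<Longrightarrow> norm (to_chart (\<gamma> y) - y *\<^sub>R Y) \<le> 1 * \<bar>y\<bar>"
    using alt'[of 1] by auto
  \<comment> \<open>In \<open>norm Y + 1\<close> the first term bounds the vector s Y and the 1
    comes from the error that \<open>d2\<close> permits.\<close>
  define d where "d = min (min d1 d2) (\<delta> / (norm Y + 1))"
  have d: "d > 0" using d1 d2 \<delta> by (simp add: d_def add_nonneg_pos)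
  have small: "\<gamma> s = lexp (s *\<^sub>R Y)" if s: "\<bar>s\<bar> < d" for s
  proof -
    have "\<bar>s\<bar> < \<delta> / (norm Y + 1)" using s by (simp add: d_def)
    then have "\<bar>s\<bar> * (norm Y + 1) < \<delta>" using pos_less_divide_eq[of "norm Y + 1"] by (simp add: add_nonneg_pos)
    then have s\<delta>: "(norm Y + 1) * \<bar>s\<bar> \<le> \<delta>" by (simp only: mult.commute less_imp_le)
    have sY: "s *\<^sub>R Y \<in> V" "norm (s *\<^sub>R Y) \<le> \<delta>" using Y V s\<delta> by (auto simp: subspace_mul algebra_simps)
    note sc = scaled_small[OF sY]
    have sn: "\<bar>s / 2 ^ n\<bar> < d" for n
    proof -
      have "\<bar>s\<bar> / 2 ^ n \<le> \<bar>s\<bar> / 1" by (intro divide_left_mono) auto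
      then show ?thesis using s by (simp add: abs_divide)
    qed
    define g' where "g' n = to_chart (\<gamma> (s / 2 ^ n))" for n
    define h where "h n = E ((s *\<^sub>R Y) /\<^sub>R 2 ^ n)" for n
    have gU: "\<gamma> (s / 2 ^ n) \<in> chart_nbhd" for n using d1(2) sn[of n] by (simp add: d_def)
    have "g' 0 = h 0"
    proof (rule koenigs.orbit_unique)
      show "g' n \<in> V" for n unfolding g'_def by (rule to_chart_V[OF gU])
      show "h n \<in> V" for n unfolding h_def by (rule koenigs.E_V(1)[OF sc])
      show "coord_mult (h (Suc n), h (Suc n)) = h n" for n
        using koenigs.f_E_half[OF sc[of n]] by (simp add: h_def)
      show "coord_mult (g' (Suc n), g' (Suc n)) = g' n" for n
      proof -
        have "coord_mult (g' (Suc n), g' (Suc n)) = to_chart (\<gamma> (s / 2 ^ Suc n) \<otimes> \<gamma> (s / 2 ^ Suc n))"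
          by (simp only: coord_mult_def g'_def fst_conv snd_conv from_chart(7)[OF gU])
        also have "\<dots> = g' n" unfolding g(3)[symmetric] g'_def by (simp add: field_simps)
        finally show ?thesis .
      qed
      show "2 ^ n * norm (g' n) \<le> 4 * \<delta>" for n
      proof -
        have "norm (g' n) \<le> norm (g' n - (s / 2 ^ n) *\<^sub>R Y) + norm ((s / 2 ^ n) *\<^sub>R Y)"
          using norm_triangle_ineq[of "g' n - (s / 2 ^ n) *\<^sub>R Y" "(s / 2 ^ n) *\<^sub>R Y"] by simp
        also have "\<dots> \<le> \<bar>s / 2 ^ n\<bar> + \<bar>s / 2 ^ n\<bar> * norm Y"
          using d2(2)[of "s / 2 ^ n"] sn[of n] by (simp add: g'_def d_def)
        also have "\<dots> = (norm Y + 1) * \<bar>s\<bar> / 2 ^ n" by (simp add: abs_divide algebra_simps add_divide_distrib)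
        finally have "2 ^ n * norm (g' n) \<le> (norm Y + 1) * \<bar>s\<bar>" by (simp add: field_simps)
        then show ?thesis using s\<delta> \<delta>(1) by linarith
      qed
      show "2 ^ n * norm (h n) \<le> 4 * \<delta>" for n
      proof -
        have "2 ^ n * norm (h n) \<le> 2 ^ n * (2 * norm ((s *\<^sub>R Y) /\<^sub>R 2 ^ n))"
          unfolding h_def by (intro mult_left_mono koenigs.E_V(2)[OF sc]) auto
        also have "\<dots> = 2 * norm (s *\<^sub>R Y)" by (simp add: abs_mult)
        finally show ?thesis using sY(2) \<delta>(1) by linarith
      qed
      show "(\<lambda>n. 2 ^ n * norm (g' n - h n)) \<longlonglongrightarrow> 0"
      proof (cases "s = 0")
        case True
        have "g' n = 0" "h n = 0" for n
          using koenigs.E_V(2)[of 0] \<delta>(1) by (simp_all add: g'_def h_def True g(2) from_chart(9))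
        then show ?thesis by simp
      next
        case False
        have lim1: "(\<lambda>n. 2 ^ n * norm (g' n - (s / 2 ^ n) *\<^sub>R Y)) \<longlonglongrightarrow> 0"
        proof (rule LIMSEQ_I)
          fix e :: real assume e: "e > 0"
          then have e2: "e / (2 * \<bar>s\<bar>) > 0" using False by simp
          obtain d3 where d3: "d3 > 0" "\<And>y. \<bar>y\<bar> < d3 \<Longrightarrow> norm (to_chart (\<gamma> y) - y *\<^sub>R Y) \<le> e / (2 * \<bar>s\<bar>) * \<bar>y\<bar>"
            using alt'[OF e2] by blast
          obtain N where N: "\<bar>s\<bar> / d3 < 2 ^ N" using real_arch_pow[of 2 "\<bar>s\<bar> / d3"] by auto
          have "norm (2 ^ n * norm (g' n - (s / 2 ^ n) *\<^sub>R Y) - 0) < e" if "n \<ge> N" for n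
          proof -
            have "(2::real) ^ N \<le> 2 ^ n" using that by (intro power_increasing) auto
            then have "\<bar>s\<bar> / d3 < 2 ^ n" using N by linarith
            then have "\<bar>s / 2 ^ n\<bar> < d3" using d3(1) by (simp add: abs_divide field_simps)
            from d3(2)[OF this] have "norm (g' n - (s / 2 ^ n) *\<^sub>R Y) \<le> e / (2 * \<bar>s\<bar>) * \<bar>s / 2 ^ n\<bar>"
              by (simp add: g'_def)
            also have "\<dots> = e / 2 / 2 ^ n" using False by (simp add: abs_divide field_simps)
            finally have "2 ^ n * norm (g' n - (s / 2 ^ n) *\<^sub>R Y) \<le> e / 2" by (simp add: field_simps)
            then show ?thesis using e by simp
          qed
          then show "\<exists>no. \<forall>n\<ge>no. norm (2 ^ n * norm (g' n - (s / 2 ^ n) *\<^sub>R Y) - 0) < e" by blast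
        qed
        have lim2: "(\<lambda>n. 8 * C0 * norm (s *\<^sub>R Y) ^ 2 * (1/2) ^ n) \<longlonglongrightarrow> 0"
          by (intro tendsto_mult_right_zero LIMSEQ_realpow_zero) auto
        have le: "2 ^ n * norm (g' n - h n) \<le> 2 ^ n * norm (g' n - (s / 2 ^ n) *\<^sub>R Y) + 8 * C0 * norm (s *\<^sub>R Y) ^ 2 * (1/2) ^ n" for n
        proof -
          have eq: "(s / 2 ^ n) *\<^sub>R Y = (s *\<^sub>R Y) /\<^sub>R 2 ^ n" by (simp add: divide_inverse mult.commute)
          have "norm (h n - (s / 2 ^ n) *\<^sub>R Y) \<le> 8 * C0 * (norm (s *\<^sub>R Y) / 2 ^ n) ^ 2"
            unfolding eq h_def using koenigs.E_approx[OF sc[of n]] by (simp add: divide_inverse abs_mult mult_ac)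
          then have "2 ^ n * norm (h n - (s / 2 ^ n) *\<^sub>R Y) \<le> 2 ^ n * (8 * C0 * (norm (s *\<^sub>R Y) / 2 ^ n) ^ 2)"
            by (rule mult_left_mono) simp
          also have "\<dots> = 8 * C0 * norm (s *\<^sub>R Y) ^ 2 * (1/2) ^ n" by (simp add: power_divide power2_eq_square field_simps)
          finally have *: "2 ^ n * norm (h n - (s / 2 ^ n) *\<^sub>R Y) \<le> 8 * C0 * norm (s *\<^sub>R Y) ^ 2 * (1/2) ^ n" .
          have "norm (g' n - h n) \<le> norm (g' n - (s / 2 ^ n) *\<^sub>R Y) + norm (h n - (s / 2 ^ n) *\<^sub>R Y)"
            using norm_triangle_ineq4[of "g' n - (s / 2 ^ n) *\<^sub>R Y" "h n - (s / 2 ^ n) *\<^sub>R Y"] by simp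
          then have "2 ^ n * norm (g' n - h n) \<le> 2 ^ n * (norm (g' n - (s / 2 ^ n) *\<^sub>R Y) + norm (h n - (s / 2 ^ n) *\<^sub>R Y))"
            by (rule mult_left_mono) simp
          then show ?thesis using * by (simp add: distrib_left)
        qed
        show ?thesis
          by (rule Lim_null_comparison[OF _ tendsto_add_zero[OF lim1 lim2]]) (use le in simp)
      qed
    qed
    then have "from_chart (g' 0) = from_chart (h 0)" by simp
    then have "\<gamma> s = near_exp (s *\<^sub>R Y)" using from_chart(7)[OF gU[of 0]] by (simp add: g'_def h_def near_exp_def)
    then show ?thesis using lexp_small[OF sY] by simp
  qed
  obtain n where n: "\<bar>s\<bar> + 1 \<le> 2 ^ n * d" using ex_scale[OF d] by metis
  then have sd: "\<bar>s / 2 ^ n\<bar> < d" by (simp add: abs_divide field_simps)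
  have "\<gamma> s = \<gamma> (s / 2 ^ n) [^] (2 ^ n :: nat)" using g(5)[of "2 ^ n" "s / 2 ^ n"] by simp
  also have "\<dots> = lexp ((s / 2 ^ n) *\<^sub>R Y) [^] (2 ^ n :: nat)" by (simp only: small[OF sd])
  also have "\<dots> = lexp (s *\<^sub>R Y)"
    using one_parameter_subgroupD(5)[OF lexp_one_parameter_subgroup[OF Y], of "2 ^ n" "s / 2 ^ n"] by simp
  finally show ?thesis .
qed

lemma lie_exp: assumes "Y \<in> V" shows "lie_exp K Y = lexp Y"
proof -
  have "(THE \<gamma>. one_parameter_subgroup K Y \<gamma>) = (\<lambda>s. lexp (s *\<^sub>R Y))"
  proof (rule the_equality)
    show "one_parameter_subgroup K Y (\<lambda>s. lexp (s *\<^sub>R Y))" by (rule lexp_one_parameter_subgroup[OF assms])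
    show "\<gamma> = (\<lambda>s. lexp (s *\<^sub>R Y))" if "one_parameter_subgroup K Y \<gamma>" for \<gamma>
      using one_parameter_subgroup_unique[OF assms that] by (rule ext)
  qed
  then show ?thesis by (simp add: lie_exp_def)
qed

end

section \<open>The adjoint representation and the bracket\<close>

context lie_group
begin

lemma continuous_map_conj:
  assumes "g \<in> carrier K" shows "continuous_map X X (\<lambda>k. g \<otimes> k \<otimes> inv g)"
  using assms by (intro continuous_map_mult) (auto simp: topspace_topo)

lemma eventually_conj:
  assumes "g \<in> carrier K" "openin X W" "\<one> \<in> W"
  shows "\<forall>\<^sub>F x in nhds 0. x \<in> chart_dom \<and> g \<otimes> from_chart x \<otimes> inv g \<in> W"
proof -
  have "openin X {k \<in> topspace X. g \<otimes> k \<otimes> inv g \<in> W}"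
    by (rule openin_continuous_map_preimage[OF continuous_map_conj assms(2)]) (rule assms(1))
  from eventually_from_chart[OF this] show ?thesis
    using assms(1,3) by (auto simp: topspace_topo elim: eventually_mono)
qed

text \<open>Conjugation is split into left translation \<open>L\<close> from the chart at the
  identity into a chart at \<open>g\<close>, and right translation \<open>R\<close> back by the
  inverse of \<open>g\<close>. Each is a product in charts with one argument frozen.\<close>

lemma conj_differentiable:
  assumes g: "g \<in> carrier K"
  shows "(\<lambda>x. to_chart (g \<otimes> from_chart x \<otimes> inv g)) differentiable (at 0)"
proof -
  obtain c where c: "c \<in> charts K" "g \<in> fst c" using g charts_Union by blast
  have ig: "inv g \<in> carrier K" using g by simp
  obtain c' where c': "c' \<in> charts K" "inv g \<in> fst c'" using ig charts_Union by blast
  have l0: "local_inv c g 0 = g" using local_inv(7)[OF c c(2)] by simp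
  have l0': "local_inv c' (inv g) 0 = inv g" using local_inv(7)[OF c' c'(2)] by simp
  have gm: "g \<otimes> \<one> \<in> fst c" "g \<otimes> inv g \<in> fst c1" using g c c1 by auto
  obtain O1 D1 where O1: "open O1" "(0, 0) \<in> O1"
    "\<And>p. p \<in> O1 \<Longrightarrow> fst p \<in> local_dom c g \<and> snd p \<in> local_dom c1 \<one> \<and>
        local_inv c g (fst p) \<otimes> local_inv c1 \<one> (snd p) \<in> fst c"
    "\<And>p. p \<in> O1 \<Longrightarrow>
       ((\<lambda>p. snd c (local_inv c g (fst p) \<otimes> local_inv c1 \<one> (snd p))) has_derivative D1 p) (at p)"
    by (rule mult_chart[OF c c1 c(1) gm(1)]) (rule that)
  obtain O2 D2 where O2: "open O2" "(0, 0) \<in> O2"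
    "\<And>p. p \<in> O2 \<Longrightarrow>
       ((\<lambda>p. snd c1 (local_inv c g (fst p) \<otimes> local_inv c' (inv g) (snd p))) has_derivative D2 p) (at p)"
    by (rule mult_chart[OF c c' c1(1) gm(2)]) (rule that)
  define L where "L x = snd c (g \<otimes> from_chart x) - snd c g" for x
  define R where "R z = snd c1 (local_inv c g z \<otimes> inv g)" for z
  have "((\<lambda>x. snd c (local_inv c g (fst (0::'e, x)) \<otimes> local_inv c1 \<one> (snd (0::'e, x)))) has_derivative (\<lambda>x. D1 (0,0) (0, x))) (at 0)"
    by (rule has_derivative_compose[of "\<lambda>x. (0, x)" "\<lambda>u. (0, u)" 0 UNIV _ "D1 (0, 0)"])
      (use O1(4)[OF O1(2)] in \<open>auto intro!: derivative_eq_intros\<close>)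
  from has_derivative_diff[OF this has_derivative_const[of "snd c g"]]
  have L: "L differentiable (at 0)"
    unfolding L_def differentiable_def by (auto simp: l0 from_chart_def)
  have "((\<lambda>z. snd c1 (local_inv c g (fst (z, 0::'e)) \<otimes> local_inv c' (inv g) (snd (z, 0::'e)))) has_derivative (\<lambda>x. D2 (0,0) (x, 0))) (at 0)"
    by (rule has_derivative_compose[of "\<lambda>z. (z, 0)" "\<lambda>u. (u, 0)" 0 UNIV _ "D2 (0, 0)"])
      (use O2(3)[OF O2(2)] in \<open>auto intro!: derivative_eq_intros\<close>)
  then have R: "R differentiable (at 0)"
    unfolding R_def by (auto simp: differentiable_def l0')
  have "L 0 = 0" using g by (simp add: L_def from_chart(8))
  then have "(\<lambda>x. R (L x)) differentiable (at 0)"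
    using differentiable_compose[of R L 0 UNIV] L R by simp
  then obtain D where D: "((\<lambda>x. R (L x)) has_derivative D) (at 0)" by (auto simp: differentiable_def)
  define N where "N = (\<lambda>x. (0, x)) -` O1"
  have N: "open N" "0 \<in> N" using O1 unfolding N_def
    by (auto intro!: open_vimage continuous_intros)
  have "((\<lambda>x. snd c1 (g \<otimes> from_chart x \<otimes> inv g)) has_derivative D) (at 0)"
  proof (rule has_derivative_transform_within_open[OF D N])
    fix x assume "x \<in> N"
    then have "g \<otimes> from_chart x \<in> fst c" using O1(3)[of "(0, x)"] by (simp add: N_def l0 from_chart_def)
    from local_inv(7)[OF c this] show "R (L x) = snd c1 (g \<otimes> from_chart x \<otimes> inv g)"
      by (simp add: R_def L_def)
  qed
  from has_derivative_diff[OF this has_derivative_const] show ?thesis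
    by (auto simp: to_chart_def to_coord differentiable_def)
qed

lemma Ad_deriv_ex:
  assumes "g \<in> carrier K"
  obtains D where "((\<lambda>x. to_chart (g \<otimes> from_chart x \<otimes> inv g)) has_derivative D) (at 0)" "\<And>Y. Y \<in> V \<Longrightarrow> Ad K g Y = D Y"
proof -
  obtain D where D: "((\<lambda>x. to_chart (g \<otimes> from_chart x \<otimes> inv g)) has_derivative D) (at 0)"
    using conj_differentiable[OF assms] by (auto simp: differentiable_def)
  have lin: "linear D" using D has_derivative_linear by blast
  have "Ad K g Y = D Y" if Y: "Y \<in> V" for Y
  proof -
    have "((\<lambda>s. to_chart (g \<otimes> from_chart (s *\<^sub>R Y) \<otimes> inv g)) has_derivative (\<lambda>s. D (s *\<^sub>R Y))) (at 0)"
      by (rule has_derivative_compose[of "\<lambda>s. s *\<^sub>R Y"]) (use D in \<open>auto intro!: derivative_eq_intros\<close>)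
    then have "((\<lambda>s. to_chart (g \<otimes> from_chart (s *\<^sub>R Y) \<otimes> inv g)) has_vector_derivative D Y) (at 0)"
      by (simp add: has_vector_derivative_def linear_cmul[OF lin])
    then have "((\<lambda>s. to_coord K (g \<otimes> coord_curve K Y s \<otimes> inv g)) has_vector_derivative D Y) (at 0)"
      by (simp add: coord_curve[OF Y] to_coord_deriv_iff)
    then show ?thesis unfolding Ad_def by (rule vector_derivative_at)
  qed
  then show thesis using that D by blast
qed

lemma Ad_add: "g \<in> carrier K \<Longrightarrow> Y \<in> V \<Longrightarrow> Z \<in> V \<Longrightarrow> Ad K g (Y + Z) = Ad K g Y + Ad K g Z"
  and Ad_scaleR: "g \<in> carrier K \<Longrightarrow> Y \<in> V \<Longrightarrow> Ad K g (c *\<^sub>R Y) = c *\<^sub>R Ad K g Y"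
  using V by (auto elim!: Ad_deriv_ex simp: subspace_add subspace_mul dest!: has_derivative_linear
      intro: linear_add linear_cmul)

text \<open>Derivatives at the identity depend on a curve only through its velocity. Identities for
  \<open>Ad\<close> and for the bracket are therefore obtained by computing the velocity of one
  curve in two ways.\<close>

definition "curve_at_one \<gamma> Y \<longleftrightarrow> Y \<in> V \<and> \<gamma> 0 = \<one> \<and> (\<forall>\<^sub>F s in nhds 0. \<gamma> s \<in> chart_nbhd) \<and>
  ((\<lambda>s::real. to_chart (\<gamma> s)) has_vector_derivative Y) (at 0)"

lemma Ad_curve:
  assumes "g \<in> carrier K" "curve_at_one \<gamma> Y"
  shows "((\<lambda>s. to_chart (g \<otimes> \<gamma> s \<otimes> inv g)) has_vector_derivative Ad K g Y) (at 0)"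
proof -
  obtain D where D: "((\<lambda>x. to_chart (g \<otimes> from_chart x \<otimes> inv g)) has_derivative D) (at 0)" "\<And>Y. Y \<in> V \<Longrightarrow> Ad K g Y = D Y"
    by (rule Ad_deriv_ex[OF assms(1)]) (rule that)
  have lin: "linear D" using D has_derivative_linear by blast
  have c: "Y \<in> V" "\<gamma> 0 = \<one>" "\<forall>\<^sub>F s in nhds 0. \<gamma> s \<in> chart_nbhd" "((\<lambda>s. to_chart (\<gamma> s)) has_derivative (\<lambda>s. s *\<^sub>R Y)) (at 0)"
    using assms(2) by (auto simp: curve_at_one_def has_vector_derivative_def)
  have "((\<lambda>s. to_chart (g \<otimes> from_chart (to_chart (\<gamma> s)) \<otimes> inv g)) has_derivative (\<lambda>s. D (s *\<^sub>R Y))) (at 0)"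
    by (rule has_derivative_compose[OF c(4)]) (simp add: c(2) from_chart(9) D(1))
  then have "((\<lambda>s. to_chart (g \<otimes> \<gamma> s \<otimes> inv g)) has_derivative (\<lambda>s. D (s *\<^sub>R Y))) (at 0)"
  proof (rule has_derivative_transform_eventually)
    show "\<forall>\<^sub>F s in at 0. to_chart (g \<otimes> from_chart (to_chart (\<gamma> s)) \<otimes> inv g) = to_chart (g \<otimes> \<gamma> s \<otimes> inv g)"
    proof -
      have "\<forall>\<^sub>F s in nhds 0. to_chart (g \<otimes> from_chart (to_chart (\<gamma> s)) \<otimes> inv g) = to_chart (g \<otimes> \<gamma> s \<otimes> inv g)"
        using c(3) by eventually_elim (simp add: from_chart(7))
      then show ?thesis by (simp add: eventually_at_filter eventually_mono)
    qed
  qed (simp_all add: c(2) from_chart(8,9))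
  then show ?thesis using D(2)[OF c(1)] by (simp add: has_vector_derivative_def linear_cmul[OF lin])
qed

lemma curve_at_one_from_chart: "Y \<in> V \<Longrightarrow> curve_at_one (\<lambda>s. from_chart (s *\<^sub>R Y)) Y"
proof -
  assume Y: "Y \<in> V"
  have ev0: "\<forall>\<^sub>F s in nhds 0. s *\<^sub>R Y \<in> chart_dom"
  proof -
    have "open ((\<lambda>s. s *\<^sub>R Y) -` chart_dom)" by (intro open_vimage from_chart(1) continuous_intros)
    then show ?thesis using from_chart(2) by (auto simp: eventually_nhds intro!: exI[of _ "(\<lambda>s. s *\<^sub>R Y) -` chart_dom"])
  qed
  have id: "((\<lambda>s::real. s *\<^sub>R Y) has_derivative (\<lambda>s. s *\<^sub>R Y)) (at 0)" by (auto intro!: derivative_eq_intros)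
  have "((\<lambda>s. to_chart (from_chart (s *\<^sub>R Y))) has_derivative (\<lambda>s. s *\<^sub>R Y)) (at 0)"
  proof (rule has_derivative_transform_eventually[OF id])
    have "\<forall>\<^sub>F s in nhds 0. s *\<^sub>R Y = to_chart (from_chart (s *\<^sub>R Y))"
      using ev0 Y V by (auto simp: from_chart(5) subspace_mul elim: eventually_mono)
    then show "\<forall>\<^sub>F s in at 0. s *\<^sub>R Y = to_chart (from_chart (s *\<^sub>R Y))"
      by (simp add: eventually_at_filter eventually_mono)
  qed (simp_all add: from_chart(8,9))
  then show ?thesis using Y ev0 by (auto simp: curve_at_one_def from_chart(4,8) has_vector_derivative_def elim: eventually_mono)
qed

lemma has_vector_derivative_in_V:
  assumes d: "(f has_vector_derivative Y) (at 0)" and "\<forall>\<^sub>F s in nhds (0::real). f s \<in> V"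
  shows "Y \<in> V"
proof -
  have f0: "f 0 \<in> V" using assms(2) eventually_nhds_x_imp_x by blast
  have "((\<lambda>s. proj (f s)) has_vector_derivative proj Y) (at 0)"
    by (rule bounded_linear.has_vector_derivative[OF proj_bl d])
  then have "((\<lambda>s. proj (f s)) has_derivative (\<lambda>s. s *\<^sub>R proj Y)) (at 0)" by (simp add: has_vector_derivative_def)
  then have "(f has_derivative (\<lambda>s. s *\<^sub>R proj Y)) (at 0)"
  proof (rule has_derivative_transform_eventually)
    show "\<forall>\<^sub>F s in at 0. proj (f s) = f s"
      using assms(2) by (auto simp: eventually_at_filter elim: eventually_mono)
  qed (simp_all add: f0)
  then have "(f has_vector_derivative proj Y) (at 0)" by (simp add: has_vector_derivative_def)
  from vector_derivative_unique_at[OF d this] show ?thesis by (metis proj_V)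
qed

lemma curve_at_one_conj:
  assumes g: "g \<in> carrier K" and c: "curve_at_one \<gamma> Y"
  shows "curve_at_one (\<lambda>s. g \<otimes> \<gamma> s \<otimes> inv g) (Ad K g Y)"
proof -
  have U: "\<forall>\<^sub>F s in nhds 0. g \<otimes> \<gamma> s \<otimes> inv g \<in> chart_nbhd"
  proof -
    have isc: "isCont (\<lambda>s. to_chart (\<gamma> s)) 0"
      using c has_vector_derivative_continuous by (auto simp: curve_at_one_def)
    have g0: "to_chart (\<gamma> 0) = 0" using c from_chart(9) by (simp add: curve_at_one_def)
    have "\<forall>\<^sub>F x in nhds 0. g \<otimes> from_chart x \<otimes> inv g \<in> chart_nbhd"
      using eventually_conj[OF g chart_nbhd(1,2)] by (auto elim: eventually_mono)
    then have "\<forall>\<^sub>F s in nhds 0. g \<otimes> from_chart (to_chart (\<gamma> s)) \<otimes> inv g \<in> chart_nbhd"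
    proof -
      have "((\<lambda>s. to_chart (\<gamma> s)) \<longlongrightarrow> to_chart (\<gamma> 0)) (nhds 0)"
        using tendsto_at_iff_tendsto_nhds[of "\<lambda>s. to_chart (\<gamma> s)" 0] isc unfolding isCont_def by blast
      then show ?thesis using \<open>\<forall>\<^sub>F x in nhds 0. g \<otimes> from_chart x \<otimes> inv g \<in> chart_nbhd\<close> unfolding g0 filterlim_iff by blast
    qed
    moreover have "\<forall>\<^sub>F s in nhds 0. \<gamma> s \<in> chart_nbhd" using c by (simp add: curve_at_one_def)
    ultimately show ?thesis by eventually_elim (simp add: from_chart(7))
  qed
  have d: "((\<lambda>s. to_chart (g \<otimes> \<gamma> s \<otimes> inv g)) has_vector_derivative Ad K g Y) (at 0)" by (rule Ad_curve[OF g c])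
  moreover have "Ad K g Y \<in> V"
    by (rule has_vector_derivative_in_V[OF d]) (use U to_chart_V in \<open>auto elim: eventually_mono\<close>)
  moreover have "g \<otimes> \<gamma> 0 \<otimes> inv g = \<one>" using c g by (simp add: curve_at_one_def)
  ultimately show ?thesis using U by (simp add: curve_at_one_def)
qed

lemma Ad_V: "g \<in> carrier K \<Longrightarrow> Y \<in> V \<Longrightarrow> Ad K g Y \<in> V"
  using curve_at_one_conj[OF _ curve_at_one_from_chart] by (auto simp: curve_at_one_def)

lemma curve_at_one_unique:
  assumes "curve_at_one \<gamma> Y" "curve_at_one \<gamma> Z" shows "Y = Z"
  using assms vector_derivative_unique_at by (auto simp: curve_at_one_def)

lemma curve_at_one_carrier: "curve_at_one \<gamma> Y \<Longrightarrow> \<forall>\<^sub>F s in nhds 0. \<gamma> s \<in> carrier K"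
  using chart_nbhd(3) by (auto simp: curve_at_one_def elim: eventually_mono)

lemma curve_at_one_cong:
  assumes "curve_at_one \<gamma> Y" "\<forall>\<^sub>F s in nhds 0. \<gamma> s = \<gamma>' s" shows "curve_at_one \<gamma>' Y"
proof -
  have e0: "\<gamma> 0 = \<gamma>' 0" using assms(2) by (rule eventually_nhds_x_imp_x)
  have "((\<lambda>s. to_chart (\<gamma> s)) has_derivative (\<lambda>s. s *\<^sub>R Y)) (at 0)"
    using assms(1) by (simp add: curve_at_one_def has_vector_derivative_def)
  then have "((\<lambda>s. to_chart (\<gamma>' s)) has_derivative (\<lambda>s. s *\<^sub>R Y)) (at 0)"
  proof (rule has_derivative_transform_eventually)
    show "\<forall>\<^sub>F s in at 0. to_chart (\<gamma> s) = to_chart (\<gamma>' s)"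
      using assms(2) by (auto simp: eventually_at_filter elim: eventually_mono)
  qed (simp_all add: e0)
  moreover have "\<forall>\<^sub>F s in nhds 0. \<gamma>' s \<in> chart_nbhd"
    using assms unfolding curve_at_one_def by (auto elim: eventually_elim2)
  ultimately show ?thesis using assms(1) e0 by (simp add: curve_at_one_def has_vector_derivative_def)
qed

lemma Ad_mult:
  assumes g: "g \<in> carrier K" and h: "h \<in> carrier K" and Y: "Y \<in> V"
  shows "Ad K (g \<otimes> h) Y = Ad K g (Ad K h Y)"
proof (rule curve_at_one_unique)
  have gh: "g \<otimes> h \<in> carrier K" using g h by simp
  show "curve_at_one (\<lambda>s. (g \<otimes> h) \<otimes> from_chart (s *\<^sub>R Y) \<otimes> inv (g \<otimes> h)) (Ad K (g \<otimes> h) Y)"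
    by (rule curve_at_one_conj[OF gh curve_at_one_from_chart[OF Y]])
  show "curve_at_one (\<lambda>s. (g \<otimes> h) \<otimes> from_chart (s *\<^sub>R Y) \<otimes> inv (g \<otimes> h)) (Ad K g (Ad K h Y))"
  proof (rule curve_at_one_cong[OF curve_at_one_conj[OF g curve_at_one_conj[OF h curve_at_one_from_chart[OF Y]]]])
    show "\<forall>\<^sub>F s in nhds 0. g \<otimes> (h \<otimes> from_chart (s *\<^sub>R Y) \<otimes> inv h) \<otimes> inv g = (g \<otimes> h) \<otimes> from_chart (s *\<^sub>R Y) \<otimes> inv (g \<otimes> h)"
      using curve_at_one_carrier[OF curve_at_one_from_chart[OF Y]]
      by eventually_elim (use g h in \<open>simp add: inv_mult_group m_assoc\<close>)
  qed
qed

lemma Ad_one: assumes Y: "Y \<in> V" shows "Ad K \<one> Y = Y"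
proof (rule curve_at_one_unique[OF _ curve_at_one_from_chart[OF Y]])
  show "curve_at_one (\<lambda>s. from_chart (s *\<^sub>R Y)) (Ad K \<one> Y)"
  proof (rule curve_at_one_cong[OF curve_at_one_conj[OF one_closed curve_at_one_from_chart[OF Y]]])
    show "\<forall>\<^sub>F s in nhds 0. \<one> \<otimes> from_chart (s *\<^sub>R Y) \<otimes> inv \<one> = from_chart (s *\<^sub>R Y)"
      using curve_at_one_carrier[OF curve_at_one_from_chart[OF Y]] by eventually_elim simp
  qed
qed

lemma Ad_inv [simp]: "g \<in> carrier K \<Longrightarrow> Y \<in> V \<Longrightarrow> Ad K (inv g) (Ad K g Y) = Y"
  "g \<in> carrier K \<Longrightarrow> Y \<in> V \<Longrightarrow> Ad K g (Ad K (inv g) Y) = Y"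
  by (simp_all add: Ad_mult[symmetric] Ad_one)

lemma one_parameter_curve_at_one:
  assumes Y: "Y \<in> V" and "one_parameter_subgroup K Y \<gamma>"
  shows "curve_at_one \<gamma> Y"
proof -
  note g = one_parameter_subgroupD[OF assms(2)]
  have "openin euclideanreal {s \<in> topspace euclideanreal. \<gamma> s \<in> chart_nbhd}"
    by (rule openin_continuous_map_preimage[OF g(6) chart_nbhd(1)])
  then have "open {s. \<gamma> s \<in> chart_nbhd}" by simp
  then have "\<forall>\<^sub>F s in nhds 0. \<gamma> s \<in> chart_nbhd"
    using g(2) chart_nbhd(2) by (auto simp: eventually_nhds intro!: exI[of _ "{s. \<gamma> s \<in> chart_nbhd}"])
  then show ?thesis using Y g by (simp add: curve_at_one_def)
qed

lemma curve_at_one_lexp: "Y \<in> V \<Longrightarrow> curve_at_one (\<lambda>s. lexp (s *\<^sub>R Y)) Y"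
  by (intro one_parameter_curve_at_one lexp_one_parameter_subgroup)

lemma one_parameter_subgroupI:
  assumes "curve_at_one \<gamma> Y" "continuous_map euclideanreal X \<gamma>" "\<And>s t. \<gamma> (s + t) = \<gamma> s \<otimes> \<gamma> t"
  shows "one_parameter_subgroup K Y \<gamma>"
  using assms by (auto simp: one_parameter_subgroup_def to_coord_deriv_iff curve_at_one_def)

text \<open>A conjugated one-parameter subgroup is again one, with velocity \<open>Ad K g Y\<close>;
  uniqueness identifies it.\<close>

lemma conj_lexp:
  assumes g: "g \<in> carrier K" and Y: "Y \<in> V"
  shows "g \<otimes> lexp Y \<otimes> inv g = lexp (Ad K g Y)"
proof -
  have "one_parameter_subgroup K (Ad K g Y) (\<lambda>s. g \<otimes> lexp (s *\<^sub>R Y) \<otimes> inv g)"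
  proof (rule one_parameter_subgroupI)
    show "curve_at_one (\<lambda>s. g \<otimes> lexp (s *\<^sub>R Y) \<otimes> inv g) (Ad K g Y)"
      by (rule curve_at_one_conj[OF g curve_at_one_lexp[OF Y]])
    show "continuous_map euclideanreal X (\<lambda>s. g \<otimes> lexp (s *\<^sub>R Y) \<otimes> inv g)"
      using continuous_map_compose[OF lexp_curve_continuous[OF Y] continuous_map_conj[OF g]] by (simp add: o_def)
    fix s t
    have c: "lexp (s *\<^sub>R Y) \<in> carrier K" for s using Y V by (simp add: subspace_mul)
    have canc: "inv g \<otimes> (g \<otimes> z) = z" if "z \<in> carrier K" for z
      using g that by (simp add: m_assoc[symmetric])
    show "g \<otimes> lexp ((s + t) *\<^sub>R Y) \<otimes> inv g = (g \<otimes> lexp (s *\<^sub>R Y) \<otimes> inv g) \<otimes> (g \<otimes> lexp (t *\<^sub>R Y) \<otimes> inv g)"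
      using g c[of s] c[of t] by (simp add: lexp_add[OF Y] m_assoc canc)
  qed
  from one_parameter_subgroup_unique[OF Ad_V[OF g Y] this, of 1] show ?thesis by simp
qed

end

section \<open>The bracket as derivative of the adjoint representation\<close>

context lie_group
begin

lemma differentiable_scaleR_at:
  fixes f :: "'x::real_normed_vector \<Rightarrow> real"
  assumes "f differentiable (at x)" "g differentiable (at x)"
  shows "(\<lambda>x. f x *\<^sub>R g x) differentiable (at x)"
  using assms by (auto simp: differentiable_def intro: has_derivative_scaleR)

lemma inv_from_chart_deriv: "((\<lambda>x. to_chart (inv (from_chart x))) has_derivative (\<lambda>x. - proj x)) (at 0)"
proof -
  obtain d where d: "d > 0" "\<And>x. x \<in> V \<Longrightarrow> norm x < d \<Longrightarrow> x \<in> chart_dom \<and> inv (from_chart x) \<in> chart_nbhd \<and>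
     norm (to_chart (inv (from_chart x))) \<le> 2 * norm x \<and> norm (to_chart (inv (from_chart x)) + x) \<le> 6 * C0 * norm x ^ 2"
    by (rule inv_near_one) (rule that)
  obtain B where B: "B > 0" "\<And>x. norm (proj x) \<le> norm x * B"
    using bounded_linear.pos_bounded[OF proj_bl] by blast
  show ?thesis
  proof (rule has_derivative_at_0_quadratic)
    show "bounded_linear (\<lambda>x. - proj x)" by (rule bounded_linear_minus[OF proj_bl])
    show "d / (2 * B) > 0" using B d by simp
    fix x :: 'e assume "norm x \<le> d / (2 * B)"
    then have "norm x * B \<le> d / 2" using B by (simp add: field_simps)
    then have n: "norm (proj x) < d" using B(2)[of x] d(1) by linarith
    have "norm (to_chart (inv (from_chart (proj x))) + proj x) \<le> 6 * C0 * norm (proj x) ^ 2"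
      using d(2)[OF proj_V n] by blast
    also have "\<dots> \<le> 6 * C0 * (norm x * B) ^ 2"
      using C0 B by (intro mult_left_mono power_mono) auto
    finally show "norm (to_chart (inv (from_chart x)) - to_chart (inv (from_chart 0)) - - proj x) \<le> (6 * C0 * B ^ 2) * norm x ^ 2"
      by (simp add: from_chart(8,9) from_chart_proj power_mult_distrib mult_ac)
  qed
qed

lemma inv_from_chart_chart_nbhd: "\<forall>\<^sub>F x in nhds 0. x \<in> chart_dom \<and> inv (from_chart x) \<in> chart_nbhd"
proof -
  have "openin X {k \<in> topspace X. inv k \<in> chart_nbhd}"
    by (rule openin_continuous_map_preimage[OF inv_continuous chart_nbhd(1)])
  from eventually_from_chart[OF this] show ?thesis
    using chart_nbhd(2) by (auto simp: topspace_topo elim: eventually_mono)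
qed

text \<open>The vector in question is the derivative at s = 0 of the product of x, s Y and the
  inverse of x, read in coordinates. The chain rule expresses it by the derivative of
  \<open>coord_mult\<close> at (x, 0) and at \<open>q x\<close>, and both depend differentiably on
  \<open>x\<close> at the origin.\<close>

lemma Ad_from_chart_differentiable:
  assumes Y: "Y \<in> V"
  shows "(\<lambda>x. Ad K (from_chart x) Y) differentiable (at 0)"
proof -
  obtain O' D where O': "open O'" "(0, 0) \<in> O'"
    "\<And>p. p \<in> O' \<Longrightarrow> fst p \<in> chart_dom \<and> snd p \<in> chart_dom \<and> from_chart (fst p) \<otimes> from_chart (snd p) \<in> chart_nbhd"
    "\<And>p. p \<in> O' \<Longrightarrow> (coord_mult has_derivative D p) (at p)"
    "\<And>p v. p \<in> O' \<Longrightarrow> (\<lambda>p. D p v) differentiable (at p)" by (rule coord_mult_deriv) (rule that)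
  define i where "i x = to_chart (inv (from_chart x))" for x
  have i0: "i 0 = 0" by (simp add: i_def from_chart(8,9))
  have id: "i differentiable (at 0)" using inv_from_chart_deriv by (auto simp: i_def[abs_def] differentiable_def)
  have pd: "proj differentiable (at 0)"
    using bounded_linear_imp_has_derivative[OF proj_bl] by (auto simp: differentiable_def)
  define q where "q x = (proj x, i x)" for x
  have qd: "q differentiable (at 0)" unfolding q_def by (intro differentiable_Pair pd id)
  have q0: "q 0 = (0, 0)" by (simp add: q_def i0)
  define w where "w x = D (x, 0) (0, Y)" for x
  have wd: "w differentiable (at 0)" unfolding w_def
    by (rule differentiable_compose[of "\<lambda>p. D p (0, Y)" "\<lambda>x. (x, 0)" 0 UNIV])
      (auto intro!: differentiable_Pair simp: O'(5)[OF O'(2)])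
  \<comment> \<open>Only \<open>D p v\<close> with fixed \<open>v\<close> is known to be
    differentiable in \<open>p\<close>, so the moving argument \<open>w x\<close> is expanded in the
    basis.\<close>
  define F where "F x = (\<Sum>b\<in>Basis. (w x \<bullet> b) *\<^sub>R D (q x) (b, 0))" for x
  have "F differentiable (at 0)" unfolding F_def
  proof (intro differentiable_sum ballI differentiable_scaleR_at)
    fix b :: 'e
    show "(\<lambda>x. w x \<bullet> b) differentiable at 0" using wd by simp
    show "(\<lambda>x. D (q x) (b, 0)) differentiable at 0"
      by (rule differentiable_compose[of "\<lambda>p. D p (b, 0)" q]) (simp_all add: q0 qd O'(5)[OF O'(2)])
  qed simp
  have "\<forall>\<^sub>F x in nhds 0. (x, 0) \<in> O'"
  proof -
    have "open ((\<lambda>x. (x, 0)) -` O')" using O'(1) by (intro open_vimage continuous_intros)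
    then show ?thesis using O'(2) by (auto simp: eventually_nhds intro!: exI[of _ "(\<lambda>x. (x, 0)) -` O'"])
  qed
  moreover have "\<forall>\<^sub>F x in nhds 0. q x \<in> O'"
  proof -
    have "isCont q 0" using qd by (rule differentiable_imp_continuous_within)
    then have "(q \<longlongrightarrow> q 0) (nhds 0)" using tendsto_at_iff_tendsto_nhds[of q 0] unfolding isCont_def by blast
    then show ?thesis using topological_tendstoD[of q "q 0" "nhds 0" O'] O' q0 by simp
  qed
  moreover note inv_from_chart_chart_nbhd
  ultimately have ev: "\<forall>\<^sub>F x in nhds 0. F x = Ad K (from_chart x) Y"
  proof eventually_elim
    fix x assume x1: "(x, 0) \<in> O'" and x2: "q x \<in> O'" and x3: "x \<in> chart_dom \<and> inv (from_chart x) \<in> chart_nbhd"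
    have xd: "x \<in> chart_dom" "from_chart x \<in> carrier K" "inv (from_chart x) \<in> chart_nbhd" using x3 from_chart(10) by auto
    have lin: "linear (D (q x))" using O'(4)[OF x2] has_derivative_linear by blast
    have y1: "((\<lambda>s. coord_mult (x, s *\<^sub>R Y)) has_derivative (\<lambda>s. D (x, 0) (0, s *\<^sub>R Y))) (at 0)"
      by (rule has_derivative_compose[of "\<lambda>s. (x, s *\<^sub>R Y)" "\<lambda>s. (0, s *\<^sub>R Y)" 0 UNIV coord_mult "D (x, 0)"])
        (use O'(4)[OF x1] in \<open>auto intro!: derivative_eq_intros\<close>)
    have lin2: "linear (D (x, 0))" using O'(4)[OF x1] has_derivative_linear by blast
    have sc: "D (x, 0) (0, s *\<^sub>R Y) = s *\<^sub>R w x" for s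
      using linear_cmul[OF lin2, of s "(0, Y)"] by (simp add: w_def)
    have y2: "((\<lambda>s. (coord_mult (x, s *\<^sub>R Y), i x)) has_derivative (\<lambda>s. (s *\<^sub>R w x, 0))) (at 0)"
      using y1 unfolding sc by (auto intro!: derivative_eq_intros)
    have e0: "(coord_mult (x, 0 *\<^sub>R Y), i x) = q x" using xd(1) by (simp add: coord_mult_0 q_def)
    have "((\<lambda>s. coord_mult (coord_mult (x, s *\<^sub>R Y), i x)) has_derivative (\<lambda>s. D (q x) (s *\<^sub>R w x, 0))) (at 0)"
      by (rule has_derivative_compose[OF y2]) (simp only: e0 O'(4)[OF x2])
    moreover have "D (q x) (s *\<^sub>R w x, 0) = s *\<^sub>R F x" for s
    proof -
      have "(w x, 0::'e) = (\<Sum>b\<in>Basis. (w x \<bullet> b) *\<^sub>R (b, 0))"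
        by (simp add: sum_prod euclidean_representation)
      then have "D (q x) (w x, 0) = F x"
        unfolding F_def by (simp only: linear_sum[OF lin] linear_cmul[OF lin])
      then show ?thesis using linear_cmul[OF lin, of s "(w x, 0)"] by simp
    qed
    ultimately have y3: "((\<lambda>s. coord_mult (coord_mult (x, s *\<^sub>R Y), i x)) has_derivative (\<lambda>s. s *\<^sub>R F x)) (at 0)" by simp
    have "((\<lambda>s. to_chart (from_chart x \<otimes> from_chart (s *\<^sub>R Y) \<otimes> inv (from_chart x))) has_derivative (\<lambda>s. s *\<^sub>R F x)) (at 0)"
    proof (rule has_derivative_transform_within_open[OF y3])
      show "open ((\<lambda>s. (x, s *\<^sub>R Y)) -` O')" using O'(1) by (intro open_vimage continuous_intros)
      show "0 \<in> (\<lambda>s. (x, s *\<^sub>R Y)) -` O'" using x1 by simp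
      fix s assume "s \<in> (\<lambda>s. (x, s *\<^sub>R Y)) -` O'"
      then have "from_chart x \<otimes> from_chart (s *\<^sub>R Y) \<in> chart_nbhd" using O'(3)[of "(x, s *\<^sub>R Y)"] by simp
      then have "from_chart (coord_mult (x, s *\<^sub>R Y)) = from_chart x \<otimes> from_chart (s *\<^sub>R Y)" by (simp add: coord_mult_def from_chart(7))
      moreover have "from_chart (i x) = inv (from_chart x)" using xd(3) by (simp add: i_def from_chart(7))
      ultimately show "coord_mult (coord_mult (x, s *\<^sub>R Y), i x) = to_chart (from_chart x \<otimes> from_chart (s *\<^sub>R Y) \<otimes> inv (from_chart x))"
        by (simp only: coord_mult_def[of "(coord_mult (x, s *\<^sub>R Y), i x)"] fst_conv snd_conv)
    qed
    then have "((\<lambda>s. to_chart (from_chart x \<otimes> from_chart (s *\<^sub>R Y) \<otimes> inv (from_chart x))) has_vector_derivative F x) (at 0)"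
      by (simp add: has_vector_derivative_def)
    from vector_derivative_unique_at[OF this Ad_curve[OF xd(2) curve_at_one_from_chart[OF Y]]]
    show "F x = Ad K (from_chart x) Y" .
  qed
  obtain F' where F': "(F has_derivative F') (at 0)" using \<open>F differentiable (at 0)\<close> by (auto simp: differentiable_def)
  have "((\<lambda>x. Ad K (from_chart x) Y) has_derivative F') (at 0)"
  proof (rule has_derivative_transform_eventually[OF F'])
    show "\<forall>\<^sub>F x in at 0. F x = Ad K (from_chart x) Y" using ev by (simp add: eventually_at_filter eventually_mono)
  qed (use eventually_nhds_x_imp_x[OF ev] in auto)
  then show ?thesis by (auto simp: differentiable_def)
qed

lemma bracket_deriv:
  assumes Y: "Y \<in> V"
  shows "((\<lambda>x. Ad K (from_chart x) Y) has_derivative (\<lambda>Z. lie_bracket K (proj Z) Y)) (at 0)"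
proof -
  obtain D where D: "((\<lambda>x. Ad K (from_chart x) Y) has_derivative D) (at 0)"
    using Ad_from_chart_differentiable[OF Y] by (auto simp: differentiable_def)
  have lin: "linear D" using D has_derivative_linear by blast
  have "((\<lambda>x. Ad K (from_chart (proj x)) Y) has_derivative (\<lambda>x. D (proj x))) (at 0)"
    by (rule has_derivative_compose[of proj proj]) (use D bounded_linear_imp_has_derivative[OF proj_bl] in auto)
  then have "((\<lambda>x. Ad K (from_chart x) Y) has_derivative (\<lambda>x. D (proj x))) (at 0)" by (simp add: from_chart_proj)
  from has_derivative_unique[OF D this] have Dp: "D = (\<lambda>x. D (proj x))" .
  have "lie_bracket K Z Y = D Z" if "Z \<in> V" for Z
  proof -
    have "((\<lambda>s. Ad K (from_chart (s *\<^sub>R Z)) Y) has_derivative (\<lambda>s. D (s *\<^sub>R Z))) (at 0)"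
      by (rule has_derivative_compose[of "\<lambda>s. s *\<^sub>R Z"]) (use D in \<open>auto intro!: derivative_eq_intros\<close>)
    then have "((\<lambda>s. Ad K (coord_curve K Z s) Y) has_vector_derivative D Z) (at 0)"
      by (simp add: coord_curve[OF that] has_vector_derivative_def linear_cmul[OF lin])
    then show ?thesis unfolding lie_bracket_def by (rule vector_derivative_at)
  qed
  then have "(\<lambda>Z. lie_bracket K (proj Z) Y) = D" by (subst Dp) (simp add: fun_eq_iff)
  then show ?thesis using D by simp
qed

lemma bracket_curve:
  assumes c: "curve_at_one \<gamma> Z" and Y: "Y \<in> V"
  shows "((\<lambda>s. Ad K (\<gamma> s) Y) has_vector_derivative lie_bracket K Z Y) (at 0)"
proof -
  have c': "Z \<in> V" "\<gamma> 0 = \<one>" "\<forall>\<^sub>F s in nhds 0. \<gamma> s \<in> chart_nbhd" "((\<lambda>s. to_chart (\<gamma> s)) has_derivative (\<lambda>s. s *\<^sub>R Z)) (at 0)"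
    using c by (auto simp: curve_at_one_def has_vector_derivative_def)
  have lin: "linear (\<lambda>Z. lie_bracket K (proj Z) Y)" using bracket_deriv[OF Y] has_derivative_linear by blast
  have "((\<lambda>s. Ad K (from_chart (to_chart (\<gamma> s))) Y) has_derivative (\<lambda>s. lie_bracket K (proj (s *\<^sub>R Z)) Y)) (at 0)"
    by (rule has_derivative_compose[OF c'(4)]) (simp add: c'(2) from_chart(9) bracket_deriv[OF Y])
  then have "((\<lambda>s. Ad K (\<gamma> s) Y) has_derivative (\<lambda>s. lie_bracket K (proj (s *\<^sub>R Z)) Y)) (at 0)"
  proof (rule has_derivative_transform_eventually)
    have "\<forall>\<^sub>F s in nhds 0. Ad K (from_chart (to_chart (\<gamma> s))) Y = Ad K (\<gamma> s) Y"
      using c'(3) by eventually_elim (simp add: from_chart(7))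
    then show "\<forall>\<^sub>F s in at 0. Ad K (from_chart (to_chart (\<gamma> s))) Y = Ad K (\<gamma> s) Y"
      by (simp add: eventually_at_filter eventually_mono)
  qed (simp_all add: c'(2) from_chart(8,9))
  then show ?thesis using linear_cmul[OF lin, of _ Z] c'(1) by (simp add: has_vector_derivative_def)
qed

text \<open>\<open>AD\<close> and \<open>br\<close> extend the adjoint representation and the bracket to the whole ambient space, so that
  linearity needs no side conditions.\<close>

definition "AD g Y = Ad K g (proj Y)"
definition "br Z Y = lie_bracket K (proj Z) (proj Y)"

lemma AD_V [simp]: "g \<in> carrier K \<Longrightarrow> AD g Y \<in> V" by (simp add: AD_def Ad_V)
lemma AD_eq: "Y \<in> V \<Longrightarrow> AD g Y = Ad K g Y" by (simp add: AD_def)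
lemma br_eq: "Z \<in> V \<Longrightarrow> Y \<in> V \<Longrightarrow> br Z Y = lie_bracket K Z Y" by (simp add: br_def)
lemma AD_proj [simp]: "AD g (proj Y) = AD g Y" by (simp add: AD_def)
lemma br_proj [simp]: "br (proj Z) Y = br Z Y" "br Z (proj Y) = br Z Y" by (simp_all add: br_def)

lemma AD_linear: "g \<in> carrier K \<Longrightarrow> linear (AD g)"
  by (rule linearI) (simp_all add: AD_def linear_add[OF proj_linear] linear_cmul[OF proj_linear] Ad_add Ad_scaleR)

lemma AD_bl: "g \<in> carrier K \<Longrightarrow> bounded_linear (AD g)"
  using AD_linear linear_conv_bounded_linear by blast

lemma AD_mult: "g \<in> carrier K \<Longrightarrow> h \<in> carrier K \<Longrightarrow> AD (g \<otimes> h) Y = AD g (AD h Y)"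
  by (simp add: AD_def Ad_mult Ad_V)

lemma AD_one: "Y \<in> V \<Longrightarrow> AD \<one> Y = Y" by (simp add: AD_def Ad_one)

lemma AD_inv: "g \<in> carrier K \<Longrightarrow> Y \<in> V \<Longrightarrow> AD (inv g) (AD g Y) = Y"
  "g \<in> carrier K \<Longrightarrow> Y \<in> V \<Longrightarrow> AD g (AD (inv g) Y) = Y"
  by (simp_all add: AD_def Ad_V)

lemma bracket_curve': "curve_at_one \<gamma> Z \<Longrightarrow> ((\<lambda>s. AD (\<gamma> s) Y) has_vector_derivative br Z Y) (at 0)"
  using bracket_curve[of \<gamma> Z "proj Y"] by (simp add: AD_def br_def curve_at_one_def)

lemma br_V [simp]: "br Z Y \<in> V"
proof -
  have "curve_at_one (\<lambda>s. from_chart (s *\<^sub>R proj Z)) (proj Z)" by (rule curve_at_one_from_chart[OF proj_V])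
  note b = bracket_curve'[OF this, of Y]
  have "\<forall>\<^sub>F s in nhds 0. AD (from_chart (s *\<^sub>R proj Z)) Y \<in> V"
    using curve_at_one_carrier[OF curve_at_one_from_chart[OF proj_V[of Z]]] by eventually_elim simp
  from has_vector_derivative_in_V[OF b this] show ?thesis by simp
qed

lemma br_bilinear: "bilinear br"
  unfolding bilinear_def
proof (intro conjI allI)
  fix Z
  note c = curve_at_one_lexp[OF proj_V[of Z]]
  have lc: "lexp (s *\<^sub>R proj Z) \<in> carrier K" for s using V by (simp add: subspace_mul)
  show "linear (br Z)"
  proof (rule linearI)
    fix Y Y'
    have "((\<lambda>s. AD (lexp (s *\<^sub>R proj Z)) Y + AD (lexp (s *\<^sub>R proj Z)) Y') has_vector_derivative
        br (proj Z) Y + br (proj Z) Y') (at 0)"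
      by (intro has_vector_derivative_add bracket_curve' c)
    then have "((\<lambda>s. AD (lexp (s *\<^sub>R proj Z)) (Y + Y')) has_vector_derivative br (proj Z) Y + br (proj Z) Y') (at 0)"
      by (simp add: linear_add[OF AD_linear[OF lc]])
    from vector_derivative_unique_at[OF bracket_curve'[OF c] this] show "br Z (Y + Y') = br Z Y + br Z Y'" by simp
  next
    fix r Y
    have "((\<lambda>s. r *\<^sub>R AD (lexp (s *\<^sub>R proj Z)) Y) has_vector_derivative r *\<^sub>R br (proj Z) Y) (at 0)"
      by (intro bounded_linear.has_vector_derivative[OF bounded_linear_scaleR_right] bracket_curve' c)
    then have "((\<lambda>s. AD (lexp (s *\<^sub>R proj Z)) (r *\<^sub>R Y)) has_vector_derivative r *\<^sub>R br (proj Z) Y) (at 0)"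
      by (simp add: linear_cmul[OF AD_linear[OF lc]])
    from vector_derivative_unique_at[OF bracket_curve'[OF c] this] show "br Z (r *\<^sub>R Y) = r *\<^sub>R br Z Y" by simp
  qed
next
  fix Y
  show "linear (\<lambda>Z. br Z Y)"
    using bracket_deriv[OF proj_V[of Y]] has_derivative_linear unfolding br_def by blast
qed

lemma br_bb: "bounded_bilinear br" using br_bilinear bilinear_conv_bounded_bilinear by blast

lemma lexp_scale_carrier: "Z \<in> V \<Longrightarrow> lexp (s *\<^sub>R Z) \<in> carrier K"
  using V by (simp add: subspace_mul)

lemma AD_lexp_deriv:
  assumes Z: "Z \<in> V"
  shows "((\<lambda>s. AD (lexp (s *\<^sub>R Z)) Y) has_vector_derivative AD (lexp (t *\<^sub>R Z)) (br Z Y)) (at t)"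
    and "((\<lambda>s. AD (lexp (s *\<^sub>R Z)) Y) has_vector_derivative br Z (AD (lexp (t *\<^sub>R Z)) Y)) (at t)"
proof -
  note lc = lexp_scale_carrier[OF Z]
  have sh: "((\<lambda>s. AD (lexp ((s - t) *\<^sub>R Z)) Y) has_vector_derivative br Z Y) (at t)" for Y
  proof -
    have 1: "((\<lambda>s. s - t) has_vector_derivative 1) (at t)" by (auto intro!: derivative_eq_intros)
    have "((\<lambda>s. AD (lexp (s *\<^sub>R Z)) Y) has_vector_derivative br Z Y) (at (t - t))"
      using bracket_curve'[OF curve_at_one_lexp[OF Z]] by simp
    from vector_diff_chain_at[OF 1 this] show ?thesis by (simp add: o_def)
  qed
  have eq1: "AD (lexp (s *\<^sub>R Z)) Y = AD (lexp (t *\<^sub>R Z)) (AD (lexp ((s - t) *\<^sub>R Z)) Y)" for s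
    using lexp_add[OF Z, of t "s - t"] by (simp add: AD_mult[OF lc lc, symmetric])
  have eq2: "AD (lexp (s *\<^sub>R Z)) Y = AD (lexp ((s - t) *\<^sub>R Z)) (AD (lexp (t *\<^sub>R Z)) Y)" for s
    using lexp_add[OF Z, of "s - t" t] by (simp add: AD_mult[OF lc lc, symmetric])
  show "((\<lambda>s. AD (lexp (s *\<^sub>R Z)) Y) has_vector_derivative AD (lexp (t *\<^sub>R Z)) (br Z Y)) (at t)"
    by (subst ext[OF eq1]) (rule bounded_linear.has_vector_derivative[OF AD_bl[OF lc] sh])
  show "((\<lambda>s. AD (lexp (s *\<^sub>R Z)) Y) has_vector_derivative br Z (AD (lexp (t *\<^sub>R Z)) Y)) (at t)"
    by (subst ext[OF eq2]) (rule sh)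
qed

lemma lexp_commute: "Z \<in> V \<Longrightarrow> lexp (s *\<^sub>R Z) \<otimes> lexp (t *\<^sub>R Z) = lexp (t *\<^sub>R Z) \<otimes> lexp (s *\<^sub>R Z)"
  using lexp_add[of Z s t] lexp_add[of Z t s] by (simp add: add.commute)

lemma commute_AD:
  assumes g: "g \<in> carrier K" and Z: "Z \<in> V" and com: "\<And>s. g \<otimes> lexp (s *\<^sub>R Z) = lexp (s *\<^sub>R Z) \<otimes> g"
  shows "AD g Z = Z"
proof -
  have "g \<otimes> lexp (s *\<^sub>R Z) \<otimes> inv g = lexp (s *\<^sub>R Z)" for s
    using g lexp_scale_carrier[OF Z, of s] by (simp add: com m_assoc)
  then have "curve_at_one (\<lambda>s. lexp (s *\<^sub>R Z)) (Ad K g Z)" using curve_at_one_conj[OF g curve_at_one_lexp[OF Z]] by simp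
  from curve_at_one_unique[OF this curve_at_one_lexp[OF Z]] show ?thesis using Z by (simp add: AD_eq)
qed

lemma AD_fixed_bracket:
  assumes Z: "Z \<in> V" and "\<And>s. AD (lexp (s *\<^sub>R Z)) Y = c" shows "br Z Y = 0"
proof -
  have "((\<lambda>s. AD (lexp (s *\<^sub>R Z)) Y) has_vector_derivative 0) (at 0)" using assms(2) by simp
  from vector_derivative_unique_at[OF bracket_curve'[OF curve_at_one_lexp[OF Z]] this] show ?thesis .
qed

text \<open>Elements of one one-parameter subgroup commute, so their adjoint action fixes the
  generator. Antisymmetry of the bracket then follows by polarization.\<close>

lemma br_self: "br Z Z = 0"
proof -
  have "AD (lexp (s *\<^sub>R proj Z)) (proj Z) = proj Z" for s
    by (intro commute_AD lexp_scale_carrier lexp_commute proj_V)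
  from AD_fixed_bracket[OF proj_V this] have "br (proj Z) (proj Z) = 0" .
  then show ?thesis by simp
qed

lemma br_anti: "br Y Z = - br Z Y"
proof -
  interpret b: bounded_bilinear br by (rule br_bb)
  have "br (Y + Z) (Y + Z) = 0" by (rule br_self)
  then have "br Y Z + br Z Y = 0" by (simp add: b.add_left b.add_right br_self[of Y] br_self[of Z] add.commute)
  then show ?thesis by (simp add: add_eq_0_iff)
qed

lemma AD_br:
  assumes g: "g \<in> carrier K" shows "AD g (br Z Y) = br (AD g Z) (AD g Y)"
proof -
  have Z: "proj Z \<in> V" by simp
  note c = curve_at_one_lexp[OF Z]
  have c2: "curve_at_one (\<lambda>s. g \<otimes> lexp (s *\<^sub>R proj Z) \<otimes> inv g) (AD g Z)"
    using curve_at_one_conj[OF g c] by (simp add: AD_def)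
  have eq: "AD (g \<otimes> lexp (s *\<^sub>R proj Z) \<otimes> inv g) (AD g Y) = AD g (AD (lexp (s *\<^sub>R proj Z)) Y)" for s
  proof -
    have "AD (g \<otimes> lexp (s *\<^sub>R proj Z) \<otimes> inv g) (AD g Y) = AD g (AD (lexp (s *\<^sub>R proj Z)) (AD (inv g) (AD g Y)))"
      using g lexp_scale_carrier[OF Z, of s] by (simp add: AD_mult)
    also have "AD (inv g) (AD g Y) = proj Y" using AD_inv(1)[OF g, of "proj Y"] by simp
    finally show ?thesis by simp
  qed
  have "((\<lambda>s. AD g (AD (lexp (s *\<^sub>R proj Z)) Y)) has_vector_derivative AD g (br (proj Z) Y)) (at 0)"
    by (intro bounded_linear.has_vector_derivative[OF AD_bl[OF g]] bracket_curve' c)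
  moreover have "((\<lambda>s. AD g (AD (lexp (s *\<^sub>R proj Z)) Y)) has_vector_derivative br (AD g Z) (AD g Y)) (at 0)"
    using bracket_curve'[OF c2, of "AD g Y"] unfolding eq .
  ultimately show ?thesis using vector_derivative_unique_at by fastforce
qed

text \<open>The invariance of the bracket under \<open>AD\<close>, differentiated along exp (s W) at
  s = 0.\<close>

lemma br_jacobi: "br W (br Z Y) = br (br W Z) Y + br Z (br W Y)"
proof -
  interpret b: bounded_bilinear br by (rule br_bb)
  have W: "proj W \<in> V" by simp
  note c = curve_at_one_lexp[OF W]
  have d: "((\<lambda>s. AD (lexp (s *\<^sub>R proj W)) A) has_derivative (\<lambda>s. s *\<^sub>R br W A)) (at 0)" for A
    using bracket_curve'[OF c, of A] by (simp add: has_vector_derivative_def)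
  have one: "AD \<one> A = proj A" for A using AD_one[of "proj A"] by simp
  have "((\<lambda>s. br (AD (lexp (s *\<^sub>R proj W)) Z) (AD (lexp (s *\<^sub>R proj W)) Y)) has_derivative
     (\<lambda>s. br (AD (lexp (0 *\<^sub>R proj W)) Z) (s *\<^sub>R br W Y) + br (s *\<^sub>R br W Z) (AD (lexp (0 *\<^sub>R proj W)) Y))) (at 0)"
    by (rule b.FDERIV[OF d d])
  then have "((\<lambda>s. br (AD (lexp (s *\<^sub>R proj W)) Z) (AD (lexp (s *\<^sub>R proj W)) Y)) has_vector_derivative
     br Z (br W Y) + br (br W Z) Y) (at 0)"
    by (simp add: has_vector_derivative_def b.scaleR_left b.scaleR_right one scaleR_right_distrib)
  moreover have "br (AD (lexp (s *\<^sub>R proj W)) Z) (AD (lexp (s *\<^sub>R proj W)) Y) = AD (lexp (s *\<^sub>R proj W)) (br Z Y)" for s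
    using AD_br[OF lexp_scale_carrier[OF W]] by simp
  ultimately have "((\<lambda>s. AD (lexp (s *\<^sub>R proj W)) (br Z Y)) has_vector_derivative br Z (br W Y) + br (br W Z) Y) (at 0)"
    by simp
  from vector_derivative_unique_at[OF bracket_curve'[OF c] this] show ?thesis by (simp add: add.commute)
qed

end

section \<open>Tori\<close>

context lie_group
begin

lemma AD_near_one:
  assumes "e > 0"
  obtains W where "openin X W" "\<one> \<in> W" "\<And>g. g \<in> W \<Longrightarrow> norm (AD g Y - proj Y) < e"
proof -
  have "isCont (\<lambda>x. AD (from_chart x) Y) 0"
    using bracket_deriv[OF proj_V[of Y]] has_derivative_continuous unfolding AD_def by blast
  then have "((\<lambda>x. AD (from_chart x) Y) \<longlongrightarrow> AD (from_chart 0) Y) (nhds 0)"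
    using tendsto_at_iff_tendsto_nhds[of "\<lambda>x. AD (from_chart x) Y" 0] unfolding isCont_def by blast
  moreover have "AD (from_chart 0) Y = proj Y" using AD_one[of "proj Y"] by (simp add: from_chart(8))
  ultimately have "\<forall>\<^sub>F x in nhds 0. dist (AD (from_chart x) Y) (proj Y) < e"
    using tendstoD[OF _ assms] by fastforce
  then obtain d where d: "d > 0" "\<And>x. dist x 0 < d \<Longrightarrow> dist (AD (from_chart x) Y) (proj Y) < e"
    unfolding eventually_nhds_metric by blast
  obtain W where W: "openin X W" "\<one> \<in> W" "W \<subseteq> chart_nbhd" "\<And>g. g \<in> W \<Longrightarrow> norm (to_chart g) < d"
    by (rule to_chart_nbhd[OF d(1)]) (rule that)
  have "norm (AD g Y - proj Y) < e" if "g \<in> W" for g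
  proof -
    have "from_chart (to_chart g) = g" using W(3) that from_chart(7) by blast
    then show ?thesis using d(2)[of "to_chart g"] W(4)[OF that] by (simp add: dist_norm)
  qed
  then show thesis using that W(1,2) by blast
qed

text \<open>Continuity at the identity comes from differentiability in the chart; left translation
  carries it to every other point.\<close>

lemma AD_continuous: "continuous_map X euclidean (\<lambda>g. AD g Y)"
  unfolding continuous_map_def
proof (intro conjI allI impI)
  fix U :: "'e set" assume "openin euclidean U"
  then have U: "open U" by simp
  show "openin X {g \<in> topspace X. AD g Y \<in> U}"
  proof (subst openin_subopen, intro ballI)
    fix g0 assume "g0 \<in> {g \<in> topspace X. AD g Y \<in> U}"
    then have g0: "g0 \<in> carrier K" "AD g0 Y \<in> U" by (auto simp: topspace_topo)
    obtain e where e: "e > 0" "ball (AD g0 Y) e \<subseteq> U" using U g0(2) open_contains_ball by blast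
    obtain b where b: "b > 0" "\<And>v. norm (AD g0 v) \<le> norm v * b"
      using bounded_linear.pos_bounded[OF AD_bl[OF g0(1)]] by blast
    have "e / b > 0" using e b by simp
    then obtain W where W: "openin X W" "\<one> \<in> W" "\<And>g. g \<in> W \<Longrightarrow> norm (AD g Y - proj Y) < e / b"
      by (rule AD_near_one) (rule that)
    let ?T = "{g \<in> topspace X. inv g0 \<otimes> g \<in> W}"
    have "openin X ?T"
      by (rule openin_continuous_map_preimage[OF continuous_map_mult W(1)])
        (use g0 in \<open>auto simp: topspace_topo\<close>)
    moreover have "g0 \<in> ?T" using g0 W(2) by (simp add: topspace_topo)
    moreover have "?T \<subseteq> {g \<in> topspace X. AD g Y \<in> U}"
    proof safe
      fix g assume g: "g \<in> topspace X" "inv g0 \<otimes> g \<in> W"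
      have gc: "g \<in> carrier K" using g by (simp add: topspace_topo)
      have "AD g Y = AD (g0 \<otimes> (inv g0 \<otimes> g)) Y" using g0 gc by (simp add: m_assoc[symmetric])
      also have "\<dots> = AD g0 (AD (inv g0 \<otimes> g) Y)" using g0 gc by (intro AD_mult) auto
      finally have "AD g Y - AD g0 Y = AD g0 (AD (inv g0 \<otimes> g) Y - proj Y)"
        by (simp add: linear_diff[OF AD_linear[OF g0(1)]])
      then have "norm (AD g Y - AD g0 Y) \<le> norm (AD (inv g0 \<otimes> g) Y - proj Y) * b" using b(2) by simp
      also have "\<dots> < e / b * b" using W(3)[OF g(2)] b(1) by (rule mult_strict_right_mono)
      finally show "AD g Y \<in> U" using e(2) b(1) by (auto simp: dist_norm norm_minus_commute)
    qed
    ultimately show "\<exists>T. openin X T \<and> g0 \<in> T \<and> T \<subseteq> {g \<in> topspace X. AD g Y \<in> U}" by blast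
  qed
qed simp

lemma coord_mult_deriv_0: "(coord_mult has_derivative (\<lambda>p. proj (fst p) + proj (snd p))) (at 0)"
proof (rule has_derivative_at_0_quadratic)
  show "bounded_linear (\<lambda>p. proj (fst p) + proj (snd p))"
    by (intro bounded_linear_add bounded_linear_compose[OF proj_bl] bounded_linear_fst bounded_linear_snd)
  show "r0 > 0" by (rule r0)
  fix p :: "'e \<times> 'e" assume "norm p \<le> r0"
  then show "norm (coord_mult p - coord_mult 0 - (proj (fst p) + proj (snd p))) \<le> C0 * norm p ^ 2"
    using coord_mult_est[of p "norm p" 0] by (simp add: power2_eq_square mult.assoc)
qed

lemma curve_at_one_mult:
  assumes a: "curve_at_one \<gamma> Y" and b: "curve_at_one \<gamma>' Z"
  shows "curve_at_one (\<lambda>s. \<gamma> s \<otimes> \<gamma>' s) (Y + Z)"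
proof -
  have ca: "Y \<in> V" "\<gamma> 0 = \<one>" "\<forall>\<^sub>F s in nhds 0. \<gamma> s \<in> chart_nbhd" "((\<lambda>s. to_chart (\<gamma> s)) has_derivative (\<lambda>s. s *\<^sub>R Y)) (at 0)"
    using a by (auto simp: curve_at_one_def has_vector_derivative_def)
  have cb: "Z \<in> V" "\<gamma>' 0 = \<one>" "\<forall>\<^sub>F s in nhds 0. \<gamma>' s \<in> chart_nbhd" "((\<lambda>s. to_chart (\<gamma>' s)) has_derivative (\<lambda>s. s *\<^sub>R Z)) (at 0)"
    using b by (auto simp: curve_at_one_def has_vector_derivative_def)
  define q where "q s = (to_chart (\<gamma> s), to_chart (\<gamma>' s))" for s
  have qd: "(q has_derivative (\<lambda>s. (s *\<^sub>R Y, s *\<^sub>R Z))) (at 0)"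
    unfolding q_def by (intro has_derivative_Pair ca cb)
  have q0: "q 0 = 0" by (simp add: q_def ca cb from_chart(9) zero_prod_def)
  have "((\<lambda>s. coord_mult (q s)) has_derivative (\<lambda>s. proj (fst (s *\<^sub>R Y, s *\<^sub>R Z)) + proj (snd (s *\<^sub>R Y, s *\<^sub>R Z)))) (at 0)"
    by (rule has_derivative_compose[OF qd]) (simp add: q0 coord_mult_deriv_0)
  moreover have "proj (fst (s *\<^sub>R Y, s *\<^sub>R Z)) + proj (snd (s *\<^sub>R Y, s *\<^sub>R Z)) = s *\<^sub>R (Y + Z)" for s
    using ca(1) cb(1) V by (simp add: subspace_mul scaleR_add_right)
  ultimately have md: "((\<lambda>s. coord_mult (q s)) has_derivative (\<lambda>s. s *\<^sub>R (Y + Z))) (at 0)" by simp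
  have ev: "\<forall>\<^sub>F s in nhds 0. coord_mult (q s) = to_chart (\<gamma> s \<otimes> \<gamma>' s)"
    using ca(3) cb(3) by eventually_elim (simp add: q_def coord_mult_def from_chart(7))
  have d: "((\<lambda>s. to_chart (\<gamma> s \<otimes> \<gamma>' s)) has_derivative (\<lambda>s. s *\<^sub>R (Y + Z))) (at 0)"
    by (rule has_derivative_transform_eventually[OF md])
      (use ev eventually_nhds_x_imp_x[OF ev] in \<open>simp_all add: eventually_at_filter eventually_mono\<close>)
  have "isCont q 0" using qd has_derivative_continuous by blast
  then have "(q \<longlongrightarrow> q 0) (nhds 0)" using tendsto_at_iff_tendsto_nhds[of q 0] unfolding isCont_def by blast
  then have "\<forall>\<^sub>F s in nhds 0. q s \<in> ball 0 r0"
    using topological_tendstoD[of q "q 0" "nhds 0" "ball 0 r0"] q0 r0 by simp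
  with ca(3) cb(3) have "\<forall>\<^sub>F s in nhds 0. \<gamma> s \<otimes> \<gamma>' s \<in> chart_nbhd"
  proof eventually_elim
    case (elim s)
    then show ?case using dom_small[of "q s"] by (simp add: q_def from_chart(7))
  qed
  then show ?thesis using d ca cb V by (simp add: curve_at_one_def has_vector_derivative_def subspace_add)
qed

lemma lexp_commuting_add:
  assumes Y: "Y \<in> V" and Z: "Z \<in> V" and com: "\<And>s t. lexp (s *\<^sub>R Y) \<otimes> lexp (t *\<^sub>R Z) = lexp (t *\<^sub>R Z) \<otimes> lexp (s *\<^sub>R Y)"
  shows "lexp (Y + Z) = lexp Y \<otimes> lexp Z"
proof -
  have "one_parameter_subgroup K (Y + Z) (\<lambda>s. lexp (s *\<^sub>R Y) \<otimes> lexp (s *\<^sub>R Z))"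
  proof (rule one_parameter_subgroupI)
    show "curve_at_one (\<lambda>s. lexp (s *\<^sub>R Y) \<otimes> lexp (s *\<^sub>R Z)) (Y + Z)"
      by (intro curve_at_one_mult curve_at_one_lexp Y Z)
    show "continuous_map euclideanreal X (\<lambda>s. lexp (s *\<^sub>R Y) \<otimes> lexp (s *\<^sub>R Z))"
      by (intro continuous_map_mult lexp_curve_continuous Y Z)
    fix s t
    note [simp] = lexp_scale_carrier[OF Y] lexp_scale_carrier[OF Z]
    have "lexp (s *\<^sub>R Y) \<otimes> lexp (t *\<^sub>R Y) \<otimes> (lexp (s *\<^sub>R Z) \<otimes> lexp (t *\<^sub>R Z))
        = lexp (s *\<^sub>R Y) \<otimes> (lexp (t *\<^sub>R Y) \<otimes> lexp (s *\<^sub>R Z)) \<otimes> lexp (t *\<^sub>R Z)" by (simp add: m_assoc)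
    also have "\<dots> = lexp (s *\<^sub>R Y) \<otimes> lexp (s *\<^sub>R Z) \<otimes> (lexp (t *\<^sub>R Y) \<otimes> lexp (t *\<^sub>R Z))"
      unfolding com[of t s] by (simp add: m_assoc)
    finally show "lexp ((s + t) *\<^sub>R Y) \<otimes> lexp ((s + t) *\<^sub>R Z) =
        lexp (s *\<^sub>R Y) \<otimes> lexp (s *\<^sub>R Z) \<otimes> (lexp (t *\<^sub>R Y) \<otimes> lexp (t *\<^sub>R Z))"
      by (simp add: lexp_add[OF Y] lexp_add[OF Z])
  qed
  from one_parameter_subgroup_unique[OF _ this, of 1] show ?thesis using Y Z V by (simp add: subspace_add)
qed

lemma lexp_in_subgroup:
  assumes A: "subgroup A K" and Y: "Y \<in> V" "lexp Y \<in> A"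
  shows "lexp (real_of_int k *\<^sub>R Y) \<in> A"
proof -
  have nat: "lexp (real n *\<^sub>R Y) \<in> A" for n
  proof (induction n)
    case 0 then show ?case using subgroup.one_closed[OF A] by simp
  next
    case (Suc n)
    have "lexp ((real n + 1) *\<^sub>R Y) = lexp (real n *\<^sub>R Y) \<otimes> lexp (1 *\<^sub>R Y)" by (rule lexp_add[OF Y(1)])
    then show ?case using Suc Y(2) subgroup.m_closed[OF A] by (simp add: add.commute)
  qed
  have neg: "lexp (- (real n) *\<^sub>R Y) \<in> A" for n
  proof -
    have "lexp (- (real n) *\<^sub>R Y) \<otimes> lexp (real n *\<^sub>R Y) = \<one>"
      using lexp_add[OF Y(1), of "- real n" "real n"] by simp
    then have "lexp (- (real n) *\<^sub>R Y) = inv (lexp (real n *\<^sub>R Y))"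
      using lexp_scale_carrier[OF Y(1), of "- real n"] lexp_scale_carrier[OF Y(1), of "real n"]
      by (intro inv_equality[symmetric]) auto
    then show ?thesis using nat[of n] subgroup.m_inv_closed[OF A] by simp
  qed
  show ?thesis by (cases k rule: int_cases2) (use nat neg in simp_all)
qed

lemma lie_algebra_of_eq: "lie_algebra_of K A = {Y \<in> V. \<forall>s. lexp (s *\<^sub>R Y) \<in> A}"
  unfolding lie_algebra_of_def using V by (auto simp: lie_exp subspace_mul)

lemma lie_algebra_ofD: "Y \<in> lie_algebra_of K A \<Longrightarrow> Y \<in> V" "Y \<in> lie_algebra_of K A \<Longrightarrow> lexp (s *\<^sub>R Y) \<in> A"
  "Y \<in> lie_algebra_of K A \<Longrightarrow> lexp Y \<in> A"
  using scaleR_one[of Y] by (auto simp: lie_algebra_of_eq simp del: scaleR_one) (metis scaleR_one)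

lemma torus_commute: "torus K A \<Longrightarrow> g \<in> A \<Longrightarrow> h \<in> A \<Longrightarrow> g \<otimes> h = h \<otimes> g" by (simp add: torus_def)

lemma torus_lexp_add:
  assumes "torus K A" "Y \<in> lie_algebra_of K A" "Z \<in> lie_algebra_of K A"
  shows "lexp (Y + Z) = lexp Y \<otimes> lexp Z"
  by (rule lexp_commuting_add) (use assms lie_algebra_ofD torus_commute in auto)

lemma lie_algebra_of_torus_subspace:
  assumes A: "torus K A"
  shows "subspace (lie_algebra_of K A)"
proof (rule subspaceI)
  have sA: "subgroup A K" using A by (simp add: torus_def)
  show "0 \<in> lie_algebra_of K A" using subgroup.one_closed[OF sA] by (simp add: lie_algebra_of_eq)
  show sc: "c *\<^sub>R Y \<in> lie_algebra_of K A" if "Y \<in> lie_algebra_of K A" for c Y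
    using that V by (auto simp: lie_algebra_of_eq subspace_mul)
  fix Y Z assume YZ: "Y \<in> lie_algebra_of K A" "Z \<in> lie_algebra_of K A"
  have "lexp (s *\<^sub>R (Y + Z)) \<in> A" for s
    using torus_lexp_add[OF A sc[OF YZ(1)] sc[OF YZ(2)], of s s] lie_algebra_ofD(2)[OF YZ(1), of s]
      lie_algebra_ofD(2)[OF YZ(2), of s] subgroup.m_closed[OF sA] by (simp add: scaleR_add_right)
  then show "Y + Z \<in> lie_algebra_of K A" using YZ V by (auto simp: lie_algebra_of_eq subspace_add)
qed

lemma torus_bracket:
  assumes A: "torus K A" "Y \<in> lie_algebra_of K A" "Z \<in> lie_algebra_of K A"
  shows "br Y Z = 0"
proof (rule AD_fixed_bracket)
  show "Y \<in> V" using A lie_algebra_ofD by blast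
  show "AD (lexp (s *\<^sub>R Y)) Z = Z" for s
    using A lie_algebra_ofD torus_commute by (intro commute_AD lexp_scale_carrier) auto
qed

lemma floor_mult_tendsto:
  fixes d :: "nat \<Rightarrow> real"
  assumes "d \<longlonglongrightarrow> 0" "\<And>n. d n > 0"
  shows "(\<lambda>n. real_of_int \<lfloor>s / d n\<rfloor> * d n) \<longlonglongrightarrow> s"
proof -
  have "norm (real_of_int \<lfloor>s / d n\<rfloor> * d n - s) \<le> d n" for n
  proof -
    have "\<bar>real_of_int \<lfloor>s / d n\<rfloor> - s / d n\<bar> \<le> 1" by linarith
    then have "\<bar>real_of_int \<lfloor>s / d n\<rfloor> - s / d n\<bar> * d n \<le> 1 * d n"
      using assms(2)[of n] by (intro mult_right_mono) auto
    moreover have "\<bar>real_of_int \<lfloor>s / d n\<rfloor> - s / d n\<bar> * d n = \<bar>(real_of_int \<lfloor>s / d n\<rfloor> - s / d n) * d n\<bar>"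
      using assms(2)[of n] by (simp add: abs_mult)
    moreover have "(real_of_int \<lfloor>s / d n\<rfloor> - s / d n) * d n = real_of_int \<lfloor>s / d n\<rfloor> * d n - s"
      using assms(2)[of n] by (simp add: left_diff_distrib)
    ultimately show ?thesis by simp
  qed
  then have "(\<lambda>n. real_of_int \<lfloor>s / d n\<rfloor> * d n - s) \<longlonglongrightarrow> 0"
    by (intro Lim_null_comparison[OF _ assms(1)]) simp
  then show ?thesis by (simp add: LIM_zero_iff)
qed

text \<open>If a closed subgroup contains exponentials of arbitrarily short vectors orthogonal to its Lie
  algebra, then their integer multiples accumulate on a whole line of directions, which is absurd.\<close>

lemma no_small_orthogonal_exponentials:
  assumes A: "subgroup A K" "closedin X A"
    and y: "\<And>n. y n \<in> V" "\<And>n. y n \<noteq> 0" "\<And>n. lexp (y n) \<in> A" "y \<longlonglongrightarrow> 0"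
    and orth: "\<And>n w. w \<in> lie_algebra_of K A \<Longrightarrow> y n \<bullet> w = 0"
  shows False
proof -
  have "compact (sphere (0::'e) 1)" by simp
  note cp = this[unfolded compact_def, rule_format, of "\<lambda>n. y n /\<^sub>R norm (y n)"]
  have "y n /\<^sub>R norm (y n) \<in> sphere 0 1" for n using y(2) by simp
  from cp[OF this] obtain u r where u: "u \<in> sphere 0 1" "strict_mono (r :: nat \<Rightarrow> nat)"
    "((\<lambda>n. y n /\<^sub>R norm (y n)) \<circ> r) \<longlonglongrightarrow> u"
    by blast
  define v where "v n = y (r n) /\<^sub>R norm (y (r n))" for n
  define d where "d n = norm (y (r n))" for n
  have v: "v \<longlonglongrightarrow> u" using u(3) by (simp add: v_def[abs_def] o_def)
  have "(y \<circ> r) \<longlonglongrightarrow> 0" using y(4) u(2) LIMSEQ_subseq_LIMSEQ by blast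
  then have d: "d \<longlonglongrightarrow> 0" unfolding d_def using tendsto_norm_zero by (fastforce simp: o_def)
  have dpos: "d n > 0" for n using y(2) by (simp add: d_def)
  have yv: "y (r n) = d n *\<^sub>R v n" for n using y(2) by (simp add: d_def v_def)
  have vV: "v n \<in> V" for n using y(1) V by (simp add: v_def subspace_mul)
  have uV: "u \<in> V" using closed_sequentially[OF closed_subspace[OF V] vV v] .
  have clos: "closed {Y \<in> V. lexp Y \<in> A}"
  proof -
    have "closedin (top_of_set V) {Y \<in> topspace (top_of_set V). lexp Y \<in> A}"
      by (rule closedin_continuous_map_preimage[OF lexp_continuous A(2)])
    then show ?thesis using closedin_closed_trans closed_subspace[OF V] by fastforce
  qed
  have "lexp (s *\<^sub>R u) \<in> A" for s
  proof -
    define k where "k n = real_of_int \<lfloor>s / d n\<rfloor>" for n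
    have lim: "(\<lambda>n. (k n * d n) *\<^sub>R v n) \<longlonglongrightarrow> s *\<^sub>R u"
      unfolding k_def by (intro tendsto_scaleR floor_mult_tendsto d dpos v)
    have mem: "(k n * d n) *\<^sub>R v n \<in> {Y \<in> V. lexp Y \<in> A}" for n
    proof -
      have "(k n * d n) *\<^sub>R v n = k n *\<^sub>R y (r n)" by (simp add: yv)
      then show ?thesis using lexp_in_subgroup[OF A(1) y(1) y(3)] y(1) V by (simp add: k_def subspace_mul)
    qed
    from closed_sequentially[OF clos mem lim] show ?thesis by simp
  qed
  then have ua: "u \<in> lie_algebra_of K A" using uV by (simp add: lie_algebra_of_eq)
  have "v n \<bullet> u = 0" for n using orth[OF ua, of "r n"] by (simp add: v_def)
  then have "(\<lambda>n. v n \<bullet> u) \<longlonglongrightarrow> 0" by simp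
  moreover have "(\<lambda>n. v n \<bullet> u) \<longlonglongrightarrow> u \<bullet> u" by (intro tendsto_inner v tendsto_const)
  ultimately have "u \<bullet> u = 0" using LIMSEQ_unique by blast
  then show False using u(1) by simp
qed

text \<open>Near the identity every element factors as exp (Q z) exp (R z), with Q z in the Lie
  algebra of the torus and R z orthogonal to it. For an element of the torus the second factor lies
  in the torus as well; if it were nontrivial arbitrarily close to the identity, the vectors R z
  would contradict \<open>no_small_orthogonal_exponentials\<close>.\<close>

lemma torus_locally_exponential:
  assumes A: "torus K A"
  obtains W where "openin X W" "\<one> \<in> W" "A \<inter> W \<subseteq> lexp ` lie_algebra_of K A"
proof (rule ccontr)
  assume neg: "\<not> thesis"
  let ?a = "lie_algebra_of K A"
  have sA: "subgroup A K" and clA: "closedin X A"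
    using A Hausdorff compactin_imp_closedin by (auto simp: torus_def)
  have AG: "A \<subseteq> carrier K" using subgroup.subset[OF sA] .
  obtain Q where Q: "bounded_linear Q" "\<And>x. Q x \<in> ?a" "\<And>x. x \<in> ?a \<Longrightarrow> Q x = x"
    "\<And>x w. w \<in> ?a \<Longrightarrow> (x - Q x) \<bullet> w = 0"
    by (rule subspace_projection[OF lie_algebra_of_torus_subspace[OF A]]) (rule that)
  have QV: "Q x \<in> V" for x using Q(2) lie_algebra_ofD(1) by blast
  define R where "R z = proj z - Q z" for z
  have R: "bounded_linear R" "R z \<in> V" for z
    unfolding R_def using bounded_linear_sub[OF proj_bl Q(1)] V QV by (auto simp: subspace_diff)
  have cont: "continuous_on T Q" "continuous_on T R" for T
    using Q(1) R(1) linear_continuous_on by blast+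
  have lin0: "Q 0 = 0" "R 0 = 0" using Q(1) R(1) linear_simps(3) by blast+
  \<comment> \<open>The summand \<open>z - proj z\<close> fills in the complement of the model
    space, so that the derivative at 0 is the identity of the whole ambient space.\<close>
  define \<Phi> where "\<Phi> z = coord_mult (E (Q z), E (R z)) + (z - proj z)" for z
  define S where "S = {z. norm (Q z) < \<delta> \<and> norm (R z) < \<delta>}"
  have S: "open S" "0 \<in> S"
  proof -
    have "S = Q -` ball 0 \<delta> \<inter> R -` ball 0 \<delta>" by (auto simp: S_def)
    then show "open S" using cont by (auto intro!: open_Int open_vimage)
    show "0 \<in> S" using \<delta> by (simp add: S_def lin0)
  qed
  have SE: "norm (E (Q z)) + norm (E (R z)) \<le> r0" if "z \<in> S" for z
    using that koenigs.E_V(2)[OF QV, of z] koenigs.E_V(2)[OF R(2), of z] \<delta> by (auto simp: S_def)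
  have contE: "continuous_on S (\<lambda>z. E (Q z))" "continuous_on S (\<lambda>z. E (R z))"
    by (rule continuous_on_compose2[OF koenigs.E_continuous cont(1)], use QV in \<open>auto simp: S_def\<close>)
      (rule continuous_on_compose2[OF koenigs.E_continuous cont(2)], use R(2) in \<open>auto simp: S_def\<close>)
  have cont\<Phi>: "continuous_on S \<Phi>" unfolding \<Phi>_def
  proof (intro continuous_intros proj_continuous)
    show "continuous_on S (\<lambda>z. coord_mult (E (Q z), E (R z)))"
      by (rule continuous_on_compose2[OF coord_mult_continuous continuous_on_Pair[OF contE]])
        (use SE norm_Pair_le order_trans in \<open>auto, blast\<close>)
  qed
  have dE: "((\<lambda>z. E (f z)) has_derivative f) (at 0)"
    if f: "bounded_linear f" "\<And>z. f z \<in> V" for f :: "'e \<Rightarrow> 'e"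
  proof -
    obtain b where b: "b > 0" "\<And>x. norm (f x) \<le> norm x * b" using bounded_linear.pos_bounded[OF f(1)] by blast
    have f0: "f 0 = 0" using f(1) linear_simps(3) by blast
    have E0: "E 0 = 0" using koenigs.E_V(2)[of 0] \<delta>(1) by simp
    show ?thesis
    proof (rule has_derivative_at_0_quadratic[OF f(1)])
      show "\<delta> / b > 0" using b \<delta> by simp
      fix x :: 'e assume "norm x \<le> \<delta> / b"
      then have "norm x * b \<le> \<delta>" using b by (simp add: field_simps)
      then have n: "norm (f x) \<le> \<delta>" using b(2)[of x] by linarith
      have "norm (E (f x) - f x) \<le> 2 * (4 * C0) * norm (f x) ^ 2" by (rule koenigs.E_approx[OF f(2) n])
      also have "\<dots> \<le> 2 * (4 * C0) * (norm x * b) ^ 2"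
        using C0 b by (intro mult_left_mono power_mono) auto
      finally show "norm (E (f x) - E (f 0) - f x) \<le> (2 * (4 * C0) * b ^ 2) * norm x ^ 2"
        by (simp add: f0 E0 power_mult_distrib mult_ac)
    qed
  qed
  have der\<Phi>: "(\<Phi> has_derivative id) (at 0)"
  proof -
    have q: "((\<lambda>z. (E (Q z), E (R z))) has_derivative (\<lambda>z. (Q z, R z))) (at 0)"
      by (intro has_derivative_Pair dE Q(1) R QV)
    have E0: "E 0 = 0" using koenigs.E_V(2)[of 0] \<delta>(1) by simp
    have 1: "((\<lambda>z. coord_mult (E (Q z), E (R z))) has_derivative (\<lambda>z. proj (fst (Q z, R z)) + proj (snd (Q z, R z)))) (at 0)"
      by (rule has_derivative_compose[OF q]) (use coord_mult_deriv_0 in \<open>simp add: lin0 E0 zero_prod_def\<close>)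
    have 2: "((\<lambda>z. z - proj z) has_derivative (\<lambda>z. z - proj z)) (at 0)"
      by (intro has_derivative_diff has_derivative_ident bounded_linear_imp_has_derivative proj_bl)
    have "(\<lambda>z. proj (fst (Q z, R z)) + proj (snd (Q z, R z)) + (z - proj z)) = id"
      using QV R(2) by (auto simp: R_def)
    then show ?thesis using has_derivative_add[OF 1 2] unfolding \<Phi>_def[abs_def] by simp
  qed
  have \<Phi>0: "\<Phi> 0 = 0"
    using koenigs.E_V(2)[of 0] \<delta>(1) coord_mult_0(1)[OF from_chart(2)] by (simp add: \<Phi>_def lin0)
  have "\<exists>y. y \<in> V \<and> y \<noteq> 0 \<and> lexp y \<in> A \<and> norm y < 1 / real (Suc n) \<and> (\<forall>w\<in>?a. y \<bullet> w = 0)" for n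
  proof -
    define T where "T = S \<inter> R -` ball 0 (1 / real (Suc n))"
    have T: "open T" "0 \<in> T" "T \<subseteq> S"
      using S cont(2) by (auto simp: T_def lin0 intro!: open_Int open_vimage)
    \<comment> \<open>Openness at 0 follows from continuity near 0 together with an invertible
      derivative at this single point.\<close>
    have "\<Phi> 0 \<in> interior (\<Phi> ` T)"
      by (rule sussmann_open_mapping[OF S(1) cont\<Phi> S(2) der\<Phi> bounded_linear_ident _ T(3)])
        (use T in \<open>auto simp: interior_open o_def id_def\<close>)
    then obtain \<epsilon> where \<epsilon>: "\<epsilon> > 0" "ball 0 \<epsilon> \<subseteq> \<Phi> ` T" unfolding \<Phi>0 mem_interior by blast
    obtain W where W: "openin X W" "\<one> \<in> W" "W \<subseteq> chart_nbhd" "\<And>g. g \<in> W \<Longrightarrow> norm (to_chart g) < \<epsilon>"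
      by (rule to_chart_nbhd[OF \<epsilon>(1)]) (rule that)
    have "\<not> A \<inter> W \<subseteq> lexp ` ?a" using neg that[OF W(1,2)] by blast
    then obtain c where c: "c \<in> A" "c \<in> W" "c \<notin> lexp ` ?a" by blast
    have cU: "c \<in> chart_nbhd" using c W by blast
    have "to_chart c \<in> ball 0 \<epsilon>" using W(4)[OF c(2)] by simp
    then obtain z where z: "z \<in> T" "to_chart c = \<Phi> z" using \<epsilon>(2) by blast
    have zS: "z \<in> S" using z T by blast
    have mV: "coord_mult (E (Q z), E (R z)) \<in> V" by (rule from_chart_coord_mult(2)[OF SE[OF zS]])
    \<comment> \<open>Both terms on the right lie in the model space, whereas the left side is
      killed by \<open>proj\<close>; hence it is zero.\<close>
    have "z - proj z = to_chart c - coord_mult (E (Q z), E (R z))" by (simp add: z(2) \<Phi>_def)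
    then have "z - proj z \<in> V" using to_chart_V[OF cU] mV V by (simp add: subspace_diff)
    then have "z - proj z = proj (z - proj z)" by simp
    also have "\<dots> = 0" by (simp only: linear_diff[OF proj_linear] proj_proj diff_self)
    finally have zp: "proj z = z" by simp
    have lgc: "to_chart c = coord_mult (E (Q z), E (R z))" by (simp add: z(2) \<Phi>_def zp)
    have nq: "norm (Q z) \<le> \<delta>" "norm (R z) \<le> \<delta>" using zS by (auto simp: S_def)
    have "c = from_chart (coord_mult (E (Q z), E (R z)))" using from_chart(7)[OF cU] lgc by simp
    also have "\<dots> = lexp (Q z) \<otimes> lexp (R z)"
      using from_chart_coord_mult(1)[OF SE[OF zS]] lexp_small[OF QV nq(1)] lexp_small[OF R(2) nq(2)] by (simp add: near_exp_def)
    finally have cc: "c = lexp (Q z) \<otimes> lexp (R z)" .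
    have qA: "lexp (Q z) \<in> A" using lie_algebra_ofD(3)[OF Q(2)] .
    have car: "lexp (Q z) \<in> carrier K" "lexp (R z) \<in> carrier K" using QV R(2) by simp_all
    have "lexp (R z) = inv (lexp (Q z)) \<otimes> c" using car by (simp add: cc m_assoc[symmetric])
    then have RA: "lexp (R z) \<in> A"
      using subgroup.m_closed[OF sA subgroup.m_inv_closed[OF sA qA] c(1)] by simp
    have R0: "R z \<noteq> 0"
    proof
      assume "R z = 0"
      then have "c = lexp (Q z)" using cc car by simp
      then show False using c(3) Q(2) by blast
    qed
    have "R z \<bullet> w = 0" if "w \<in> ?a" for w using Q(4)[OF that, of z] by (simp add: R_def zp)
    moreover have "norm (R z) < 1 / real (Suc n)" using z(1) by (simp add: T_def)
    ultimately show ?thesis using R(2) R0 RA by blast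
  qed
  then obtain y where y: "\<And>n. y n \<in> V" "\<And>n. y n \<noteq> 0" "\<And>n. lexp (y n) \<in> A"
    "\<And>n. norm (y n) < 1 / real (Suc n)" "\<And>n w. w \<in> ?a \<Longrightarrow> y n \<bullet> w = 0" by metis
  have "y \<longlonglongrightarrow> 0"
    by (rule Lim_null_comparison[OF _ LIMSEQ_inverse_real_of_nat])
      (use y(4) in \<open>auto simp: inverse_eq_divide less_imp_le intro!: always_eventually\<close>)
  from no_small_orthogonal_exponentials[OF sA clA y(1-3) this y(5)] show False .
qed

text \<open>The exponential image is a subgroup that contains a neighbourhood of the identity in the
  torus. Its cosets are therefore open, so it is open and closed, and the torus is
  connected.\<close>

lemma torus_exponential:
  assumes A: "torus K A"
  shows "A = lexp ` lie_algebra_of K A"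
proof
  let ?a = "lie_algebra_of K A" and ?B = "lexp ` lie_algebra_of K A"
  have sA: "subgroup A K" and conA: "connectedin X A" using A by (auto simp: torus_def)
  have AG: "A \<subseteq> carrier K" using subgroup.subset[OF sA] .
  note sub = lie_algebra_of_torus_subspace[OF A]
  show BA: "?B \<subseteq> A" using lie_algebra_ofD(3) by blast
  have Bm: "g \<otimes> h \<in> ?B" if gh: "g \<in> ?B" "h \<in> ?B" for g h
  proof -
    obtain Y Z where YZ: "Y \<in> ?a" "Z \<in> ?a" "g = lexp Y" "h = lexp Z" using gh by blast
    then have "g \<otimes> h = lexp (Y + Z)" using torus_lexp_add[OF A YZ(1,2)] by simp
    then show ?thesis using subspace_add[OF sub YZ(1,2)] by blast
  qed
  have Bi: "inv g \<in> ?B" if gB: "g \<in> ?B" for g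
  proof -
    obtain Y where Y: "Y \<in> ?a" "g = lexp Y" using gB by blast
    have mY: "- Y \<in> ?a" using sub Y subspace_neg by blast
    have "lexp (- Y) \<otimes> lexp Y = lexp (- Y + Y)" using torus_lexp_add[OF A mY Y(1)] by simp
    then have "lexp (- Y) \<otimes> lexp Y = \<one>" by simp
    then have "inv g = lexp (- Y)" using Y mY lie_algebra_ofD(1) by (intro inv_equality) auto
    then show ?thesis using mY by blast
  qed
  have "\<one> \<in> ?B" using subspace_0[OF sub] lexp_0 by force
  obtain W where W: "openin X W" "\<one> \<in> W" "A \<inter> W \<subseteq> ?B" by (rule torus_locally_exponential[OF A]) (rule that)
  have tr: "openin X {g \<in> topspace X. inv a \<otimes> g \<in> W}" if "a \<in> A" for a
    by (rule openin_continuous_map_preimage[OF continuous_map_mult W(1)])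
      (use that AG in \<open>auto simp: topspace_topo\<close>)
  have trB: "inv a \<otimes> g \<in> ?B" if "a \<in> A" "g \<in> A" "inv a \<otimes> g \<in> W" for a g
    using that W(3) subgroup.m_closed[OF sA subgroup.m_inv_closed[OF sA]] by blast
  \<comment> \<open>One criterion covers the image and its complement: both are unions of cosets,
    and a translate of \<open>W\<close> meets the torus within a single coset.\<close>
  have op: "openin (subtopology X A) P" if P: "P \<subseteq> A" "\<And>a g. a \<in> P \<Longrightarrow> g \<in> A \<Longrightarrow> inv a \<otimes> g \<in> ?B \<Longrightarrow> g \<in> P" for P
  proof (subst openin_subopen, intro ballI)
    fix a assume a: "a \<in> P"
    let ?T = "{g \<in> topspace X. inv a \<otimes> g \<in> W} \<inter> A"
    have "openin (subtopology X A) ?T"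
      using tr[of a] a P(1) by (auto simp: openin_subtopology)
    moreover have "a \<in> ?T" using a P(1) AG W(2) by (auto simp: topspace_topo)
    moreover have "?T \<subseteq> P" using P a trB by blast
    ultimately show "\<exists>T. openin (subtopology X A) T \<and> a \<in> T \<and> T \<subseteq> P" by blast
  qed
  have rew: "a \<otimes> (inv a \<otimes> g) = g" "inv (inv a \<otimes> g) \<otimes> inv a = inv g" if "a \<in> A" "g \<in> A" for a g
  proof -
    have "a \<in> carrier K" "g \<in> carrier K" using that AG by auto
    then show "a \<otimes> (inv a \<otimes> g) = g" "inv (inv a \<otimes> g) \<otimes> inv a = inv g"
      by (simp_all add: m_assoc[symmetric] inv_mult_group) (simp add: m_assoc)
  qed
  have B1: "openin (subtopology X A) ?B"
  proof (rule op[OF BA])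
    fix a g assume ag: "a \<in> ?B" "g \<in> A" "inv a \<otimes> g \<in> ?B"
    have "a \<in> A" using ag(1) BA by blast
    from Bm[OF ag(1,3)] show "g \<in> ?B" by (simp only: rew(1)[OF \<open>a \<in> A\<close> ag(2)])
  qed
  have "openin (subtopology X A) (A - ?B)"
  proof (rule op)
    fix a g assume ag: "a \<in> A - ?B" "g \<in> A" "inv a \<otimes> g \<in> ?B"
    have "g \<notin> ?B"
    proof
      assume "g \<in> ?B"
      then have "g \<otimes> inv (inv a \<otimes> g) \<in> ?B" using Bm Bi ag by blast
      moreover have "g \<otimes> inv (inv a \<otimes> g) = a"
      proof -
        have "a \<in> carrier K" "g \<in> carrier K" using ag AG by auto
        then show ?thesis by (simp add: inv_mult_group) (simp add: m_assoc[symmetric])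
      qed
      ultimately show False using ag by simp
    qed
    then show "g \<in> A - ?B" using ag by blast
  qed blast
  then have B2: "closedin (subtopology X A) ?B"
    using BA AG by (simp add: closedin_def topspace_topo Int_absorb1)
  have "connected_space (subtopology X A)" using conA by (simp add: connectedin_def)
  then have "?B = topspace (subtopology X A)"
    using B1 B2 \<open>\<one> \<in> ?B\<close> unfolding connected_space_clopen_in by blast
  then show "A \<subseteq> ?B" using AG by (auto simp: topspace_topo)
qed

end

section \<open>Root planes in metric Lie algebras\<close>

locale inner_form =
  fixes B :: "'e::euclidean_space \<Rightarrow> 'e \<Rightarrow> real"
  assumes B: "bilinear B" and B_sym: "B x y = B y x" and B_pos: "x \<noteq> 0 \<Longrightarrow> B x x > 0"
begin

lemmas B_simps [simp] = bilinear_ladd[OF B] bilinear_radd[OF B] bilinear_lmul[OF B] bilinear_rmul[OF B]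
  bilinear_lneg[OF B] bilinear_rneg[OF B] bilinear_lzero[OF B] bilinear_rzero[OF B]
  bilinear_lsub[OF B] bilinear_rsub[OF B]

lemma B_eq_0 [simp]: "B x x = 0 \<longleftrightarrow> x = 0" using B_pos[of x] by fastforce
lemma B_nonneg [simp]: "B x x \<ge> 0" using B_pos[of x] by (cases "x = 0") auto

text \<open>The Gram operator of \<open>B\<close>, compressed to \<open>W\<close> by the projection,
  is completed by the identity on the complement to an endomorphism \<open>N\<close> of the ambient
  space. Definiteness makes \<open>N\<close> injective, hence surjective, and a solution of
  \<open>N x = P a\<close> lies in \<open>W\<close>.\<close>

lemma riesz:
  assumes W: "subspace W" and f: "\<And>x y. x \<in> W \<Longrightarrow> y \<in> W \<Longrightarrow> f (x + y) = f x + f y"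
    "\<And>c x. x \<in> W \<Longrightarrow> f (c *\<^sub>R x) = c * f x"
  obtains w where "w \<in> W" "\<And>y. y \<in> W \<Longrightarrow> f y = B w y"
proof -
  obtain P where P: "bounded_linear P" "\<And>x. P x \<in> W" "\<And>x. x \<in> W \<Longrightarrow> P x = x"
    "\<And>x w. w \<in> W \<Longrightarrow> (x - P x) \<bullet> w = 0"
    by (rule subspace_projection[OF W]) (rule that)
  have Pl: "linear P" using P(1) by (rule bounded_linear.linear)
  define S where "S x = (\<Sum>b\<in>Basis. B x b *\<^sub>R b)" for x
  have Bl: "linear (B x)" "linear (\<lambda>x. B x y)" for x y using B by (auto simp: bilinear_def)
  have Sl: "linear S"
    by (rule linearI) (simp_all add: S_def scaleR_add_left sum.distrib scaleR_sum_right)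
  have S: "S x \<bullet> y = B x y" for x y
  proof -
    have "S x \<bullet> y = (\<Sum>b\<in>Basis. B x b * (b \<bullet> y))" by (simp add: S_def inner_sum_left)
    also have "\<dots> = (\<Sum>b\<in>Basis. B x ((y \<bullet> b) *\<^sub>R b))" by (simp add: inner_commute mult.commute)
    also have "\<dots> = B x (\<Sum>b\<in>Basis. (y \<bullet> b) *\<^sub>R b)" by (simp only: linear_sum[OF Bl(1)])
    finally show ?thesis by (simp only: euclidean_representation)
  qed
  define N where "N x = P (S (P x)) + (x - P x)" for x
  have Nl: "linear N" unfolding N_def
    by (intro linear_compose_add linear_compose_sub linear_ident Pl linear_compose[OF linear_compose[OF Pl Sl] Pl, unfolded o_def])
  have fixP: "P x = x" if "x - P x \<in> W" for x
  proof -
    have "x - P x = P (x - P x)" using P(3)[OF that] by simp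
    then show ?thesis using P(3)[OF P(2)[of x]] by (simp add: linear_diff[OF Pl])
  qed
  have PS: "P (S x) \<bullet> y = B x y" if "y \<in> W" for x y
    using P(4)[OF that, of "S x"] by (simp add: inner_diff_left S)
  have "inj N"
  proof (subst linear_injective_0[OF Nl], intro allI impI)
    fix x assume N0: "N x = 0"
    then have "x - P x = - P (S (P x))" by (simp add: N_def add_eq_0_iff)
    then have "x - P x \<in> W" using P(2) W by (simp add: subspace_neg)
    then have px: "P x = x" by (rule fixP)
    then have "P (S x) \<bullet> x = 0" using N0 by (simp add: N_def)
    then have "B x x = 0" using PS[of x x] P(2)[of x] px by simp
    then show "x = 0" by simp
  qed
  then have "surj N" by (rule linear_injective_imp_surjective[OF Nl]) simp
  define a where "a = (\<Sum>b\<in>Basis. f (P b) *\<^sub>R b)"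
  obtain x where x: "N x = P a" using \<open>surj N\<close> by (metis surjD)
  have "x - P x = P a - P (S (P x))" using x by (simp add: N_def algebra_simps)
  then have "x - P x \<in> W" using P(2) W by (simp add: subspace_diff)
  then have px: "P x = x" by (rule fixP)
  have fl: "linear (\<lambda>z. f (P z))"
    by (rule linearI) (simp_all add: linear_add[OF Pl] linear_cmul[OF Pl] f P(2))
  have "f y = B x y" if y: "y \<in> W" for y
  proof -
    have "B x y = P (S x) \<bullet> y" using PS[OF y] by simp
    also have "\<dots> = P a \<bullet> y" using x px by (simp add: N_def)
    also have "\<dots> = a \<bullet> y" using P(4)[OF y, of a] by (simp add: inner_diff_left)
    also have "\<dots> = (\<Sum>b\<in>Basis. (y \<bullet> b) *\<^sub>R f (P b))" by (simp add: a_def inner_sum_left inner_commute[of y] mult.commute)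
    also have "\<dots> = f (P (\<Sum>b\<in>Basis. (y \<bullet> b) *\<^sub>R b))"
      by (simp only: linear_sum[OF fl] linear_cmul[OF fl])
    finally show ?thesis using P(3)[OF y] by (simp only: euclidean_representation)
  qed
  then show thesis using that[of x] P(2)[of x] px by simp
qed

lemma riesz_unique: "subspace W \<Longrightarrow> w \<in> W \<Longrightarrow> w' \<in> W \<Longrightarrow> (\<And>y. y \<in> W \<Longrightarrow> B w y = B w' y) \<Longrightarrow> w = w'"
proof -
  assume *: "subspace W" "w \<in> W" "w' \<in> W" "\<And>y. y \<in> W \<Longrightarrow> B w y = B w' y"
  have "B (w - w') (w - w') = 0"
    using *(4)[OF subspace_diff[OF *(1-3)]] unfolding bilinear_lsub[OF B, of w w'] by simp
  then show "w = w'" by (simp only: B_eq_0 right_minus_eq)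
qed

lemma quadratic_nonneg_linear_zero:
  fixes a c :: real
  assumes "\<And>t. 0 \<le> 2 * t * a + t^2 * c" shows "a = 0"
proof (rule ccontr)
  assume a: "a \<noteq> 0"
  define k where "k = \<bar>c\<bar> + 1"
  have k: "k > 0" "c < k" by (auto simp: k_def)
  have "0 \<le> (2 * (- a / k) * a + (- a / k)^2 * c) * k^2"
    using assms[of "- a / k"] by (intro mult_nonneg_nonneg) auto
  also have "\<dots> = a^2 * (c - 2 * k)" using k(1) by (simp add: field_simps power2_eq_square)
  finally have "0 \<le> a^2 * (c - 2 * k)" .
  moreover have "a^2 * (c - 2 * k) < 0" using a k by (intro mult_pos_neg) auto
  ultimately show False by simp
qed

text \<open>At a maximizer \<open>u\<close> of the Rayleigh quotient, with maximum \<open>l\<close>,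
  the nonnegative quadratic form l B(v, v) - B(T v, v) vanishes, so its first variation there is
  zero.\<close>

lemma symmetric_eigenvector:
  assumes M: "subspace M" "M \<noteq> {0}" and T: "linear T" "\<And>u. u \<in> M \<Longrightarrow> T u \<in> M"
    and sym: "\<And>u v. u \<in> M \<Longrightarrow> v \<in> M \<Longrightarrow> B (T u) v = B u (T v)"
  obtains l u where "u \<in> M" "u \<noteq> 0" "T u = l *\<^sub>R u"
proof -
  interpret bb: bounded_bilinear B using B bilinear_conv_bounded_bilinear by blast
  define S where "S = M \<inter> sphere 0 1"
  define f where "f u = B (T u) u / B u u" for u
  have "compact S" unfolding S_def by (intro closed_Int_compact closed_subspace M compact_sphere)
  moreover have "S \<noteq> {}"
  proof -
    obtain v where v: "v \<in> M" "v \<noteq> 0" using M subspace_0 by blast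
    then have "v /\<^sub>R norm v \<in> S" using M(1) by (simp add: S_def subspace_mul)
    then show ?thesis by blast
  qed
  moreover have "continuous_on S f" unfolding f_def
  proof (intro continuous_on_divide bb.continuous_on continuous_on_id)
    show "continuous_on S T" using T(1) linear_continuous_on linear_conv_bounded_linear by blast
    show "\<forall>x\<in>S. B x x \<noteq> 0" by (auto simp: S_def)
  qed
  ultimately have "\<exists>u\<in>S. \<forall>v\<in>S. f v \<le> f u" by (rule continuous_attains_sup)
  then obtain u where u: "u \<in> S" "\<And>v. v \<in> S \<Longrightarrow> f v \<le> f u" by blast
  have uM: "u \<in> M" "u \<noteq> 0" using u by (auto simp: S_def)
  define l where "l = f u"
  have le: "B (T v) v \<le> l * B v v" if "v \<in> M" for v
  proof (cases "v = 0")
    case True then show ?thesis using linear_0[OF T(1)] by simp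
  next
    case False
    have "v /\<^sub>R norm v \<in> S" using False that M(1) by (simp add: S_def subspace_mul)
    then have "f (v /\<^sub>R norm v) \<le> l" using u by (simp add: l_def)
    moreover have "f (v /\<^sub>R norm v) = f v" using False by (simp add: f_def linear_cmul[OF T(1)])
    ultimately show ?thesis using B_pos[OF False] by (simp add: f_def pos_divide_le_eq)
  qed
  have eq: "B (T u) u = l * B u u" using uM by (simp add: l_def f_def)
  have "l * B u v - B (T u) v = 0" if v: "v \<in> M" for v
  proof (rule quadratic_nonneg_linear_zero)
    fix t :: real
    have "u + t *\<^sub>R v \<in> M" using uM v M by (simp add: subspace_add subspace_mul)
    from le[OF this] have "0 \<le> l * B (u + t *\<^sub>R v) (u + t *\<^sub>R v) - B (T (u + t *\<^sub>R v)) (u + t *\<^sub>R v)" by simp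
    also have "\<dots> = 2 * t * (l * B u v - B (T u) v) + t^2 * (l * B v v - B (T v) v)"
      using sym[OF uM(1) v] eq
      by (simp add: linear_add[OF T(1)] linear_cmul[OF T(1)] B_sym[of v u] B_sym[of u "T v"] algebra_simps power2_eq_square)
    finally show "0 \<le> 2 * t * (l * B u v - B (T u) v) + t^2 * (l * B v v - B (T v) v)" .
  qed
  then have "B (l *\<^sub>R u - T u) v = 0" if "v \<in> M" for v using that by simp
  moreover have "l *\<^sub>R u - T u \<in> M" using uM M T by (simp add: subspace_diff subspace_mul)
  ultimately have "l *\<^sub>R u - T u = 0" using B_eq_0 by blast
  then show thesis using that[of u l] uM by simp
qed

end

locale metric_lie_algebra = inner_form B for B :: "'e::euclidean_space \<Rightarrow> 'e \<Rightarrow> real" +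
  fixes br :: "'e \<Rightarrow> 'e \<Rightarrow> 'e"
  assumes br: "bilinear br" and br_anti: "br x y = - br y x"
    and jacobi: "br x (br y z) = br (br x y) z + br y (br x z)"
    and B_inv: "B (br z x) y = - B x (br z y)"
begin

lemmas br_simps [simp] = bilinear_ladd[OF br] bilinear_radd[OF br] bilinear_lmul[OF br] bilinear_rmul[OF br]
  bilinear_lneg[OF br] bilinear_rneg[OF br] bilinear_lzero[OF br] bilinear_rzero[OF br]
  bilinear_lsub[OF br] bilinear_rsub[OF br]

lemma br_self [simp]: "br x x = 0" proof -
  have "br x x + br x x = 0" using br_anti[of x x] by (simp only: add_eq_0_iff)
  then show ?thesis by (simp add: scaleR_2[symmetric])
qed

lemma br_linear: "linear (br x)" using br by (simp add: bilinear_def)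

text \<open>\<open>pair A r U W\<close>: the vector \<open>U + \<i> W\<close> has the weight \<open>B r\<close> under \<open>A\<close>. In an orthonormal plane the
  invariance of \<open>B\<close> forces this weight to be represented by \<open>[W, U]\<close>.\<close>

definition "pair A r U W \<longleftrightarrow> (\<forall>X\<in>A. br X U = - (B r X) *\<^sub>R W \<and> br X W = B r X *\<^sub>R U)"
definition "plane A U W \<longleftrightarrow> B U U = 1 \<and> B W W = 1 \<and> B U W = 0 \<and> pair A (br W U) U W"

lemma B_br_swap: "B (br W U) X = B (br X W) U"
proof -
  have "B (br W U) X = - B U (br W X)" by (rule B_inv)
  also have "\<dots> = B U (br X W)" by (subst br_anti) simp
  finally show ?thesis by (simp add: B_sym)
qed

text \<open>On a nonzero invariant subspace of least dimension every symmetric operator commuting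
  with the action is scalar. The square of a nonzero \<open>br X0\<close> is one, with a negative
  eigenvalue, so a rescaling \<open>I\<close> of \<open>br X0\<close> is a complex structure. Each
  \<open>br X\<close> composed with \<open>I\<close> is symmetric again, hence scalar, and all of
  \<open>A\<close> acts on the plane of \<open>U\<close> and \<open>I U\<close>.\<close>

lemma invariant_plane:
  assumes A: "\<And>X Y. X \<in> A \<Longrightarrow> Y \<in> A \<Longrightarrow> br X Y = 0"
    and M: "subspace M" "M \<noteq> {0}" "\<And>X u. X \<in> A \<Longrightarrow> u \<in> M \<Longrightarrow> br X u \<in> M"
    and nz: "\<And>u. u \<in> M \<Longrightarrow> (\<And>X. X \<in> A \<Longrightarrow> br X u = 0) \<Longrightarrow> u = 0"
  obtains U W X where "U \<in> M" "W \<in> M" "plane A U W" "X \<in> A" "B (br W U) X \<noteq> 0"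
proof -
  define good where "good N \<longleftrightarrow> subspace N \<and> N \<noteq> {0} \<and> N \<subseteq> M \<and> (\<forall>X\<in>A. \<forall>u\<in>N. br X u \<in> N)" for N
  have "good M" using M by (auto simp: good_def)
  then obtain N where N: "good N" "\<And>N'. good N' \<Longrightarrow> dim N \<le> dim N'"
    using ex_has_least_nat[of good M dim] by blast
  have Ns: "subspace N" "N \<noteq> {0}" "N \<subseteq> M" and Ni: "\<And>X u. X \<in> A \<Longrightarrow> u \<in> N \<Longrightarrow> br X u \<in> N"
    using N(1) by (auto simp: good_def)
  \<comment> \<open>An eigenspace of \<open>T\<close> is itself invariant, so minimality of the
    dimension makes it the whole of \<open>N\<close>.\<close>
  have scalar: "\<exists>l. \<forall>u\<in>N. T u = l *\<^sub>R u"
    if T: "linear T" "\<And>u. u \<in> N \<Longrightarrow> T u \<in> N" and sym: "\<And>u v. u \<in> N \<Longrightarrow> v \<in> N \<Longrightarrow> B (T u) v = B u (T v)"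
      and com: "\<And>X u. X \<in> A \<Longrightarrow> u \<in> N \<Longrightarrow> T (br X u) = br X (T u)" for T
  proof -
    obtain l u where lu: "u \<in> N" "u \<noteq> 0" "T u = l *\<^sub>R u"
      by (rule symmetric_eigenvector[OF Ns(1,2) T sym], assumption, assumption, assumption, erule (2) that)
    define N' where "N' = {u \<in> N. T u = l *\<^sub>R u}"
    have "subspace N'" unfolding N'_def using Ns(1)
      by (intro subspaceI)
        (auto simp: linear_add[OF T(1)] linear_cmul[OF T(1)] linear_0[OF T(1)] scaleR_add_right subspace_0 subspace_add subspace_mul)
    moreover have "N' \<noteq> {0}" using lu by (auto simp: N'_def)
    ultimately have "good N'" using Ns Ni com by (auto simp: good_def N'_def)
    then have "dim N \<le> dim N'" by (rule N(2))
    then have "N' = N" using \<open>subspace N'\<close> Ns(1) by (intro subspace_dim_equal) (auto simp: N'_def)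
    then show ?thesis by (auto simp: N'_def)
  qed
  have brc: "br X (br Y u) = br Y (br X u)" if "X \<in> A" "Y \<in> A" for X Y u
    using jacobi[of X Y u] A[OF that] by simp
  obtain u0 where u0: "u0 \<in> N" "u0 \<noteq> 0" using Ns subspace_0 by blast
  obtain X0 where X0: "X0 \<in> A" "br X0 u0 \<noteq> 0" using nz[of u0] u0 Ns(3) by blast
  have "\<exists>l. \<forall>u\<in>N. (br X0 \<circ> br X0) u = l *\<^sub>R u"
  proof (rule scalar)
    show "linear (br X0 \<circ> br X0)" by (intro linear_compose br_linear)
    show "B ((br X0 \<circ> br X0) u) v = B u ((br X0 \<circ> br X0) v)" for u v by (simp add: B_inv)
    show "(br X0 \<circ> br X0) (br X u) = br X ((br X0 \<circ> br X0) u)" if "X \<in> A" for X u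
      using brc[OF X0(1) that] by simp
  qed (use Ni X0(1) in auto)
  then obtain l where l: "\<And>u. u \<in> N \<Longrightarrow> br X0 (br X0 u) = l *\<^sub>R u" by auto
  have "l * B u0 u0 = B (br X0 (br X0 u0)) u0" using l[OF u0(1)] by simp
  also have "\<dots> = - B (br X0 u0) (br X0 u0)" by (rule B_inv)
  also have "\<dots> < 0" using B_pos[OF X0(2)] by simp
  finally have "l < 0" using B_pos[OF u0(2)] by (simp add: mult_less_0_iff)
  define c where "c = sqrt (- l)"
  have c: "c > 0" "c * c = - l" using \<open>l < 0\<close> by (auto simp: c_def)
  define I where "I u = br X0 u /\<^sub>R c" for u
  have Ilin: "linear I" unfolding I_def
    by (rule linear_compose_scale_right[OF br_linear])
  have IN: "u \<in> N \<Longrightarrow> I u \<in> N" for u using Ni[OF X0(1)] Ns(1) by (simp add: I_def subspace_mul)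
  have II: "I (I u) = - u" if "u \<in> N" for u
  proof -
    have "I (I u) = (inverse c * inverse c * l) *\<^sub>R u" using l[OF that] by (simp add: I_def)
    also have "inverse c * inverse c * l = -1" using c \<open>l < 0\<close> by (simp add: field_simps)
    finally show ?thesis by simp
  qed
  have Iskew: "B (I u) v = - B u (I v)" for u v by (simp add: I_def B_inv)
  have Ic: "br X (I u) = I (br X u)" if "X \<in> A" for X u using brc[OF that X0(1)] by (simp add: I_def)
  have "\<exists>s. \<forall>u\<in>N. br X (I u) = s *\<^sub>R u" if X: "X \<in> A" for X
  proof -
    have "\<exists>s. \<forall>u\<in>N. (br X \<circ> I) u = s *\<^sub>R u"
    proof (rule scalar)
      show "linear (br X \<circ> I)" by (intro linear_compose br_linear Ilin)
      show "B ((br X \<circ> I) u) v = B u ((br X \<circ> I) v)" for u v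
      proof -
        have "B ((br X \<circ> I) u) v = B u (I (br X v))" by (simp add: B_inv Iskew)
        then show ?thesis by (simp add: Ic[OF X])
      qed
      show "(br X \<circ> I) (br Y u) = br Y ((br X \<circ> I) u)" if "Y \<in> A" for Y u
        using brc[OF X that] Ic[OF that, of u, symmetric] by simp
    qed (use IN Ni X in auto)
    then show ?thesis by simp
  qed
  then obtain s where s: "\<And>X u. X \<in> A \<Longrightarrow> u \<in> N \<Longrightarrow> br X (I u) = s X *\<^sub>R u" by metis
  have brX: "br X u = - s X *\<^sub>R I u" if "X \<in> A" "u \<in> N" for X u
  proof -
    have "br X (I (I u)) = s X *\<^sub>R I u" by (rule s[OF that(1) IN[OF that(2)]])
    then have "- br X u = s X *\<^sub>R I u" using II[OF that(2)] by simp
    then have "br X u = - (s X *\<^sub>R I u)" by (metis minus_minus)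
    then show ?thesis by simp
  qed
  define U where "U = u0 /\<^sub>R sqrt (B u0 u0)"
  define W where "W = I U"
  have UN: "U \<in> N" using u0 Ns(1) by (simp add: U_def subspace_mul)
  have WN: "W \<in> N" using IN[OF UN] by (simp add: W_def)
  have UU: "B U U = 1" using B_pos[OF u0(2)] u0(2) by (simp add: U_def field_simps)
  have WW: "B W W = 1" using II[OF UN] UU by (simp add: W_def Iskew)
  have UW: "B U W = 0" using Iskew[of U U] by (simp add: W_def B_sym)
  have sX: "s X = B (br W U) X" if "X \<in> A" for X
    using s[OF that UN] UU by (simp add: B_br_swap W_def)
  have "pair A (br W U) U W"
    unfolding pair_def using brX[OF _ UN] s[OF _ UN] sX by (auto simp: W_def)
  then have pl: "plane A U W" using UU WW UW by (simp add: plane_def)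
  have "s X0 \<noteq> 0"
  proof
    assume "s X0 = 0"
    then have "br X0 u0 = 0" using brX[OF X0(1) u0(1)] by simp
    then show False using X0(2) by simp
  qed
  then show thesis using that[OF _ _ pl X0(1)] UN WN Ns(3) sX[OF X0(1)] by auto
qed

end

text \<open>\<open>G\<close> is the Lie algebra proper, inside an ambient space on which form and
  bracket are defined everywhere. The condition on centralizers is the regularity of
  \<open>x\<close>; this one vector determines the Cartan subalgebra and, by the sign of its
  products with roots, positivity.\<close>

locale toral_algebra = metric_lie_algebra +
  fixes G :: "'a::euclidean_space set" and x :: 'a
  assumes G: "subspace G" and br_G [simp]: "br Y Z \<in> G" and x_G: "x \<in> G"
    and centralizer_abelian: "\<And>Y Z. Y \<in> G \<Longrightarrow> Z \<in> G \<Longrightarrow> br x Y = 0 \<Longrightarrow> br x Z = 0 \<Longrightarrow> br Y Z = 0"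
begin

definition "cartan = {Y \<in> G. br x Y = 0}"

lemma cartan_subspace: "subspace cartan"
  unfolding cartan_def using G by (intro subspaceI) (auto simp: subspace_0 subspace_add subspace_mul)
lemma x_cartan: "x \<in> cartan" using x_G by (simp add: cartan_def)
lemma cartan_abelian: "Y \<in> cartan \<Longrightarrow> Z \<in> cartan \<Longrightarrow> br Y Z = 0"
  using centralizer_abelian by (auto simp: cartan_def)
lemma cartan_G: "Y \<in> cartan \<Longrightarrow> Y \<in> G" by (simp add: cartan_def)

lemma pair_orthogonal_cartan:
  assumes "pair cartan r U W" "r \<in> cartan" "r \<noteq> 0" "Y \<in> cartan"
  shows "B U Y = 0" "B W Y = 0"
proof -
  have r: "br r U = - (B r r) *\<^sub>R W" "br r W = B r r *\<^sub>R U" using assms by (auto simp: pair_def)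
  have z: "B (br r Z) Y = 0" for Z using cartan_abelian[OF assms(2,4)] by (simp add: B_inv)
  have p: "B r r \<noteq> 0" using assms(3) by simp
  show "B U Y = 0" using z[of W] p unfolding r(2) by simp
  show "B W Y = 0" using z[of U] p unfolding r(1) by simp
qed

text \<open>The skew operator \<open>br r\<close> acts on both pairs with the same weight;
  evaluation at \<open>r\<close> itself makes the common factor \<open>B r r\<close>
  nonzero.\<close>

lemma pair_products:
  assumes "pair cartan r U1 W1" "pair cartan r U2 W2" "r \<in> cartan" "r \<noteq> 0"
  shows "B U2 U1 = B W2 W1" "B W2 U1 = - B U2 W1"
proof -
  have r: "br r U1 = - (B r r) *\<^sub>R W1" "br r U2 = - (B r r) *\<^sub>R W2" "br r W2 = B r r *\<^sub>R U2"
    using assms by (auto simp: pair_def)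
  have p: "B r r \<noteq> 0" using assms(4) by simp
  have "B (br r W2) U1 = - B W2 (br r U1)" "B (br r U2) U1 = - B U2 (br r U1)" by (rule B_inv)+
  then have e: "B r r * B U2 U1 = B r r * B W2 W1" "- (B r r * B W2 U1) = B r r * B U2 W1" unfolding r by simp_all
  show "B U2 U1 = B W2 W1" using e(1) p by simp
  have "B r r * (B W2 U1 + B U2 W1) = 0" using e(2) by (simp add: algebra_simps)
  then show "B W2 U1 = - B U2 W1" using p by (simp add: add_eq_0_iff)
qed

lemma pair_self:
  assumes "pair cartan r U W" "r \<in> cartan" "r \<noteq> 0"
  shows "B U U = B W W" "B U W = 0"
  using pair_products[OF assms(1,1,2,3)] by (simp_all add: B_sym[of W U])

lemma plane_root_cartan:
  assumes "plane cartan U W" shows "br W U \<in> cartan"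
proof -
  define c where "c = B (br W U) x"
  have p: "br x U = - c *\<^sub>R W" "br x W = c *\<^sub>R U"
    using assms x_cartan by (auto simp: plane_def pair_def c_def)
  have "br x (br W U) = 0" using jacobi[of x W U] p by simp
  then show ?thesis by (simp add: cartan_def)
qed

lemma plane_pair: "plane cartan U W \<Longrightarrow> pair cartan (br W U) U W" by (simp add: plane_def)

lemma plane_swap: "plane cartan U W \<Longrightarrow> plane cartan W U"
  using br_anti[of U W] by (auto simp: plane_def pair_def B_sym)

text \<open>Roots are vectors of the Cartan subalgebra rather than functionals on it, so that
  reflections and half sums can be formed with \<open>B\<close>.\<close>

definition "root_set = {r \<in> cartan. r \<noteq> 0 \<and> (\<exists>U\<in>G. \<exists>W\<in>G. (U, W) \<noteq> (0, 0) \<and> pair cartan r U W)}"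

lemma root_plane:
  assumes "r \<in> root_set"
  obtains U W where "U \<in> G" "W \<in> G" "plane cartan U W" "br W U = r"
proof -
  obtain U0 W0 where *: "r \<in> cartan" "r \<noteq> 0" "U0 \<in> G" "W0 \<in> G" "(U0, W0) \<noteq> (0, 0)" "pair cartan r U0 W0"
    using assms by (auto simp: root_set_def)
  note s = pair_self[OF *(6,1,2)]
  have "B U0 U0 \<noteq> 0" using *(5) s(1) by auto
  then have pos: "B U0 U0 > 0" using B_nonneg[of U0] by linarith
  define c where "c = 1 / sqrt (B U0 U0)"
  have cc: "c * (c * B U0 U0) = 1" using pos \<open>B U0 U0 \<noteq> 0\<close> by (simp add: c_def field_simps)
  define U where "U = c *\<^sub>R U0"
  define W where "W = c *\<^sub>R W0"
  have p: "pair cartan r U W" using *(6) by (auto simp: pair_def U_def W_def mult.commute)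
  have on: "B U U = 1" "B W W = 1" "B U W = 0" using cc s by (simp_all add: U_def W_def)
  have "br x (br W U) = 0" using jacobi[of x W U] p x_cartan by (simp add: pair_def)
  then have t: "br W U \<in> cartan" by (simp add: cartan_def)
  have "br W U = r"
  proof (rule riesz_unique[OF cartan_subspace t *(1)])
    fix Y assume "Y \<in> cartan"
    then show "B (br W U) Y = B r Y" using p on(1) by (subst B_br_swap) (simp add: pair_def)
  qed
  moreover have "plane cartan U W" using on p calculation by (simp add: plane_def)
  moreover have "U \<in> G" "W \<in> G" using * G by (simp_all add: U_def W_def subspace_mul)
  ultimately show thesis using that by blast
qed

text \<open>A root vanishing at \<open>x\<close> would put both vectors of its plane into the
  centralizer of \<open>x\<close>; this is abelian, so the root [W, U] would be zero.\<close>

lemma plane_root: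
  assumes "plane cartan U W" "U \<in> G" "W \<in> G" "br W U \<noteq> 0"
  shows "br W U \<in> root_set" "B (br W U) x \<noteq> 0"
proof -
  have n0: "U \<noteq> 0" using assms(1) by (auto simp: plane_def)
  show "B (br W U) x \<noteq> 0"
  proof
    assume "B (br W U) x = 0"
    then have "br x U = 0" "br x W = 0" using plane_pair[OF assms(1)] x_cartan by (auto simp: pair_def)
    then have "br W U = 0" using centralizer_abelian assms(2,3) by blast
    then show False using assms(4) by simp
  qed
  show "br W U \<in> root_set" using plane_root_cartan[OF assms(1)] plane_pair[OF assms(1)] assms n0
    by (auto simp: root_set_def)
qed

lemma root_regular:
  assumes "r \<in> root_set" shows "B r x \<noteq> 0" "r \<in> cartan" "r \<noteq> 0" "- r \<in> root_set"
proof -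
  show r: "r \<in> cartan" "r \<noteq> 0" using assms by (auto simp: root_set_def)
  obtain U W where *: "U \<in> G" "W \<in> G" "plane cartan U W" "br W U = r" by (rule root_plane[OF assms]) (rule that)
  show "B r x \<noteq> 0" using plane_root(2)[OF *(3,1,2)] *(4) r(2) by simp
  have "br U W = - r" using br_anti[of U W] *(4) by simp
  then show "- r \<in> root_set" using plane_root(1)[OF plane_swap[OF *(3)] *(2,1)] r(2) by simp
qed

text \<open>The symmetric operator (ad Y)^2 has the eigenvalues -(r, Y)^2 and -(s, Y)^2 on the two
  vectors. Without orthogonality these would agree for every Y; Y = r and Y = s then give equality
  in the Cauchy-Schwarz inequality for vectors of equal length, so r = s or r = -s.\<close>

lemma pair_distinct_orthogonal:
  assumes p: "pair cartan r U W" "pair cartan s U' W'" and rs: "r \<in> cartan" "s \<in> cartan" "r \<noteq> s" "r \<noteq> - s"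
  shows "B U U' = 0"
proof -
  have sq: "(B r Y)\<^sup>2 * B U U' = (B s Y)\<^sup>2 * B U U'" if Y: "Y \<in> cartan" for Y
  proof -
    have "br Y (br Y U) = - ((B r Y)\<^sup>2) *\<^sub>R U" "br Y (br Y U') = - ((B s Y)\<^sup>2) *\<^sub>R U'"
      using p Y by (simp_all add: pair_def power2_eq_square)
    moreover have "B (br Y (br Y U)) U' = B U (br Y (br Y U'))" by (simp add: B_inv)
    ultimately show ?thesis by simp
  qed
  show ?thesis
  proof (rule ccontr)
    assume n: "B U U' \<noteq> 0"
    then have e: "(B r Y)\<^sup>2 = (B s Y)\<^sup>2" if "Y \<in> cartan" for Y using sq[OF that] by simp
    have e1: "(B r r)\<^sup>2 = (B r s)\<^sup>2" "(B s s)\<^sup>2 = (B r s)\<^sup>2" using e[OF rs(1)] e[OF rs(2)] by (simp_all add: B_sym[of s r])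
    then have "B r r = B s s" using power2_eq_iff_nonneg[OF B_nonneg B_nonneg, of r s] by simp
    then consider "B r s = B r r" | "B r s = - B r r" using e1(1) power2_eq_iff by metis
    then show False
    proof cases
      case 1
      then have "B (r - s) (r - s) = 0" using \<open>B r r = B s s\<close> by (simp add: B_sym[of s r])
      then show False using rs(3) by (simp only: B_eq_0 right_minus_eq)
    next
      case 2
      then have "B (r + s) (r + s) = 0" using \<open>B r r = B s s\<close> by (simp add: B_sym[of s r])
      then have "r + s = 0" by (simp only: B_eq_0)
      then show False using rs(4) by (simp add: eq_neg_iff_add_eq_0)
    qed
  qed
qed

lemma pair_rotate: "pair A r U W \<Longrightarrow> pair A r (- W) U"
  by (auto simp: pair_def)

text \<open>For the complex root vectors \<open>F = U1 - \<i> W1\<close> and \<open>e = U2 + \<i> W2\<close> of weights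
  \<open>-r\<close> and \<open>s\<close>: if \<open>[F, e] = 0\<close>, then the operator \<open>ad (conj F)\<close> would have a negative square norm on \<open>e\<close>.\<close>

lemma lowest_weight_zero:
  assumes p: "plane cartan U1 W1" "br W1 U1 = r" and q: "pair cartan s U2 W2" and r: "r \<in> cartan" "B s r > 0"
    and a: "br U1 U2 + br W1 W2 = 0" and b: "br U1 W2 - br W1 U2 = 0"
  shows "U2 = 0" "W2 = 0"
proof -
  have a': "br W1 W2 = - br U1 U2" using a by (simp add: add_eq_0_iff)
  have b': "br U1 W2 = br W1 U2" using b by simp
  have u1: "B (br U1 U2) (br U1 U2) = B U2 (br U1 (br W1 W2))"
    unfolding a' using B_inv[of U1 U2 "br U1 U2"] by simp
  have u2: "B (br U1 W2) (br U1 W2) = - B U2 (br W1 (br U1 W2))"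
    using B_inv[of W1 U2 "br U1 W2"] by (simp add: b')
  have "br U1 (br W1 W2) - br W1 (br U1 W2) = br (br U1 W1) W2" using jacobi[of U1 W1 W2] by simp
  also have "br U1 W1 = - r" using br_anti[of U1 W1] p(2) by simp
  finally have j: "br U1 (br W1 W2) - br W1 (br U1 W2) = - (B s r) *\<^sub>R U2" using q r by (simp add: pair_def)
  have "B (br U1 U2) (br U1 U2) + B (br U1 W2) (br U1 W2) = B U2 (br U1 (br W1 W2) - br W1 (br U1 W2))"
    unfolding u1 u2 by simp
  also have "\<dots> = - (B s r) * B U2 U2" unfolding j by simp
  finally have "B s r * B U2 U2 \<le> 0" using B_nonneg[of "br U1 U2"] B_nonneg[of "br U1 W2"] by linarith
  then have "B U2 U2 \<le> 0" using r(2) by (simp add: mult_le_0_iff)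
  then show U2: "U2 = 0" using B_nonneg[of U2] B_eq_0 by (metis order_antisym)
  have "br r U2 = - (B s r) *\<^sub>R W2" using q r by (simp add: pair_def)
  then show "W2 = 0" using U2 r(2) by simp
qed

text \<open>Put F = U1 - \<i> W1 and e = U2 + \<i> W2. Then [F, e] = a + \<i> b has weight 0, hence
  lies in the complexified Cartan subalgebra, and the orthogonality hypotheses make it orthogonal to
  that subalgebra. So [F, e] = 0, and \<open>lowest_weight_zero\<close> forces e = 0.\<close>

lemma multiplicity_one:
  assumes p: "plane cartan U1 W1" "U1 \<in> G" "W1 \<in> G" "br W1 U1 = r" "r \<noteq> 0"
    and q: "pair cartan r U2 W2" "U2 \<in> G" "W2 \<in> G"
    and orth: "B U2 U1 = 0" "B U2 W1 = 0"
  shows "U2 = 0" "W2 = 0"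
proof -
  have r: "r \<in> cartan" using plane_root_cartan[OF p(1)] p(4) by simp
  have p': "pair cartan r U1 W1" using plane_pair[OF p(1)] p(4) by simp
  have orth': "B W2 W1 = 0" "B W2 U1 = 0" using pair_products[OF p' q(1) r p(5)] orth by simp_all
  define a where "a = br U1 U2 + br W1 W2"
  define b where "b = br U1 W2 - br W1 U2"
  have x1: "br x U1 = - (B r x) *\<^sub>R W1" "br x W1 = B r x *\<^sub>R U1" "br x U2 = - (B r x) *\<^sub>R W2" "br x W2 = B r x *\<^sub>R U2"
    using p' q x_cartan by (auto simp: pair_def)
  have "br x a = 0" "br x b = 0" unfolding a_def b_def by (simp_all add: jacobi[of x] x1)
  then have t: "a \<in> cartan" "b \<in> cartan" using G by (auto simp: cartan_def a_def b_def subspace_add subspace_diff)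
  have B0: "B (br Y Z) X = 0" if "B Z (br X Y) = 0" for X Y Z
    using that br_anti[of X Y] by (simp add: B_inv)
  have "B a X = 0" "B b X = 0" if X: "X \<in> cartan" for X
  proof -
    have X1: "br X U1 = - (B r X) *\<^sub>R W1" "br X W1 = B r X *\<^sub>R U1" using p' X by (auto simp: pair_def)
    have "B (br U1 U2) X = 0" "B (br W1 W2) X = 0" "B (br U1 W2) X = 0" "B (br W1 U2) X = 0"
      by (rule B0; simp add: X1 orth orth')+
    then show "B a X = 0" "B b X = 0" by (simp_all add: a_def b_def)
  qed
  then have "a = 0" "b = 0" using t B_eq_0 by blast+
  then show "U2 = 0" "W2 = 0"
    using lowest_weight_zero[OF p(1,4) q(1) r] B_pos[OF p(5)] by (simp_all add: a_def b_def)
qed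

text \<open>Let F = U1 - \<i> W1, E = U1 + \<i> W1, and let e be a root vector for 2 r. Now [F, e] =
  a + \<i> b has weight r, so by multiplicity one it is the multiple P - \<i> Q of E, and [E,
  [F, e]] = 0. By invariance the squared norm of [F, e] is a pairing of [E, [F, e]] with e and
  vanishes, so that \<open>lowest_weight_zero\<close> gives e = 0.\<close>

lemma roots_reduced:
  assumes "r \<in> root_set" shows "2 *\<^sub>R r \<notin> root_set"
proof
  assume "2 *\<^sub>R r \<in> root_set"
  then obtain U2 W2 where q: "U2 \<in> G" "W2 \<in> G" "plane cartan U2 W2" "br W2 U2 = 2 *\<^sub>R r"
    by (rule root_plane) (rule that)
  obtain U1 W1 where p: "U1 \<in> G" "W1 \<in> G" "plane cartan U1 W1" "br W1 U1 = r" by (rule root_plane[OF assms]) (rule that)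
  have r: "r \<in> cartan" "r \<noteq> 0" using root_regular[OF assms] by auto
  have q': "pair cartan (2 *\<^sub>R r) U2 W2" using plane_pair[OF q(3)] q(4) by simp
  have p': "pair cartan r U1 W1" using plane_pair[OF p(3)] p(4) by simp
  have on: "B U1 U1 = 1" "B W1 W1 = 1" "B U1 W1 = 0" "B W1 U1 = 0" using p(3) by (auto simp: plane_def B_sym)
  define a where "a = br U1 U2 + br W1 W2"
  define b where "b = br U1 W2 - br W1 U2"
  have ab: "pair cartan r a b" unfolding pair_def
  proof (intro ballI conjI)
    fix X assume X: "X \<in> cartan"
    have X1: "br X U1 = - (B r X) *\<^sub>R W1" "br X W1 = B r X *\<^sub>R U1" using p' X by (auto simp: pair_def)
    have B2: "B (2 *\<^sub>R r) X = B r X + B r X" by simp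
    have "br X U2 = - (B (2 *\<^sub>R r) X) *\<^sub>R W2" "br X W2 = B (2 *\<^sub>R r) X *\<^sub>R U2"
      using q' X unfolding pair_def by blast+
    then have X2: "br X U2 = - (B r X *\<^sub>R W2) - B r X *\<^sub>R W2" "br X W2 = B r X *\<^sub>R U2 + B r X *\<^sub>R U2"
      unfolding B2 by (simp_all only: scaleR_minus_left scaleR_left_distrib minus_add_distrib diff_conv_add_uminus)
    show "br X a = - (B r X) *\<^sub>R b" "br X b = B r X *\<^sub>R a"
      unfolding a_def b_def by (simp_all add: jacobi[of X] X1 X2 algebra_simps)
  qed
  define P where "P = B a U1"
  define Q where "Q = B a W1"
  have rot: "pair cartan r (a - P *\<^sub>R U1 - Q *\<^sub>R W1) (b - P *\<^sub>R W1 + Q *\<^sub>R U1)"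
    using ab p' by (auto simp: pair_def algebra_simps)
  have mem: "a - P *\<^sub>R U1 - Q *\<^sub>R W1 \<in> G" "b - P *\<^sub>R W1 + Q *\<^sub>R U1 \<in> G"
    unfolding a_def b_def using G p(1,2) by (simp_all add: subspace_add subspace_diff subspace_mul)
  have "a - P *\<^sub>R U1 - Q *\<^sub>R W1 = 0" "b - P *\<^sub>R W1 + Q *\<^sub>R U1 = 0"
    by (rule multiplicity_one[OF p(3,1,2,4) r(2) rot mem], simp add: P_def Q_def on, simp add: P_def Q_def on)+
  then have a: "a = P *\<^sub>R U1 + Q *\<^sub>R W1" and b: "b = P *\<^sub>R W1 - Q *\<^sub>R U1"
    by (simp_all add: algebra_simps add_eq_0_iff)
  have c1: "br U1 a - br W1 b = 0" "br W1 a + br U1 b = 0"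
    unfolding a b using br_anti[of W1 U1] by (simp_all add: algebra_simps)
  have "B a a = - B (br U1 a) U2 - B (br W1 a) W2"
    using B_inv[of U1 U2 a] B_inv[of W1 W2 a] by (simp add: a_def[symmetric] B_sym) (simp add: a_def B_sym)
  moreover have "B b b = - B (br U1 b) W2 + B (br W1 b) U2"
    using B_inv[of U1 W2 b] B_inv[of W1 U2 b] by (simp add: B_sym) (simp add: b_def B_sym)
  ultimately have "B a a + B b b = - B (br U1 a - br W1 b) U2 - B (br W1 a + br U1 b) W2" by simp
  then have s0: "B a a + B b b = 0" unfolding c1 by simp
  have "B a a = 0" "B b b = 0" using s0 B_nonneg[of a] B_nonneg[of b] by linarith+
  then have "a = 0" "b = 0" by simp_all
  moreover have "B (2 *\<^sub>R r) r > 0" using B_pos[OF r(2)] by simp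
  ultimately have "U2 = 0"
    using lowest_weight_zero(1)[OF p(3,4) q' r(1)] by (simp add: a_def b_def)
  then show False using q(3) by (simp add: plane_def)
qed

text \<open>Positivity at \<open>x\<close> fixes the order of the two vectors of each plane, because
  exchanging them changes the sign of the root.\<close>

definition "planes F \<longleftrightarrow> finite F \<and>
  (\<forall>p\<in>F. fst p \<in> G \<and> snd p \<in> G \<and> plane cartan (fst p) (snd p) \<and> B (br (snd p) (fst p)) x > 0) \<and>
  (\<forall>p\<in>F. \<forall>q\<in>F. p \<noteq> q \<longrightarrow> B (fst p) (fst q) = 0 \<and> B (fst p) (snd q) = 0 \<and> B (snd p) (fst q) = 0 \<and> B (snd p) (snd q) = 0)"

lemma planes_card: assumes "planes F" shows "card F \<le> DIM('a)"
proof -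
  have F: "finite F" "\<And>p. p \<in> F \<Longrightarrow> B (fst p) (fst p) = 1"
    "\<And>p q. p \<in> F \<Longrightarrow> q \<in> F \<Longrightarrow> p \<noteq> q \<Longrightarrow> B (fst p) (fst q) = 0"
    using assms by (auto simp: planes_def plane_def)
  have inj: "inj_on fst F"
  proof (rule inj_onI, rule ccontr)
    fix p q assume "p \<in> F" "q \<in> F" "fst p = fst q" "p \<noteq> q"
    then show False using F(2)[of p] F(3)[of p q] by simp
  qed
  have "independent (fst ` F)"
  proof (rule independent_if_scalars_zero)
    fix f u assume s: "(\<Sum>v\<in>fst ` F. f v *\<^sub>R v) = 0" and u: "u \<in> fst ` F"
    have Bl: "linear (\<lambda>v. B v u)" using B by (simp add: bilinear_def)
    have "0 = B (\<Sum>v\<in>fst ` F. f v *\<^sub>R v) u" by (simp add: s)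
    also have "\<dots> = (\<Sum>v\<in>fst ` F. f v * B v u)" by (simp add: linear_sum[OF Bl])
    also have "\<dots> = (\<Sum>v\<in>fst ` F. if v = u then f u else 0)"
      using u F(2,3) by (intro sum.cong) auto
    also have "\<dots> = f u" using u F(1) by simp
    finally show "f u = 0" by simp
  qed (use F in simp)
  then have "card (fst ` F) \<le> DIM('a)" using independent_bound by blast
  then show ?thesis using card_image[OF inj] by simp
qed

text \<open>In a family of greatest cardinality nothing is left over: the orthogonal complement of
  the Cartan subalgebra and of the planes is invariant, and if it were nonzero
  \<open>invariant_plane\<close> would supply a further plane, with its two vectors exchanged if the
  root is negative at \<open>x\<close>.\<close>

lemma complete_planes_exist:
  "\<exists>F. planes F \<and> (\<forall>v\<in>G. (\<forall>Y\<in>cartan. B v Y = 0) \<longrightarrow> (\<forall>p\<in>F. B v (fst p) = 0 \<and> B v (snd p) = 0) \<longrightarrow> v = 0)"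
proof -
  have e: "planes {}" by (simp add: planes_def)
  have bd: "\<forall>F. planes F \<longrightarrow> card F < DIM('a) + 1" using planes_card by fastforce
  obtain F where F: "planes F" "\<And>F'. planes F' \<Longrightarrow> card F' \<le> card F"
    using ex_has_greatest_nat[of planes "{}" card "DIM('a) + 1"] e bd by blast
  define M where "M = {v \<in> G. (\<forall>Y\<in>cartan. B v Y = 0) \<and> (\<forall>p\<in>F. B v (fst p) = 0 \<and> B v (snd p) = 0)}"
  have "M = {0}"
  proof (rule ccontr)
    assume n: "M \<noteq> {0}"
    have sM: "subspace M" unfolding M_def using G
      by (intro subspaceI) (auto simp: subspace_0 subspace_add subspace_mul)
    have nt: "u = 0" if "u \<in> M" "br x u = 0" for u
    proof -
      have "u \<in> cartan" "B u u = 0" using that by (auto simp: M_def cartan_def)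
      then show ?thesis by simp
    qed
    have inv: "br Y u \<in> M" if Y: "Y \<in> cartan" and u: "u \<in> M" for Y u
    proof -
      have "B (br Y u) Z = 0" if "Z \<in> cartan" for Z using cartan_abelian[OF Y that] by (simp add: B_inv)
      moreover have "B (br Y u) (fst p) = 0" "B (br Y u) (snd p) = 0" if p: "p \<in> F" for p
      proof -
        have "pair cartan (br (snd p) (fst p)) (fst p) (snd p)" using F(1) p plane_pair by (auto simp: planes_def)
        then show "B (br Y u) (fst p) = 0" "B (br Y u) (snd p) = 0"
          using u p Y by (auto simp: B_inv pair_def M_def)
      qed
      ultimately show ?thesis by (simp add: M_def)
    qed
    have nz: "u = 0" if "u \<in> M" "\<And>Y. Y \<in> cartan \<Longrightarrow> br Y u = 0" for u using nt that x_cartan by blast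
    obtain U W Y where *: "U \<in> M" "W \<in> M" "plane cartan U W" "Y \<in> cartan" "B (br W U) Y \<noteq> 0"
      by (rule invariant_plane[of cartan M], erule (1) cartan_abelian, rule sM, rule n, erule (1) inv, erule nz, blast, erule (4) that)
    have rn: "br W U \<noteq> 0" using *(5) by auto
    have GG: "U \<in> G" "W \<in> G" using * by (auto simp: M_def)
    obtain U' W' where p: "U' \<in> M" "W' \<in> M" "plane cartan U' W'" "B (br W' U') x > 0"
    proof (cases "B (br W U) x > 0")
      case False
      then have "B (br U W) x > 0" using plane_root(2)[OF *(3) GG rn] br_anti[of U W] by simp
      then show thesis using that[OF *(2,1) plane_swap[OF *(3)]] by simp
    qed (use * that in blast)
    have n: "(U', W') \<notin> F" using p(1,3) by (auto simp: M_def plane_def)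
    have "planes (insert (U', W') F)"
      using F(1) p unfolding planes_def M_def by (auto simp: B_sym)
    then have "card (insert (U', W') F) \<le> card F" by (rule F(2))
    then show False using n F(1) by (simp add: planes_def)
  qed
  then show ?thesis using F(1) by (intro exI[of _ F]) (auto simp: M_def)
qed

definition "root_planes = (SOME F. planes F \<and> (\<forall>v\<in>G. (\<forall>Y\<in>cartan. B v Y = 0) \<longrightarrow> (\<forall>p\<in>F. B v (fst p) = 0 \<and> B v (snd p) = 0) \<longrightarrow> v = 0))"

lemma root_planes: "planes root_planes"
  and root_planes_complete: "v \<in> G \<Longrightarrow> (\<And>Y. Y \<in> cartan \<Longrightarrow> B v Y = 0) \<Longrightarrow> (\<And>p. p \<in> root_planes \<Longrightarrow> B v (fst p) = 0 \<and> B v (snd p) = 0) \<Longrightarrow> v = 0"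
  using someI_ex[OF complete_planes_exist] unfolding root_planes_def[symmetric] by blast+

definition "root_of p = br (snd p) (fst p)"

lemma root_planes_facts:
  assumes "p \<in> root_planes"
  shows "fst p \<in> G" "snd p \<in> G" "plane cartan (fst p) (snd p)" "B (root_of p) x > 0" "pair cartan (root_of p) (fst p) (snd p)"
    "B (fst p) (fst p) = 1" "B (snd p) (snd p) = 1" "B (fst p) (snd p) = 0" "root_of p \<in> cartan" "root_of p \<in> root_set"
    "br x (fst p) = - (B (root_of p) x) *\<^sub>R snd p" "br x (snd p) = B (root_of p) x *\<^sub>R fst p"
proof -
  show *: "fst p \<in> G" "snd p \<in> G" "plane cartan (fst p) (snd p)" "B (root_of p) x > 0"
    using root_planes assms by (auto simp: planes_def root_of_def)
  show "pair cartan (root_of p) (fst p) (snd p)" using plane_pair[OF *(3)] by (simp add: root_of_def)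
  then show "br x (fst p) = - (B (root_of p) x) *\<^sub>R snd p" "br x (snd p) = B (root_of p) x *\<^sub>R fst p"
    using x_cartan by (auto simp: pair_def)
  show "B (fst p) (fst p) = 1" "B (snd p) (snd p) = 1" "B (fst p) (snd p) = 0"
    using *(3) by (auto simp: plane_def)
  show "root_of p \<in> cartan" using plane_root_cartan[OF *(3)] by (simp add: root_of_def)
  have "root_of p \<noteq> 0" using *(4) by auto
  then show "root_of p \<in> root_set" using plane_root(1)[OF *(3,1,2)] by (simp add: root_of_def)
qed

lemma root_planes_finite: "finite root_planes" using root_planes by (simp add: planes_def)

lemma root_planes_orth:
  assumes "p \<in> root_planes" "q \<in> root_planes" "p \<noteq> q"
  shows "B (fst p) (fst q) = 0" "B (fst p) (snd q) = 0" "B (snd p) (fst q) = 0" "B (snd p) (snd q) = 0"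
  using root_planes assms by (auto simp: planes_def)

text \<open>Two distinct planes of the family are orthogonal, so equal roots would contradict
  multiplicity one.\<close>

lemma root_of_inj: "inj_on root_of root_planes"
proof (rule inj_onI, rule ccontr)
  fix p q assume *: "p \<in> root_planes" "q \<in> root_planes" "root_of p = root_of q" "p \<noteq> q"
  note P = root_planes_facts[OF *(1)] and Q = root_planes_facts[OF *(2)]
  have "root_of p \<noteq> 0" using P(4) by auto
  have "fst q = 0"
    by (rule multiplicity_one(1)[OF P(3,1,2) root_of_def[symmetric] \<open>root_of p \<noteq> 0\<close>, of "fst q" "snd q"])
      (use Q * root_planes_orth[OF *(2,1)] in auto)
  then show False using Q(6) by simp
qed

text \<open>A positive root missing from the family differs from all its roots even up to sign,
  since all are positive at \<open>x\<close>. Its plane would be orthogonal to the Cartan subalgebra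
  and to the whole family, hence zero by completeness.\<close>

lemma root_of_positive_roots: "root_of ` root_planes = {r \<in> root_set. B r x > 0}"
proof
  show "root_of ` root_planes \<subseteq> {r \<in> root_set. B r x > 0}" using root_planes_facts by auto
  show "{r \<in> root_set. B r x > 0} \<subseteq> root_of ` root_planes"
  proof
    fix r assume "r \<in> {r \<in> root_set. B r x > 0}"
    then have r: "r \<in> root_set" "B r x > 0" by auto
    obtain U W where u: "U \<in> G" "W \<in> G" "plane cartan U W" "br W U = r" by (rule root_plane[OF r(1)]) (rule that)
    have p': "pair cartan r U W" using plane_pair[OF u(3)] u(4) by simp
    show "r \<in> root_of ` root_planes"
    proof (rule ccontr)
      assume n: "r \<notin> root_of ` root_planes"
      have "U = 0"
      proof (rule root_planes_complete[OF u(1)])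
        show "B U Y = 0" if "Y \<in> cartan" for Y
          using pair_orthogonal_cartan[OF p' _ _ that] root_regular[OF r(1)] by blast
        fix p assume p: "p \<in> root_planes"
        note P = root_planes_facts[OF p]
        have "r \<noteq> root_of p" using n p by blast
        moreover have "r \<noteq> - root_of p" using r(2) P(4) by auto
        ultimately show "B U (fst p) = 0 \<and> B U (snd p) = 0"
          using pair_distinct_orthogonal[OF p' P(5) root_regular(2)[OF r(1)] P(9)]
            pair_distinct_orthogonal[OF p' pair_rotate[OF P(5)] root_regular(2)[OF r(1)] P(9)] by simp
      qed
      then show False using u(3) by (simp add: plane_def)
    qed
  qed
qed

lemma root_set_finite: "finite root_set"
proof -
  have "root_set \<subseteq> root_of ` root_planes \<union> uminus ` root_of ` root_planes"
  proof
    fix r assume r: "r \<in> root_set"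
    show "r \<in> root_of ` root_planes \<union> uminus ` root_of ` root_planes"
    proof (cases "B r x > 0")
      case True then show ?thesis using r root_of_positive_roots by blast
    next
      case False
      then have "- r \<in> root_of ` root_planes" using root_regular[OF r] root_of_positive_roots by auto
      then have "- (- r) \<in> uminus ` root_of ` root_planes" by blast
      then show ?thesis by simp
    qed
  qed
  then show ?thesis using root_planes_finite finite_subset by blast
qed

lemma root_planes_decomposition:
  assumes v: "v \<in> G"
  shows "v - (\<Sum>p\<in>root_planes. B v (fst p) *\<^sub>R fst p + B v (snd p) *\<^sub>R snd p) \<in> cartan"
proof -
  define s where "s = (\<Sum>p\<in>root_planes. B v (fst p) *\<^sub>R fst p + B v (snd p) *\<^sub>R snd p)"
  have Bl: "linear (B y)" "linear (\<lambda>z. B z y)" for y using B by (auto simp: bilinear_def)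
  have sG: "s \<in> G" unfolding s_def
    by (intro subspace_sum G subspace_add subspace_mul) (auto simp: root_planes_facts)
  obtain w where w: "w \<in> cartan" "\<And>Y. Y \<in> cartan \<Longrightarrow> B (v - s) Y = B w Y"
    by (rule riesz[OF cartan_subspace, of "B (v - s)"]) (simp, simp, erule that)
  have pt: "B (fst q) Y = 0" "B (snd q) Y = 0" if "q \<in> root_planes" "Y \<in> cartan" for q Y
    using pair_orthogonal_cartan[OF root_planes_facts(5,9)[OF that(1)[THEN subsetD[OF subset_refl]]] _ that(2)] that
      root_planes_facts(5,9)[OF that(1)] root_regular(3)[OF root_planes_facts(10)[OF that(1)]]
      pair_orthogonal_cartan by blast+
  have sq: "B s (fst q) = B v (fst q)" "B s (snd q) = B v (snd q)" if q: "q \<in> root_planes" for q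
  proof -
    have "B s (fst q) = (\<Sum>p\<in>root_planes. if p = q then B v (fst q) else 0)"
      unfolding s_def linear_sum[OF Bl(2)]
      by (intro sum.cong) (use q root_planes_facts root_planes_orth B_sym[of "snd q" "fst q"] in auto)
    then show "B s (fst q) = B v (fst q)" using q root_planes_finite by simp
    have "B s (snd q) = (\<Sum>p\<in>root_planes. if p = q then B v (snd q) else 0)"
      unfolding s_def linear_sum[OF Bl(2)]
      by (intro sum.cong) (use q root_planes_facts root_planes_orth in auto)
    then show "B s (snd q) = B v (snd q)" using q root_planes_finite by simp
  qed
  have "v - s - w = 0"
  proof (rule root_planes_complete)
    show "v - s - w \<in> G" using v sG w cartan_G G by (simp add: subspace_diff)
    show "B (v - s - w) Y = 0" if "Y \<in> cartan" for Y using w(2)[OF that] by simp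
    show "B (v - s - w) (fst q) = 0 \<and> B (v - s - w) (snd q) = 0" if q: "q \<in> root_planes" for q
      using sq[OF q] pt[OF q w(1)] by (simp add: B_sym)
  qed
  then show ?thesis using w(1) by (simp add: s_def)
qed

end

section \<open>Root systems\<close>

locale root_system = inner_form B for B :: "'e::euclidean_space \<Rightarrow> 'e \<Rightarrow> real" +
  fixes R :: "'e set" and x :: 'e
  assumes R_finite: "finite R" and R_regular: "\<And>r. r \<in> R \<Longrightarrow> B r x \<noteq> 0"
    and R_integral: "\<And>r s. r \<in> R \<Longrightarrow> s \<in> R \<Longrightarrow> 2 * B s r / B r r \<in> \<int>"
    and R_reflect: "\<And>r s. r \<in> R \<Longrightarrow> s \<in> R \<Longrightarrow> s - (2 * B s r / B r r) *\<^sub>R r \<in> R"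
    and R_reduced: "\<And>r. r \<in> R \<Longrightarrow> 2 *\<^sub>R r \<notin> R"
begin

definition "pos = {r \<in> R. B r x > 0}"
definition "simple a \<longleftrightarrow> a \<in> pos \<and> (\<forall>b\<in>pos. \<forall>c\<in>pos. a \<noteq> b + c)"

lemma root_nonzero: "r \<in> R \<Longrightarrow> r \<noteq> 0" using R_regular by fastforce
lemma root_sq: "r \<in> R \<Longrightarrow> B r r > 0" using root_nonzero B_pos by blast

lemma root_minus: assumes "r \<in> R" shows "- r \<in> R"
  using R_reflect[OF assms assms] root_nonzero[OF assms] by (simp add: scaleR_2)

lemma pos_or_neg: "r \<in> R \<Longrightarrow> r \<in> pos \<or> - r \<in> pos"
  using R_regular[of r] root_minus[of r] by (auto simp: pos_def)

text \<open>Both Cartan integers \<open>p\<close> and \<open>q\<close> are positive. If one of them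
  is 1, a reflection produces r - s up to sign; if both are at least 2, then r - s has squared
  length at most 0.\<close>

lemma root_difference:
  assumes r: "r \<in> R" and s: "s \<in> R" and rs: "B r s > 0" "r \<noteq> s"
  shows "r - s \<in> R"
proof -
  define p where "p = 2 * B r s / B s s"
  define q where "q = 2 * B r s / B r r"
  note sq = root_sq[OF r] root_sq[OF s]
  have "p \<in> \<int>" "q \<in> \<int>" using R_integral[OF s r] R_integral[OF r s] by (simp_all add: p_def q_def B_sym)
  moreover have "p > 0" "q > 0" using rs sq by (simp_all add: p_def q_def)
  ultimately obtain m n :: int where mn: "p = m" "q = n" "m \<ge> 1" "n \<ge> 1"
    by (auto elim!: Ints_cases)
  consider "p = 1" | "q = 1" | "p \<ge> 2" "q \<ge> 2" using mn by fastforce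
  then show ?thesis
  proof cases
    case 1
    then show ?thesis using R_reflect[OF s r] rs(1) by (simp add: p_def)
  next
    case 2
    then have "s - r \<in> R" using R_reflect[OF r s] rs(1) by (simp add: q_def B_sym[of s r])
    then show ?thesis using root_minus by fastforce
  next
    case 3
    have pq: "p * B s s = 2 * B r s" "q * B r r = 2 * B r s" using sq by (simp_all add: p_def q_def)
    have s1: "B s s \<le> B r s" "B r r \<le> B r s"
      using pq mult_right_mono[OF 3(1) less_imp_le[OF sq(2)]] mult_right_mono[OF 3(2) less_imp_le[OF sq(1)]] by linarith+
    have "B (r - s) (r - s) = B r r + B s s - 2 * B r s" by (simp add: B_sym[of s r])
    also have "\<dots> \<le> 0" using s1 by linarith
    finally have "B (r - s) (r - s) = 0" using B_nonneg[of "r - s"] by linarith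
    then show ?thesis using rs(2) by (simp only: B_eq_0 right_minus_eq)
  qed
qed

text \<open>Prepares the fact that a simple reflection keeps the other positive roots positive: a
  counterexample \<open>b\<close> and its negated image \<open>c\<close> add up to a multiple of
  \<open>a\<close>. Subtracting \<open>a\<close> from both gives roots again; they are positive
  because \<open>a\<close> is simple and different from \<open>a\<close> because the system is
  reduced, while n drops by 2. The descent ends at n = 1 or n = 0, where the products with
  \<open>x\<close> have the wrong sign.\<close>

lemma simple_no_negative_reflection:
  assumes a: "simple a"
  shows "b \<in> pos \<Longrightarrow> c \<in> pos \<Longrightarrow> b \<noteq> a \<Longrightarrow> c \<noteq> a \<Longrightarrow> b + c = real n *\<^sub>R a \<Longrightarrow> 2 * B b a = real n * B a a \<Longrightarrow> False"
proof (induction n arbitrary: b c rule: less_induct)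
  case (less n)
  have aR: "a \<in> R" "B a x > 0" "a \<in> pos" using a by (auto simp: simple_def pos_def)
  note sq = root_sq[OF aR(1)]
  have bR: "b \<in> R" "B b x > 0" "c \<in> R" "B c x > 0" using less.prems by (auto simp: pos_def)
  have h: "B b x + B c x = real n * B a x" using arg_cong[OF less.prems(5), of "\<lambda>v. B v x"] by simp
  have n0: "n > 0" using h bR by (cases n) auto
  have "2 * B (b + c) a = 2 * real n * B a a" using less.prems(5) by simp
  then have cB: "2 * B c a = real n * B a a" using less.prems(6) by (simp add: algebra_simps)
  have "real n * B a a > 0" using n0 sq by simp
  then have Bp: "B b a > 0" "B c a > 0" using less.prems(6) cB by linarith+
  have shift: "y - a \<in> pos" "y - a \<noteq> a" if y: "y \<in> R" "y \<in> pos" "y \<noteq> a" "B y a > 0" for y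
  proof -
    have d: "y - a \<in> R" by (rule root_difference[OF y(1) aR(1) y(4,3)])
    have "a - y \<notin> pos"
    proof
      assume "a - y \<in> pos"
      moreover have "a = y + (a - y)" by simp
      ultimately show False using a y(2) unfolding simple_def by blast
    qed
    then show "y - a \<in> pos" using pos_or_neg[OF d] by simp
    show "y - a \<noteq> a"
    proof
      assume "y - a = a"
      then have "y = 2 *\<^sub>R a" by (simp add: scaleR_2 algebra_simps)
      then show False using y(1) R_reduced[OF aR(1)] by simp
    qed
  qed
  note b' = shift[OF bR(1) less.prems(1,3) Bp(1)] and c' = shift[OF bR(3) less.prems(2,4) Bp(2)]
  show False
  proof (cases "n = 1")
    case True
    then have "B (b - a) x + B (c - a) x = - B a x" using h by simp
    then show False using b'(1) c'(1) aR(2) by (simp add: pos_def)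
  next
    case False
    \<comment> \<open>Here n is at least 2, so the truncated subtraction is exact.\<close>
    then have n2: "real (n - 2) = real n - 2" using n0 by simp
    have "(b - a) + (c - a) = (b + c) - 2 *\<^sub>R a" by (simp add: scaleR_2)
    also have "\<dots> = real (n - 2) *\<^sub>R a" unfolding less.prems(5) n2 by (simp add: scaleR_left_diff_distrib)
    finally have sum: "(b - a) + (c - a) = real (n - 2) *\<^sub>R a" .
    have "2 * B (b - a) a = real (n - 2) * B a a" using less.prems(6) n2 by (simp add: algebra_simps)
    then show False using less.IH[OF _ b'(1) c'(1) b'(2) c'(2) sum] n0 by simp
  qed
qed

definition "reflect a v = v - (2 * B v a / B a a) *\<^sub>R a"

text \<open>If the image of \<open>b\<close> were negative, \<open>b\<close> and its negated image
  would be positive with sum k a, where k is an integer by integrality and positive by evaluation at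
  \<open>x\<close>. The preceding lemma excludes this, once the case that the negated image is
  \<open>a\<close> itself has been traced back to b = a.\<close>

lemma simple_reflection_pos:
  assumes a: "simple a" and b: "b \<in> pos" "b \<noteq> a"
  shows "reflect a b \<in> pos - {a}"
proof -
  have aR: "a \<in> R" "B a x > 0" using a by (auto simp: simple_def pos_def)
  note sq = root_sq[OF aR(1)]
  have bR: "b \<in> R" "B b x > 0" using b by (auto simp: pos_def)
  have rR: "reflect a b \<in> R" using R_reflect[OF aR(1) bR(1)] by (simp add: reflect_def)
  have "reflect a b \<noteq> a"
  proof
    assume e: "reflect a b = a"
    have "B (reflect a b) a = - B b a" using sq by (simp add: reflect_def)
    then have "B b a = - B a a" using e by simp
    then have "reflect a b = b + 2 *\<^sub>R a" using sq by (simp add: reflect_def)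
    then have "b = - a" using e by (simp add: scaleR_2 add_eq_0_iff)
    then show False using bR(2) aR(2) by simp
  qed
  moreover have "- reflect a b \<notin> pos"
  proof
    assume neg: "- reflect a b \<in> pos"
    define k where "k = 2 * B b a / B a a"
    have sum: "b + - reflect a b = k *\<^sub>R a" by (simp add: reflect_def k_def)
    have "B b x + B (- reflect a b) x = k * B a x" using arg_cong[OF sum, of "\<lambda>v. B v x"] by simp
    then have "k * B a x > 0" using neg bR(2) by (simp add: pos_def)
    then have "k > 0" using aR(2) by (simp add: zero_less_mult_iff)
    moreover have "k \<in> \<int>" using R_integral[OF aR(1) bR(1)] by (simp add: k_def)
    ultimately obtain m :: int where m: "k = of_int m" "m > 0" by (auto elim!: Ints_cases)
    define n where "n = nat m"
    have n: "k = real n" using m by (simp add: n_def)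
    have "- reflect a b \<noteq> a"
    proof
      assume e: "- reflect a b = a"
      have "B (reflect a b) a = - B b a" using sq by (simp add: reflect_def)
      moreover have "B (- reflect a b) a = B a a" by (simp only: e)
      ultimately have "B b a = B a a" by simp
      then have "reflect a b = b - 2 *\<^sub>R a" using sq by (simp add: reflect_def)
      moreover have "reflect a b = - a" using e by (metis minus_minus)
      ultimately have "b = a" by (simp add: scaleR_2 algebra_simps)
      then show False using b(2) by simp
    qed
    moreover have "2 * B b a = real n * B a a" unfolding n[symmetric] k_def using sq by simp
    ultimately show False
      using simple_no_negative_reflection[OF a b(1) neg b(2), of n] sum n by simp
  qed
  ultimately show ?thesis using pos_or_neg[OF rR] by simp
qed

lemma refl_involution: "a \<in> R \<Longrightarrow> reflect a (reflect a v) = v"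
proof -
  assume a: "a \<in> R"
  have "B (reflect a v) a = - B v a" using root_nonzero[OF a] by (simp add: reflect_def)
  then have "reflect a (reflect a v) = reflect a v + (2 * B v a / B a a) *\<^sub>R a"
    by (simp add: reflect_def[of a "reflect a v"])
  then show ?thesis by (simp add: reflect_def)
qed

lemma refl_linear: "linear (reflect a)"
  by (rule linearI) (simp_all add: reflect_def algebra_simps add_divide_distrib)

text \<open>The reflection in \<open>a\<close> permutes the positive roots other than
  \<open>a\<close>, so their sum is orthogonal to \<open>a\<close>. In other words, half the sum of
  the positive roots has the value 1 on every simple coroot.\<close>

lemma sum_pos_simple:
  assumes a: "simple a"
  shows "B (\<Sum>pos) a = B a a"
proof -
  have aR: "a \<in> R" "a \<in> pos" using a by (auto simp: simple_def pos_def)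
  note sq = root_sq[OF aR(1)]
  have fin: "finite pos" using R_finite by (simp add: pos_def)
  have maps: "reflect a ` (pos - {a}) \<subseteq> pos - {a}" 
    by (rule image_subsetI) (use simple_reflection_pos[OF a] in simp)
  have inj: "inj_on (reflect a) (pos - {a})"
    by (rule inj_on_inverseI[where g = "reflect a"]) (rule refl_involution[OF aR(1)])
  have im: "reflect a ` (pos - {a}) = pos - {a}"
    using endo_inj_surj[OF _ maps inj] fin by simp
  define \<sigma> where "\<sigma> = \<Sum>(pos - {a})"
  have "reflect a \<sigma> = (\<Sum>b\<in>pos - {a}. reflect a b)" unfolding \<sigma>_def by (rule linear_sum[OF refl_linear])
  also have "\<dots> = \<Sum>(reflect a ` (pos - {a}))" using sum.reindex[OF inj, of "\<lambda>b. b"] by simp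
  also have "\<dots> = \<sigma>" by (simp add: im \<sigma>_def)
  finally have "(2 * B \<sigma> a / B a a) *\<^sub>R a = 0" by (simp add: reflect_def)
  then have s0: "B \<sigma> a = 0" using sq root_nonzero[OF aR(1)] by simp
  have "\<Sum>pos = a + \<sigma>" unfolding \<sigma>_def using fin aR(2) by (simp add: sum.remove)
  then show ?thesis using s0 by simp
qed

text \<open>A counterexample with the least product with \<open>x\<close> is not simple, so it is a
  sum of two positive roots with smaller products, at which the claim holds.\<close>

lemma pos_from_simple:
  assumes "\<And>a. simple a \<Longrightarrow> B v a \<ge> 0" "b \<in> pos"
  shows "B v b \<ge> 0"
proof (rule ccontr)
  assume n: "\<not> B v b \<ge> 0"
  define C where "C = {b \<in> pos. \<not> B v b \<ge> 0}"
  have C: "finite C" "C \<noteq> {}" using R_finite n assms(2) by (auto simp: C_def pos_def)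
  obtain c where c: "c \<in> C" "\<And>d. d \<in> C \<Longrightarrow> B c x \<le> B d x"
    using ex_min_if_finite[of "(\<lambda>b. B b x) ` C"] C by (force simp: not_less)
  have "\<not> simple c" using assms(1)[of c] c(1) by (auto simp: C_def)
  then obtain d e where de: "d \<in> pos" "e \<in> pos" "c = d + e" using c(1) by (auto simp: simple_def C_def)
  have "B d x < B c x" "B e x < B c x" using de by (auto simp: pos_def)
  then have "d \<notin> C" "e \<notin> C" using c(2) by (meson not_le)+
  then have "B v d \<ge> 0" "B v e \<ge> 0" using de by (auto simp: C_def)
  then show False using c(1) de by (simp add: C_def)
qed

theorem half_sum_norm_le:
  assumes "\<And>a. simple a \<Longrightarrow> B v a \<ge> B a a / 2"
  shows "B ((1/2) *\<^sub>R \<Sum>pos) ((1/2) *\<^sub>R \<Sum>pos) \<le> B v v"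
proof -
  define \<rho> where "\<rho> = (1/2) *\<^sub>R \<Sum>pos"
  have "B (v - \<rho>) b \<ge> 0" if "b \<in> pos" for b
    by (rule pos_from_simple[OF _ that]) (use assms sum_pos_simple in \<open>auto simp: \<rho>_def\<close>)
  then have "0 \<le> (\<Sum>b\<in>pos. B (v - \<rho>) b)" by (rule sum_nonneg)
  also have "\<dots> = B (v - \<rho>) (\<Sum>pos)"
    using linear_sum[of "B (v - \<rho>)" "\<lambda>b. b" pos] B by (simp add: bilinear_def)
  finally have "0 \<le> B (v - \<rho>) \<rho>" by (simp add: \<rho>_def)
  moreover have "B v v = B \<rho> \<rho> + 2 * B (v - \<rho>) \<rho> + B (v - \<rho>) (v - \<rho>)"
    by (simp add: B_sym[of v \<rho>])
  ultimately have "B \<rho> \<rho> \<le> B v v" using B_nonneg[of "v - \<rho>"] by linarith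
  then show ?thesis by (simp only: \<rho>_def)
qed

end

section \<open>Invariant complex structures\<close>

context toral_algebra
begin

text \<open>The coordinates of \<open>G / cartan\<close> with respect to the complex basis \<open>fst ` root_planes\<close>; the complex
  structure sends \<open>fst p\<close> to \<open>- snd p\<close>.\<close>

definition "plane_coord p v = Complex (B v (fst p)) (- B v (snd p))"

lemma B_right_linear: "linear (B y)" using B by (simp add: bilinear_def)
lemma B_left_linear: "linear (\<lambda>z. B z y)" using B by (simp add: bilinear_def)

lemma plane_coord_add: "plane_coord p (v + w) = plane_coord p v + plane_coord p w"
  and plane_coord_diff: "plane_coord p (v - w) = plane_coord p v - plane_coord p w"
  and plane_coord_scaleR: "plane_coord p (c *\<^sub>R v) = of_real c * plane_coord p v"
  and plane_coord_0 [simp]: "plane_coord p 0 = 0"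
  by (simp_all add: plane_coord_def complex_eq_iff)

lemma plane_coord_sum: "plane_coord p (\<Sum>i\<in>I. f i) = (\<Sum>i\<in>I. plane_coord p (f i))"
  by (induction I rule: infinite_finite_induct) (simp_all add: plane_coord_add)

lemma plane_coord_cartan: assumes "p \<in> root_planes" "Y \<in> cartan" shows "plane_coord p Y = 0"
  using pair_orthogonal_cartan[OF root_planes_facts(5,9)[OF assms(1)] root_regular(3)[OF root_planes_facts(10)[OF assms(1)]] assms(2)]
  by (simp add: plane_coord_def B_sym[of Y] complex_eq_iff)

lemma cartan_iff_plane_coord: assumes "v \<in> G" shows "v \<in> cartan \<longleftrightarrow> (\<forall>p\<in>root_planes. plane_coord p v = 0)"
proof
  assume "\<forall>p\<in>root_planes. plane_coord p v = 0"
  then have "(\<Sum>p\<in>root_planes. B v (fst p) *\<^sub>R fst p + B v (snd p) *\<^sub>R snd p) = 0"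
    by (intro sum.neutral) (simp add: plane_coord_def complex_eq_iff)
  then show "v \<in> cartan" using root_planes_decomposition[OF assms] by simp
qed (simp add: plane_coord_cartan)

lemma plane_coord_root_planes: assumes "p \<in> root_planes" "q \<in> root_planes"
  shows "plane_coord p (fst q) = (if p = q then 1 else 0)" "plane_coord p (snd q) = (if p = q then - \<i> else 0)"
  using root_planes_facts(6-8)[OF assms(1)] root_planes_orth[of q p] assms B_sym[of "snd p" "fst p"]
  by (auto simp: plane_coord_def complex_eq_iff)

lemma plane_coord_br: assumes "p \<in> root_planes" "Y \<in> cartan"
  shows "plane_coord p (br Y v) = \<i> * of_real (B (root_of p) Y) * plane_coord p v"
proof -
  have "br Y (fst p) = - (B (root_of p) Y) *\<^sub>R snd p" "br Y (snd p) = B (root_of p) Y *\<^sub>R fst p"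
    using root_planes_facts(5)[OF assms(1)] assms(2) by (auto simp: pair_def)
  then show ?thesis by (simp add: plane_coord_def complex_eq_iff B_inv)
qed

definition "J0 v = (\<Sum>p\<in>root_planes. B v (snd p) *\<^sub>R fst p - B v (fst p) *\<^sub>R snd p)"

lemma J0_linear: "linear J0"
  unfolding J0_def
  by (rule linearI) (simp_all add: sum.distrib[symmetric] scaleR_sum_right algebra_simps sum_subtractf)

lemma J0_G: "J0 v \<in> G"
  unfolding J0_def by (intro subspace_sum G subspace_diff subspace_mul) (auto simp: root_planes_facts)

lemma J0_cartan: assumes "Y \<in> cartan" shows "J0 Y = 0"
  unfolding J0_def
  by (intro sum.neutral ballI) (use plane_coord_cartan[OF _ assms] in \<open>simp add: plane_coord_def complex_eq_iff\<close>)

lemma plane_coord_J0: assumes p: "p \<in> root_planes" shows "plane_coord p (J0 v) = \<i> * plane_coord p v"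
proof -
  have "plane_coord p (J0 v) = (\<Sum>q\<in>root_planes. if q = p then of_real (B v (snd p)) + \<i> * of_real (B v (fst p)) else 0)"
    unfolding J0_def plane_coord_sum
    by (intro sum.cong) (auto simp: plane_coord_diff plane_coord_scaleR plane_coord_root_planes p)
  also have "\<dots> = of_real (B v (snd p)) + \<i> * of_real (B v (fst p))" using p root_planes_finite by simp
  also have "\<dots> = \<i> * plane_coord p v" by (simp add: plane_coord_def complex_eq_iff)
  finally show ?thesis .
qed

lemma J0_square: assumes v: "v \<in> G" shows "J0 (J0 v) + v \<in> cartan"
proof -
  have "J0 (J0 v) + v \<in> G" using J0_G v G by (simp add: subspace_add)
  then show ?thesis by (simp add: cartan_iff_plane_coord plane_coord_add plane_coord_J0 mult.assoc[symmetric])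
qed

text \<open>In the orthonormal root planes this form is diagonal with the positive weights (root,
  x); the symmetry and the positivity required of the complex structure can be read off.\<close>

lemma B_br_x_J0: "B (br x v) (J0 w) = (\<Sum>p\<in>root_planes. B (root_of p) x * (B v (fst p) * B w (fst p) + B v (snd p) * B w (snd p)))"
proof -
  have "B (br x v) (J0 w) = (\<Sum>p\<in>root_planes. B (br x v) (B w (snd p) *\<^sub>R fst p - B w (fst p) *\<^sub>R snd p))"
    unfolding J0_def by (rule linear_sum[OF B_right_linear])
  also have "\<dots> = (\<Sum>p\<in>root_planes. B (root_of p) x * (B v (fst p) * B w (fst p) + B v (snd p) * B w (snd p)))"
    by (intro sum.cong) (simp_all add: B_inv root_planes_facts(11,12) algebra_simps)
  finally show ?thesis .
qed

lemma B_br_x_J0_pos: assumes v: "v \<in> G" "v \<notin> cartan" shows "B (br x v) (J0 v) > 0"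
proof -
  obtain p where p: "p \<in> root_planes" "plane_coord p v \<noteq> 0" using v cartan_iff_plane_coord by blast
  have nn: "0 \<le> B (root_of q) x * (B v (fst q) * B v (fst q) + B v (snd q) * B v (snd q))" if "q \<in> root_planes" for q
    using root_planes_facts(4)[OF that] by simp
  have "B v (fst p) \<noteq> 0 \<or> B v (snd p) \<noteq> 0" using p(2) by (simp add: plane_coord_def complex_eq_iff)
  then have "B v (fst p) * B v (fst p) + B v (snd p) * B v (snd p) > 0"
    using sum_squares_gt_zero_iff[of "B v (fst p)" "B v (snd p)"] by simp
  then have "0 < B (root_of p) x * (B v (fst p) * B v (fst p) + B v (snd p) * B v (snd p))"
    using root_planes_facts(4)[OF p(1)] by simp
  then show ?thesis unfolding B_br_x_J0 using root_planes_finite p(1) nn by (intro sum_pos2) auto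
qed

text \<open>By uniqueness of the positive square root of \<open>-(ad x)\<^sup>2\<close>, any admissible complex structure
  agrees with \<open>J0\<close> modulo \<open>cartan\<close>.\<close>

lemma complex_structure_unique:
  assumes JG: "\<And>v. v \<in> G \<Longrightarrow> J v \<in> G" and Jt: "\<And>v. v \<in> cartan \<Longrightarrow> J v \<in> cartan"
    and Jadd: "\<And>v w. v \<in> G \<Longrightarrow> w \<in> G \<Longrightarrow> J (v + w) = J v + J w"
    and Jscale: "\<And>c v. v \<in> G \<Longrightarrow> J (c *\<^sub>R v) = c *\<^sub>R J v"
    and JJ: "\<And>v. v \<in> G \<Longrightarrow> J (J v) + v \<in> cartan"
    and com: "\<And>v. v \<in> G \<Longrightarrow> J (br x v) - br x (J v) \<in> cartan"
    and pos: "\<And>v. v \<in> G \<Longrightarrow> v \<notin> cartan \<Longrightarrow> B (br x v) (J v) > 0"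
    and v: "v \<in> G" and p: "p \<in> root_planes"
  shows "plane_coord p (J v) = \<i> * plane_coord p v"
proof -
  have br0: "br x Y = 0" if "Y \<in> cartan" for Y using that by (simp add: cartan_def)
  have brJ: "br x (J (br x w)) = br x (br x (J w))" if w: "w \<in> G" for w
    using br0[OF com[OF w]] by simp
  have brJJ: "br x (J (J w)) = - br x w" if w: "w \<in> G" for w
    using br0[OF JJ[OF w]] by (simp add: add_eq_0_iff2)
  have key: "J (fst q) + snd q \<in> cartan" "J (snd q) - fst q \<in> cartan" if q: "q \<in> root_planes" for q
  proof -
    note Q = root_planes_facts[OF q]
    define b where "b = B (root_of q) x"
    have b: "b > 0" using Q(4) by (simp add: b_def)
    have xu: "br x (fst q) = - b *\<^sub>R snd q" "br x (snd q) = b *\<^sub>R fst q" using Q(11,12) by (simp_all add: b_def)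
    \<comment> \<open>On \<open>fst q\<close> the operator squares to b^2, in agreement with -(ad
      x)^2; positivity of the form attached to \<open>J\<close> makes it the positive square root
      modulo the Cartan subalgebra.\<close>
    define S where "S w = - br x (J w)" for w
    have SG: "S w \<in> G" for w using G by (simp add: S_def subspace_neg)
    have SS: "S (S (fst q)) = b\<^sup>2 *\<^sub>R fst q"
    proof -
      have "S (S (fst q)) = br x (J (br x (J (fst q))))"
        using Jscale[of "br x (J (fst q))" "-1"] by (simp add: S_def)
      also have "\<dots> = br x (br x (J (J (fst q))))" by (rule brJ[OF JG[OF Q(1)]])
      also have "\<dots> = b\<^sup>2 *\<^sub>R fst q" using brJJ[OF Q(1)] xu by (simp add: power2_eq_square)
      finally show ?thesis .
    qed
    \<comment> \<open>S - b sends \<open>fst q\<close> to an eigenvector for -b. Positivity allows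
      such a vector only inside the Cartan subalgebra, and being orthogonal to that subalgebra it is
      zero.\<close>
    define w where "w = S (fst q) - b *\<^sub>R fst q"
    have wG: "w \<in> G" unfolding w_def using SG Q(1) G by (simp add: subspace_diff subspace_mul)
    have Sw: "S w = - b *\<^sub>R w"
    proof -
      have "J w = J (S (fst q)) - b *\<^sub>R J (fst q)"
        using Jadd[of "S (fst q)" "(- b) *\<^sub>R fst q"] Jscale[OF Q(1), of "- b"] SG Q(1) G
        by (simp add: w_def subspace_mul subspace_neg)
      then have "S w = S (S (fst q)) - b *\<^sub>R S (fst q)" by (simp add: S_def)
      then show ?thesis using SS by (simp add: w_def power2_eq_square algebra_simps)
    qed
    have "B (br x w) (J w) = B w (S w)" by (simp add: B_inv S_def)
    also have "\<dots> = - b * B w w" using Sw by simp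
    also have "\<dots> \<le> 0" using b by simp
    finally have wt: "w \<in> cartan" using pos[OF wG] by force
    have "B w w = 0"
    proof -
      have "B (br x (J (fst q))) w = 0" using br0[OF wt] by (simp add: B_inv)
      moreover have "B (fst q) w = 0"
        using pair_orthogonal_cartan(1)[OF Q(5,9) root_regular(3)[OF Q(10)] wt] .
      ultimately show ?thesis by (subst w_def) (simp add: S_def)
    qed
    then have "w = 0" by (simp only: B_eq_0)
    then have "- br x (J (fst q)) = b *\<^sub>R fst q" by (simp add: w_def S_def)
    then have "br x (J (fst q)) = - (b *\<^sub>R fst q)" by (metis minus_minus)
    then have "br x (J (fst q) + snd q) = 0" using xu by simp
    then show 1: "J (fst q) + snd q \<in> cartan" using JG[OF Q(1)] Q(2) G by (simp add: cartan_def subspace_add)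
    have "J (J (fst q)) + J (snd q) \<in> cartan" using Jt[OF 1] Jadd[OF JG[OF Q(1)] Q(2)] by simp
    then have "(J (J (fst q)) + J (snd q)) - (J (J (fst q)) + fst q) \<in> cartan"
      by (rule subspace_diff[OF cartan_subspace _ JJ[OF Q(1)]])
    then show "J (snd q) - fst q \<in> cartan" by simp
  qed
  have kk: "plane_coord p (J (fst q)) = \<i> * plane_coord p (fst q)" "plane_coord p (J (snd q)) = \<i> * plane_coord p (snd q)" if q: "q \<in> root_planes" for q
    using plane_coord_cartan[OF p key(1)[OF q]] plane_coord_cartan[OF p key(2)[OF q]]
    by (simp_all add: plane_coord_add plane_coord_diff plane_coord_root_planes p q add_eq_0_iff split: if_splits)
  have J0: "J 0 = 0" using Jscale[OF subspace_0[OF G], of 0] by simp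
  have Jsum: "J (\<Sum>i\<in>I. f i) = (\<Sum>i\<in>I. J (f i))" if "\<And>i. f i \<in> G" for I and f :: "'i \<Rightarrow> 'a"
    by (induction I rule: infinite_finite_induct) (simp_all add: J0 Jadd that subspace_sum[OF G])
  define f where "f q = (if q \<in> root_planes then B v (fst q) *\<^sub>R fst q + B v (snd q) *\<^sub>R snd q else 0)" for q
  have fG: "f q \<in> G" for q using G root_planes_facts[of q] by (simp add: f_def subspace_add subspace_mul subspace_0)
  define t where "t = v - (\<Sum>q\<in>root_planes. f q)"
  have t: "t \<in> cartan" using root_planes_decomposition[OF v] by (simp add: t_def f_def)
  have vs: "v = t + (\<Sum>q\<in>root_planes. f q)" by (simp add: t_def)
  have kf: "plane_coord p (J (f q)) = \<i> * plane_coord p (f q)" if q: "q \<in> root_planes" for q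
    using root_planes_facts(1,2)[OF q] G kk[OF q] q
    by (simp add: f_def Jadd Jscale subspace_mul plane_coord_add plane_coord_scaleR algebra_simps)
  have "J v = J t + (\<Sum>q\<in>root_planes. J (f q))"
    by (subst vs) (simp add: Jadd Jsum fG cartan_G[OF t] subspace_sum[OF G])
  then have "plane_coord p (J v) = (\<Sum>q\<in>root_planes. \<i> * plane_coord p (f q))"
    using plane_coord_cartan[OF p Jt[OF t]] kf by (simp add: plane_coord_add plane_coord_sum)
  also have "\<dots> = \<i> * plane_coord p v"
    using arg_cong[OF vs, of "plane_coord p"] by (simp add: plane_coord_add plane_coord_sum plane_coord_cartan[OF p t] sum_distrib_left)
  finally show ?thesis .
qed

text \<open>The trace is taken in an arbitrarily chosen complex basis. Its coordinates are expressed
  through the coordinates \<open>plane_coord\<close>, in which \<open>br Y\<close> is diagonal;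
  interchanging the two sums leaves the sum of the eigenvalues.\<close>

lemma complex_trace_br:
  assumes JG: "\<And>v. v \<in> G \<Longrightarrow> J v \<in> G" and J: "\<And>v p. v \<in> G \<Longrightarrow> p \<in> root_planes \<Longrightarrow> plane_coord p (J v) = \<i> * plane_coord p v"
    and Y: "Y \<in> cartan" and A: "\<And>v. v \<in> G \<Longrightarrow> A v = br Y v"
  shows "complex_trace G cartan J A = \<i> * of_real (\<Sum>p\<in>root_planes. B (root_of p) Y)"
proof -
  have kc: "plane_coord p (cscale J z v) = z * plane_coord p v" if "v \<in> G" "p \<in> root_planes" for p z v
    using J[OF that] by (simp add: cscale_def plane_coord_add plane_coord_scaleR complex_eq_iff)
  have cG: "cscale J z v \<in> G" if "v \<in> G" for z v
    using JG[OF that] that G by (simp add: cscale_def subspace_add subspace_mul)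
  \<comment> \<open>Membership in the Cartan subalgebra means that all plane coordinates vanish, so
    congruences modulo it become systems of complex linear equations.\<close>
  have crit: "v - (\<Sum>b\<in>E. cscale J (c b) b) \<in> cartan \<longleftrightarrow> (\<forall>p\<in>root_planes. plane_coord p v = (\<Sum>b\<in>E. c b * plane_coord p b))"
    if v: "v \<in> G" and E: "E \<subseteq> G" for v E c
  proof -
    have "v - (\<Sum>b\<in>E. cscale J (c b) b) \<in> G"
      using v cG E by (intro subspace_diff G subspace_sum) auto
    moreover have "plane_coord p (\<Sum>b\<in>E. cscale J (c b) b) = (\<Sum>b\<in>E. c b * plane_coord p b)" if "p \<in> root_planes" for p
      unfolding plane_coord_sum by (intro sum.cong refl kc) (use E that in auto)
    ultimately show ?thesis by (simp add: cartan_iff_plane_coord plane_coord_diff)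
  qed
  have injF: "inj_on fst root_planes"
  proof (rule inj_onI, rule ccontr)
    fix p q assume "p \<in> root_planes" "q \<in> root_planes" "fst p = fst q" "p \<noteq> q"
    then show False using plane_coord_root_planes(1)[of p p] plane_coord_root_planes(1)[of p q] by simp
  qed
  have ksum: "(\<Sum>b\<in>fst ` root_planes. c b * plane_coord p b) = c (fst p)" if p: "p \<in> root_planes" for p c
  proof -
    have "(\<Sum>b\<in>fst ` root_planes. c b * plane_coord p b) = (\<Sum>q\<in>root_planes. if q = p then c (fst p) else 0)"
      unfolding sum.reindex[OF injF] o_def using p by (intro sum.cong) (auto simp: plane_coord_root_planes)
    then show ?thesis using p root_planes_finite by simp
  qed
  have "complex_basis G cartan J (fst ` root_planes)"
    unfolding complex_basis_def
  proof (intro conjI ballI)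
    show "finite (fst ` root_planes)" using root_planes_finite by simp
    show FG: "fst ` root_planes \<subseteq> G" using root_planes_facts(1) by auto
    fix v assume v: "v \<in> G"
    define c where "c = (\<lambda>b\<in>fst ` root_planes. plane_coord (the_inv_into root_planes fst b) v)"
    show "\<exists>!c. c \<in> fst ` root_planes \<rightarrow>\<^sub>E UNIV \<and> v - (\<Sum>b\<in>fst ` root_planes. cscale J (c b) b) \<in> cartan"
    proof (rule ex1I[of _ c])
      show "c \<in> fst ` root_planes \<rightarrow>\<^sub>E UNIV \<and> v - (\<Sum>b\<in>fst ` root_planes. cscale J (c b) b) \<in> cartan"
        unfolding crit[OF v FG] using ksum by (auto simp: c_def the_inv_into_f_f[OF injF])
      fix c' assume c': "c' \<in> fst ` root_planes \<rightarrow>\<^sub>E UNIV \<and> v - (\<Sum>b\<in>fst ` root_planes. cscale J (c' b) b) \<in> cartan"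
      then have "c' (fst p) = plane_coord p v" if "p \<in> root_planes" for p
        using ksum[OF that] that unfolding crit[OF v FG] by metis
      note k' = this
      show "c' = c"
      proof
        fix b show "c' b = c b"
        proof (cases "b \<in> fst ` root_planes")
          case True
          then obtain p where p: "p \<in> root_planes" "b = fst p" by blast
          then show ?thesis using k'[OF p(1)] the_inv_into_f_f[OF injF p(1)] by (simp add: c_def)
        next
          case False
          then show ?thesis using c' by (auto simp: c_def PiE_def extensional_def)
        qed
      qed
    qed
  qed
  then have ex: "\<exists>E. complex_basis G cartan J E" by blast
  define E where "E = (SOME E. complex_basis G cartan J E)"
  have E: "complex_basis G cartan J E" unfolding E_def using ex by (rule someI_ex)
  then have Ef: "finite E" "E \<subseteq> G"
    and Eu: "\<And>v. v \<in> G \<Longrightarrow> \<exists>!c. c \<in> E \<rightarrow>\<^sub>E UNIV \<and> v - (\<Sum>b\<in>E. cscale J (c b) b) \<in> cartan"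
    by (auto simp: complex_basis_def)
  define cc where "cc v = complex_coord cartan J E v" for v
  have cc: "cc v \<in> E \<rightarrow>\<^sub>E UNIV" "v - (\<Sum>b\<in>E. cscale J (cc v b) b) \<in> cartan" if "v \<in> G" for v
    using theI'[OF Eu[OF that]] by (auto simp: cc_def complex_coord_def)
  have cck: "(\<Sum>b\<in>E. cc v b * plane_coord p b) = plane_coord p v" if "v \<in> G" "p \<in> root_planes" for v p
    using cc(2)[OF that(1)] that(2) unfolding crit[OF that(1) Ef(2)] by simp
  \<comment> \<open>Uniqueness of coordinates makes those with respect to \<open>E\<close> complex
    linear in the plane coordinates.\<close>
  have lin: "cc v b = (\<Sum>p\<in>root_planes. plane_coord p v * cc (fst p) b)" if v: "v \<in> G" and b: "b \<in> E" for v b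
  proof -
    define c where "c = (\<lambda>b\<in>E. \<Sum>p\<in>root_planes. plane_coord p v * cc (fst p) b)"
    have "(\<Sum>b\<in>E. c b * plane_coord q b) = plane_coord q v" if q: "q \<in> root_planes" for q
    proof -
      have "(\<Sum>b\<in>E. c b * plane_coord q b) = (\<Sum>b\<in>E. \<Sum>p\<in>root_planes. plane_coord p v * (cc (fst p) b * plane_coord q b))"
        by (intro sum.cong) (simp_all add: c_def sum_distrib_right mult.assoc)
      also have "\<dots> = (\<Sum>p\<in>root_planes. plane_coord p v * (\<Sum>b\<in>E. cc (fst p) b * plane_coord q b))"
        unfolding sum_distrib_left by (rule sum.swap)
      also have "\<dots> = (\<Sum>p\<in>root_planes. if p = q then plane_coord q v else 0)"
        using q root_planes_facts(1) by (intro sum.cong) (auto simp: cck plane_coord_root_planes)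
      also have "\<dots> = plane_coord q v" using q root_planes_finite by simp
      finally show ?thesis .
    qed
    then have "v - (\<Sum>b\<in>E. cscale J (c b) b) \<in> cartan" unfolding crit[OF v Ef(2)] by simp
    moreover have "c \<in> E \<rightarrow>\<^sub>E UNIV" by (simp add: c_def)
    ultimately have "cc v = c" using Eu[OF v] cc[OF v] by blast
    then show ?thesis using b by (simp add: c_def)
  qed
  have "complex_trace G cartan J A = (\<Sum>b\<in>E. cc (A b) b)"
    by (simp add: complex_trace_def Let_def E_def cc_def)
  also have "\<dots> = (\<Sum>b\<in>E. \<Sum>p\<in>root_planes. \<i> * of_real (B (root_of p) Y) * (cc (fst p) b * plane_coord p b))"
  proof (intro sum.cong refl)
    fix b assume b: "b \<in> E"
    then have bG: "b \<in> G" using Ef(2) by blast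
    have "cc (A b) b = (\<Sum>p\<in>root_planes. plane_coord p (br Y b) * cc (fst p) b)" using lin[OF br_G b] A[OF bG] by simp
    also have "\<dots> = (\<Sum>p\<in>root_planes. \<i> * of_real (B (root_of p) Y) * (cc (fst p) b * plane_coord p b))"
      by (intro sum.cong) (simp_all add: plane_coord_br Y mult_ac)
    finally show "cc (A b) b = (\<Sum>p\<in>root_planes. \<i> * of_real (B (root_of p) Y) * (cc (fst p) b * plane_coord p b))" .
  qed
  also have "\<dots> = (\<Sum>p\<in>root_planes. \<i> * of_real (B (root_of p) Y) * (\<Sum>b\<in>E. cc (fst p) b * plane_coord p b))"
    unfolding sum_distrib_left by (rule sum.swap)
  also have "\<dots> = (\<Sum>p\<in>root_planes. \<i> * of_real (B (root_of p) Y))"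
    by (intro sum.cong) (simp_all add: cck root_planes_facts(1) plane_coord_root_planes)
  also have "\<dots> = \<i> * of_real (\<Sum>p\<in>root_planes. B (root_of p) Y)" by (simp add: sum_distrib_left)
  finally show ?thesis .
qed

end

section \<open>Compact Lie groups\<close>

text \<open>The relations give i^2 = j^2. Conjugation by j therefore fixes i^2, yet it inverts i, so
  that i^2 equals its own inverse.\<close>

lemma (in group) quaternion_relations_order_4:
  assumes i: "i \<in> carrier G" and j: "j \<in> carrier G"
    and ij: "i \<otimes> j \<otimes> inv i = inv j" and ji: "j \<otimes> i \<otimes> inv j = inv i"
  shows "(i \<otimes> i) \<otimes> (i \<otimes> i) = \<one>"
proof -
  have c [simp]: "inv i \<in> carrier G" "inv j \<in> carrier G" using i j by auto
  have "i \<otimes> j = i \<otimes> j \<otimes> inv i \<otimes> i" using i j by (simp add: m_assoc)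
  then have 1: "i \<otimes> j = inv j \<otimes> i" using ij by simp
  have "j \<otimes> i = j \<otimes> i \<otimes> inv j \<otimes> j" using i j by (simp add: m_assoc)
  then have 2: "j \<otimes> i = inv i \<otimes> j" using ji by simp
  have a: "j \<otimes> (i \<otimes> j) = i" using i j by (simp add: 1 m_assoc[symmetric])
  have b: "i \<otimes> (j \<otimes> i) = j" using i j by (simp add: 2 m_assoc[symmetric])
  have "i \<otimes> i = i \<otimes> (j \<otimes> (i \<otimes> j))" by (simp add: a)
  also have "\<dots> = (i \<otimes> (j \<otimes> i)) \<otimes> j" using i j by (simp add: m_assoc)
  finally have sq: "i \<otimes> i = j \<otimes> j" by (simp add: b)
  have "inv i \<otimes> inv i = (j \<otimes> i \<otimes> inv j) \<otimes> (j \<otimes> i \<otimes> inv j)" by (simp add: ji)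
  also have "\<dots> = j \<otimes> (i \<otimes> (inv j \<otimes> j) \<otimes> i) \<otimes> inv j" using i j by (simp only: m_assoc m_closed c)
  also have "\<dots> = j \<otimes> (i \<otimes> i) \<otimes> inv j" using i j by simp
  also have "\<dots> = j \<otimes> j \<otimes> (j \<otimes> inv j)" unfolding sq using i j by (simp only: m_assoc m_closed c)
  also have "\<dots> = i \<otimes> i" using i j sq by simp
  finally have e: "inv i \<otimes> inv i = i \<otimes> i" .
  have "(i \<otimes> i) \<otimes> (inv i \<otimes> inv i) = i \<otimes> (i \<otimes> inv i) \<otimes> inv i" using i by (simp only: m_assoc m_closed c)
  also have "\<dots> = \<one>" using i by simp
  finally show ?thesis by (simp only: e)
qed

locale compact_lie_group = lie_group K for K :: "('g, 'e::euclidean_space) lie_struct" (structure) +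
  fixes ip :: "'e \<Rightarrow> 'e \<Rightarrow> real"
  assumes compact: "compact_space (topo K)" and ip: "invariant_inner_product K ip"
begin

lemma ip_add: "x \<in> V \<Longrightarrow> y \<in> V \<Longrightarrow> z \<in> V \<Longrightarrow> ip (x + y) z = ip x z + ip y z"
  and ip_sym: "x \<in> V \<Longrightarrow> y \<in> V \<Longrightarrow> ip x y = ip y x"
  and ip_scale: "x \<in> V \<Longrightarrow> y \<in> V \<Longrightarrow> ip (c *\<^sub>R x) y = c * ip x y"
  and ip_pos: "x \<in> V \<Longrightarrow> x \<noteq> 0 \<Longrightarrow> ip x x > 0"
  and ip_Ad: "g \<in> carrier K \<Longrightarrow> x \<in> V \<Longrightarrow> y \<in> V \<Longrightarrow> ip (Ad K g x) (Ad K g y) = ip x y"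
  using ip by (auto simp: invariant_inner_product_def)

text \<open>The form is extended by the Euclidean one to the orthogonal complement of the model space,
  so that bilinearity needs no side conditions.\<close>

definition "form x y = ip (proj x) (proj y) + (x - proj x) \<bullet> (y - proj y)"

lemma form_VV: "x \<in> V \<Longrightarrow> y \<in> V \<Longrightarrow> form x y = ip x y" by (simp add: form_def)
lemma form_sym: "form x y = form y x" by (simp add: form_def ip_sym inner_commute)

lemma form_bilinear: "bilinear form"
proof -
  have l: "linear (\<lambda>x. form x y)" for y
    by (rule linearI) (simp_all add: form_def linear_add[OF proj_linear] linear_cmul[OF proj_linear]
        ip_add ip_scale inner_add_left inner_diff_left algebra_simps)
  moreover have "linear (form x)" for x
  proof -
    have "form x = (\<lambda>y. form y x)" by (rule ext) (rule form_sym)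
    then show ?thesis using l[of x] by simp
  qed
  ultimately show ?thesis by (simp add: bilinear_def)
qed

lemma form_pos: assumes "x \<noteq> 0" shows "form x x > 0"
proof (cases "proj x = 0")
  case True then show ?thesis using assms ip_scale[of 0 0 0] by (simp add: form_def)
next
  case False
  then have "ip (proj x) (proj x) > 0" by (simp add: ip_pos)
  then show ?thesis by (simp add: form_def add_pos_nonneg)
qed

lemma form_AD: "g \<in> carrier K \<Longrightarrow> x \<in> V \<Longrightarrow> y \<in> V \<Longrightarrow> form (AD g x) (AD g y) = form x y"
  by (simp add: form_VV) (simp add: AD_def ip_Ad)

lemma form_proj: "x \<in> V \<Longrightarrow> form x (proj y) = form x y" "y \<in> V \<Longrightarrow> form (proj x) y = form x y"
  by (simp_all add: form_def)

lemma form_bb: "bounded_bilinear form" using form_bilinear bilinear_conv_bounded_bilinear by blast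

text \<open>The derivative at s = 0 of the constant function that pairs the two vectors moved by exp
  (s z).\<close>

lemma form_inv: "form (br z x) y = - form x (br z y)"
proof -
  interpret b: bounded_bilinear form by (rule form_bb)
  have Z: "proj z \<in> V" by simp
  note c = curve_at_one_lexp[OF Z]
  have d: "((\<lambda>s. AD (lexp (s *\<^sub>R proj z)) A) has_derivative (\<lambda>s. s *\<^sub>R br z A)) (at 0)" for A
    using bracket_curve'[OF c, of A] by (simp add: has_vector_derivative_def)
  have one: "AD \<one> A = proj A" for A using AD_one[of "proj A"] by simp
  have "((\<lambda>s. form (AD (lexp (s *\<^sub>R proj z)) x) (AD (lexp (s *\<^sub>R proj z)) y)) has_derivative
     (\<lambda>s. form (AD (lexp (0 *\<^sub>R proj z)) x) (s *\<^sub>R br z y) + form (s *\<^sub>R br z x) (AD (lexp (0 *\<^sub>R proj z)) y))) (at 0)"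
    by (rule b.FDERIV[OF d d])
  moreover have "form (AD (lexp (s *\<^sub>R proj z)) x) (AD (lexp (s *\<^sub>R proj z)) y) = form (proj x) (proj y)" for s
    using form_AD[OF lexp_scale_carrier[OF Z], of "proj x" "proj y"] by simp
  ultimately have "((\<lambda>s::real. form (proj x) (proj y)) has_derivative
     (\<lambda>s. form (AD (lexp (0 *\<^sub>R proj z)) x) (s *\<^sub>R br z y) + form (s *\<^sub>R br z x) (AD (lexp (0 *\<^sub>R proj z)) y))) (at 0)"
    by simp
  from has_derivative_unique[OF this has_derivative_const]
  have "form (AD (lexp (0 *\<^sub>R proj z)) x) (1 *\<^sub>R br z y) + form (1 *\<^sub>R br z x) (AD (lexp (0 *\<^sub>R proj z)) y) = 0"
    by (rule fun_cong)
  then have "form x (br z y) + form (br z x) y = 0" by (simp add: one form_proj)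
  then show ?thesis by (simp add: add_eq_0_iff)
qed

end

sublocale compact_lie_group \<subseteq> mla: metric_lie_algebra form br
  by unfold_locales (rule form_bilinear form_sym form_pos br_bilinear br_anti br_jacobi form_inv | assumption)+

context compact_lie_group
begin

lemma AD_adjoint:
  assumes "g \<in> carrier K" "x \<in> V" "y \<in> V" shows "form x (AD (inv g) y) = form (AD g x) y"
  using form_AD[of g x "AD (inv g) y"] assms by (simp add: AD_inv)

definition "sharp \<xi> = (THE w. w \<in> V \<and> (\<forall>y\<in>V. \<xi> y = form w y))"

lemma sharp_eqI:
  assumes "w \<in> V" "\<And>y. y \<in> V \<Longrightarrow> \<xi> y = form w y" shows "sharp \<xi> = w"
  unfolding sharp_def
proof (rule the_equality)
  fix w' assume *: "w' \<in> V \<and> (\<forall>y\<in>V. \<xi> y = form w' y)"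
  show "w' = w" by (rule mla.riesz_unique[OF V]) (use * assms in auto)
qed (use assms in auto)

lemma sharp:
  assumes "\<xi> \<in> dual V"
  shows "sharp \<xi> \<in> V" "\<And>y. y \<in> V \<Longrightarrow> \<xi> y = form (sharp \<xi>) y"
proof -
  obtain w where w: "w \<in> V" "\<And>y. y \<in> V \<Longrightarrow> \<xi> y = form w y"
    by (rule mla.riesz[OF V, of \<xi>]) (use assms in \<open>auto simp: dual_def\<close>)
  show "sharp \<xi> \<in> V" "\<And>y. y \<in> V \<Longrightarrow> \<xi> y = form (sharp \<xi>) y"
    using sharp_eqI[OF w] w by auto
qed

lemma dual_eqI:
  assumes "\<xi> \<in> dual V" "\<eta> \<in> dual V" "sharp \<xi> = sharp \<eta>" shows "\<xi> = \<eta>"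
proof (rule extensionalityI[of _ V])
  show "\<xi> \<in> extensional V" "\<eta> \<in> extensional V" using assms unfolding dual_def by blast+
  show "\<xi> y = \<eta> y" if "y \<in> V" for y
    by (simp only: sharp(2)[OF assms(1) that] sharp(2)[OF assms(2) that] assms(3))
qed

lemma dual_norm_eq:
  assumes W: "subspace W" "W \<subseteq> V" and w: "w \<in> W" "\<And>y. y \<in> W \<Longrightarrow> f y = form w y"
  shows "dual_norm ip W f = sqrt (form w w)"
proof -
  have "(THE x. x \<in> W \<and> (\<forall>y\<in>W. f y = ip x y)) = w"
  proof (rule the_equality)
    have "f y = ip w y" if y: "y \<in> W" for y
      using w(2)[OF y] form_VV[of w y] w(1) y W(2) by auto
    then show "w \<in> W \<and> (\<forall>y\<in>W. f y = ip w y)" using w(1) by blast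
    fix x assume *: "x \<in> W \<and> (\<forall>y\<in>W. f y = ip x y)"
    show "x = w"
    proof (rule mla.riesz_unique[OF W(1)])
      show "form x y = form w y" if "y \<in> W" for y
        using * w(2)[OF that] that form_VV[of x y] W(2) by auto
    qed (use * w in auto)
  qed
  then show ?thesis using w(1) W(2) form_VV[of w w] by (auto simp: dual_norm_def)
qed

lemma Coad_apply: "y \<in> V \<Longrightarrow> Coad K g \<xi> y = \<xi> (AD (inv g) y)" by (simp add: Coad_def AD_eq)

lemma Coad_sharp:
  assumes \<xi>: "\<xi> \<in> dual V" and g: "g \<in> carrier K"
  shows "Coad K g \<xi> \<in> dual V" "sharp (Coad K g \<xi>) = AD g (sharp \<xi>)"
proof -
  have ig: "inv g \<in> carrier K" using g by simp
  have *: "Coad K g \<xi> y = form (AD g (sharp \<xi>)) y" if y: "y \<in> V" for y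
    using sharp(2)[OF \<xi>, of "AD (inv g) y"] AD_adjoint[OF g sharp(1)[OF \<xi>] y] ig y by (simp add: Coad_apply)
  then show "sharp (Coad K g \<xi>) = AD g (sharp \<xi>)" using g by (intro sharp_eqI) auto
  have "Coad K g \<xi> \<in> extensional V" by (simp add: Coad_def)
  then show "Coad K g \<xi> \<in> dual V"
    using * V by (auto simp: dual_def subspace_add subspace_mul)
qed

definition "stab x = {g \<in> carrier K. AD g x = x}"
definition "cent x = {Y \<in> V. br x Y = 0}"

lemma coad_stabilizer_eq: assumes \<xi>: "\<xi> \<in> dual V" shows "coad_stabilizer K \<xi> = stab (sharp \<xi>)"
proof -
  have "Coad K g \<xi> = \<xi> \<longleftrightarrow> AD g (sharp \<xi>) = sharp \<xi>" if "g \<in> carrier K" for g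
    using Coad_sharp(2)[OF \<xi> that] dual_eqI[OF Coad_sharp(1)[OF \<xi> that] \<xi>] by auto
  then show ?thesis by (auto simp: coad_stabilizer_def stab_def)
qed

lemma AD_lexp_fixed:
  assumes Y: "Y \<in> V" and x: "x \<in> V" and "br Y x = 0"
  shows "AD (lexp (s *\<^sub>R Y)) x = x"
proof -
  have "((\<lambda>s. AD (lexp (s *\<^sub>R Y)) x) has_derivative (\<lambda>h. 0)) (at t)" for t
    using AD_lexp_deriv(1)[OF Y, of x t] linear_0[OF AD_linear[OF lexp_scale_carrier[OF Y]]]
    by (simp add: assms(3) has_vector_derivative_def)
  then have "\<exists>c. \<forall>s\<in>UNIV. AD (lexp (s *\<^sub>R Y)) x = c"
    by (intro has_derivative_zero_constant) auto
  then obtain c where c: "\<And>s. AD (lexp (s *\<^sub>R Y)) x = c" by blast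
  have "c = x" using c[of 0] AD_one[OF x] by simp
  then show ?thesis using c by simp
qed

lemma lie_algebra_of_stab: assumes x: "x \<in> V" shows "lie_algebra_of K (stab x) = cent x"
proof (intro Set.set_eqI iffI)
  fix Y assume "Y \<in> lie_algebra_of K (stab x)"
  then have Y: "Y \<in> V" "\<And>s. AD (lexp (s *\<^sub>R Y)) x = x" by (auto simp: lie_algebra_of_eq stab_def)
  from AD_fixed_bracket[OF Y] show "Y \<in> cent x" using Y(1) br_anti[of x Y] by (simp add: cent_def)
next
  fix Y assume "Y \<in> cent x"
  then have Y: "Y \<in> V" "br Y x = 0" using br_anti[of x Y] by (auto simp: cent_def)
  then show "Y \<in> lie_algebra_of K (stab x)"
    using AD_lexp_fixed[OF Y(1) x Y(2)] lexp_scale_carrier[OF Y(1)] by (auto simp: lie_algebra_of_eq stab_def)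
qed

lemma stab_subgroup: assumes x: "x \<in> V" shows "subgroup (stab x) K"
proof (rule subgroupI)
  show "stab x \<subseteq> carrier K" by (auto simp: stab_def)
  show "stab x \<noteq> {}" using AD_one[OF x] by (auto simp: stab_def)
  show "inv a \<in> stab x" if "a \<in> stab x" for a
    using that AD_inv(1)[of a x] x by (auto simp: stab_def)
  show "a \<otimes> b \<in> stab x" if "a \<in> stab x" "b \<in> stab x" for a b
    using that by (auto simp: stab_def AD_mult)
qed

lemma stab_closed: "closedin X (stab x)"
proof -
  have "closedin X {g \<in> topspace X. AD g x \<in> {x}}"
    by (rule closedin_continuous_map_preimage[OF AD_continuous]) auto
  then show ?thesis by (simp add: stab_def topspace_topo)
qed

text \<open>Rotating the moving vectors back by the angle b s gives two curves with zero derivative.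
  They are constant, and the resulting linear system is solved with cos^2 + sin^2 = 1.\<close>

lemma AD_rotation:
  assumes Y: "Y \<in> V" and u: "u \<in> V" "w \<in> V" and b: "br Y u = - b *\<^sub>R w" "br Y w = b *\<^sub>R u"
  shows "AD (lexp (s *\<^sub>R Y)) u = cos (b * s) *\<^sub>R u - sin (b * s) *\<^sub>R w"
    "AD (lexp (s *\<^sub>R Y)) w = cos (b * s) *\<^sub>R w + sin (b * s) *\<^sub>R u"
proof -
  define f where "f s v = AD (lexp (s *\<^sub>R Y)) v" for s v
  have lin: "linear (f s)" for s unfolding f_def by (rule AD_linear[OF lexp_scale_carrier[OF Y]])
  have f0: "f 0 v = v" if "v \<in> V" for v using AD_one[OF that] by (simp add: f_def)
  have d: "((\<lambda>s. f s v) has_vector_derivative f t (br Y v)) (at t)" for t v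
    unfolding f_def by (rule AD_lexp_deriv(1)[OF Y])
  have du: "((\<lambda>s. f s u) has_vector_derivative - b *\<^sub>R f t w) (at t)" for t
    using d[of u t] by (simp add: b linear_cmul[OF lin] linear_neg[OF lin])
  have dw: "((\<lambda>s. f s w) has_vector_derivative b *\<^sub>R f t u) (at t)" for t
    using d[of w t] by (simp add: b linear_cmul[OF lin])
  have cd: "((\<lambda>s. cos (b * s)) has_real_derivative - b * sin (b * t)) (at t)"
    "((\<lambda>s. sin (b * s)) has_real_derivative b * cos (b * t)) (at t)" for t
    by (auto intro!: derivative_eq_intros)
  have const: "h s = h 0" if "\<And>t. (h has_vector_derivative 0) (at t)" for h :: "real \<Rightarrow> 'e" and s
  proof -
    have "\<exists>c. \<forall>s\<in>UNIV. h s = c"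
      by (intro has_derivative_zero_constant) (use that in \<open>auto simp: has_vector_derivative_def\<close>)
    then obtain c where "\<And>s. h s = c" by blast
    then show ?thesis by simp
  qed
  have "((\<lambda>s. cos (b * s) *\<^sub>R f s u + sin (b * s) *\<^sub>R f s w) has_vector_derivative 0) (at t)" for t
  proof -
    have "((\<lambda>s. cos (b * s) *\<^sub>R f s u + sin (b * s) *\<^sub>R f s w) has_vector_derivative
      (cos (b * t) *\<^sub>R (- b *\<^sub>R f t w) + (- b * sin (b * t)) *\<^sub>R f t u) + (sin (b * t) *\<^sub>R (b *\<^sub>R f t u) + (b * cos (b * t)) *\<^sub>R f t w)) (at t)"
      by (intro has_vector_derivative_add has_vector_derivative_scaleR cd du dw)
    then show ?thesis by (simp add: mult.commute)
  qed
  from const[OF this, of s] have 1: "cos (b * s) *\<^sub>R f s u + sin (b * s) *\<^sub>R f s w = u" by (simp add: f0 u)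
  have "((\<lambda>s. cos (b * s) *\<^sub>R f s w - sin (b * s) *\<^sub>R f s u) has_vector_derivative 0) (at t)" for t
  proof -
    have "((\<lambda>s. cos (b * s) *\<^sub>R f s w - sin (b * s) *\<^sub>R f s u) has_vector_derivative
      (cos (b * t) *\<^sub>R (b *\<^sub>R f t u) + (- b * sin (b * t)) *\<^sub>R f t w) - (sin (b * t) *\<^sub>R (- b *\<^sub>R f t w) + (b * cos (b * t)) *\<^sub>R f t u)) (at t)"
      by (intro has_vector_derivative_diff has_vector_derivative_scaleR cd du dw)
    then show ?thesis by (simp add: mult.commute)
  qed
  from const[OF this, of s] have 2: "cos (b * s) *\<^sub>R f s w - sin (b * s) *\<^sub>R f s u = w" by (simp add: f0 u)
  have cs: "cos (b * s) * cos (b * s) + sin (b * s) * sin (b * s) = 1"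
    using sin_cos_squared_add3[of "b * s"] by simp
  have solve: "c *\<^sub>R (c *\<^sub>R p + d *\<^sub>R q) - d *\<^sub>R (c *\<^sub>R q - d *\<^sub>R p) = (c * c + d * d) *\<^sub>R p"
    "c *\<^sub>R (c *\<^sub>R q - d *\<^sub>R p) + d *\<^sub>R (c *\<^sub>R p + d *\<^sub>R q) = (c * c + d * d) *\<^sub>R q"
    for c d :: real and p q :: 'e
    by (simp_all add: algebra_simps)
  show "AD (lexp (s *\<^sub>R Y)) u = cos (b * s) *\<^sub>R u - sin (b * s) *\<^sub>R w"
    "AD (lexp (s *\<^sub>R Y)) w = cos (b * s) *\<^sub>R w + sin (b * s) *\<^sub>R u"
    using solve(1)[of "cos (b * s)" "f s u" "sin (b * s)" "f s w"] solve(2)[of "cos (b * s)" "f s w" "sin (b * s)" "f s u"]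
    unfolding 1 2 cs by (simp_all add: f_def)
qed

section \<open>The three-dimensional subalgebra of a root\<close>

definition "coroot r = (2 / form r r) *\<^sub>R r"
text \<open>The scaled vector \<open>u\<close> is the second member of a triple like the imaginary
  quaternions, with structure constants of absolute value 2 (see \<open>su2_triple\<close>). At time
  pi / 2 its adjoint action is thus a half-turn of the plane spanned by the other two, which negates
  the coroot.\<close>

definition "weyl u r = lexp ((pi / 2) *\<^sub>R (2 / sqrt (form r r)) *\<^sub>R u)"

lemma su2_triple:
  assumes A: "mla.plane A u w" "br w u = r" "r \<in> A" "r \<noteq> 0"
  defines "e \<equiv> (2 / sqrt (form r r)) *\<^sub>R u" and "f \<equiv> (2 / sqrt (form r r)) *\<^sub>R w" and "h \<equiv> coroot r"
  shows "br h e = - 2 *\<^sub>R f" "br h f = 2 *\<^sub>R e" "br e f = - 2 *\<^sub>R h" "br e h = 2 *\<^sub>R f"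
proof -
  have p: "form r r > 0" by (rule form_pos[OF A(4)])
  have b: "br r u = - (form r r) *\<^sub>R w" "br r w = form r r *\<^sub>R u"
    using A(1,3) by (auto simp: mla.plane_def mla.pair_def A(2))
  show "br h e = - 2 *\<^sub>R f" "br h f = 2 *\<^sub>R e" using p A(4) by (simp_all add: h_def e_def f_def coroot_def b)
  then show "br e h = 2 *\<^sub>R f" using br_anti[of e h] by simp
  have "br u w = - r" using br_anti[of u w] A(2) by simp
  then show "br e f = - 2 *\<^sub>R h" using p by (simp add: h_def e_def f_def coroot_def)
qed

text \<open>The root is a multiple of the coroot and changes sign; the component of \<open>Y\<close>
  orthogonal to the root commutes with \<open>u\<close> and stays fixed.\<close>

lemma weyl_reflection:
  assumes A: "mla.plane A u w" "br w u = r" "r \<in> A" "r \<noteq> 0" and m: "u \<in> V" "w \<in> V" "Y \<in> A" "Y \<in> V"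
  shows "weyl u r \<in> carrier K" "AD (weyl u r) Y = Y - (2 * form Y r / form r r) *\<^sub>R r"
proof -
  define e where "e = (2 / sqrt (form r r)) *\<^sub>R u"
  define f where "f = (2 / sqrt (form r r)) *\<^sub>R w"
  define h where "h = coroot r"
  note t = su2_triple[OF A, folded e_def f_def h_def]
  have rV: "r \<in> V" using br_V[of w u] A(2) by simp
  have mem: "e \<in> V" "f \<in> V" "h \<in> V" using m rV V by (simp_all add: e_def f_def h_def coroot_def subspace_mul)
  have n: "weyl u r = lexp ((pi / 2) *\<^sub>R e)" by (simp add: weyl_def e_def)
  show c: "weyl u r \<in> carrier K" unfolding n by (rule lexp_scale_carrier[OF mem(1)])
  have "AD (weyl u r) h = cos (2 * (pi / 2)) *\<^sub>R h + sin (2 * (pi / 2)) *\<^sub>R f"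
    unfolding n by (rule AD_rotation(2)[OF mem(1,2,3)]) (use t in auto)
  then have nh: "AD (weyl u r) h = - h" by simp
  define c where "c = form Y r / form r r"
  define Y0 where "Y0 = Y - c *\<^sub>R r"
  have p: "form r r > 0" by (rule form_pos[OF A(4)])
  have Y0V: "Y0 \<in> V" using m rV V by (simp add: Y0_def subspace_diff subspace_mul)
  have "br r u = - (form r r) *\<^sub>R w" "br Y u = - (form r Y) *\<^sub>R w"
    using A(1,3) m(3) by (auto simp: mla.plane_def mla.pair_def A(2))
  then have "br Y0 u = 0" using p by (simp add: Y0_def c_def form_sym[of r Y])
  then have "br e Y0 = 0" using br_anti[of u Y0] by (simp add: e_def)
  then have n0: "AD (weyl u r) Y0 = Y0" unfolding n by (rule AD_lexp_fixed[OF mem(1) Y0V])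
  have rh: "r = (form r r / 2) *\<^sub>R h" using p by (simp add: h_def coroot_def)
  have nr: "AD (weyl u r) r = - r"
    by (subst (1 2) rh) (simp add: linear_cmul[OF AD_linear[OF \<open>weyl u r \<in> carrier K\<close>]] nh)
  have "AD (weyl u r) Y = AD (weyl u r) (Y0 + c *\<^sub>R r)" by (simp add: Y0_def)
  also have "\<dots> = Y0 - c *\<^sub>R r"
    using n0 nr by (simp add: linear_add[OF AD_linear[OF \<open>weyl u r \<in> carrier K\<close>]] linear_cmul[OF AD_linear[OF \<open>weyl u r \<in> carrier K\<close>]])
  also have "\<dots> = Y - (c + c) *\<^sub>R r" unfolding scaleR_left_distrib by (simp add: Y0_def)
  also have "c + c = 2 * c" by simp
  finally show "AD (weyl u r) Y = Y - (2 * form Y r / form r r) *\<^sub>R r" by (simp add: c_def)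
qed

text \<open>The half-turn about \<open>h\<close> negates \<open>e\<close> and the half-turn about
  \<open>e\<close> negates \<open>h\<close>. As conjugation corresponds to \<open>AD\<close>, the
  elements \<open>i\<close> and \<open>j\<close> satisfy the quaternion relations, and the fourth
  power of \<open>i\<close> is the element in question.\<close>

lemma lexp_coroot:
  assumes A: "mla.plane A u w" "br w u = r" "r \<in> A" "r \<noteq> 0" and uw: "u \<in> V" "w \<in> V"
  shows "lexp ((2 * pi) *\<^sub>R coroot r) = \<one>"
proof -
  define e where "e = (2 / sqrt (form r r)) *\<^sub>R u"
  define f where "f = (2 / sqrt (form r r)) *\<^sub>R w"
  define h where "h = coroot r"
  note t = su2_triple[OF A, folded e_def f_def h_def]
  have rV: "r \<in> V" using br_V[of w u] A(2) by simp
  have mem: "e \<in> V" "f \<in> V" "h \<in> V" using uw rV V by (simp_all add: e_def f_def h_def coroot_def subspace_mul)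
  define i where "i = lexp ((pi / 2) *\<^sub>R h)"
  define j where "j = lexp ((pi / 2) *\<^sub>R e)"
  have ij: "i \<in> carrier K" "j \<in> carrier K" using lexp_scale_carrier mem by (auto simp: i_def j_def)
  have "AD i e = cos (2 * (pi / 2)) *\<^sub>R e - sin (2 * (pi / 2)) *\<^sub>R f"
    unfolding i_def by (rule AD_rotation(1)[OF mem(3,1,2)]) (use t in auto)
  then have ie: "AD i e = - e" by simp
  have "AD j h = cos (2 * (pi / 2)) *\<^sub>R h + sin (2 * (pi / 2)) *\<^sub>R f"
    unfolding j_def by (rule AD_rotation(2)[OF mem(1,2,3)]) (use t in auto)
  then have jh: "AD j h = - h" by simp
  have neg: "lexp (- (s *\<^sub>R Y)) = inv (lexp (s *\<^sub>R Y))" if Y: "Y \<in> V" for s Y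
  proof -
    have "lexp ((- s) *\<^sub>R Y) \<otimes> lexp (s *\<^sub>R Y) = \<one>" using lexp_add[OF Y, of "- s" s] by simp
    then show ?thesis using lexp_scale_carrier[OF Y, of s] lexp_scale_carrier[OF Y, of "- s"]
      by (intro inv_equality[symmetric]) auto
  qed
  have conj: "g \<otimes> lexp (s *\<^sub>R Y) \<otimes> inv g = inv (lexp (s *\<^sub>R Y))"
    if "g \<in> carrier K" "Y \<in> V" "AD g Y = - Y" for g s Y
  proof -
    have sY: "s *\<^sub>R Y \<in> V" using that V by (simp add: subspace_mul)
    have "Ad K g (s *\<^sub>R Y) = - (s *\<^sub>R Y)"
      using that linear_cmul[OF AD_linear[OF that(1)], of s Y] AD_eq[OF sY, of g] by simp
    then show ?thesis using conj_lexp[OF that(1) sY] neg[OF that(2)] by simp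
  qed
  have "(i \<otimes> i) \<otimes> (i \<otimes> i) = \<one>"
    using conj[OF ij(1) mem(1) ie, of "pi / 2"] conj[OF ij(2) mem(3) jh, of "pi / 2"]
    by (intro quaternion_relations_order_4[OF ij]) (simp_all add: i_def j_def)
  moreover have "i \<otimes> i = lexp (pi *\<^sub>R h)" unfolding i_def using lexp_add[OF mem(3), of "pi/2" "pi/2"] by simp
  moreover have "lexp (pi *\<^sub>R h) \<otimes> lexp (pi *\<^sub>R h) = lexp ((2 * pi) *\<^sub>R h)"
  proof -
    have "pi + pi = 2 * pi" by simp
    then show ?thesis using lexp_add[OF mem(3), of pi pi] by (simp only:)
  qed
  ultimately show ?thesis by (simp add: h_def)
qed

end

section \<open>Regular orbits\<close>

locale regular_orbit = compact_lie_group K ip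
  for K :: "('g, 'e::euclidean_space) lie_struct" (structure) and ip +
  fixes x :: 'e
  assumes x_V: "x \<in> V" and stab_torus: "torus K (stab x)"

sublocale regular_orbit \<subseteq> ta: toral_algebra form br "model K" x
proof
  show "br Y Z = 0" if "Y \<in> V" "Z \<in> V" "br x Y = 0" "br x Z = 0" for Y Z
    using torus_bracket[OF stab_torus] that by (simp add: lie_algebra_of_stab[OF x_V] cent_def)
qed (simp_all add: V x_V)

context regular_orbit
begin

lemma cartan_eq: "ta.cartan = cent x" by (simp add: ta.cartan_def cent_def)

lemma cartan_lie: "lie_algebra_of K (stab x) = ta.cartan" by (simp add: lie_algebra_of_stab[OF x_V] cartan_eq)

lemma stab_exp: "stab x = lexp ` ta.cartan" using torus_exponential[OF stab_torus] cartan_lie by simp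

lemma cartan_V: "Y \<in> ta.cartan \<Longrightarrow> Y \<in> V" by (simp add: ta.cartan_def)

lemma coroot_cartan: "r \<in> ta.root_set \<Longrightarrow> coroot r \<in> ta.cartan"
  using ta.root_regular(2) ta.cartan_subspace by (simp add: coroot_def subspace_mul)

lemma lexp_coroot': assumes r: "r \<in> ta.root_set" shows "lexp ((2 * pi) *\<^sub>R coroot r) = \<one>"
proof -
  obtain u w where "u \<in> V" "w \<in> V" "mla.plane ta.cartan u w" "br w u = r" by (rule ta.root_plane[OF r]) (rule that)
  then show ?thesis using lexp_coroot ta.root_regular(2,3)[OF r] by blast
qed

text \<open>The exponential of 2 pi h is the identity, yet it rotates the plane of \<open>s\<close>
  by the angle 2 pi (s, h); so (s, h) is an integer.\<close>

lemma roots_integral: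
  assumes r: "r \<in> ta.root_set" and s: "s \<in> ta.root_set"
  shows "2 * form s r / form r r \<in> \<int>"
proof -
  obtain u w where p: "u \<in> V" "w \<in> V" "mla.plane ta.cartan u w" "br w u = s" by (rule ta.root_plane[OF s]) (rule that)
  define h where "h = coroot r"
  have h: "h \<in> ta.cartan" using coroot_cartan[OF r] by (simp add: h_def)
  have b: "br h u = - (form s h) *\<^sub>R w" "br h w = form s h *\<^sub>R u"
    using p(3,4) h by (auto simp: mla.plane_def mla.pair_def)
  have on: "form u u = 1" "form w u = 0" using p(3) form_sym[of w u] by (auto simp: mla.plane_def)
  have "AD (lexp ((2 * pi) *\<^sub>R h)) u = cos (form s h * (2 * pi)) *\<^sub>R u - sin (form s h * (2 * pi)) *\<^sub>R w"
    by (rule AD_rotation(1)[OF cartan_V[OF h] p(1,2) b])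
  then have "u = cos (form s h * (2 * pi)) *\<^sub>R u - sin (form s h * (2 * pi)) *\<^sub>R w"
    using lexp_coroot'[OF r] AD_one[OF p(1)] by (simp add: h_def)
  then have "form u u = form (cos (form s h * (2 * pi)) *\<^sub>R u - sin (form s h * (2 * pi)) *\<^sub>R w) u" by simp
  then have "cos (form s h * (2 * pi)) = 1" by (simp only: mla.B_simps on) simp
  then obtain n :: int where "form s h * (2 * pi) = real_of_int n * 2 * pi" using cos_one_2pi_int by blast
  then have "form s h = real_of_int n" by simp
  then show ?thesis by (simp add: h_def coroot_def)
qed

text \<open>The Weyl element of \<open>r\<close> acts on the Cartan subalgebra as the reflection
  \<open>R\<close> and carries the plane of \<open>s\<close> to a plane on which the Cartan
  subalgebra acts with weight \<open>R s\<close>.\<close>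

lemma roots_reflect:
  assumes r: "r \<in> ta.root_set" and s: "s \<in> ta.root_set"
  shows "s - (2 * form s r / form r r) *\<^sub>R r \<in> ta.root_set"
proof -
  obtain u w where p: "u \<in> V" "w \<in> V" "mla.plane ta.cartan u w" "br w u = r" by (rule ta.root_plane[OF r]) (rule that)
  obtain us ws where q: "us \<in> V" "ws \<in> V" "mla.plane ta.cartan us ws" "br ws us = s" by (rule ta.root_plane[OF s]) (rule that)
  note rr = ta.root_regular[OF r] and ss = ta.root_regular[OF s]
  define R where "R Y = Y - (2 * form Y r / form r r) *\<^sub>R r" for Y
  define n where "n = weyl u r"
  have n: "n \<in> carrier K" "\<And>Y. Y \<in> ta.cartan \<Longrightarrow> AD n Y = R Y"
    using weyl_reflection[OF p(3,4) rr(2,3) p(1,2)] weyl_reflection(1)[OF p(3,4) rr(2,3) p(1,2) rr(2) cartan_V[OF rr(2)]] cartan_V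
    by (auto simp: n_def R_def)
  have Rt: "R Y \<in> ta.cartan" if "Y \<in> ta.cartan" for Y
    unfolding R_def using that rr(2) by (intro subspace_diff subspace_mul ta.cartan_subspace)
  have pos: "form r r > 0" by (rule form_pos[OF rr(3)])
  have RR: "R (R Y) = Y" for Y
  proof -
    have "form (R Y) r = - form Y r" using pos by (simp add: R_def)
    then show ?thesis by (simp add: R_def[of "R Y"]) (simp add: R_def)
  qed
  have Rsym: "form s (R Y) = form (R s) Y" for Y by (simp add: R_def form_sym[of r Y])
  have ni: "AD (inv n) Y = R Y" if "Y \<in> ta.cartan" for Y
  proof -
    have "AD n (R Y) = Y" using n(2)[OF Rt[OF that]] RR by simp
    then show ?thesis using AD_inv(1)[OF n(1) cartan_V[OF Rt[OF that]]] by simp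
  qed
  have br: "br Y (AD n v) = AD n (br (R Y) v)" if "Y \<in> ta.cartan" for Y v
    using AD_br[OF n(1), of "R Y" v] n(2)[OF Rt[OF that]] RR by simp
  have nl: "linear (AD n)" by (rule AD_linear[OF n(1)])
  have "mla.pair ta.cartan (R s) (AD n us) (AD n ws)"
    unfolding mla.pair_def
  proof (intro ballI conjI)
    fix Y assume Y: "Y \<in> ta.cartan"
    have b: "br (R Y) us = - (form s (R Y)) *\<^sub>R ws" "br (R Y) ws = form s (R Y) *\<^sub>R us"
      using q(3,4) Rt[OF Y] by (auto simp: mla.plane_def mla.pair_def)
    show "br Y (AD n us) = - form (R s) Y *\<^sub>R AD n ws" "br Y (AD n ws) = form (R s) Y *\<^sub>R AD n us"
      unfolding br[OF Y] b linear_cmul[OF nl] Rsym by (rule refl)+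
  qed
  moreover have "AD n us \<noteq> 0"
  proof
    assume "AD n us = 0"
    then have "form us us = 0" using form_AD[OF n(1) q(1,1)] by simp
    then show False using q(3) by (simp add: mla.plane_def)
  qed
  moreover have "R s \<noteq> 0"
  proof
    assume "R s = 0"
    then have "form s s = 0" using form_AD[OF n(1) cartan_V[OF ss(2)] cartan_V[OF ss(2)]] n(2)[OF ss(2)] by simp
    then show False using ss(3) by simp
  qed
  ultimately have "R s \<in> ta.root_set"
    unfolding ta.root_set_def using Rt[OF ss(2)] AD_V[OF n(1), of us] AD_V[OF n(1), of ws] by blast
  then show ?thesis by (simp add: R_def)
qed

text \<open>For \<open>y\<close> in the Cartan subalgebra these are the roots of its stabilizer. All
  hypotheses on roots pass to the subset because reflections in its members preserve orthogonality
  to \<open>y\<close>; y = 0 gives the full system.\<close>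

lemma sub_root_system: "root_system form {r \<in> ta.root_set. form r y = 0} x"
proof
  show "finite {r \<in> ta.root_set. form r y = 0}" using ta.root_set_finite by simp
qed (use ta.root_regular roots_integral roots_reflect ta.roots_reduced in auto)

lemma full_root_system: "root_system form ta.root_set x"
  using sub_root_system[of 0] by simp

end

sublocale regular_orbit \<subseteq> rs: root_system form "ta.root_set" x by (rule full_root_system)

context regular_orbit
begin

lemma plane_coord_AD:
  assumes Y: "Y \<in> ta.cartan" and p: "p \<in> ta.root_planes" and v: "v \<in> V"
  shows "ta.plane_coord p (AD (lexp Y) v) = cis (form (ta.root_of p) Y) * ta.plane_coord p v"
proof -
  note P = ta.root_planes_facts[OF p]
  define b where "b = form (ta.root_of p) Y"
  have yb: "br Y (fst p) = - b *\<^sub>R snd p" "br Y (snd p) = b *\<^sub>R fst p"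
    using P(5) Y by (auto simp: mla.pair_def b_def)
  note YV = cartan_V[OF Y]
  have c: "lexp Y \<in> carrier K" using YV by simp
  have inv: "inv (lexp Y) = lexp ((-1) *\<^sub>R Y)"
  proof (rule inv_equality)
    show "lexp ((-1) *\<^sub>R Y) \<otimes> lexp Y = \<one>" using lexp_add[OF YV, of "-1" 1] by simp
    show "lexp ((-1) *\<^sub>R Y) \<in> carrier K" by (rule lexp_scale_carrier[OF YV])
  qed (rule c)
  have adj: "form (AD (lexp Y) v) z = form v (AD (lexp ((-1) *\<^sub>R Y)) z)" if "z \<in> V" for z
    using AD_adjoint[OF c v that] by (simp add: inv)
  note rot = AD_rotation[OF YV P(1,2) yb, of "-1"]
  have "form (AD (lexp Y) v) (fst p) = cos b * form v (fst p) + sin b * form v (snd p)"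
    "form (AD (lexp Y) v) (snd p) = cos b * form v (snd p) - sin b * form v (fst p)"
    using adj[OF P(1)] adj[OF P(2)] rot by simp_all
  then show ?thesis by (simp add: ta.plane_coord_def complex_eq_iff b_def algebra_simps)
qed

text \<open>Every element of the stabilizer is an exponential from the Cartan subalgebra and
  multiplies each plane coordinate by a complex number, which commutes with multiplication by
  \<i>.\<close>

lemma J0_equivariant:
  assumes g: "g \<in> stab x" and v: "v \<in> V"
  shows "ta.J0 (AD g v) - AD g (ta.J0 v) \<in> ta.cartan"
proof -
  obtain Y where Y: "Y \<in> ta.cartan" "g = lexp Y" using g stab_exp by blast
  have c: "g \<in> carrier K" using g by (simp add: stab_def)
  have G: "ta.J0 (AD g v) - AD g (ta.J0 v) \<in> V" using ta.J0_G c V by (simp add: subspace_diff)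
  show ?thesis unfolding ta.cartan_iff_plane_coord[OF G]
    using plane_coord_AD[OF Y(1) _ v] plane_coord_AD[OF Y(1) _ ta.J0_G] by (simp add: ta.plane_coord_diff ta.plane_coord_J0 Y(2))
qed

lemma derivative_in_subspace:
  fixes W :: "'e set"
  assumes W: "subspace W" and f: "(f has_vector_derivative d) (at t)" "\<And>s. f s \<in> W"
  shows "d \<in> W"
proof -
  obtain P where P: "bounded_linear P" "\<And>x. P x \<in> W" "\<And>x. x \<in> W \<Longrightarrow> P x = x"
    "\<And>x w. w \<in> W \<Longrightarrow> (x - P x) \<bullet> w = 0"
    by (rule subspace_projection[OF W]) (rule that)
  have "((\<lambda>s. P (f s)) has_vector_derivative P d) (at t)" by (rule bounded_linear.has_vector_derivative[OF P(1) f(1)])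
  then have "(f has_vector_derivative P d) (at t)" using P(3)[OF f(2)] by simp
  from vector_derivative_unique_at[OF f(1) this] show ?thesis using P(2)[of d] by metis
qed

context
  fixes \<xi> :: "'e \<Rightarrow> real"
  assumes \<xi>: "\<xi> \<in> dual V" "sharp \<xi> = x"
begin

lemma stabilizer_algebra_cartan: "stabilizer_algebra K \<xi> = ta.cartan"
  using coad_stabilizer_eq[OF \<xi>(1)] \<xi>(2) cartan_lie by simp

lemma Omega_eq: "Y \<in> V \<Longrightarrow> Z \<in> V \<Longrightarrow> Omega K \<xi> Y Z = form (br x Y) Z"
  using sharp(2)[OF \<xi>(1), of "br Y Z"] form_inv[of Y x Z] br_anti[of Y x]
  by (simp add: Omega_def br_eq[symmetric] \<xi>(2))

text \<open>Existence: it guarantees that the structure selected in \<open>rho\<close> has the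
  required properties.\<close>

lemma orbit_complex_structure_J0: "orbit_complex_structure K \<xi> ta.J0"
  unfolding orbit_complex_structure_def Let_def coad_stabilizer_eq[OF \<xi>(1)] \<xi>(2) cartan_lie
proof (intro conjI ballI allI)
  show "ta.J0 ` V \<subseteq> V" using ta.J0_G by blast
  show "ta.J0 ` ta.cartan \<subseteq> ta.cartan" using ta.J0_cartan subspace_0[OF ta.cartan_subspace] by auto
  show "ta.J0 (Y + Z) = ta.J0 Y + ta.J0 Z" for Y Z by (rule linear_add[OF ta.J0_linear])
  show "ta.J0 (c *\<^sub>R Y) = c *\<^sub>R ta.J0 Y" for c Y by (rule linear_cmul[OF ta.J0_linear])
  show "ta.J0 (ta.J0 Y) + Y \<in> ta.cartan" if "Y \<in> V" for Y by (rule ta.J0_square[OF that])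
  show "ta.J0 (Ad K g Y) - Ad K g (ta.J0 Y) \<in> ta.cartan" if "g \<in> stab x" "Y \<in> V" for g Y
    using J0_equivariant[OF that] that ta.J0_G by (simp add: AD_eq)
  show "Omega K \<xi> Y (ta.J0 Z) = Omega K \<xi> Z (ta.J0 Y)" if "Y \<in> V" "Z \<in> V" for Y Z
    using that ta.J0_G by (simp add: Omega_eq ta.B_br_x_J0 mult.commute)
  show "0 < Omega K \<xi> Y (ta.J0 Y)" if "Y \<in> V - ta.cartan" for Y
    using that ta.B_br_x_J0_pos[of Y] ta.J0_G by (simp add: Omega_eq)
qed

text \<open>The selected structure \<open>J\<close> need not be \<open>J0\<close>, but it has the
  same effect on plane coordinates, and these determine the trace. The factor 1 / (2 \<i>) turns the
  sum of the imaginary eigenvalues into half the sum of the positive roots.\<close>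

lemma rho_eq:
  assumes Y: "Y \<in> ta.cartan"
  shows "rho K \<xi> Y = form (\<Sum>rs.pos) Y / 2"
proof -
  define J where "J = (SOME J. orbit_complex_structure K \<xi> J)"
  have "orbit_complex_structure K \<xi> J" unfolding J_def
    by (rule someI[where P = "orbit_complex_structure K \<xi>", OF orbit_complex_structure_J0])
  note J = this[unfolded orbit_complex_structure_def Let_def coad_stabilizer_eq[OF \<xi>(1)] \<xi>(2) cartan_lie]
  have JV: "J v \<in> V" if "v \<in> V" for v using J that by blast
  have Jt: "J v \<in> ta.cartan" if "v \<in> ta.cartan" for v using J that by blast
  have Jadd: "J (v + w) = J v + J w" if "v \<in> V" "w \<in> V" for v w using J that by blast
  have Jsc: "J (c *\<^sub>R v) = c *\<^sub>R J v" if "v \<in> V" for c v using J that by blast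
  have JJ: "J (J v) + v \<in> ta.cartan" if "v \<in> V" for v using J that by blast
  have Jeq: "J (Ad K g v) - Ad K g (J v) \<in> ta.cartan" if "g \<in> stab x" "v \<in> V" for g v using J that by blast
  have Jpos: "form (br x v) (J v) > 0" if "v \<in> V" "v \<notin> ta.cartan" for v
  proof -
    have "\<forall>v\<in>V - ta.cartan. 0 < Omega K \<xi> v (J v)" by (intro J[THEN conjunct2, THEN conjunct2, THEN conjunct2, THEN conjunct2, THEN conjunct2, THEN conjunct2, THEN conjunct2])
    then have "0 < Omega K \<xi> v (J v)" using that by blast
    then show ?thesis by (simp only: Omega_eq[OF that(1) JV[OF that(1)]])
  qed
  \<comment> \<open>Equivariance under exp (s x), differentiated at s = 0. The curve stays in the
    Cartan subalgebra, hence so does its derivative; composing \<open>J\<close> with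
    \<open>proj\<close> makes it linear on the ambient space.\<close>
  have com: "J (br x v) - br x (J v) \<in> ta.cartan" if v: "v \<in> V" for v
  proof -
    have Jl: "bounded_linear (\<lambda>v. J (proj v))"
      by (subst linear_conv_bounded_linear[symmetric], rule linearI)
        (simp_all add: linear_add[OF proj_linear] linear_cmul[OF proj_linear] Jadd Jsc)
    have xs: "lexp (s *\<^sub>R x) \<in> stab x" for s
      using stab_exp ta.x_cartan ta.cartan_subspace by (auto simp: subspace_mul)
    have d: "((\<lambda>s. AD (lexp (s *\<^sub>R x)) z) has_vector_derivative br x z) (at 0)" for z
      by (rule bracket_curve'[OF curve_at_one_lexp[OF x_V]])
    have "((\<lambda>s. J (proj (AD (lexp (s *\<^sub>R x)) v)) - AD (lexp (s *\<^sub>R x)) (J v)) has_vector_derivative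
        J (proj (br x v)) - br x (J v)) (at 0)"
      by (intro has_vector_derivative_diff bounded_linear.has_vector_derivative[OF Jl] d)
    moreover have "J (proj (AD (lexp (s *\<^sub>R x)) v)) - AD (lexp (s *\<^sub>R x)) (J v) \<in> ta.cartan" for s
      using Jeq[OF xs v] JV[OF v] v lexp_scale_carrier[OF x_V] by (simp add: AD_eq Ad_V)
    ultimately have "J (proj (br x v)) - br x (J v) \<in> ta.cartan"
      by (rule derivative_in_subspace[OF ta.cartan_subspace])
    then show ?thesis by simp
  qed
  have kJ: "ta.plane_coord p (J v) = \<i> * ta.plane_coord p v" if "v \<in> V" "p \<in> ta.root_planes" for v p
    by (rule ta.complex_structure_unique[OF JV Jt Jadd Jsc JJ com Jpos that])
  have "complex_trace V ta.cartan J (lie_bracket K Y) = \<i> * of_real (\<Sum>p\<in>ta.root_planes. form (ta.root_of p) Y)"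
    by (rule ta.complex_trace_br[of J, OF JV kJ Y br_eq[OF cartan_V[OF Y], symmetric]])
  moreover have "(\<Sum>p\<in>ta.root_planes. form (ta.root_of p) Y) = form (\<Sum>rs.pos) Y"
  proof -
    have "rs.pos = ta.root_of ` ta.root_planes" using ta.root_of_positive_roots by (simp add: rs.pos_def)
    then have "form (\<Sum>rs.pos) Y = (\<Sum>r\<in>ta.root_of ` ta.root_planes. form r Y)"
      by (simp add: linear_sum[OF ta.B_left_linear])
    then show ?thesis by (simp add: sum.reindex[OF ta.root_of_inj])
  qed
  ultimately have "complex_trace V ta.cartan J (lie_bracket K Y) = \<i> * of_real (form (\<Sum>rs.pos) Y)" by simp
  then show ?thesis
    using Y by (simp add: rho_def Let_def stabilizer_algebra_cartan J_def[symmetric] complex_eq_iff Re_divide)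
qed

lemma admissible_integral:
  assumes adm: "admissible K \<xi>" and a: "rs.simple a"
  shows "form x a \<ge> form a a / 2"
proof -
  have aR: "a \<in> ta.root_set" "form a x > 0" using a by (auto simp: rs.simple_def rs.pos_def)
  have aa: "form a a > 0" by (rule form_pos) (use ta.root_regular(3)[OF aR(1)] in simp)
  obtain \<tau> where \<tau>: "unitary_character K (stab x) \<tau>"
    "\<And>Y. Y \<in> ta.cartan \<Longrightarrow> ((\<lambda>s. \<tau> (lie_exp K (s *\<^sub>R Y))) has_vector_derivative \<i> * of_real (\<xi> Y - rho K \<xi> Y)) (at 0)"
    using adm unfolding admissible_def coad_stabilizer_eq[OF \<xi>(1)] \<xi>(2) cartan_lie by blast
  define h where "h = coroot a"
  have h: "h \<in> ta.cartan" using coroot_cartan[OF aR(1)] by (simp add: h_def)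
  note hV = cartan_V[OF h]
  define \<mu> where "\<mu> = \<xi> h - rho K \<xi> h"
  \<comment> \<open>A differentiable homomorphism from the reals to the unit circle with velocity
    \<i> \<mu>, hence s -> exp (\<i> \<mu> s). Its value at 2 pi is 1, so \<mu> is an
    integer.\<close>
  define F where "F s = \<tau> (lexp (s *\<^sub>R h))" for s
  have hs: "lexp (s *\<^sub>R h) \<in> stab x" for s
    using stab_exp h ta.cartan_subspace by (auto simp: subspace_mul)
  have Fm: "F (s + t) = F s * F t" for s t
    using \<tau>(1) hs by (simp add: F_def lexp_add[OF hV] unitary_character_def)
  have Fn: "norm (F s) = 1" for s using \<tau>(1) hs by (simp add: F_def unitary_character_def)
  have F0: "F 0 = 1" using Fm[of 0 0] Fn[of 0] by auto
  have "lie_exp K (s *\<^sub>R h) = lexp (s *\<^sub>R h)" for s using hV V by (intro lie_exp) (simp add: subspace_mul)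
  then have d0: "(F has_vector_derivative \<i> * of_real \<mu>) (at 0)" using \<tau>(2)[OF h] by (simp add: F_def[abs_def] \<mu>_def)
  have d: "(F has_vector_derivative F t * (\<i> * of_real \<mu>)) (at t)" for t
  proof -
    have 1: "((\<lambda>s. s - t) has_vector_derivative 1) (at t)" by (auto intro!: derivative_eq_intros)
    have "(F has_vector_derivative \<i> * of_real \<mu>) (at (t - t))" using d0 by simp
    from vector_diff_chain_at[OF 1 this]
    have "((\<lambda>s. F (s - t)) has_vector_derivative \<i> * of_real \<mu>) (at t)" by (simp add: o_def)
    then have "((\<lambda>s. F t * F (s - t)) has_vector_derivative F t * (\<i> * of_real \<mu>)) (at t)"
      by (rule has_vector_derivative_mult_right)
    then show ?thesis using Fm[of t] by (simp add: Fm[symmetric])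
  qed
  have e: "((\<lambda>s. exp (of_real s * (- \<i> * of_real \<mu>))) has_vector_derivative
      (- \<i> * of_real \<mu>) * exp (of_real t * (- \<i> * of_real \<mu>))) (at t)" for t :: real
    using exp_scaleR_has_vector_derivative_right[of "- \<i> * of_real \<mu>" t UNIV]
    by (simp only: scaleR_conv_of_real mult.commute[of "exp _"])
  have "((\<lambda>s. F s * exp (of_real s * (- \<i> * of_real \<mu>))) has_derivative (\<lambda>h. 0)) (at t)" for t :: real
  proof -
    have "((\<lambda>s. F s * exp (of_real s * (- \<i> * of_real \<mu>))) has_vector_derivative
      F t * ((- \<i> * of_real \<mu>) * exp (of_real t * (- \<i> * of_real \<mu>))) + F t * (\<i> * of_real \<mu>) * exp (of_real t * (- \<i> * of_real \<mu>))) (at t)"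
      by (rule has_vector_derivative_mult[OF d e])
    then show ?thesis by (simp add: has_vector_derivative_def)
  qed
  then have "\<exists>c. \<forall>s\<in>UNIV. F s * exp (of_real s * (- \<i> * of_real \<mu>)) = c"
    by (intro has_derivative_zero_constant) auto
  then obtain c where c: "\<And>s. F s * exp (of_real s * (- \<i> * of_real \<mu>)) = c" by blast
  have "c = 1" using c[of 0] F0 by simp
  moreover have "F (2 * pi) = F 0" using lexp_coroot'[OF aR(1)] by (simp add: F_def h_def)
  ultimately have "exp (of_real (2 * pi) * (- \<i> * of_real \<mu>)) = 1" using c[of "2 * pi"] F0 by simp
  then obtain n :: int where n: "Im (of_real (2 * pi) * (- \<i> * of_real \<mu>)) = of_int (2 * n) * pi"
    using exp_eq_1 by blast
  then have "- (2 * pi * \<mu>) = 2 * pi * of_int n" by (simp add: algebra_simps)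
  then have "2 * pi * (\<mu> + of_int n) = 0" by (simp only: distrib_left)
  then have "\<mu> = of_int (- n)" by simp
  \<comment> \<open>The subtracted 1 is the value of \<rho> on a simple coroot.\<close>
  moreover have "\<mu> = 2 * form x a / form a a - 1"
  proof -
    have "form (\<Sum>rs.pos) h = 2" using rs.sum_pos_simple[OF a] ta.root_regular(3)[OF aR(1)] by (simp add: h_def coroot_def)
    then have "rho K \<xi> h = 1" by (simp add: rho_eq[OF h])
    moreover have "\<xi> h = 2 * form x a / form a a" using sharp(2)[OF \<xi>(1) hV] \<xi>(2) by (simp add: h_def coroot_def)
    ultimately show ?thesis by (simp add: \<mu>_def)
  qed
  ultimately have eq: "2 * form x a / form a a = of_int (1 - n)" by simp
  have "2 * form x a / form a a > 0" using aR(2) aa by (simp add: form_sym)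
  then have "1 - n \<ge> 1" unfolding eq by linarith
  then have "2 * form x a / form a a \<ge> 1" unfolding eq by linarith
  then show ?thesis using aa by (simp add: field_simps)
qed

text \<open>A root that is simple among those vanishing at \<open>y\<close> is simple among all of
  them: if it were b + c with positive b and c, then (b, y) and (c, y) would be nonnegative with sum
  0, so both summands would vanish at \<open>y\<close>. This makes
  \<open>admissible_integral\<close> available, and the product with \<open>y\<close> drops
  out.\<close>

lemma half_sum_norm_le_distance:
  assumes adm: "admissible K \<xi>" and y: "y \<in> ta.cartan" and dom: "\<And>b. b \<in> ta.root_set \<Longrightarrow> form b x > 0 \<Longrightarrow> form b y \<ge> 0"
  defines "P \<equiv> {b \<in> ta.root_set. form b y = 0 \<and> form b x > 0}"
  shows "form ((1/2) *\<^sub>R \<Sum>P) ((1/2) *\<^sub>R \<Sum>P) \<le> form (x - y) (x - y)"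
proof -
  interpret ry: root_system form "{r \<in> ta.root_set. form r y = 0}" x by (rule sub_root_system)
  have P: "P = ry.pos" by (auto simp: P_def ry.pos_def)
  have "form (x - y) a \<ge> form a a / 2" if a: "ry.simple a" for a
  proof -
    have aP: "a \<in> ta.root_set" "form a y = 0" "form a x > 0" using a by (auto simp: ry.simple_def ry.pos_def)
    have "rs.simple a" unfolding rs.simple_def
    proof (intro conjI ballI)
      show "a \<in> rs.pos" using aP by (simp add: rs.pos_def)
      fix b c assume bc: "b \<in> rs.pos" "c \<in> rs.pos"
      show "a \<noteq> b + c"
      proof
        assume e: "a = b + c"
        have "form b y \<ge> 0" "form c y \<ge> 0" "form b y + form c y = 0" using bc dom aP(2) e by (auto simp: rs.pos_def)
        then have "form b y = 0" "form c y = 0" by linarith+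
        then have "b \<in> ry.pos" "c \<in> ry.pos" using bc by (auto simp: rs.pos_def ry.pos_def)
        then show False using a e by (auto simp: ry.simple_def)
      qed
    qed
    from admissible_integral[OF adm this] show ?thesis using aP(2) by (simp add: form_sym[of y])
  qed
  from ry.half_sum_norm_le[OF this] show ?thesis by (simp add: P)
qed

end

end

section \<open>Conjugation, extremal points of orbits, and centralizers\<close>

context compact_lie_group
begin

lemma conj_lexp_AD: "g \<in> carrier K \<Longrightarrow> Y \<in> V \<Longrightarrow> g \<otimes> lexp Y \<otimes> inv g = lexp (AD g Y)"
  by (simp add: conj_lexp AD_eq)

lemma lie_algebra_of_conj:
  assumes g: "g \<in> carrier K" and A: "A \<subseteq> carrier K"
  shows "lie_algebra_of K ((\<lambda>k. g \<otimes> k \<otimes> inv g) ` A) = AD g ` lie_algebra_of K A" (is "?L = ?R")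
proof
  have sc: "AD g (s *\<^sub>R Y) = s *\<^sub>R AD g Y" if "g \<in> carrier K" for g s Y by (rule linear_cmul[OF AD_linear[OF that]])
  show "?L \<subseteq> ?R"
  proof
    fix Y assume "Y \<in> ?L"
    then have Y: "Y \<in> V" and l: "\<And>s. lexp (s *\<^sub>R Y) \<in> (\<lambda>k. g \<otimes> k \<otimes> inv g) ` A" by (auto simp: lie_algebra_of_eq)
    have "lexp (s *\<^sub>R AD (inv g) Y) \<in> A" for s
    proof -
      obtain a where a: "a \<in> A" "lexp (s *\<^sub>R Y) = g \<otimes> a \<otimes> inv g" using l[of s] by blast
      have ac: "a \<in> carrier K" using a A by blast
      have "lexp (s *\<^sub>R AD (inv g) Y) = inv g \<otimes> lexp (s *\<^sub>R Y) \<otimes> inv (inv g)"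
        using conj_lexp_AD[of "inv g" "s *\<^sub>R Y"] g Y V by (simp add: subspace_mul sc)
      also have "\<dots> = (inv g \<otimes> g) \<otimes> a \<otimes> (inv g \<otimes> g)" unfolding a(2) using ac g by (simp only: m_assoc m_closed inv_closed inv_inv)
      also have "\<dots> = a" using ac g by simp
      finally show ?thesis using a(1) by simp
    qed
    then have "AD (inv g) Y \<in> lie_algebra_of K A" using g by (simp add: lie_algebra_of_eq)
    moreover have "Y = AD g (AD (inv g) Y)" using AD_inv(2)[OF g Y] by simp
    ultimately show "Y \<in> ?R" by blast
  qed
  show "?R \<subseteq> ?L"
  proof clarify
    fix Y assume Y: "Y \<in> lie_algebra_of K A"
    have "lexp (s *\<^sub>R AD g Y) = g \<otimes> lexp (s *\<^sub>R Y) \<otimes> inv g" for s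
      using conj_lexp_AD[OF g, of "s *\<^sub>R Y"] lie_algebra_ofD(1)[OF Y] V by (simp add: subspace_mul sc[OF g])
    then show "AD g Y \<in> ?L" using lie_algebra_ofD(2)[OF Y] g by (auto simp: lie_algebra_of_eq)
  qed
qed

lemma torus_conj:
  assumes g: "g \<in> carrier K" and T: "torus K T"
  shows "torus K ((\<lambda>k. g \<otimes> k \<otimes> inv g) ` T)"
proof -
  have s: "subgroup T K" using T by (simp add: torus_def)
  have Tc: "k \<in> carrier K" if "k \<in> T" for k using subgroup.mem_carrier[OF s that] .
  have mult: "(g \<otimes> a \<otimes> inv g) \<otimes> (g \<otimes> b \<otimes> inv g) = g \<otimes> (a \<otimes> b) \<otimes> inv g" if "a \<in> T" "b \<in> T" for a b
  proof -
    have "(g \<otimes> a \<otimes> inv g) \<otimes> (g \<otimes> b \<otimes> inv g) = g \<otimes> a \<otimes> (inv g \<otimes> g) \<otimes> b \<otimes> inv g"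
      using that Tc g by (simp only: m_assoc m_closed inv_closed)
    then show ?thesis using that Tc g by (simp add: m_assoc)
  qed
  have iv: "inv (g \<otimes> a \<otimes> inv g) = g \<otimes> inv a \<otimes> inv g" if "a \<in> T" for a
    using Tc[OF that] g by (simp add: inv_mult_group m_assoc)
  have "subgroup ((\<lambda>k. g \<otimes> k \<otimes> inv g) ` T) K"
  proof (rule subgroupI)
    show "(\<lambda>k. g \<otimes> k \<otimes> inv g) ` T \<subseteq> carrier K" using Tc g by auto
    show "(\<lambda>k. g \<otimes> k \<otimes> inv g) ` T \<noteq> {}" using subgroup.one_closed[OF s] by auto
    show "inv a \<in> (\<lambda>k. g \<otimes> k \<otimes> inv g) ` T" if "a \<in> (\<lambda>k. g \<otimes> k \<otimes> inv g) ` T" for a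
      using that iv subgroup.m_inv_closed[OF s] by auto
    show "a \<otimes> b \<in> (\<lambda>k. g \<otimes> k \<otimes> inv g) ` T"
      if "a \<in> (\<lambda>k. g \<otimes> k \<otimes> inv g) ` T" "b \<in> (\<lambda>k. g \<otimes> k \<otimes> inv g) ` T" for a b
      using that mult subgroup.m_closed[OF s] by auto
  qed
  moreover have "compactin X ((\<lambda>k. g \<otimes> k \<otimes> inv g) ` T)"
    using T by (intro image_compactin[OF _ continuous_map_conj[OF g]]) (simp add: torus_def)
  moreover have "connectedin X ((\<lambda>k. g \<otimes> k \<otimes> inv g) ` T)"
    using T by (intro connectedin_continuous_map_image[OF continuous_map_conj[OF g]]) (simp add: torus_def)
  moreover have "(g \<otimes> a \<otimes> inv g) \<otimes> (g \<otimes> b \<otimes> inv g) = (g \<otimes> b \<otimes> inv g) \<otimes> (g \<otimes> a \<otimes> inv g)" if "a \<in> T" "b \<in> T" for a b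
    using mult[OF that] mult[OF that(2,1)] torus_commute[OF T that] by simp
  ultimately show ?thesis by (auto simp: torus_def)
qed

lemma compact_maximizer:
  assumes C: "closedin X C" "C \<noteq> {}"
  obtains k where "k \<in> C" "\<And>g. g \<in> C \<Longrightarrow> form (AD g a) x \<le> form (AD k a) x"
proof -
  have l: "bounded_linear (\<lambda>v. form v x)" using form_bb by (rule bounded_bilinear.bounded_linear_left)
  have cm: "continuous_map X euclideanreal ((\<lambda>v. form v x) \<circ> (\<lambda>g. AD g a))"
    by (rule continuous_map_compose[OF AD_continuous]) (use linear_continuous_on[OF l] in simp)
  have "compactin X C" using C compact by (simp add: closedin_compact_space)
  from image_compactin[OF this cm] have "compact ((\<lambda>g. form (AD g a) x) ` C)" by (simp add: o_def)
  from compact_attains_sup[OF this] C(2) show ?thesis using that by blast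
qed

text \<open>The variation is taken in the direction u = [a, x] itself: by invariance the derivative
  of the pairing with \<open>x\<close> is then the squared length of u.\<close>

lemma maximizer_commutes:
  assumes a: "a \<in> V" and x: "x \<in> V" and max: "\<And>s. form (AD (lexp (s *\<^sub>R br a x)) a) x \<le> form a x"
  shows "br a x = 0"
proof -
  define u where "u = br a x"
  have u: "u \<in> V" by (simp add: u_def)
  have l: "bounded_linear (\<lambda>v. form v x)" using form_bb by (rule bounded_bilinear.bounded_linear_left)
  have "((\<lambda>s. AD (lexp (s *\<^sub>R u)) a) has_vector_derivative br u a) (at 0)"
    by (rule bracket_curve'[OF curve_at_one_lexp[OF u]])
  from bounded_linear.has_vector_derivative[OF l this]
  have "((\<lambda>s. form (AD (lexp (s *\<^sub>R u)) a) x) has_real_derivative form (br u a) x) (at 0)"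
    by (simp add: has_real_derivative_iff_has_vector_derivative)
  moreover have "\<forall>s. \<bar>0 - s\<bar> < 1 \<longrightarrow> form (AD (lexp (s *\<^sub>R u)) a) x \<le> form (AD (lexp (0 *\<^sub>R u)) a) x"
    using max AD_one[OF a] by (simp add: u_def)
  ultimately have "form (br u a) x = 0" using DERIV_local_max[of _ _ 0 1] by auto
  then have "form (br a u) x = 0" using br_anti[of u a] by simp
  then have "form u u = 0" using form_inv[of a u x] by (simp add: u_def)
  then show ?thesis by (simp add: u_def)
qed

text \<open>The generated group lies between the exponentials of the centralizer and the stabilizer
  of \<open>z\<close>. The Lie algebra of the latter is the centralizer, so the group in between has
  the same one.\<close>

lemma generate_cent:
  assumes z: "z \<in> V"
  shows "connected_lie_subgroup K (cent z) = generate K (lexp ` cent z)"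
    "lexp ` cent z \<subseteq> generate K (lexp ` cent z)"
    "generate K (lexp ` cent z) \<subseteq> stab z"
    "lie_algebra_of K (generate K (lexp ` cent z)) = cent z"
proof -
  have "lie_exp K ` cent z = lexp ` cent z" by (rule image_cong) (auto simp: cent_def lie_exp)
  then show "connected_lie_subgroup K (cent z) = generate K (lexp ` cent z)" by (simp add: connected_lie_subgroup_def)
  show sub: "lexp ` cent z \<subseteq> generate K (lexp ` cent z)" by (auto intro: generate.incl)
  have "lexp ` cent z \<subseteq> stab z" using lie_algebra_of_stab[OF z] lie_algebra_ofD(3)[of _ "stab z"] by auto
  then show *: "generate K (lexp ` cent z) \<subseteq> stab z" by (rule generate_subgroup_incl[OF _ stab_subgroup[OF z]])
  have "s *\<^sub>R Y \<in> cent z" if "Y \<in> cent z" for s Y using that V by (auto simp: cent_def subspace_mul)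
  then have "cent z \<subseteq> lie_algebra_of K (generate K (lexp ` cent z))"
    using sub by (auto simp: lie_algebra_of_eq cent_def)
  moreover have "lie_algebra_of K (generate K (lexp ` cent z)) \<subseteq> cent z"
    using * lie_algebra_of_stab[OF z] by (auto simp: lie_algebra_of_eq)
  ultimately show "lie_algebra_of K (generate K (lexp ` cent z)) = cent z" by blast
qed

lemma cent_AD: "w \<in> carrier K \<Longrightarrow> z \<in> V \<Longrightarrow> Y \<in> V \<Longrightarrow> AD w Y \<in> cent (AD w z) \<longleftrightarrow> Y \<in> cent z"
proof -
  assume w: "w \<in> carrier K" and z: "z \<in> V" and Y: "Y \<in> V"
  have "br (AD w z) (AD w Y) = AD w (br z Y)" using AD_br[OF w, of z Y] by simp
  moreover have "AD w (br z Y) = 0 \<longleftrightarrow> br z Y = 0"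
    using AD_inv(1)[OF w, of "br z Y"] linear_0[OF AD_linear, of w] linear_0[OF AD_linear, of "inv w"] w by auto
  ultimately show ?thesis using w Y by (auto simp: cent_def)
qed

text \<open>An element at which no root vanishes has the same centralizer in \<hh> as the whole Lie
  algebra of \<open>A\<close>. Otherwise the part \<open>M\<close> of its centralizer orthogonal to
  the smaller one is nonzero and invariant, hence contains a weight plane; the weight is a root, and
  it vanishes at \<open>a\<close> because \<open>M\<close> commutes with \<open>a\<close>.\<close>

lemma regular_element_centralizer:
  assumes A: "torus K A" and a: "a \<in> lie_algebra_of K A"
    and h: "subspace \<hh>" "lie_algebra_of K A \<subseteq> \<hh>" "\<hh> \<subseteq> V" "\<And>Y Z. Y \<in> \<hh> \<Longrightarrow> Z \<in> \<hh> \<Longrightarrow> br Y Z \<in> \<hh>"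
    and reg: "\<And>\<alpha>. \<alpha> \<in> roots K \<hh> (lie_algebra_of K A) \<Longrightarrow> \<alpha> a \<noteq> 0"
    and Z: "Z \<in> \<hh>" "br a Z = 0" and Y: "Y \<in> lie_algebra_of K A"
  shows "br Y Z = 0"
proof -
  define \<aa> where "\<aa> = lie_algebra_of K A"
  define C where "C = {Z \<in> \<hh>. \<forall>Y\<in>\<aa>. br Y Z = 0}"
  define M where "M = {Z \<in> \<hh>. br a Z = 0 \<and> (\<forall>c\<in>C. form Z c = 0)}"
  have aV: "X \<in> V" if "X \<in> \<aa>" for X using that lie_algebra_ofD(1) by (simp add: \<aa>_def)
  have ah: "X \<in> \<hh>" if "X \<in> \<aa>" for X using that h by (auto simp: \<aa>_def)
  have ab: "br X Y = 0" if "X \<in> \<aa>" "Y \<in> \<aa>" for X Y using torus_bracket[OF A] that by (simp add: \<aa>_def)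
  have sC: "subspace C" unfolding C_def using h(1) by (intro subspaceI) (auto simp: subspace_0 subspace_add subspace_mul)
  have sM: "subspace M" unfolding M_def using h(1) by (intro subspaceI) (auto simp: subspace_0 subspace_add subspace_mul)
  have "M = {0}"
  proof (rule ccontr)
    assume "M \<noteq> {0}"
    moreover have "br X u \<in> M" if X: "X \<in> \<aa>" and u: "u \<in> M" for X u
    proof -
      have "br a (br X u) = br (br a X) u + br X (br a u)" by (rule br_jacobi)
      also have "\<dots> = 0" using ab[OF _ X] a u by (simp add: M_def \<aa>_def)
      finally have "br a (br X u) = 0" .
      moreover have "form (br X u) c = 0" if "c \<in> C" for c using form_inv[of X u c] that X by (simp add: C_def)
      ultimately show ?thesis using h(4)[OF ah[OF X]] u by (simp add: M_def)
    qed
    moreover have "u = 0" if u: "u \<in> M" "\<And>X. X \<in> \<aa> \<Longrightarrow> br X u = 0" for u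
    proof -
      have "u \<in> C" using u by (simp add: C_def M_def)
      then have "form u u = 0" using u(1) by (simp add: M_def)
      then show ?thesis by simp
    qed
    ultimately obtain U W X where UW: "U \<in> M" "W \<in> M" "mla.plane \<aa> U W" "X \<in> \<aa>" "form (br W U) X \<noteq> 0"
      using ab sM by (rule_tac mla.invariant_plane[of \<aa> M]) blast+
    define \<alpha> where "\<alpha> = restrict (form (br W U)) \<aa>"
    have sa: "subspace \<aa>" unfolding \<aa>_def by (rule lie_algebra_of_torus_subspace[OF A])
    have UWh: "U \<in> \<hh>" "W \<in> \<hh>" using UW by (auto simp: M_def)
    have pr: "br X U = - (form (br W U) X) *\<^sub>R W" "br X W = form (br W U) X *\<^sub>R U" if "X \<in> \<aa>" for X
      using UW(3) that by (auto simp: mla.plane_def mla.pair_def)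
    have un: "form W W = 1" using UW(3) by (simp add: mla.plane_def)
    then have W0: "W \<noteq> 0" by auto
    have "\<alpha> \<in> dual \<aa>" using sa by (auto simp: dual_def \<alpha>_def subspace_add subspace_mul)
    moreover have "\<exists>X\<in>\<aa>. \<alpha> X \<noteq> 0" using UW(4,5) by (auto simp: \<alpha>_def)
    moreover have "lie_bracket K X U = - \<alpha> X *\<^sub>R W \<and> lie_bracket K X W = \<alpha> X *\<^sub>R U" if X: "X \<in> \<aa>" for X
      using pr[OF X] X br_eq[OF aV[OF X]] UWh h(3) by (auto simp: \<alpha>_def)
    ultimately have "\<alpha> \<in> roots K \<hh> \<aa>" using UWh W0 unfolding roots_def by blast
    then have "\<alpha> a \<noteq> 0" using reg by (simp add: \<aa>_def)
    moreover have "br a U = - \<alpha> a *\<^sub>R W" using pr(1)[of a] a by (simp add: \<alpha>_def \<aa>_def)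
    ultimately show False using UW(1) W0 by (simp add: M_def)
  qed
  obtain c where c: "c \<in> C" "\<And>v. v \<in> C \<Longrightarrow> form Z v = form c v"
    by (rule mla.riesz[OF sC, of "form Z"]) (auto intro: that)
  have cC: "c \<in> \<hh>" "br a c = 0" using c(1) a by (auto simp: C_def \<aa>_def)
  have "Z - c \<in> M" using Z cC c(2) h(1) by (simp add: M_def subspace_diff)
  then have "Z = c" using \<open>M = {0}\<close> by simp
  then show ?thesis using c(1) Y by (simp add: C_def \<aa>_def)
qed

end

context regular_orbit
begin

text \<open>Maximizes the pairing with \<open>x\<close> over the stabilizer of \<open>y\<close>. For
  the maximizer b, the Jacobi identity shows that [b, x] commutes with \<open>y\<close>, so the
  variation in this direction stays in the stabilizer and b commutes with \<open>x\<close>. Weyl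
  elements of roots vanishing at \<open>y\<close> lie in the stabilizer too, and comparison with
  them gives the signs. The case y = 0 yields the closest point of an orbit; general
  \<open>y\<close> serves to compare maximal tori and positive systems.\<close>

lemma dominant_conjugate:
  assumes y: "y \<in> ta.cartan" and a: "a \<in> cent y"
  obtains k where "k \<in> stab y" "AD k a \<in> ta.cartan" "\<And>g. g \<in> stab y \<Longrightarrow> form (AD g a) x \<le> form (AD k a) x"
    "\<And>r. r \<in> ta.root_set \<Longrightarrow> form r y = 0 \<Longrightarrow> form (AD k a) r * form r x \<ge> 0"
proof -
  note yV = cartan_V[OF y]
  have aV: "a \<in> V" "br y a = 0" using a by (auto simp: cent_def)
  have sg: "subgroup (stab y) K" by (rule stab_subgroup[OF yV])
  have "stab y \<noteq> {}" using subgroup.one_closed[OF sg] by blast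
  then obtain k where k: "k \<in> stab y" "\<And>g. g \<in> stab y \<Longrightarrow> form (AD g a) x \<le> form (AD k a) x"
    by (rule compact_maximizer[OF stab_closed]) (rule that)
  have kc: "k \<in> carrier K" "AD k y = y" using k(1) by (auto simp: stab_def)
  define b where "b = AD k a"
  have bV: "b \<in> V" using kc by (simp add: b_def)
  have max: "form (AD g b) x \<le> form b x" if "g \<in> stab y" for g
    using k(2)[OF subgroup.m_closed[OF sg that k(1)]] that kc(1) by (simp add: b_def AD_mult stab_def)
  have yb: "br y b = 0" using cent_AD[OF kc(1) yV aV(1)] a by (simp add: kc(2) b_def cent_def)
  have yx: "br y x = 0" using y br_anti[of y x] by (simp add: ta.cartan_def)
  have "br y (br b x) = 0" using br_jacobi[of y b x] yb yx by simp
  then have "br (br b x) y = 0" using br_anti[of "br b x" y] by simp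
  then have "lexp (s *\<^sub>R br b x) \<in> stab y" for s
    using AD_lexp_fixed[OF br_V yV] lexp_scale_carrier[OF br_V] by (simp add: stab_def)
  then have "br b x = 0" by (intro maximizer_commutes[OF bV x_V] max)
  then have bt: "b \<in> ta.cartan" using br_anti[of x b] bV by (simp add: ta.cartan_def)
  have "form b r * form r x \<ge> 0" if r: "r \<in> ta.root_set" "form r y = 0" for r
  proof -
    obtain u w where p: "u \<in> V" "w \<in> V" "mla.plane ta.cartan u w" "br w u = r" by (rule ta.root_plane[OF r(1)]) (rule that)
    note rr = ta.root_regular[OF r(1)]
    note n = weyl_reflection[OF p(3,4) rr(2,3) p(1,2)]
    have "AD (weyl u r) y = y" using n(2)[OF y yV] r(2) by (simp add: form_sym[of y])
    then have "weyl u r \<in> stab y" using n(1)[OF y yV] by (simp add: stab_def)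
    from max[OF this] have "(2 * form b r / form r r) * form r x \<ge> 0" using n(2)[OF bt bV] by simp
    then show ?thesis using form_pos[OF rr(3)] by (simp add: zero_le_divide_iff zero_le_mult_iff mult_le_0_iff)
  qed
  then show ?thesis using that[OF k(1) bt[unfolded b_def] k(2)] by (simp add: b_def)
qed

section \<open>Maximal tori of the connected group with centralizer as Lie algebra, and their
  roots\<close>

context
  fixes y z w
  assumes z: "z \<in> V" and w: "w \<in> carrier K" and y: "y \<in> ta.cartan" and wz: "AD w z = y"
begin

lemma w_inv [simp]: "inv w \<in> carrier K" using w by simp

lemma AD_w: "Y \<in> V \<Longrightarrow> AD w (AD (inv w) Y) = Y" "Y \<in> V \<Longrightarrow> AD (inv w) (AD w Y) = Y"
  using AD_inv[OF w] by auto

lemma cent_z_iff: "Y \<in> V \<Longrightarrow> AD w Y \<in> cent y \<longleftrightarrow> Y \<in> cent z"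
  using cent_AD[OF w z] wz by simp

lemma cartan_cent: "Y \<in> ta.cartan \<Longrightarrow> Y \<in> cent y"
  using ta.cartan_abelian[OF y] cartan_V by (simp add: cent_def)

text \<open>The Cartan subalgebra of \<open>x\<close>, carried by the inverse of \<open>w\<close>
  into the centralizer of \<open>z\<close>. Different choices of \<open>w\<close> give different
  maximal tori.\<close>

definition "\<tt> = AD (inv w) ` ta.cartan"

lemma tt_iff: "Y \<in> \<tt> \<longleftrightarrow> Y \<in> V \<and> AD w Y \<in> ta.cartan"
proof
  show "Y \<in> V \<and> AD w Y \<in> ta.cartan" if "Y \<in> \<tt>" using that w cartan_V by (auto simp: \<tt>_def AD_w)
  show "Y \<in> \<tt>" if Y: "Y \<in> V \<and> AD w Y \<in> ta.cartan"
  proof -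
    have "Y = AD (inv w) (AD w Y)" using AD_w(2) Y by simp
    then show ?thesis using Y unfolding \<tt>_def by blast
  qed
qed

lemma tt_cent: "\<tt> \<subseteq> cent z" 
proof
  fix Y assume "Y \<in> \<tt>"
  then show "Y \<in> cent z" using cent_z_iff[of Y] cartan_cent[of "AD w Y"] by (simp add: tt_iff)
qed

lemma tt_subspace: "subspace \<tt>"
  unfolding \<tt>_def by (rule linear_subspace_image[OF AD_linear[OF w_inv] ta.cartan_subspace])

definition "conj_torus = (\<lambda>k. inv w \<otimes> k \<otimes> inv (inv w)) ` stab x"

lemma conj_torus_torus: "torus K conj_torus" unfolding conj_torus_def by (rule torus_conj[OF w_inv stab_torus])

lemma conj_torus_algebra: "lie_algebra_of K conj_torus = \<tt>"
  unfolding conj_torus_def \<tt>_def using subgroup.subset[OF stab_subgroup[OF x_V]]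
  by (simp add: lie_algebra_of_conj[OF w_inv] cartan_lie)

lemma conj_torus_exp: "conj_torus = lexp ` \<tt>" using torus_exponential[OF conj_torus_torus] by (simp add: conj_torus_algebra)

lemma conj_torus_generate: "conj_torus \<subseteq> generate K (lexp ` cent z)"
  unfolding conj_torus_exp using tt_cent generate_cent(2)[OF z] by blast

lemma commutes_tt:
  assumes "Y \<in> V" "br Y (AD (inv w) x) = 0" shows "Y \<in> \<tt>"
proof -
  have "br (AD w Y) x = AD w (br Y (AD (inv w) x))" using AD_br[OF w, of Y "AD (inv w) x"] AD_w(1)[OF x_V] by simp
  then have "br (AD w Y) x = 0" using assms linear_0[OF AD_linear[OF w]] by simp
  then have "AD w Y \<in> ta.cartan" using br_anti[of x "AD w Y"] w by (simp add: ta.cartan_def)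
  then show ?thesis using assms by (simp add: tt_iff)
qed

lemma x_tt: "AD (inv w) x \<in> \<tt>" using ta.x_cartan by (simp add: \<tt>_def)

text \<open>A larger torus has a Lie algebra commuting with the transported \<open>x\<close>, whose
  centralizer is \<tt>; being the exponential image of its Lie algebra, it is no larger after
  all.\<close>

lemma conj_torus_maximal: "maximal_torus K (generate K (lexp ` cent z)) conj_torus"
  unfolding maximal_torus_def
proof (intro conjI allI impI conj_torus_torus conj_torus_generate)
  fix B assume B: "torus K B \<and> conj_torus \<subseteq> B \<and> B \<subseteq> generate K (lexp ` cent z)"
  then have x: "AD (inv w) x \<in> lie_algebra_of K B"
    using x_tt conj_torus_algebra by (auto simp: lie_algebra_of_eq)
  have "lie_algebra_of K B \<subseteq> \<tt>"
    using commutes_tt torus_bracket[of B _ "AD (inv w) x"] lie_algebra_ofD(1) x B by blast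
  then have "B \<subseteq> conj_torus" using torus_exponential[of B] B unfolding conj_torus_exp by blast
  then show "B = conj_torus" using B by blast
qed

text \<open>Turns a root vector into an extensional functional on \<tt>, the form in which
  \<open>roots\<close> presents roots.\<close>

definition "\<Phi> r = restrict (\<lambda>X. form r (AD w X)) \<tt>"

lemma \<Phi>_roots:
  assumes r: "r \<in> ta.root_set" "form r y = 0" shows "\<Phi> r \<in> roots K (cent z) \<tt>"
proof -
  obtain u v where p: "u \<in> V" "v \<in> V" "mla.plane ta.cartan u v" "br v u = r" by (rule ta.root_plane[OF r(1)]) (rule that)
  note rr = ta.root_regular[OF r(1)]
  have pr: "br X u = - (form r X) *\<^sub>R v" "br X v = form r X *\<^sub>R u" if "X \<in> ta.cartan" for X
    using p(3,4) that by (auto simp: mla.plane_def mla.pair_def)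
  have cy: "u \<in> cent y" "v \<in> cent y" using pr[OF y] p(1,2) r(2) by (auto simp: cent_def)
  define U W where "U = AD (inv w) u" and "W = AD (inv w) v"
  have UW: "AD w U = u" "AD w W = v" using p AD_w by (auto simp: U_def W_def)
  have UWV: "U \<in> V" "W \<in> V" by (simp_all add: U_def W_def)
  have UWc: "U \<in> cent z" "W \<in> cent z" using cent_z_iff[OF UWV(1)] cent_z_iff[OF UWV(2)] UW cy by auto
  have "form u u = 1" using p(3) by (simp add: mla.plane_def)
  then have U0: "U \<noteq> 0" using UW(1) linear_0[OF AD_linear[OF w]] by auto
  have lin: "linear (AD w)" "linear (AD (inv w))" using AD_linear w w_inv by blast+
  have "\<Phi> r \<in> dual \<tt>"
    using tt_subspace by (auto simp: \<Phi>_def dual_def subspace_add subspace_mul linear_add[OF lin(1)] linear_cmul[OF lin(1)])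
  moreover have "\<exists>X\<in>\<tt>. \<Phi> r X \<noteq> 0"
  proof
    show m: "AD (inv w) r \<in> \<tt>" using rr(2) by (simp add: \<tt>_def)
    show "\<Phi> r (AD (inv w) r) \<noteq> 0" using m rr AD_w(1)[OF cartan_V[OF rr(2)]] by (simp add: \<Phi>_def)
  qed
  moreover have "lie_bracket K X U = - \<Phi> r X *\<^sub>R W \<and> lie_bracket K X W = \<Phi> r X *\<^sub>R U" if X: "X \<in> \<tt>" for X
  proof -
    have X': "X \<in> V" "AD w X \<in> ta.cartan" using X by (auto simp: tt_iff)
    have "br X U = AD (inv w) (br (AD w X) u)" "br X W = AD (inv w) (br (AD w X) v)"
      using AD_br[OF w_inv, of "AD w X"] AD_w(2)[OF X'(1)] by (simp_all add: U_def W_def)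
    then have "br X U = - (form r (AD w X)) *\<^sub>R W" "br X W = form r (AD w X) *\<^sub>R U"
      unfolding pr[OF X'(2)] linear_cmul[OF lin(2)] by (simp_all only: U_def W_def)
    then show ?thesis using X X'(1) UWV by (simp add: \<Phi>_def br_eq)
  qed
  ultimately show ?thesis using UWc U0 unfolding roots_def by blast
qed

text \<open>Riesz representation produces the vector \<open>r\<close>. Its root vectors, moved by
  \<open>w\<close>, commute with \<open>y\<close>, so the weight vanishes there; this is why exactly
  the roots orthogonal to \<open>y\<close> occur.\<close>

lemma roots_\<Phi>:
  assumes \<alpha>: "\<alpha> \<in> roots K (cent z) \<tt>"
  obtains r where "r \<in> ta.root_set" "form r y = 0" "\<alpha> = \<Phi> r"
proof -
  obtain U W X0 where UW: "U \<in> cent z" "W \<in> cent z" "(U, W) \<noteq> (0, 0)" and d: "\<alpha> \<in> dual \<tt>" and X0: "X0 \<in> \<tt>" "\<alpha> X0 \<noteq> 0"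
    and b: "\<And>X. X \<in> \<tt> \<Longrightarrow> lie_bracket K X U = - \<alpha> X *\<^sub>R W" "\<And>X. X \<in> \<tt> \<Longrightarrow> lie_bracket K X W = \<alpha> X *\<^sub>R U"
    using \<alpha> unfolding roots_def by blast
  have UWV: "U \<in> V" "W \<in> V" using UW by (auto simp: cent_def)
  have lin: "linear (AD w)" "linear (AD (inv w))" using AD_linear w w_inv by blast+
  have m: "AD (inv w) Y \<in> \<tt>" if "Y \<in> ta.cartan" for Y using that by (simp add: \<tt>_def)
  have dd: "\<alpha> (X + Y) = \<alpha> X + \<alpha> Y" if "X \<in> \<tt>" "Y \<in> \<tt>" for X Y using d that by (auto simp: dual_def)
  have ds: "\<alpha> (c *\<^sub>R X) = c * \<alpha> X" if "X \<in> \<tt>" for X c using d that by (auto simp: dual_def)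
  obtain r where r: "r \<in> ta.cartan" "\<And>Y. Y \<in> ta.cartan \<Longrightarrow> \<alpha> (AD (inv w) Y) = form r Y"
    by (rule mla.riesz[OF ta.cartan_subspace, of "\<lambda>Y. \<alpha> (AD (inv w) Y)"])
      (auto intro: that simp: linear_add[OF lin(2)] linear_cmul[OF lin(2)] dd ds m)
  have ar: "\<alpha> X = form r (AD w X)" if "X \<in> \<tt>" for X using r(2)[of "AD w X"] that AD_w(2)[of X] by (simp add: tt_iff)
  have pr: "br Y (AD w U) = - (form r Y) *\<^sub>R AD w W" "br Y (AD w W) = form r Y *\<^sub>R AD w U" if Y: "Y \<in> ta.cartan" for Y
  proof -
    have YV: "AD (inv w) Y \<in> V" by simp
    have "br Y (AD w u) = AD w (br (AD (inv w) Y) u)" for u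
      using AD_br[OF w, of "AD (inv w) Y" u] AD_w(1)[OF cartan_V[OF Y]] by simp
    then have *: "br Y (AD w U) = AD w (- (form r Y) *\<^sub>R W)" "br Y (AD w W) = AD w (form r Y *\<^sub>R U)"
      using b[OF m[OF Y]] r(2)[OF Y] br_eq[OF YV] UWV by simp_all
    show "br Y (AD w U) = - (form r Y) *\<^sub>R AD w W" "br Y (AD w W) = form r Y *\<^sub>R AD w U"
      by (simp_all only: * linear_cmul[OF lin(1)])
  qed
  have "AD w U \<noteq> 0 \<or> AD w W \<noteq> 0"
    using UW(3) AD_w(2)[OF UWV(1)] AD_w(2)[OF UWV(2)] linear_0[OF lin(2)] by auto
  moreover have "AD w U \<in> cent y" "AD w W \<in> cent y" using cent_z_iff UWV UW by auto
  then have "br y (AD w U) = 0" "br y (AD w W) = 0" by (auto simp: cent_def)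
  ultimately have ry: "form r y = 0" using pr[OF y] by auto
  have "r \<noteq> 0" using ar[OF X0(1)] X0(2) by auto
  moreover have "mla.pair ta.cartan r (AD w U) (AD w W)" using pr by (simp add: mla.pair_def)
  moreover have "AD w U \<in> V" "AD w W \<in> V" using w by simp_all
  ultimately have rR: "r \<in> ta.root_set" using r(1) \<open>AD w U \<noteq> 0 \<or> AD w W \<noteq> 0\<close> unfolding ta.root_set_def by blast
  have "\<alpha> = \<Phi> r"
  proof (rule extensionalityI[of _ \<tt>])
    show "\<alpha> \<in> extensional \<tt>" using d by (simp add: dual_def)
    show "\<Phi> r \<in> extensional \<tt>" by (simp add: \<Phi>_def)
  qed (simp add: \<Phi>_def ar)
  then show ?thesis using that rR ry by blast
qed

lemma \<Phi>_inj: "inj_on \<Phi> ta.root_set"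
proof (rule inj_onI)
  fix r s assume rs: "r \<in> ta.root_set" "s \<in> ta.root_set" "\<Phi> r = \<Phi> s"
  show "r = s"
  proof (rule mla.riesz_unique[OF ta.cartan_subspace])
    show "r \<in> ta.cartan" "s \<in> ta.cartan" using rs ta.root_regular(2) by auto
    fix Y assume Y: "Y \<in> ta.cartan"
    have "\<Phi> r (AD (inv w) Y) = \<Phi> s (AD (inv w) Y)" by (simp only: rs(3))
    then show "form r Y = form s Y" using Y AD_w(1)[OF cartan_V[OF Y]] by (simp add: \<Phi>_def \<tt>_def)
  qed
qed

text \<open>By the chamber hypothesis the moved \<open>a\<close> lies weakly on the same side as
  \<open>x\<close> of every root vanishing at \<open>y\<close>, and regularity of \<open>a\<close>
  excludes zero. The positive system of \<open>a\<close> is thus the transport of \<open>P\<close>,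
  and \<open>AD\<close> preserves lengths.\<close>

lemma dual_norm_half_sum:
  assumes a: "a \<in> \<tt>" "\<And>\<alpha>. \<alpha> \<in> roots K (cent z) \<tt> \<Longrightarrow> \<alpha> a \<noteq> 0"
    and chamber: "\<And>r. r \<in> ta.root_set \<Longrightarrow> form r y = 0 \<Longrightarrow> form (AD w a) r * form r x \<ge> 0"
  defines "P \<equiv> {r \<in> ta.root_set. form r y = 0 \<and> form r x > 0}"
  shows "dual_norm ip \<tt> (\<lambda>X. (\<Sum>\<alpha>\<in>{\<alpha> \<in> roots K (cent z) \<tt>. \<alpha> a > 0}. \<alpha> X) / 2) =
    sqrt (form ((1/2) *\<^sub>R \<Sum>P) ((1/2) *\<^sub>R \<Sum>P))"
proof -
  define \<rho> where "\<rho> = (1/2) *\<^sub>R \<Sum>P"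
  have PR: "P \<subseteq> ta.root_set" by (auto simp: P_def)
  have sgn: "\<Phi> r a > 0 \<longleftrightarrow> form r x > 0" if r: "r \<in> ta.root_set" "form r y = 0" for r
  proof -
    have e: "\<Phi> r a = form (AD w a) r" using a(1) by (simp add: \<Phi>_def form_sym)
    have "\<Phi> r a \<noteq> 0" by (rule a(2)[OF \<Phi>_roots[OF r]])
    moreover have "\<Phi> r a * form r x \<ge> 0" unfolding e by (rule chamber[OF r])
    ultimately show ?thesis using ta.root_regular(1)[OF r(1)] by (auto simp: zero_le_mult_iff)
  qed
  have "{\<alpha> \<in> roots K (cent z) \<tt>. \<alpha> a > 0} = \<Phi> ` P"
  proof (intro equalityI subsetI)
    fix \<alpha> assume \<alpha>: "\<alpha> \<in> {\<alpha> \<in> roots K (cent z) \<tt>. \<alpha> a > 0}"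
    then obtain r where "r \<in> ta.root_set" "form r y = 0" "\<alpha> = \<Phi> r" using roots_\<Phi> by blast
    then show "\<alpha> \<in> \<Phi> ` P" using \<alpha> sgn by (auto simp: P_def)
  qed (use sgn \<Phi>_roots in \<open>auto simp: P_def\<close>)
  moreover have "(\<Sum>\<alpha>\<in>\<Phi> ` P. \<alpha> X) / 2 = form (AD (inv w) \<rho>) X" if X: "X \<in> \<tt>" for X
  proof -
    have X': "X \<in> V" "AD w X \<in> ta.cartan" using X by (auto simp: tt_iff)
    have "(\<Sum>\<alpha>\<in>\<Phi> ` P. \<alpha> X) = (\<Sum>r\<in>P. \<Phi> r X)" by (rule sum.reindex_cong[OF inj_on_subset[OF \<Phi>_inj PR]]) auto
    also have "\<dots> = (\<Sum>r\<in>P. form r (AD w X))" using X by (simp add: \<Phi>_def)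
    also have "\<dots> = form (\<Sum>P) (AD w X)" by (simp add: linear_sum[OF ta.B_left_linear])
    finally have "(\<Sum>\<alpha>\<in>\<Phi> ` P. \<alpha> X) / 2 = form \<rho> (AD w X)" by (simp add: \<rho>_def)
    also have "\<dots> = form (AD (inv w) \<rho>) X"
    proof -
      have "\<rho> \<in> V" unfolding \<rho>_def using PR ta.root_regular(2) cartan_V V by (intro subspace_mul subspace_sum) auto
      then show ?thesis using AD_adjoint[OF w_inv _ X'(1), of \<rho>] w by simp
    qed
    finally show ?thesis .
  qed
  moreover have \<rho>: "\<rho> \<in> ta.cartan"
    unfolding \<rho>_def using PR ta.root_regular(2) by (intro subspace_mul subspace_sum ta.cartan_subspace) auto
  then have "AD (inv w) \<rho> \<in> \<tt>" by (simp add: \<tt>_def)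
  moreover have "\<tt> \<subseteq> V" by (auto simp: tt_iff)
  ultimately have "dual_norm ip \<tt> (\<lambda>X. (\<Sum>\<alpha>\<in>{\<alpha> \<in> roots K (cent z) \<tt>. \<alpha> a > 0}. \<alpha> X) / 2) =
      sqrt (form (AD (inv w) \<rho>) (AD (inv w) \<rho>))"
    using tt_subspace by (intro dual_norm_eq) auto
  then show ?thesis using form_AD[OF w_inv cartan_V[OF \<rho>] cartan_V[OF \<rho>]] by (simp add: \<rho>_def)
qed

text \<open>The moved \<open>a\<close> lies in the Cartan subalgebra, so \<open>a\<close> commutes
  with the transported \<open>x\<close>. By \<open>regular_element_centralizer\<close> the whole Lie
  algebra of \<open>A\<close> then commutes with it and lies in \<tt>; maximality of
  \<open>A\<close> gives equality.\<close>

lemma maximal_torus_algebra: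
  assumes A: "maximal_torus K (generate K (lexp ` cent z)) A"
    and a: "a \<in> lie_algebra_of K A" "\<And>\<alpha>. \<alpha> \<in> roots K (cent z) (lie_algebra_of K A) \<Longrightarrow> \<alpha> a \<noteq> 0"
    and wa: "AD w a \<in> ta.cartan"
  shows "lie_algebra_of K A = \<tt>"
proof -
  have At: "torus K A" and Ag: "A \<subseteq> generate K (lexp ` cent z)" using A by (auto simp: maximal_torus_def)
  have ac: "lie_algebra_of K A \<subseteq> cent z"
    using Ag generate_cent(4)[OF z] by (auto simp: lie_algebra_of_eq)
  have sub: "subspace (cent z)"
    unfolding cent_def using V by (intro subspaceI) (auto simp: subspace_0 subspace_add subspace_mul)
  have "lie_algebra_of K A \<subseteq> \<tt>"
  proof
    fix Y assume Y: "Y \<in> lie_algebra_of K A"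
    have "br Y (AD (inv w) x) = 0"
    proof (rule regular_element_centralizer[where \<hh> = "cent z" and a = a, OF At a(1) sub ac _ _ _ _ _ Y])
      show "cent z \<subseteq> V" by (auto simp: cent_def)
      show "\<alpha> a \<noteq> 0" if "\<alpha> \<in> roots K (cent z) (lie_algebra_of K A)" for \<alpha> by (rule a(2)[OF that])
      show "br Y Z \<in> cent z" if "Y \<in> cent z" "Z \<in> cent z" for Y Z
        using that br_jacobi[of z Y Z] by (simp add: cent_def)
      show "AD (inv w) x \<in> cent z" using x_tt tt_cent by blast
      have "br a (AD (inv w) x) = AD (inv w) (br (AD w a) x)"
        using AD_br[OF w_inv, of "AD w a" x] AD_w(2)[OF lie_algebra_ofD(1)[OF a(1)]] by simp
      then show "br a (AD (inv w) x) = 0"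
        using ta.cartan_abelian[OF wa ta.x_cartan] linear_0[OF AD_linear[OF w_inv]] by simp
    qed
    then show "Y \<in> \<tt>" using commutes_tt lie_algebra_ofD(1)[OF Y] by blast
  qed
  then have "A \<subseteq> conj_torus" using torus_exponential[OF At] unfolding conj_torus_exp by blast
  then have "conj_torus = A" using A conj_torus_torus conj_torus_generate unfolding maximal_torus_def by blast
  then show ?thesis using conj_torus_algebra by simp
qed

end

text \<open>Well-definedness of the norm: every maximal torus and every positive system give the
  same value, so the choice inside \<open>rho_norm\<close> does not affect the result.\<close>

lemma rho_norm_eq:
  assumes z: "z \<in> V" and w: "w \<in> carrier K" and y: "y \<in> ta.cartan" and wz: "AD w z = y"
  defines "P \<equiv> {r \<in> ta.root_set. form r y = 0 \<and> form r x > 0}"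
  shows "rho_norm K ip (connected_lie_subgroup K (cent z)) = sqrt (form ((1/2) *\<^sub>R \<Sum>P) ((1/2) *\<^sub>R \<Sum>P))"
  unfolding rho_norm_def generate_cent(1)[OF z] generate_cent(4)[OF z]
proof (rule some_equality)
  note l = z w y wz
  note T = conj_torus_algebra[OF l]
  show "\<exists>A Q. maximal_torus K (generate K (lexp ` cent z)) A \<and>
      positive_system (lie_algebra_of K A) (roots K (cent z) (lie_algebra_of K A)) Q \<and>
      sqrt (form ((1/2) *\<^sub>R \<Sum>P) ((1/2) *\<^sub>R \<Sum>P)) = dual_norm ip (lie_algebra_of K A) (\<lambda>X. (\<Sum>\<alpha>\<in>Q. \<alpha> X) / 2)"
  proof (intro exI conjI)
    \<comment> \<open>The transported \<open>x\<close> is regular for the transported torus, and its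
      positive system is the transport of \<open>P\<close>; this settles existence.\<close>
    define a where "a = AD (inv w) x"
    have a: "a \<in> \<tt> w" unfolding a_def by (rule x_tt[OF l])
    have wa: "AD w a = x" unfolding a_def by (rule AD_w(1)[OF l x_V])
    have reg: "\<alpha> a \<noteq> 0" if \<alpha>: "\<alpha> \<in> roots K (cent z) (\<tt> w)" for \<alpha>
    proof -
      obtain r where r: "r \<in> ta.root_set" "\<alpha> = \<Phi> w r" by (rule roots_\<Phi>[OF l \<alpha>]) (rule that)
      then show ?thesis using a ta.root_regular(1)[OF r(1)] by (simp add: \<Phi>_def[OF l] wa)
    qed
    show "maximal_torus K (generate K (lexp ` cent z)) (conj_torus w)" by (rule conj_torus_maximal[OF l])
    show "positive_system (lie_algebra_of K (conj_torus w)) (roots K (cent z) (lie_algebra_of K (conj_torus w)))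
      {\<alpha> \<in> roots K (cent z) (\<tt> w). \<alpha> a > 0}" unfolding T positive_system_def using a reg by blast
    show "sqrt (form ((1/2) *\<^sub>R \<Sum>P) ((1/2) *\<^sub>R \<Sum>P)) = dual_norm ip (lie_algebra_of K (conj_torus w))
       (\<lambda>X. (\<Sum>\<alpha>\<in>{\<alpha> \<in> roots K (cent z) (\<tt> w). \<alpha> a > 0}. \<alpha> X) / 2)"
      unfolding T P_def by (rule dual_norm_half_sum[where a = a, OF l a, symmetric]) (use reg in \<open>simp_all add: wa form_sym\<close>)
  qed
next
  fix r assume "\<exists>A Q. maximal_torus K (generate K (lexp ` cent z)) A \<and>
      positive_system (lie_algebra_of K A) (roots K (cent z) (lie_algebra_of K A)) Q \<and>
      r = dual_norm ip (lie_algebra_of K A) (\<lambda>X. (\<Sum>\<alpha>\<in>Q. \<alpha> X) / 2)"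
  then obtain A Q where A: "maximal_torus K (generate K (lexp ` cent z)) A"
    and ps: "positive_system (lie_algebra_of K A) (roots K (cent z) (lie_algebra_of K A)) Q"
    and r: "r = dual_norm ip (lie_algebra_of K A) (\<lambda>X. (\<Sum>\<alpha>\<in>Q. \<alpha> X) / 2)" by blast
  obtain a where a: "a \<in> lie_algebra_of K A" "\<And>\<alpha>. \<alpha> \<in> roots K (cent z) (lie_algebra_of K A) \<Longrightarrow> \<alpha> a \<noteq> 0"
    and Q: "Q = {\<alpha> \<in> roots K (cent z) (lie_algebra_of K A). \<alpha> a > 0}"
    using ps unfolding positive_system_def by blast
  have aV: "a \<in> V" by (rule lie_algebra_ofD(1)[OF a(1)])
  have "a \<in> cent z" using a(1) A generate_cent(4)[OF z] by (auto simp: maximal_torus_def lie_algebra_of_eq)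
  then have "AD w a \<in> cent y" using cent_AD[OF w z aV] wz by simp
  then obtain k where k: "k \<in> stab y" "AD k (AD w a) \<in> ta.cartan"
    "\<And>r. r \<in> ta.root_set \<Longrightarrow> form r y = 0 \<Longrightarrow> form (AD k (AD w a)) r * form r x \<ge> 0"
    by (rule dominant_conjugate[OF y]) (rule that)
  have kc: "k \<in> carrier K" "AD k y = y" using k(1) by (auto simp: stab_def)
  \<comment> \<open>Since \<open>k\<close> fixes \<open>y\<close>, the product k w still carries
    \<open>z\<close> to \<open>y\<close>. It moves the element defining the given positive system
    into the Cartan subalgebra and into the chamber of \<open>x\<close>, as the two preceding lemmas
    require.\<close>
  define v where "v = k \<otimes> w"
  have v: "v \<in> carrier K" "\<And>Y. AD v Y = AD k (AD w Y)" using kc w by (auto simp: v_def AD_mult)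
  have "AD v z = y" by (simp add: v(2) wz kc(2))
  note l = z v(1) y this
  have at: "lie_algebra_of K A = \<tt> v"
    by (rule maximal_torus_algebra[where a = a, OF l A a(1)]) (use a(2) in \<open>simp_all add: v(2) k(2)\<close>)
  show "r = sqrt (form ((1/2) *\<^sub>R \<Sum>P) ((1/2) *\<^sub>R \<Sum>P))"
    unfolding r Q at P_def by (rule dual_norm_half_sum[where a = a, OF l]) (use a k(3) in \<open>simp_all add: at v(2)\<close>)
qed

text \<open>Norms are constant along an orbit, so the point closest to \<open>x\<close> is the one
  maximizing the pairing with \<open>x\<close>. It is supplied by \<open>dominant_conjugate\<close>
  at 0, whose stabilizer is the whole group and where every root vanishes.\<close>

lemma rho_norm_le_distance:
  assumes \<xi>: "\<xi> \<in> dual V" "sharp \<xi> = x" and adm: "admissible K \<xi>" and z: "z \<in> V" and g: "g \<in> carrier K"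
  shows "rho_norm K ip (connected_lie_subgroup K (cent z)) \<le> sqrt (form (x - AD g z) (x - AD g z))"
proof -
  have 0: "0 \<in> ta.cartan" by (rule subspace_0[OF ta.cartan_subspace])
  have st: "stab 0 = carrier K" using linear_0[OF AD_linear] by (auto simp: stab_def)
  have "z \<in> cent 0" using z by (simp add: cent_def)
  then obtain w where w: "w \<in> carrier K" "AD w z \<in> ta.cartan" "\<And>g. g \<in> carrier K \<Longrightarrow> form (AD g z) x \<le> form (AD w z) x"
    "\<And>r. r \<in> ta.root_set \<Longrightarrow> form (AD w z) r * form r x \<ge> 0"
    by (rule dominant_conjugate[OF 0, unfolded st]) (auto intro: that)
  define y where "y = AD w z"
  define P where "P = {r \<in> ta.root_set. form r y = 0 \<and> form r x > 0}"
  have sq: "form (x - AD h z) (x - AD h z) = form x x + form z z - 2 * form (AD h z) x" if "h \<in> carrier K" for h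
    using form_AD[OF that z z] form_sym[of x "AD h z"] by simp
  have "rho_norm K ip (connected_lie_subgroup K (cent z)) = sqrt (form ((1/2) *\<^sub>R \<Sum>P) ((1/2) *\<^sub>R \<Sum>P))"
    unfolding P_def by (rule rho_norm_eq[OF z w(1)]) (use w(2) in \<open>simp_all add: y_def\<close>)
  also have "form ((1/2) *\<^sub>R \<Sum>P) ((1/2) *\<^sub>R \<Sum>P) \<le> form (x - y) (x - y)"
    unfolding P_def
  proof (rule half_sum_norm_le_distance[OF \<xi> adm])
    show "y \<in> ta.cartan" using w(2) by (simp add: y_def)
    show "form b y \<ge> 0" if "b \<in> ta.root_set" "form b x > 0" for b
      using w(4)[OF that(1)] that(2) by (simp add: zero_le_mult_iff form_sym[of b] y_def)
  qed
  also have "form (x - y) (x - y) \<le> form (x - AD g z) (x - AD g z)"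
    using sq[OF g] sq[OF w(1)] w(3)[OF g] by (simp add: y_def)
  finally show ?thesis by simp
qed

end

theorem theorem1p1:
  fixes K :: "('g, 'e::euclidean_space) lie_struct"
    and ip :: "'e \<Rightarrow> 'e \<Rightarrow> real"
    and \<xi> \<zeta> :: "'e \<Rightarrow> real"
    and \<hh> :: "'e set"
    and \<O> \<P> :: "('e \<Rightarrow> real) set"
    and S :: "('e \<Rightarrow> real) set set"
  assumes "lie_group K"
    and "compact_space (topo K)"
    and "connected_space (topo K)"
    and "invariant_inner_product K ip"
    and "\<xi> \<in> dual (lie_algebra K)"
    and "\<O> = coadjoint_orbit K \<xi>"
    and "regular K \<xi>"
    and "admissible K \<xi>"
    and "\<zeta> \<in> dual (lie_algebra K)"
    and "\<hh> = stabilizer_algebra K \<zeta>"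
    and "S = dixmier_sheet K \<hh>"
    and "\<P> \<in> S"
  shows "orbit_distance K ip \<O> \<P> \<ge> rho_norm K ip (connected_lie_subgroup K \<hh>)"
proof -
  interpret compact_lie_group K ip
    using assms(1,2,4) by (simp add: compact_lie_group_def compact_lie_group_axioms_def)
  define x where "x = sharp \<xi>"
  interpret regular_orbit K ip x
  proof
    show "x \<in> V" using sharp(1)[OF assms(5)] by (simp add: x_def)
    show "torus K (stab x)"
      using assms(7) coad_stabilizer_eq[OF assms(5)] by (simp add: regular_def maximal_torus_def x_def)
  qed
  obtain \<zeta>' g where \<P>: "\<P> = coadjoint_orbit K \<zeta>'" "\<zeta>' \<in> dual V" "g \<in> carrier K"
    and st: "stabilizer_algebra K \<zeta>' = Ad K g ` \<hh>"
    using assms(11,12) by (auto simp: dixmier_sheet_def)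
  \<comment> \<open>The sheet prescribes the stabilizer algebra only up to conjugacy. Moving the
    representative back by \<open>g\<close> makes the centralizer of \<open>z\<close> equal to \<hh>
    itself, for which the norm is evaluated.\<close>
  define z where "z = AD (inv\<^bsub>K\<^esub> g) (sharp \<zeta>')"
  have z: "z \<in> V" using \<P>(3) by (simp add: z_def)
  have gz: "sharp \<zeta>' = AD g z" using AD_inv(2)[OF \<P>(3) sharp(1)[OF \<P>(2)]] by (simp add: z_def)
  have "\<hh> = cent (sharp \<zeta>)"
    using assms(10) coad_stabilizer_eq[OF assms(9)] lie_algebra_of_stab[OF sharp(1)[OF assms(9)]] by simp
  then have hV: "\<hh> \<subseteq> V" by (auto simp: cent_def)
  have "cent (AD g z) = Ad K g ` \<hh>"
    using st coad_stabilizer_eq[OF \<P>(2)] lie_algebra_of_stab[OF sharp(1)[OF \<P>(2)]] by (simp add: gz)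
  also have "\<dots> = AD g ` \<hh>" using hV by (intro image_cong) (auto simp: AD_eq)
  finally have c: "cent (AD g z) = AD g ` \<hh>" .
  have "\<hh> = cent z"
  proof (intro equalityI subsetI)
    fix Y assume Y: "Y \<in> \<hh>"
    then have "AD g Y \<in> cent (AD g z)" unfolding c by (rule imageI)
    then show "Y \<in> cent z" using cent_AD[OF \<P>(3) z] Y hV by blast
  next
    fix Y assume "Y \<in> cent z"
    then have Y: "Y \<in> V" "AD g Y \<in> cent (AD g z)" using cent_AD[OF \<P>(3) z] by (auto simp: cent_def)
    then obtain Y' where Y': "Y' \<in> \<hh>" "AD g Y = AD g Y'" unfolding c by blast
    then have "Y = Y'" using AD_inv(1)[OF \<P>(3) Y(1)] AD_inv(1)[OF \<P>(3), of Y'] hV by auto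
    then show "Y \<in> \<hh>" using Y' by simp
  qed
  moreover have "rho_norm K ip (connected_lie_subgroup K (cent z)) \<le> dual_norm ip V (\<lambda>X. \<eta> X - \<theta> X)"
    if mem: "\<eta> \<in> \<O>" "\<theta> \<in> \<P>" for \<eta> \<theta>
  proof -
    obtain h k where hk: "h \<in> carrier K" "\<eta> = Coad K h \<xi>" "k \<in> carrier K" "\<theta> = Coad K k \<zeta>'"
      using mem \<P>(1) assms(6) by (auto simp: coadjoint_orbit_def)
    \<comment> \<open>Invariance of the form reduces the distance between arbitrary points of the
      two orbits to the distance from \<open>x\<close> to a point of the orbit of
      \<open>z\<close>.\<close>
    define m where "m = inv\<^bsub>K\<^esub> h \<otimes>\<^bsub>K\<^esub> k \<otimes>\<^bsub>K\<^esub> g"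
    have m: "m \<in> carrier K" using hk \<P>(3) by (simp add: m_def)
    have "h \<otimes>\<^bsub>K\<^esub> m = k \<otimes>\<^bsub>K\<^esub> g" using hk \<P>(3) by (simp add: m_def m_assoc[symmetric])
    then have hm: "AD h (AD m z) = AD k (AD g z)" using hk m \<P>(3) by (simp add: AD_mult[symmetric])
    define d where "d = AD h x - AD k (AD g z)"
    have dV: "d \<in> V" using hk V by (simp add: d_def subspace_diff)
    have d: "d = AD h (x - AD m z)" unfolding d_def hm[symmetric] by (rule linear_diff[OF AD_linear[OF hk(1)], symmetric])
    have "\<eta> X - \<theta> X = form d X" if X: "X \<in> V" for X
      using sharp(2)[OF Coad_sharp(1)[OF assms(5) hk(1)] X] sharp(2)[OF Coad_sharp(1)[OF \<P>(2) hk(3)] X]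
      by (simp add: hk Coad_sharp(2)[OF assms(5) hk(1)] Coad_sharp(2)[OF \<P>(2) hk(3)] d_def gz x_def)
    then have "dual_norm ip V (\<lambda>X. \<eta> X - \<theta> X) = sqrt (form d d)"
      by (intro dual_norm_eq V subset_refl dV)
    also have "form d d = form (x - AD m z) (x - AD m z)"
      unfolding d using m x_V V by (intro form_AD[OF hk(1)]) (simp_all add: subspace_diff)
    finally show ?thesis using rho_norm_le_distance[OF assms(5) x_def[symmetric] assms(8) z m] by simp
  qed
  \<comment> \<open>The infimum is taken over a nonempty set, so that a lower bound of its elements
    is a lower bound of the infimum.\<close>
  moreover have "\<xi> \<in> \<O> \<or> \<O> \<noteq> {}" "\<P> \<noteq> {}" using assms(6) \<P>(1) by (auto simp: coadjoint_orbit_def)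
  ultimately show ?thesis unfolding orbit_distance_def by (intro cInf_greatest) auto
qed

end
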